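(* Let $T>0$, $\lambda>0$, $s>1$, let $D\subset\mathbb{R}^2$ be a bounded domain with Lipschitz boundary, and let $P$ be an analytic function. Let $\mathcal{H}=C^1([0,T],H^{s-1}(D))\cap C^0([0,T],H^s(D))$, $\mathcal{H}'=C^0([0,T],H^{s-1}(D))$, $H=\mathcal{H}^{2\times2}$, $H'=\mathcal{H}'^{\,2\times2}$, and $H_{sym}=\{\bm{X}\in H:\bm{X}^T=\bm{X}\}$. Let $\bm{u}\in C^0([0,T],H^s(D,\mathbb{R}^2))$ be given. If $\bm{\Psi}\in H_{sym}$ is a solution (in $H'$) of $$\partial_t\bm{\Psi}+(\bm{u}\cdot\nabla)\bm{\Psi}+[\bm{\Psi},\Omega(\bm{u})]+\frac1\lambda P\left(e^{\bm{\Psi}}\right)e^{-\bm{\Psi}}-2\varepsilon(\bm{u})-2\begin{pmatrix}-\Psi_{12}&\gamma(\bm{\Psi})\\ \gamma(\bm{\Psi})&\Psi_{12}\end{pmatrix}\left[\gamma(\bm{\Psi})\,\varepsilon(\bm{u})_{12}-\Psi_{12}\,\gamma(\varepsilon(\bm{u}))\right] f(\bm{\Psi})=0,$$ where $\gamma(\bm{C})=\frac12(C_{11}-C_{22})$ and $$f(\bm{\Psi})=\frac{1}{\gamma(\bm{\Psi})^2+\Psi_{12}^2}\left(\sqrt{\gamma(\bm{\Psi})^2+\Psi_{12}^2}+\frac{2\sqrt{\gamma(\bm{\Psi})^2+\Psi_{12}^2}}{\exp\left(2\sqrt{\gamma(\bm{\Psi})^2+\Psi_{12}^2}\right)-1}-1\right),$$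 then $\bm{\sigma}=\exp\bm{\Psi}\in H_{sym}$ and $\bm{\sigma}$ satisfies (in $H'$) $$\partial_t\bm{\sigma}+(\bm{u}\cdot\nabla)\bm{\sigma}-(\varepsilon(\bm{u})+\Omega(\bm{u}))\bm{\sigma}-\bm{\sigma}(\varepsilon(\bm{u})-\Omega(\bm{u}))=-\frac1\lambda P(\bm{\sigma}).$$
   Context: All functions are real-valued. $\varepsilon(\bm{u})=\frac12(\nabla\bm{u}+\nabla\bm{u}^T)$ and $\Omega(\bm{u})=\frac12(\nabla\bm{u}-\nabla\bm{u}^T)$ are the symmetric and antisymmetric parts of the velocity gradient $\nabla\bm{u}$, $(\nabla\bm u)_{ij}=\partial_j u_i$. $[\bm{X},\bm{Y}]=\bm{X}\bm{Y}-\bm{Y}\bm{X}$. Since $s>1=d/2$, the pointwise multiplications $H^s(D)\times H^s(D)\to H^s(D)$ and $H^{s-1}(D)\times H^s(D)\to H^{s-1}(D)$ are continuous; hence $\mathcal{H}$ is a commutative unital Banach algebra under pointwise multiplication, $\mathcal{H}\subseteq\mathcal{H}'$ continuously, and the multiplication extends to a continuous multiplication $\mathcal{H}'\times\mathcal{H}\to\mathcal{H}'$. Consequently $H$ is a Banach algebra under matrix multiplication, and elements of $H'$ may be multiplied from the left and right by elements of $H$. For $\bm{\Psi}\in H$ one has $\partial_t\bm{\Psi},\partial_{x_i}\bm{\Psi}\in H'$, and $\varepsilon(\bm{u}),\Omega(\bm{u})\in H'$. The exponential is the one of the Banach algebra $H$ (pointwise matrix exponential). $P$ is a scalar analytic function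 (real on the real axis, analytic on a neighbourhood of the spectrum of the argument) applied to elements of $H$ by the analytic functional calculus; e.g. $P(\bm\sigma)=\bm\sigma-1$ or $P(\bm\sigma)=\bm\sigma-1+\alpha(\bm\sigma-1)^2$ with $\alpha\in[0,1]$, where $1$ is the identity matrix. The scalar function $f(\bm{\Psi})\in\mathcal{H}$ is understood as $h(\gamma(\bm{\Psi})^2+\Psi_{12}^2)$ where $h(z)=\frac1z\left(\sqrt z+\frac{2\sqrt z}{e^{2\sqrt z}-1}-1\right)$, which is even in $\sqrt z$ and extends analytically to a neighbourhood of $[0,\infty)$ (removable singularity at $z=0$, with $h(0)=\frac13$). *)

theory Defs
  imports "HOL-Complex_Analysis.Complex_Analysis"
begin

text \<open>
  Near each boundary point, after a rotation/reflection and a translation, the domain is the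
  region strictly below the graph of a Lipschitz function.
\<close>

definition bounded_lipschitz_domain :: "(real^2) set \<Rightarrow> bool" where
  "bounded_lipschitz_domain D \<longleftrightarrow>
     open D \<and> connected D \<and> D \<noteq> {} \<and> bounded D \<and>
     (\<forall>p\<in>frontier D. \<exists>(Q :: real^2 \<Rightarrow> real^2) (g :: real \<Rightarrow> real) L e.
        orthogonal_transformation Q \<and> lipschitz_on L UNIV g \<and> e > 0 \<and>
        (\<forall>x\<in>ball p e. x \<in> D \<longleftrightarrow> Q (x - p) $ 2 < g (Q (x - p) $ 1)))"

definition square_integrable :: "(real^2 \<Rightarrow> 'b::real_normed_vector) \<Rightarrow> bool" where
  "square_integrable f \<longleftrightarrow>
     f \<in> borel_measurable lborel \<and> integrable lborel (\<lambda>x. (norm (f x))\<^sup>2)"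

definition fourier_integral :: "(real^2 \<Rightarrow> real) \<Rightarrow> real^2 \<Rightarrow> complex" where
  "fourier_integral f \<xi> =
     (1 / (2 * pi)) *\<^sub>R (LINT x|lborel. cis (- (x \<bullet> \<xi>)) * complex_of_real (f x))"

text \<open>
  The Fourier--Plancherel transform on \<open>L\<^sup>2\<close>, given as the \<open>L\<^sup>2\<close>-closure of the Fourier integral
  on \<open>L\<^sup>1 \<inter> L\<^sup>2\<close>.  The distances are written with the nonnegative integral so that no convention
  about non-integrable functions can interfere.
\<close>

definition has_fourier_transform :: "(real^2 \<Rightarrow> real) \<Rightarrow> (real^2 \<Rightarrow> complex) \<Rightarrow> bool" where
  "has_fourier_transform f g \<longleftrightarrow>
     square_integrable f \<and> square_integrable g \<and>
     (\<exists>F :: nat \<Rightarrow> real^2 \<Rightarrow> real.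
        (\<forall>n. integrable lborel (F n) \<and> square_integrable (F n)) \<and>
        (\<lambda>n. \<integral>\<^sup>+x. ennreal ((norm (F n x - f x))\<^sup>2) \<partial>lborel) \<longlonglongrightarrow> 0 \<and>
        (\<lambda>n. \<integral>\<^sup>+\<xi>. ennreal ((norm (fourier_integral (F n) \<xi> - g \<xi>))\<^sup>2) \<partial>lborel) \<longlonglongrightarrow> 0)"

definition fourier_transform :: "(real^2 \<Rightarrow> real) \<Rightarrow> real^2 \<Rightarrow> complex" where
  "fourier_transform f = (SOME g. has_fourier_transform f g)"

text \<open>
  \<open>H\<^sup>r(\<real>\<^sup>2)\<close> and its norm, for \<open>r \<ge> 0\<close> (only these orders are used, so that all elements are
  functions in \<open>L\<^sup>2\<close>).
\<close>

definition sobolev_plane :: "real \<Rightarrow> (real^2 \<Rightarrow> real) set" where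
  "sobolev_plane r =
     {f. square_integrable f \<and>
         (\<exists>g. has_fourier_transform f g \<and>
              integrable lborel (\<lambda>\<xi>. (1 + (norm \<xi>)\<^sup>2) powr r * (norm (g \<xi>))\<^sup>2))}"

definition sobolev_plane_norm :: "real \<Rightarrow> (real^2 \<Rightarrow> real) \<Rightarrow> real" where
  "sobolev_plane_norm r f =
     sqrt (LINT \<xi>|lborel. (1 + (norm \<xi>)\<^sup>2) powr r * (norm (fourier_transform f \<xi>))\<^sup>2)"

text \<open>
  \<open>H\<^sup>r(D)\<close> consists of the restrictions to \<open>D\<close> of the elements of \<open>H\<^sup>r(\<real>\<^sup>2)\<close>, with the quotient norm;
  on bounded Lipschitz domains this is the usual fractional Sobolev space.  Elements are represented
  by functions on the plane, to be identified if they agree almost everywhere on \<open>D\<close>; values off \<open>D\<close>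
  are irrelevant.
\<close>

definition sobolev_extensions ::
    "real \<Rightarrow> (real^2) set \<Rightarrow> (real^2 \<Rightarrow> real) \<Rightarrow> (real^2 \<Rightarrow> real) set" where
  "sobolev_extensions r D f =
     {F \<in> sobolev_plane r. AE x in lborel. x \<in> D \<longrightarrow> F x = f x}"

definition sobolev :: "real \<Rightarrow> (real^2) set \<Rightarrow> (real^2 \<Rightarrow> real) set" where
  "sobolev r D = {f. sobolev_extensions r D f \<noteq> {}}"

definition sobolev_norm :: "real \<Rightarrow> (real^2) set \<Rightarrow> (real^2 \<Rightarrow> real) \<Rightarrow> real" where
  "sobolev_norm r D f = Inf (sobolev_plane_norm r ` sobolev_extensions r D f)"

primrec Ck :: "nat \<Rightarrow> (real^2 \<Rightarrow> real) \<Rightarrow> bool" where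
  "Ck 0 f \<longleftrightarrow> continuous_on UNIV f"
| "Ck (Suc k) f \<longleftrightarrow>
     (\<forall>x. f differentiable (at x)) \<and>
     (\<forall>i. Ck k (\<lambda>x. frechet_derivative f (at x) (axis i 1)))"

definition test_function :: "(real^2) set \<Rightarrow> (real^2 \<Rightarrow> real) \<Rightarrow> bool" where
  "test_function D \<phi> \<longleftrightarrow>
     (\<forall>k. Ck k \<phi>) \<and> (\<exists>K. compact K \<and> K \<subseteq> D \<and> (\<forall>x. x \<notin> K \<longrightarrow> \<phi> x = 0))"

definition locally_integrable :: "(real^2) set \<Rightarrow> (real^2 \<Rightarrow> real) \<Rightarrow> bool" where
  "locally_integrable D f \<longleftrightarrow>
     (\<forall>K. compact K \<and> K \<subseteq> D \<longrightarrow> set_integrable lebesgue K f)"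

definition has_weak_partial ::
    "(real^2) set \<Rightarrow> 2 \<Rightarrow> (real^2 \<Rightarrow> real) \<Rightarrow> (real^2 \<Rightarrow> real) \<Rightarrow> bool" where
  "has_weak_partial D i f g \<longleftrightarrow>
     locally_integrable D f \<and> locally_integrable D g \<and>
     (\<forall>\<phi>. test_function D \<phi> \<longrightarrow>
        (LINT x:D|lebesgue. f x * frechet_derivative \<phi> (at x) (axis i 1)) =
        - (LINT x:D|lebesgue. g x * \<phi> x))"

definition weak_partial :: "(real^2) set \<Rightarrow> 2 \<Rightarrow> (real^2 \<Rightarrow> real) \<Rightarrow> real^2 \<Rightarrow> real" where
  "weak_partial D i f = (SOME g. has_weak_partial D i f g)"

definition C0_sobolev :: "real \<Rightarrow> real \<Rightarrow> (real^2) set \<Rightarrow> (real \<Rightarrow> real^2 \<Rightarrow> real) set" where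
  "C0_sobolev T r D =
     {v. (\<forall>t\<in>{0..T}. v t \<in> sobolev r D) \<and>
         (\<forall>t\<in>{0..T}. ((\<lambda>\<tau>. sobolev_norm r D (\<lambda>x. v \<tau> x - v t x)) \<longlongrightarrow> 0) (at t within {0..T}))}"

definition has_time_deriv ::
    "real \<Rightarrow> real \<Rightarrow> (real^2) set \<Rightarrow> (real \<Rightarrow> real^2 \<Rightarrow> real) \<Rightarrow> (real \<Rightarrow> real^2 \<Rightarrow> real) \<Rightarrow> bool" where
  "has_time_deriv T r D v w \<longleftrightarrow>
     (\<forall>t\<in>{0..T}. v t \<in> sobolev r D \<and> w t \<in> sobolev r D \<and>
        ((\<lambda>\<tau>. sobolev_norm r D (\<lambda>x. (v \<tau> x - v t x) / (\<tau> - t) - w t x)) \<longlongrightarrow> 0)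
          (at t within {0..T}))"

definition C1_sobolev :: "real \<Rightarrow> real \<Rightarrow> (real^2) set \<Rightarrow> (real \<Rightarrow> real^2 \<Rightarrow> real) set" where
  "C1_sobolev T r D = {v. \<exists>w \<in> C0_sobolev T r D. has_time_deriv T r D v w}"

definition time_deriv ::
    "real \<Rightarrow> real \<Rightarrow> (real^2) set \<Rightarrow> (real \<Rightarrow> real^2 \<Rightarrow> real) \<Rightarrow> real \<Rightarrow> real^2 \<Rightarrow> real" where
  "time_deriv T r D v = (SOME w. has_time_deriv T r D v w)"

definition calH :: "real \<Rightarrow> real \<Rightarrow> (real^2) set \<Rightarrow> (real \<Rightarrow> real^2 \<Rightarrow> real) set" where
  "calH T s D = C1_sobolev T (s - 1) D \<inter> C0_sobolev T s D"

definition calH' :: "real \<Rightarrow> real \<Rightarrow> (real^2) set \<Rightarrow> (real \<Rightarrow> real^2 \<Rightarrow> real) set" where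
  "calH' T s D = C0_sobolev T (s - 1) D"

definition matH :: "real \<Rightarrow> real \<Rightarrow> (real^2) set \<Rightarrow> (real \<Rightarrow> real^2 \<Rightarrow> real^2^2) set" where
  "matH T s D = {X. \<forall>i j. (\<lambda>t x. X t x $ i $ j) \<in> calH T s D}"

definition matH' :: "real \<Rightarrow> real \<Rightarrow> (real^2) set \<Rightarrow> (real \<Rightarrow> real^2 \<Rightarrow> real^2^2) set" where
  "matH' T s D = {X. \<forall>i j. (\<lambda>t x. X t x $ i $ j) \<in> calH' T s D}"

definition matH_sym :: "real \<Rightarrow> real \<Rightarrow> (real^2) set \<Rightarrow> (real \<Rightarrow> real^2 \<Rightarrow> real^2^2) set" where
  "matH_sym T s D =
     {X \<in> matH T s D.
        \<forall>t\<in>{0..T}. AE x in lborel. x \<in> D \<longrightarrow> transpose (X t x) = X t x}"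

definition eq_in_matH' ::
    "real \<Rightarrow> real \<Rightarrow> (real^2) set \<Rightarrow> (real \<Rightarrow> real^2 \<Rightarrow> real^2^2) \<Rightarrow> (real \<Rightarrow> real^2 \<Rightarrow> real^2^2) \<Rightarrow> bool"
  where
  "eq_in_matH' T s D X Y \<longleftrightarrow>
     X \<in> matH' T s D \<and> Y \<in> matH' T s D \<and>
     (\<forall>t\<in>{0..T}. AE x in lborel. x \<in> D \<longrightarrow> X t x = Y t x)"

definition dt_mat ::
    "real \<Rightarrow> real \<Rightarrow> (real^2) set \<Rightarrow> (real \<Rightarrow> real^2 \<Rightarrow> real^2^2) \<Rightarrow> real \<Rightarrow> real^2 \<Rightarrow> real^2^2" where
  "dt_mat T s D X t x = (\<chi> i j. time_deriv T (s - 1) D (\<lambda>\<tau> y. X \<tau> y $ i $ j) t x)"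

definition advect ::
    "(real^2) set \<Rightarrow> (real \<Rightarrow> real^2 \<Rightarrow> real^2) \<Rightarrow> (real \<Rightarrow> real^2 \<Rightarrow> real^2^2) \<Rightarrow> real \<Rightarrow> real^2 \<Rightarrow> real^2^2"
  where
  "advect D u X t x =
     (\<chi> i j. \<Sum>k\<in>UNIV. u t x $ k * weak_partial D k (\<lambda>y. X t y $ i $ j) x)"

definition grad :: "(real^2) set \<Rightarrow> (real \<Rightarrow> real^2 \<Rightarrow> real^2) \<Rightarrow> real \<Rightarrow> real^2 \<Rightarrow> real^2^2" where
  "grad D u t x = (\<chi> i j. weak_partial D j (\<lambda>y. u t y $ i) x)"

definition strain :: "(real^2) set \<Rightarrow> (real \<Rightarrow> real^2 \<Rightarrow> real^2) \<Rightarrow> real \<Rightarrow> real^2 \<Rightarrow> real^2^2" where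
  "strain D u t x = (1/2) *\<^sub>R (grad D u t x + transpose (grad D u t x))"

definition vorticity :: "(real^2) set \<Rightarrow> (real \<Rightarrow> real^2 \<Rightarrow> real^2) \<Rightarrow> real \<Rightarrow> real^2 \<Rightarrow> real^2^2" where
  "vorticity D u t x = (1/2) *\<^sub>R (grad D u t x - transpose (grad D u t x))"

definition commutator :: "real^2^2 \<Rightarrow> real^2^2 \<Rightarrow> real^2^2" where
  "commutator X Y = X ** Y - Y ** X"

text \<open>The library's multiplication on \<open>real^2^2\<close> is entrywise, so its \<open>exp\<close> cannot be used.\<close>

definition mexp :: "real^2^2 \<Rightarrow> real^2^2" where
  "mexp A = (\<Sum>n. (1 / fact n) *\<^sub>R (((**) A ^^ n) (mat 1)))"

definition cmat :: "real^2^2 \<Rightarrow> complex^2^2" where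
  "cmat A = map_matrix complex_of_real A"

text \<open>
  Analytic functional calculus at a point: the Riesz--Dunford integral
  \<open>(1/2\<pi>i) \<integral> P(z) (z - A)\<^sup>-\<^sup>1 dz\<close> over small circles around the eigenvalues of \<open>A\<close>.
  (The library defines \<open>residue\<close> as exactly such a normalised integral over small circles.)
  For \<open>P\<close> real on the real axis and \<open>A\<close> real the result is real, so \<open>Re\<close> is merely a coercion.
  Evaluation at a point is a continuous homomorphism on \<open>H\<close>, so the calculus of the Banach
  algebra \<open>H\<close> is computed pointwise.
\<close>

definition matfun :: "(complex \<Rightarrow> complex) \<Rightarrow> real^2^2 \<Rightarrow> real^2^2" where
  "matfun P A =
     (\<chi> i j. Re (\<Sum>z | \<not> invertible (mat z - cmat A).
                   residue (\<lambda>w. P w * matrix_inv (mat w - cmat A) $ i $ j) z))"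

text \<open>
  The spectrum is that of the Banach algebra \<open>H\<close>, so inverses are sought in its complexification
  \<open>cmatH\<close>, not merely pointwise.
\<close>

definition cmatH :: "real \<Rightarrow> real \<Rightarrow> (real^2) set \<Rightarrow> (real \<Rightarrow> real^2 \<Rightarrow> complex^2^2) set" where
  "cmatH T s D =
     {Y. (\<lambda>t x. map_matrix Re (Y t x)) \<in> matH T s D \<and> (\<lambda>t x. map_matrix Im (Y t x)) \<in> matH T s D}"

definition spectrum_matH ::
    "real \<Rightarrow> real \<Rightarrow> (real^2) set \<Rightarrow> (real \<Rightarrow> real^2 \<Rightarrow> real^2^2) \<Rightarrow> complex set" where
  "spectrum_matH T s D X =
     {z. \<not> (\<exists>Y \<in> cmatH T s D. \<forall>t\<in>{0..T}. AE x in lborel. x \<in> D \<longrightarrow>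
              (mat z - cmat (X t x)) ** Y t x = mat 1 \<and>
              Y t x ** (mat z - cmat (X t x)) = mat 1)}"

definition gam :: "real^2^2 \<Rightarrow> real" where
  "gam C = (C $ 1 $ 1 - C $ 2 $ 2) / 2"

text \<open>
  Evaluated only at \<open>z \<ge> 0\<close>; the value at \<open>0\<close> is that of the analytic continuation.
\<close>

definition h_fun :: "real \<Rightarrow> real" where
  "h_fun z = (if z = 0 then 1/3
     else (1 / z) * (sqrt z + 2 * sqrt z / (exp (2 * sqrt z) - 1) - 1))"

definition f_fun :: "real^2^2 \<Rightarrow> real" where
  "f_fun A = h_fun ((gam A)\<^sup>2 + (A $ 1 $ 2)\<^sup>2)"

definition corr_mat :: "real^2^2 \<Rightarrow> real^2^2" where
  "corr_mat A = vector [vector [- (A $ 1 $ 2), gam A], vector [gam A, A $ 1 $ 2]]"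

end

theory Submission
  imports Defs "HOL-Probability.Probability"
begin

text \<open>
  For symmetric \<open>\<Psi> = m + d\<close> with \<open>d\<close> trace-free, \<open>d\<^sup>2 = z\<close> is a scalar, so
  \<open>e\<^sup>\<Psi> = e\<^sup>m (Ch(z) + Sh(z) d)\<close> with the entire functions \<open>Ch(z) = cosh \<surd>z\<close> and
  \<open>Sh(z) = sinh \<surd>z / \<surd>z\<close>.  Products and entire functions act on \<open>H\<close>, and \<open>\<partial>\<^sub>t\<close> and
  the weak \<open>\<partial>\<^sub>k\<close> obey the Leibniz and chain rules there, so the material derivative of
  \<open>e\<^sup>\<Psi>\<close> is explicit in that of \<open>\<Psi>\<close>.  Substituting the equation for \<open>\<Psi>\<close>, everything
  follows pointwise from \<open>Ch\<^sup>2 - z Sh\<^sup>2 = 1\<close>, \<open>2 z Sh' = Ch - Sh\<close>, \<open>f(\<Psi>) Sh = 2 Sh'\<close>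
  and \<open>P(\<sigma>) = a + b \<sigma>\<close>.

  The terms \<open>f(\<Psi>)\<close> and \<open>P(\<sigma>)\<close> are only ever evaluated pointwise: the left-hand side of the
  equation for \<open>\<sigma>\<close> lies in \<open>H'\<close> by itself, hence so does the right-hand side, which agrees with it
  almost everywhere.
\<close>

text \<open>Two obstacles shape the proof. Time derivatives, weak derivatives and Fourier transforms
  are all chosen by \<open>SOME\<close>, so every rule needs an explicit witness and then uniqueness
  up to null sets; hence predicates such as \<open>sob_pair\<close>, \<open>tpair\<close> and
  \<open>dq2\<close>, which name the witness. And an element of H^{s-1} is in general just an L^2
  function, so no rule is classical: in time the rules come from the product estimate H^{s-1} x H^s
  -> H^{s-1}, in space from L^2-convergent difference quotients of an extension to the plane. Both
  chain rules rest on one algebraic fact, a second-order divided difference of a power series that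
  is bounded on bounded sets. Entire functions suffice because the exponential is written with exp,
  Ch and Sh in variables polynomial in the entries of \<Psi>; the root of z would fail to be smooth
  where eigenvalues meet. The product estimates need Plancherel and the convolution formula,
  obtained from Gaussian weights. In P(sigma) = a + b sigma the numbers a and b may depend on the
  point without any regularity, as they are never differentiated.\<close>

no_notation fps_nth (infixl "$" 75)

section \<open>Square-integrable functions on the plane\<close>

text \<open>The Bochner integral of a non-integrable function is 0, so the value is meaningful only
  together with \<open>square_integrable\<close>.\<close>

definition l2norm :: "(real^2 \<Rightarrow> 'b::real_normed_vector) \<Rightarrow> real" where
  "l2norm f = sqrt (LINT x|lborel. (norm (f x))\<^sup>2)"

lemma square_integrable_measurable [measurable_dest]:
  "square_integrable f \<Longrightarrow> f \<in> borel_measurable lborel"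
  by (simp add: square_integrable_def)

lemma square_integrableD: "square_integrable f \<Longrightarrow> integrable lborel (\<lambda>x. (norm (f x))\<^sup>2)"
  by (simp add: square_integrable_def)

lemma l2norm_nonneg [simp]: "0 \<le> l2norm f"
  by (simp add: l2norm_def)

lemma l2norm_power2: "(l2norm f)\<^sup>2 = (LINT x|lborel. (norm (f x))\<^sup>2)"
  by (simp add: l2norm_def)

lemma nn_integral_eq_l2norm:
  "square_integrable f \<Longrightarrow> (\<integral>\<^sup>+x. ennreal ((norm (f x))\<^sup>2) \<partial>lborel) = ennreal ((l2norm f)\<^sup>2)"
  unfolding l2norm_power2 by (intro nn_integral_eq_integral square_integrableD) auto

lemma square_integrable_bound:
  assumes g: "square_integrable g" and [measurable]: "f \<in> borel_measurable lborel"
    and le: "AE x in lborel. norm (f x) \<le> norm (g x)"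
  shows "square_integrable f" "l2norm f \<le> l2norm g"
proof -
  have [measurable]: "g \<in> borel_measurable lborel" using g by (rule square_integrable_measurable)
  have i: "integrable lborel (\<lambda>x. (norm (f x))\<^sup>2)"
    by (rule Bochner_Integration.integrable_bound[OF square_integrableD[OF g]])
      (use le in \<open>auto intro!: power_mono\<close>)
  then show f: "square_integrable f" by (simp add: square_integrable_def)
  show "l2norm f \<le> l2norm g"
    unfolding l2norm_def
    by (intro real_sqrt_le_mono integral_mono_AE i square_integrableD[OF g])
      (use le in \<open>auto intro!: power_mono\<close>)
qed

lemma square_integrable_cong_AE:
  assumes "square_integrable g" and "f \<in> borel_measurable lborel" and "AE x in lborel. f x = g x"
  shows "square_integrable f"
  by (rule square_integrable_bound(1)[OF assms(1,2)]) (use assms(3) in auto)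

lemma l2norm_cong_AE:
  assumes "f \<in> borel_measurable lborel" "g \<in> borel_measurable lborel" "AE x in lborel. norm (f x) = norm (g x)"
  shows "l2norm f = l2norm g"
  unfolding l2norm_def using assms by (intro arg_cong[of _ _ sqrt] integral_cong_AE) auto

lemma square_integrable_norm: "square_integrable f \<Longrightarrow> square_integrable (\<lambda>x. norm (f x))"
  by (auto simp add: square_integrable_def)

lemma l2norm_norm: "l2norm (\<lambda>x. norm (f x)) = l2norm f"
  by (simp add: l2norm_def)

lemma square_integrable_zero [simp]: "square_integrable (\<lambda>x. 0)"
  by (simp add: square_integrable_def)

lemma l2norm_zero [simp]: "l2norm (\<lambda>x. 0) = 0"
  by (simp add: l2norm_def)

lemma square_integrable_add:
  fixes f g :: "real^2 \<Rightarrow> 'b::{real_normed_vector, second_countable_topology}"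
  assumes "square_integrable f" "square_integrable g"
  shows "square_integrable (\<lambda>x. f x + g x)"
proof -
  have [measurable]: "f \<in> borel_measurable lborel" "g \<in> borel_measurable lborel"
    using assms by (auto dest: square_integrable_measurable)
  have "(norm (a + b))\<^sup>2 \<le> 2 * (norm a)\<^sup>2 + 2 * (norm b)\<^sup>2" for a b :: 'b
  proof -
    have "(norm (a + b))\<^sup>2 \<le> (norm a + norm b)\<^sup>2"
      by (intro power_mono norm_triangle_ineq) auto
    also have "\<dots> \<le> 2 * (norm a)\<^sup>2 + 2 * (norm b)\<^sup>2"
      using sum_squares_bound[of "norm a" "norm b"] by (simp add: power2_sum)
    finally show ?thesis .
  qed
  then have "AE x in lborel. norm ((norm (f x + g x))\<^sup>2) \<le> norm (2 * (norm (f x))\<^sup>2 + 2 * (norm (g x))\<^sup>2)"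
    by simp
  moreover have "integrable lborel (\<lambda>x. 2 * (norm (f x))\<^sup>2 + 2 * (norm (g x))\<^sup>2)"
    using square_integrableD[OF assms(1)] square_integrableD[OF assms(2)] by simp
  ultimately have "integrable lborel (\<lambda>x. (norm (f x + g x))\<^sup>2)"
    by (rule Bochner_Integration.integrable_bound[rotated 2]) measurable
  then show ?thesis by (simp add: square_integrable_def)
qed

lemma square_integrable_mult_left:
  fixes f :: "real^2 \<Rightarrow> 'b::{real_normed_div_algebra, second_countable_topology}"
  assumes "square_integrable f"
  shows "square_integrable (\<lambda>x. c * f x)"
  using assms by (auto simp: square_integrable_def norm_mult power_mult_distrib)

lemma l2norm_mult_left:
  fixes f :: "real^2 \<Rightarrow> 'b::real_normed_div_algebra"
  shows "l2norm (\<lambda>x. c * f x) = norm c * l2norm f"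
  by (simp add: l2norm_def norm_mult power_mult_distrib real_sqrt_mult)

lemma square_integrable_uminus:
  fixes f :: "real^2 \<Rightarrow> 'b::{real_normed_vector, second_countable_topology}"
  shows "square_integrable f \<Longrightarrow> square_integrable (\<lambda>x. - f x)"
  by (auto simp: square_integrable_def)

lemma square_integrable_diff:
  fixes f g :: "real^2 \<Rightarrow> 'b::{real_normed_vector, second_countable_topology}"
  assumes "square_integrable f" "square_integrable g"
  shows "square_integrable (\<lambda>x. f x - g x)"
  using square_integrable_add[OF assms(1) square_integrable_uminus[OF assms(2)]] by simp

lemma square_integrable_sum:
  fixes f :: "'i \<Rightarrow> real^2 \<Rightarrow> 'b::{real_normed_vector, second_countable_topology}"
  assumes "\<And>i. i \<in> I \<Longrightarrow> square_integrable (f i)"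
  shows "square_integrable (\<lambda>x. \<Sum>i\<in>I. f i x)"
  using assms by (induction I rule: infinite_finite_induct) (auto intro!: square_integrable_add)

lemma l2norm_minus_commute: "l2norm (\<lambda>x. f x - g x) = l2norm (\<lambda>x. g x - f x)"
  by (simp add: l2norm_def norm_minus_commute)

lemma cauchy_schwarz_norm:
  assumes f: "square_integrable f" and g: "square_integrable g"
  shows "integrable lborel (\<lambda>x. norm (f x) * norm (g x))"
    and "(LINT x|lborel. norm (f x) * norm (g x)) \<le> l2norm f * l2norm g"
proof -
  have [measurable]: "f \<in> borel_measurable lborel" "g \<in> borel_measurable lborel"
    using assms by (auto dest: square_integrable_measurable)
  have "integrable lborel (\<lambda>x. (norm (f x))\<^sup>2 + (norm (g x))\<^sup>2)"
    using square_integrableD[OF assms(1)] square_integrableD[OF assms(2)] by simp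
  then show i: "integrable lborel (\<lambda>x. norm (f x) * norm (g x))"
  proof (rule Bochner_Integration.integrable_bound)
    show "AE x in lborel. norm (norm (f x) * norm (g x)) \<le> norm ((norm (f x))\<^sup>2 + (norm (g x))\<^sup>2)"
    proof (rule AE_I2)
      fix x
      have "norm (f x) * norm (g x) \<ge> 0" by simp
      then show "norm (norm (f x) * norm (g x)) \<le> norm ((norm (f x))\<^sup>2 + (norm (g x))\<^sup>2)"
        using sum_squares_bound[of "norm (f x)" "norm (g x)"] unfolding real_norm_def mult.assoc by linarith
    qed
  qed auto
  \<comment> \<open>The inequality is taken from nonnegative integrals in \<open>ennreal\<close>;
    \<open>J\<close> is finite by the integrability just shown, so the result can be read back in
    the reals.\<close>
  define J where "J = (LINT x|lborel. norm (f x) * norm (g x))"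
  have "(ennreal J)\<^sup>2 = (\<integral>\<^sup>+x. ennreal (norm (f x)) * ennreal (norm (g x)) \<partial>lborel)\<^sup>2"
    unfolding J_def by (subst nn_integral_eq_integral[OF i, symmetric]) (auto simp: ennreal_mult)
  also have "\<dots> \<le> (\<integral>\<^sup>+x. (ennreal (norm (f x)))\<^sup>2 \<partial>lborel) * (\<integral>\<^sup>+x. (ennreal (norm (g x)))\<^sup>2 \<partial>lborel)"
    by (rule Cauchy_Schwarz_nn_integral) auto
  also have "\<dots> = ennreal ((l2norm f)\<^sup>2) * ennreal ((l2norm g)\<^sup>2)"
    using nn_integral_eq_l2norm[OF f] nn_integral_eq_l2norm[OF g] by (simp add: ennreal_power)
  also have "\<dots> = ennreal ((l2norm f * l2norm g)\<^sup>2)"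
    by (simp add: ennreal_mult[symmetric] power_mult_distrib)
  finally have "J\<^sup>2 \<le> (l2norm f * l2norm g)\<^sup>2"
    by (subst (asm) ennreal_power) (auto simp: J_def ennreal_le_iff)
  then show "(LINT x|lborel. norm (f x) * norm (g x)) \<le> l2norm f * l2norm g"
    unfolding J_def[symmetric] by (rule power2_le_imp_le) auto
qed

lemma l2norm_triangle:
  fixes f g :: "real^2 \<Rightarrow> 'b::{real_normed_vector, second_countable_topology}"
  assumes f: "square_integrable f" and g: "square_integrable g"
  shows "l2norm (\<lambda>x. f x + g x) \<le> l2norm f + l2norm g"
proof -
  note i = square_integrableD[OF f] square_integrableD[OF g] cauchy_schwarz_norm[OF f g]
  have "(l2norm (\<lambda>x. f x + g x))\<^sup>2 = (LINT x|lborel. (norm (f x + g x))\<^sup>2)"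
    by (rule l2norm_power2)
  also have "\<dots> \<le> (LINT x|lborel. (norm (f x))\<^sup>2 + 2 * (norm (f x) * norm (g x)) + (norm (g x))\<^sup>2)"
  proof (rule integral_mono)
    show "integrable lborel (\<lambda>x. (norm (f x + g x))\<^sup>2)"
      by (intro square_integrableD square_integrable_add f g)
    show "integrable lborel (\<lambda>x. (norm (f x))\<^sup>2 + 2 * (norm (f x) * norm (g x)) + (norm (g x))\<^sup>2)"
      using i by auto
    show "(norm (f x + g x))\<^sup>2 \<le> (norm (f x))\<^sup>2 + 2 * (norm (f x) * norm (g x)) + (norm (g x))\<^sup>2" for x
      using power_mono[OF norm_triangle_ineq[of "f x" "g x"], of 2] by (simp add: power2_sum)
  qed
  also have "\<dots> = (l2norm f)\<^sup>2 + 2 * (LINT x|lborel. norm (f x) * norm (g x)) + (l2norm g)\<^sup>2"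
    using i by (simp add: l2norm_power2)
  also have "\<dots> \<le> (l2norm f + l2norm g)\<^sup>2"
    using i(4) by (simp add: power2_sum)
  finally show ?thesis
    by (rule power2_le_imp_le) simp
qed

lemma l2norm_triangle_diff:
  fixes f g h :: "real^2 \<Rightarrow> 'b::{real_normed_vector, second_countable_topology}"
  assumes "square_integrable f" "square_integrable g" "square_integrable h"
  shows "l2norm (\<lambda>x. f x - h x) \<le> l2norm (\<lambda>x. f x - g x) + l2norm (\<lambda>x. g x - h x)"
  using l2norm_triangle[OF square_integrable_diff[OF assms(1,2)] square_integrable_diff[OF assms(2,3)]]
  by simp

lemma l2norm_diff_bound:
  fixes f g :: "real^2 \<Rightarrow> 'b::{real_normed_vector, second_countable_topology}"
  assumes f: "square_integrable f" and g: "square_integrable g"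
  shows "\<bar>l2norm f - l2norm g\<bar> \<le> l2norm (\<lambda>x. f x - g x)"
  using l2norm_triangle[OF square_integrable_diff[OF f g] g]
    l2norm_triangle[OF square_integrable_diff[OF g f] f] l2norm_minus_commute[of f g]
  by simp

lemma l2norm_sum_le:
  fixes f :: "'i \<Rightarrow> real^2 \<Rightarrow> 'b::{real_normed_vector, second_countable_topology}"
  assumes "\<And>i. i \<in> I \<Longrightarrow> square_integrable (f i)"
  shows "l2norm (\<lambda>x. \<Sum>i\<in>I. f i x) \<le> (\<Sum>i\<in>I. l2norm (f i))"
  using assms
proof (induction I rule: infinite_finite_induct)
  case (insert i I)
  have "l2norm (\<lambda>x. \<Sum>i\<in>insert i I. f i x) = l2norm (\<lambda>x. f i x + (\<Sum>i\<in>I. f i x))"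
    using insert by simp
  also have "\<dots> \<le> l2norm (f i) + l2norm (\<lambda>x. \<Sum>i\<in>I. f i x)"
    by (intro l2norm_triangle square_integrable_sum insert) auto
  also have "\<dots> \<le> (\<Sum>i\<in>insert i I. l2norm (f i))"
    using insert by auto
  finally show ?case .
qed auto

lemma l2norm_eq_0D:
  assumes f: "square_integrable f" and "l2norm f = 0"
  shows "AE x in lborel. f x = 0"
proof -
  have "(LINT x|lborel. (norm (f x))\<^sup>2) = 0"
    using l2norm_power2[of f] assms(2) by simp
  then have "AE x in lborel. (norm (f x))\<^sup>2 = 0"
    by (subst (asm) integral_nonneg_eq_0_iff_AE) (auto intro: square_integrableD f)
  then show ?thesis by auto
qed

lemma square_integrable_times:
  fixes f g :: "real^2 \<Rightarrow> 'b::{real_normed_div_algebra, banach, second_countable_topology}"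
  assumes f: "square_integrable f" and g: "square_integrable g"
  shows "integrable lborel (\<lambda>x. f x * g x)"
    and "norm (LINT x|lborel. f x * g x) \<le> l2norm f * l2norm g"
proof -
  have [measurable]: "f \<in> borel_measurable lborel" "g \<in> borel_measurable lborel"
    using assms by (auto dest: square_integrable_measurable)
  show i: "integrable lborel (\<lambda>x. f x * g x)"
    by (rule Bochner_Integration.integrable_bound[OF cauchy_schwarz_norm(1)[OF f g]]) (auto simp: norm_mult)
  have "norm (LINT x|lborel. f x * g x) \<le> (LINT x|lborel. norm (f x * g x))"
    by (rule integral_norm_bound)
  also have "\<dots> \<le> l2norm f * l2norm g"
    using cauchy_schwarz_norm(2)[OF f g] by (simp add: norm_mult)
  finally show "norm (LINT x|lborel. f x * g x) \<le> l2norm f * l2norm g" .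
qed

text \<open>The difference is (F - f) G + f (G - g), and Cauchy-Schwarz bounds each part; the norms
  of \<open>G n\<close> stay bounded by convergence. This carries Parseval from approximants to
  limits that need not be integrable.\<close>

lemma tendsto_integral_times:
  fixes f g :: "real^2 \<Rightarrow> 'b::{real_normed_field, banach, second_countable_topology}"
  assumes F: "\<And>n. square_integrable (F n)" and G: "\<And>n. square_integrable (G n)"
    and f: "square_integrable f" and g: "square_integrable g"
    and Ff: "((\<lambda>n. l2norm (\<lambda>x. F n x - f x)) \<longlongrightarrow> 0) A"
    and Gg: "((\<lambda>n. l2norm (\<lambda>x. G n x - g x)) \<longlongrightarrow> 0) A"
  shows "((\<lambda>n. LINT x|lborel. F n x * G n x) \<longlongrightarrow> (LINT x|lborel. f x * g x)) A"
proof -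
  have b: "norm ((LINT x|lborel. F n x * G n x) - (LINT x|lborel. f x * g x))
    \<le> l2norm (\<lambda>x. F n x - f x) * (l2norm (\<lambda>x. G n x - g x) + l2norm g)
      + l2norm f * l2norm (\<lambda>x. G n x - g x)" for n
  proof -
    have "(LINT x|lborel. F n x * G n x) - (LINT x|lborel. f x * g x)
       = (LINT x|lborel. F n x * G n x - f x * g x)"
      by (intro Bochner_Integration.integral_diff[symmetric] square_integrable_times F G f g)
    also have "\<dots> = (LINT x|lborel. (F n x - f x) * G n x + f x * (G n x - g x))"
      by (simp add: algebra_simps)
    also have "\<dots> = (LINT x|lborel. (F n x - f x) * G n x) + (LINT x|lborel. f x * (G n x - g x))"
      by (intro Bochner_Integration.integral_add square_integrable_times square_integrable_diff F G f g)
    finally have "norm ((LINT x|lborel. F n x * G n x) - (LINT x|lborel. f x * g x))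
      \<le> norm (LINT x|lborel. (F n x - f x) * G n x) + norm (LINT x|lborel. f x * (G n x - g x))"
      by (simp add: norm_triangle_ineq)
    also have "\<dots> \<le> l2norm (\<lambda>x. F n x - f x) * l2norm (G n) + l2norm f * l2norm (\<lambda>x. G n x - g x)"
      by (intro add_mono square_integrable_times square_integrable_diff F G f g)
    also have "l2norm (\<lambda>x. F n x - f x) * l2norm (G n)
        \<le> l2norm (\<lambda>x. F n x - f x) * (l2norm (\<lambda>x. G n x - g x) + l2norm g)"
      using l2norm_diff_bound[OF G[of n] g] by (intro mult_left_mono) auto
    finally show ?thesis by simp
  qed
  have "((\<lambda>n. l2norm (\<lambda>x. F n x - f x) * (l2norm (\<lambda>x. G n x - g x) + l2norm g)
      + l2norm f * l2norm (\<lambda>x. G n x - g x)) \<longlongrightarrow> 0 * (0 + l2norm g) + l2norm f * 0) A"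
    by (intro tendsto_add tendsto_mult tendsto_const Ff Gg)
  then have "((\<lambda>n. (LINT x|lborel. F n x * G n x) - (LINT x|lborel. f x * g x)) \<longlongrightarrow> 0) A"
    by (intro Lim_null_comparison[OF always_eventually[OF allI[OF b]]]) (simp only: mult_zero_left mult_zero_right add_0_left)
  then show ?thesis by (rule LIM_zero_cancel)
qed

lemma l2_dominated_convergence:
  fixes f :: "real^2 \<Rightarrow> 'b::{real_normed_vector, second_countable_topology}"
  assumes F: "\<And>n. F n \<in> borel_measurable lborel" and f: "f \<in> borel_measurable lborel"
    and g: "square_integrable g" and le: "\<And>n. AE x in lborel. norm (F n x) \<le> norm (g x)"
    and lim: "AE x in lborel. (\<lambda>n. F n x) \<longlonglongrightarrow> f x"
  shows "square_integrable f" "(\<lambda>n. l2norm (\<lambda>x. F n x - f x)) \<longlonglongrightarrow> 0"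
proof -
  note [measurable] = F f
  have le': "AE x in lborel. \<forall>n. norm (F n x) \<le> norm (g x)"
    using le by (simp add: AE_all_countable)
  have lef: "AE x in lborel. norm (f x) \<le> norm (g x)"
    using le' lim
  proof eventually_elim
    case (elim x)
    show ?case by (rule LIMSEQ_le_const2[OF tendsto_norm[OF elim(2)]]) (use elim(1) in auto)
  qed
  then show "square_integrable f"
    using square_integrable_bound(1)[OF g f] by auto
  have "(\<lambda>n. LINT x|lborel. (norm (F n x - f x))\<^sup>2) \<longlonglongrightarrow> (LINT x|(lborel :: (real^2) measure). (0::real))"
  proof (rule Bochner_Integration.integral_dominated_convergence[where w="\<lambda>x. 4 * (norm (g x))\<^sup>2"])
    show "integrable lborel (\<lambda>x. 4 * (norm (g x))\<^sup>2)" using square_integrableD[OF g] by simp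
    show "AE x in lborel. (\<lambda>n. (norm (F n x - f x))\<^sup>2) \<longlonglongrightarrow> 0"
      using lim
    proof eventually_elim
      case (elim x)
      then show ?case
        using tendsto_power[OF tendsto_norm_zero[OF LIM_zero[OF elim]], of 2] by simp
    qed
    show "AE x in lborel. norm ((norm (F n x - f x))\<^sup>2) \<le> 4 * (norm (g x))\<^sup>2" for n
      using le' lef
    proof eventually_elim
      case (elim x)
      have "norm (F n x - f x) \<le> 2 * norm (g x)"
        using norm_triangle_ineq4[of "F n x" "f x"] elim(1)[rule_format, of n] elim(2) by linarith
      from power_mono[OF this, of 2] show ?case by (simp add: power_mult_distrib)
    qed
  qed auto
  from tendsto_real_sqrt[OF this] show "(\<lambda>n. l2norm (\<lambda>x. F n x - f x)) \<longlonglongrightarrow> 0"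
    by (simp add: l2norm_def)
qed

text \<open>Riesz-Fischer for absolutely convergent series: monotone convergence for the squared
  partial sums of the norms gives an L^2 majorant, which forces a.e. convergence and dominates the
  partial sums.\<close>

lemma l2_series:
  fixes F :: "nat \<Rightarrow> real^2 \<Rightarrow> 'b::{banach, second_countable_topology}"
  assumes F: "\<And>n. square_integrable (F n)" and s: "summable (\<lambda>n. l2norm (F n))"
  shows "AE x in lborel. summable (\<lambda>n. norm (F n x))"
    and "square_integrable (\<lambda>x. \<Sum>n. F n x)"
    and "(\<lambda>N. l2norm (\<lambda>x. (\<Sum>i<N. F i x) - (\<Sum>n. F n x))) \<longlonglongrightarrow> 0"
    and "l2norm (\<lambda>x. \<Sum>n. F n x) \<le> (\<Sum>n. l2norm (F n))"
proof -
  have [measurable]: "F n \<in> borel_measurable lborel" for n using F by (rule square_integrable_measurable)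
  define B where "B = (\<Sum>n. l2norm (F n))"
  define G where "G N x = (\<Sum>i<N. norm (F i x))" for N x
  have [measurable]: "G N \<in> borel_measurable lborel" for N unfolding G_def by measurable
  have G0: "G N x \<ge> 0" for N x by (simp add: G_def sum_nonneg)
  have B0: "B \<ge> 0" unfolding B_def using s by (intro suminf_nonneg) auto
  have sqG: "square_integrable (G N)" for N
    unfolding G_def by (intro square_integrable_sum square_integrable_norm F)
  have "l2norm (G N) \<le> B" for N
  proof -
    have "l2norm (G N) \<le> (\<Sum>i<N. l2norm (\<lambda>x. norm (F i x)))"
      unfolding G_def by (intro l2norm_sum_le square_integrable_norm F)
    also have "\<dots> \<le> B" unfolding B_def l2norm_norm by (intro sum_le_suminf s) auto
    finally show ?thesis .
  qed
  then have GB: "(\<integral>\<^sup>+x. ennreal ((G N x)\<^sup>2) \<partial>lborel) \<le> ennreal (B\<^sup>2)" for N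
    using nn_integral_eq_l2norm[OF sqG[of N]] by (auto intro!: ennreal_leI power_mono)
  have "(\<integral>\<^sup>+x. (SUP N. ennreal ((G N x)\<^sup>2)) \<partial>lborel) = (SUP N. \<integral>\<^sup>+x. ennreal ((G N x)\<^sup>2) \<partial>lborel)"
  proof (rule nn_integral_monotone_convergence_SUP)
    show "incseq (\<lambda>N x. ennreal ((G N x)\<^sup>2))"
    proof (intro incseq_SucI le_funI ennreal_leI power_mono G0)
      show "G i x \<le> G (Suc i) x" for i x by (simp add: G_def)
    qed
  qed auto
  also have "\<dots> \<le> ennreal (B\<^sup>2)" by (rule SUP_least) (rule GB)
  finally have le: "(\<integral>\<^sup>+x. (SUP N. ennreal ((G N x)\<^sup>2)) \<partial>lborel) \<le> ennreal (B\<^sup>2)" .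
  have "AE x in lborel. (SUP N. ennreal ((G N x)\<^sup>2)) \<noteq> \<infinity>"
    by (rule nn_integral_noteq_infinite) (use le in \<open>auto simp: top_unique\<close>)
  then show ae: "AE x in lborel. summable (\<lambda>n. norm (F n x))"
  proof eventually_elim
    case (elim x)
    then obtain c where c: "(SUP N. ennreal ((G N x)\<^sup>2)) = ennreal c" "c \<ge> 0"
      by (cases "SUP N. ennreal ((G N x)\<^sup>2)") auto
    have "(G N x)\<^sup>2 \<le> c" for N
    proof -
      have "ennreal ((G N x)\<^sup>2) \<le> (SUP N. ennreal ((G N x)\<^sup>2))" by (rule SUP_upper) simp
      then show ?thesis using c by simp
    qed
    then have "\<bar>G N x\<bar> \<le> sqrt c" for N by (simp add: real_le_rsqrt abs_le_square_iff)
    then have "(\<Sum>i<N. norm (F i x)) \<le> sqrt c" for N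
      using G0[of N x] unfolding G_def by (metis abs_of_nonneg)
    then show ?case
      by (intro bounded_imp_summable[of _ "sqrt c"]) (simp_all flip: lessThan_Suc_atMost del: sum.lessThan_Suc)
  qed
  \<comment> \<open>The majorant. Where the series of norms diverges, \<open>suminf\<close> has no
    useful value, but this happens only on a null set.\<close>
  define g where "g x = (\<Sum>n. norm (F n x))" for x
  have [measurable]: "g \<in> borel_measurable lborel" unfolding g_def by measurable
  have "AE x in lborel. ennreal ((g x)\<^sup>2) \<le> (SUP N. ennreal ((G N x)\<^sup>2))"
    using ae
  proof eventually_elim
    case (elim x)
    have "(\<lambda>N. (G N x)\<^sup>2) \<longlonglongrightarrow> (g x)\<^sup>2"
      unfolding G_def g_def by (intro tendsto_power summable_LIMSEQ elim)
    then have "(\<lambda>N. ennreal ((G N x)\<^sup>2)) \<longlonglongrightarrow> ennreal ((g x)\<^sup>2)" by (rule tendsto_ennrealI)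
    then show ?case by (rule LIMSEQ_le_const2) (use SUP_upper[of _ UNIV "\<lambda>N. ennreal ((G N x)\<^sup>2)"] in auto)
  qed
  then have "(\<integral>\<^sup>+x. ennreal ((g x)\<^sup>2) \<partial>lborel) \<le> (\<integral>\<^sup>+x. (SUP N. ennreal ((G N x)\<^sup>2)) \<partial>lborel)"
    by (rule nn_integral_mono_AE)
  also note le
  finally have gB: "(\<integral>\<^sup>+x. ennreal ((g x)\<^sup>2) \<partial>lborel) \<le> ennreal (B\<^sup>2)" .
  have "integrable lborel (\<lambda>x. (g x)\<^sup>2)"
    by (rule integrableI_nonneg) (use gB in \<open>auto simp: le_less_trans\<close>)
  then have sg: "square_integrable g" by (simp add: square_integrable_def)
  have "ennreal ((l2norm g)\<^sup>2) \<le> ennreal (B\<^sup>2)"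
    using nn_integral_eq_l2norm[OF sg] gB by simp
  then have lg: "l2norm g \<le> B" using B0 by (auto intro: power2_le_imp_le)
  have gn: "AE x in lborel. norm (\<Sum>n. F n x) \<le> norm (g x)"
    using ae by eventually_elim (auto simp: g_def suminf_nonneg intro!: summable_norm)
  show "square_integrable (\<lambda>x. \<Sum>n. F n x)" by (rule square_integrable_bound[OF sg _ gn]) measurable
  show "l2norm (\<lambda>x. \<Sum>n. F n x) \<le> (\<Sum>n. l2norm (F n))"
    using square_integrable_bound(2)[OF sg _ gn] lg unfolding B_def by simp
  show "(\<lambda>N. l2norm (\<lambda>x. (\<Sum>i<N. F i x) - (\<Sum>n. F n x))) \<longlonglongrightarrow> 0"
  proof (rule l2_dominated_convergence(2)[OF _ _ sg])
    show "AE x in lborel. norm (\<Sum>i<n. F i x) \<le> norm (g x)" for n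
      using ae
    proof eventually_elim
      case (elim x)
      have "norm (\<Sum>i<n. F i x) \<le> (\<Sum>i<n. norm (F i x))" by (rule norm_sum)
      also have "\<dots> \<le> g x" unfolding g_def by (intro sum_le_suminf elim) auto
      finally show ?case by simp
    qed
    show "AE x in lborel. (\<lambda>N. \<Sum>i<N. F i x) \<longlonglongrightarrow> (\<Sum>n. F n x)"
      using ae by eventually_elim (auto intro!: summable_LIMSEQ summable_norm_cancel)
  qed measurable
qed

text \<open>Along a subsequence with increments below (1/2)^k the telescoping series falls under
  \<open>l2_series\<close>; the Cauchy property then carries the limit to the whole
  sequence.\<close>

lemma l2_complete:
  fixes F :: "nat \<Rightarrow> real^2 \<Rightarrow> 'b::{banach, second_countable_topology}"
  assumes F: "\<And>n. square_integrable (F n)"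
    and C: "\<And>e. e > 0 \<Longrightarrow> \<exists>N. \<forall>m\<ge>N. \<forall>n\<ge>N. l2norm (\<lambda>x. F m x - F n x) < e"
  shows "\<exists>f. square_integrable f \<and> (\<lambda>n. l2norm (\<lambda>x. F n x - f x)) \<longlonglongrightarrow> 0"
proof -
  have "\<forall>k. \<exists>N. \<forall>m\<ge>N. \<forall>n\<ge>N. l2norm (\<lambda>x. F m x - F n x) < (1/2)^k" using C by simp
  then obtain N where N: "\<And>k m n. m \<ge> N k \<Longrightarrow> n \<ge> N k \<Longrightarrow> l2norm (\<lambda>x. F m x - F n x) < (1/2)^k"
    by metis
  \<comment> \<open>Partial sums of \<open>N\<close> instead of \<open>N\<close> itself, so that the
    indices are monotone and still at least \<open>N k\<close>.\<close>
  define K where "K k = (\<Sum>i\<le>k. N i)" for k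
  have KN: "K k \<ge> N k" for k unfolding K_def by (rule member_le_sum) auto
  have KS: "K (Suc k) \<ge> K k" for k unfolding K_def by simp
  define D where "D k x = F (K (Suc k)) x - F (K k) x" for k x
  have sqD: "square_integrable (D k)" for k unfolding D_def by (intro square_integrable_diff F)
  have "l2norm (D k) \<le> (1/2)^k" for k
    unfolding D_def using KN[of k] KS[of k] by (intro less_imp_le[OF N]) auto
  then have sD: "summable (\<lambda>k. l2norm (D k))"
    by (intro summable_comparison_test'[OF summable_geometric[of "1/2::real"], of 0]) auto
  define f where "f x = F (K 0) x + (\<Sum>k. D k x)" for x
  have sqf: "square_integrable f" unfolding f_def by (intro square_integrable_add F l2_series[OF sqD sD])
  have tele: "(\<Sum>k<n. D k x) = F (K n) x - F (K 0) x" for n x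
    unfolding D_def by (rule sum_lessThan_telescope)
  have lim: "(\<lambda>n. l2norm (\<lambda>x. F (K n) x - f x)) \<longlonglongrightarrow> 0"
    using l2_series(3)[OF sqD sD] unfolding tele f_def by (simp add: algebra_simps)
  have "(\<lambda>n. l2norm (\<lambda>x. F n x - f x)) \<longlonglongrightarrow> 0"
  proof (rule LIMSEQ_I)
    fix e :: real assume e: "e > 0"
    have "(\<lambda>k. (1/2::real)^k) \<longlonglongrightarrow> 0" by (rule LIMSEQ_realpow_zero) auto
    then have "\<forall>\<^sub>F k in sequentially. (1/2::real)^k < e/2 \<and> l2norm (\<lambda>x. F (K k) x - f x) < e/2"
      using order_tendstoD(2)[OF lim, of "e/2"] order_tendstoD(2)[OF \<open>(\<lambda>k. (1/2::real)^k) \<longlonglongrightarrow> 0\<close>, of "e/2"] e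
      by (intro eventually_conj) auto
    then obtain k where k: "(1/2::real)^k < e/2" "l2norm (\<lambda>x. F (K k) x - f x) < e/2"
      by (auto simp: eventually_sequentially)
    have "norm (l2norm (\<lambda>x. F n x - f x) - 0) < e" if "n \<ge> N k" for n
    proof -
      have "l2norm (\<lambda>x. F n x - f x) \<le> l2norm (\<lambda>x. F n x - F (K k) x) + l2norm (\<lambda>x. F (K k) x - f x)"
        by (intro l2norm_triangle_diff F sqf)
      also have "\<dots> < e/2 + e/2" using N[OF that KN[of k]] k by (intro add_strict_mono) auto
      finally show ?thesis by simp
    qed
    then show "\<exists>no. \<forall>n\<ge>no. norm (l2norm (\<lambda>x. F n x - f x) - 0) < e" by blast
  qed
  then show ?thesis using sqf by blast
qed

section \<open>Translations, reflections and Young's inequality\<close>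

lemma lborel_distr_translate: "distr lborel borel (\<lambda>x. x + h) = (lborel :: (real^2) measure)"
proof -
  have "(\<lambda>x. x + h) = (+) h" by (auto simp: add.commute)
  then show ?thesis using lborel_distr_plus[of h] by simp
qed

lemma lborel_distr_reflect: "distr lborel borel (\<lambda>x. h - x) = (lborel :: (real^2) measure)"
  using lborel_affine[of "-1" h] by (simp add: density_1)

lemma nn_integral_translate:
  fixes f :: "real^2 \<Rightarrow> ennreal"
  assumes [measurable]: "f \<in> borel_measurable borel"
  shows "(\<integral>\<^sup>+x. f (x + h) \<partial>lborel) = (\<integral>\<^sup>+x. f x \<partial>lborel)"
  by (subst (2) lborel_distr_translate[of h, symmetric], subst nn_integral_distr) auto

lemma nn_integral_reflect:
  fixes f :: "real^2 \<Rightarrow> ennreal"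
  assumes [measurable]: "f \<in> borel_measurable borel"
  shows "(\<integral>\<^sup>+x. f (h - x) \<partial>lborel) = (\<integral>\<^sup>+x. f x \<partial>lborel)"
  by (subst (2) lborel_distr_reflect[of h, symmetric], subst nn_integral_distr) auto

lemma integral_translate:
  fixes f :: "real^2 \<Rightarrow> 'b::{banach, second_countable_topology}"
  assumes [measurable]: "f \<in> borel_measurable borel"
  shows "(LINT x|lborel. f (x + h)) = (LINT x|lborel. f x)"
    and "integrable lborel (\<lambda>x. f (x + h)) \<longleftrightarrow> integrable lborel f"
  using integral_distr[of "\<lambda>x. x + h" lborel borel f] integrable_distr_eq[of "\<lambda>x. x + h" lborel borel f]
  by (auto simp: lborel_distr_translate)

lemma integral_reflect:
  fixes f :: "real^2 \<Rightarrow> 'b::{banach, second_countable_topology}"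
  assumes [measurable]: "f \<in> borel_measurable borel"
  shows "(LINT x|lborel. f (h - x)) = (LINT x|lborel. f x)"
    and "integrable lborel (\<lambda>x. f (h - x)) \<longleftrightarrow> integrable lborel f"
  using integral_distr[of "\<lambda>x. h - x" lborel borel f] integrable_distr_eq[of "\<lambda>x. h - x" lborel borel f]
  by (auto simp: lborel_distr_reflect)

lemma AE_translate:
  assumes "AE x in (lborel :: (real^2) measure). P x"
  shows "AE x in lborel. P (x + h)"
proof -
  from assms have "AE x in distr lborel borel (\<lambda>x. x + h). P x" by (subst lborel_distr_translate)
  then show ?thesis by (rule AE_distrD[rotated]) simp
qed

lemma square_integrable_translate:
  assumes "square_integrable f"
  shows "square_integrable (\<lambda>x. f (x + h))" "l2norm (\<lambda>x. f (x + h)) = l2norm f"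
proof -
  have [measurable]: "f \<in> borel_measurable borel" using assms square_integrable_measurable by fastforce
  show "square_integrable (\<lambda>x. f (x + h))"
    using integral_translate(2)[of "\<lambda>x. (norm (f x))\<^sup>2" h] square_integrableD[OF assms]
    by (simp add: square_integrable_def)
  show "l2norm (\<lambda>x. f (x + h)) = l2norm f"
    using integral_translate(1)[of "\<lambda>x. (norm (f x))\<^sup>2" h] by (simp add: l2norm_def)
qed

lemma square_integrable_reflect:
  assumes "square_integrable f"
  shows "square_integrable (\<lambda>x. f (h - x))" "l2norm (\<lambda>x. f (h - x)) = l2norm f"
proof -
  have [measurable]: "f \<in> borel_measurable borel" using assms square_integrable_measurable by fastforce
  show "square_integrable (\<lambda>x. f (h - x))"
    using integral_reflect(2)[of "\<lambda>x. (norm (f x))\<^sup>2" h] square_integrableD[OF assms]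
    by (simp add: square_integrable_def)
  show "l2norm (\<lambda>x. f (h - x)) = l2norm f"
    using integral_reflect(1)[of "\<lambda>x. (norm (f x))\<^sup>2" h] by (simp add: l2norm_def)
qed

text \<open>Convolution of L^1 with L^2: Cauchy-Schwarz for the measure with density
  \<open>a\<close> against the constant 1, then Tonelli and translation invariance. In
  \<open>ennreal\<close> no integrability has to be checked.\<close>

lemma young_nn_integral:
  fixes a b :: "real^2 \<Rightarrow> ennreal"
  assumes [measurable]: "a \<in> borel_measurable borel" "b \<in> borel_measurable borel"
  shows "(\<integral>\<^sup>+\<xi>. (\<integral>\<^sup>+\<eta>. a \<eta> * b (\<xi> - \<eta>) \<partial>lborel)\<^sup>2 \<partial>lborel)
    \<le> (\<integral>\<^sup>+\<eta>. a \<eta> \<partial>lborel)\<^sup>2 * (\<integral>\<^sup>+\<eta>. (b \<eta>)\<^sup>2 \<partial>lborel)"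
proof -
  have "(\<integral>\<^sup>+\<eta>. a \<eta> * b (\<xi> - \<eta>) \<partial>lborel)\<^sup>2
      \<le> (\<integral>\<^sup>+\<eta>. a \<eta> * (b (\<xi> - \<eta>))\<^sup>2 \<partial>lborel) * (\<integral>\<^sup>+\<eta>. a \<eta> \<partial>lborel)" for \<xi>
    using Cauchy_Schwarz_nn_integral[of "\<lambda>\<eta>. b (\<xi> - \<eta>)" "density lborel a" "\<lambda>_. 1"]
    by (simp add: nn_integral_density emeasure_density)
  then have "(\<integral>\<^sup>+\<xi>. (\<integral>\<^sup>+\<eta>. a \<eta> * b (\<xi> - \<eta>) \<partial>lborel)\<^sup>2 \<partial>lborel)
      \<le> (\<integral>\<^sup>+\<xi>. (\<integral>\<^sup>+\<eta>. a \<eta> * (b (\<xi> - \<eta>))\<^sup>2 \<partial>lborel) * (\<integral>\<^sup>+\<eta>. a \<eta> \<partial>lborel) \<partial>lborel)"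
    by (intro nn_integral_mono) auto
  also have "\<dots> = (\<integral>\<^sup>+\<xi>. (\<integral>\<^sup>+\<eta>. a \<eta> * (b (\<xi> - \<eta>))\<^sup>2 \<partial>lborel) \<partial>lborel) * (\<integral>\<^sup>+\<eta>. a \<eta> \<partial>lborel)"
    by (rule nn_integral_multc) measurable
  also have "(\<integral>\<^sup>+\<xi>. (\<integral>\<^sup>+\<eta>. a \<eta> * (b (\<xi> - \<eta>))\<^sup>2 \<partial>lborel) \<partial>lborel)
     = (\<integral>\<^sup>+\<eta>. (\<integral>\<^sup>+\<xi>. a \<eta> * (b (\<xi> - \<eta>))\<^sup>2 \<partial>lborel) \<partial>lborel)"
    by (rule lborel_pair.Fubini') measurable
  also have "\<dots> = (\<integral>\<^sup>+\<eta>. a \<eta> * (\<integral>\<^sup>+\<xi>. (b \<xi>)\<^sup>2 \<partial>lborel) \<partial>lborel)"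
  proof (rule nn_integral_cong)
    fix \<eta> :: "real^2"
    have "(\<integral>\<^sup>+\<xi>. a \<eta> * (b (\<xi> - \<eta>))\<^sup>2 \<partial>lborel) = a \<eta> * (\<integral>\<^sup>+\<xi>. (b (\<xi> - \<eta>))\<^sup>2 \<partial>lborel)"
      by (rule nn_integral_cmult) measurable
    also have "(\<integral>\<^sup>+\<xi>. (b (\<xi> - \<eta>))\<^sup>2 \<partial>lborel) = (\<integral>\<^sup>+\<xi>. (b \<xi>)\<^sup>2 \<partial>lborel)"
      using nn_integral_translate[of "\<lambda>\<xi>. (b \<xi>)\<^sup>2" "- \<eta>"] by simp
    finally show "(\<integral>\<^sup>+\<xi>. a \<eta> * (b (\<xi> - \<eta>))\<^sup>2 \<partial>lborel) = a \<eta> * (\<integral>\<^sup>+\<xi>. (b \<xi>)\<^sup>2 \<partial>lborel)" .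
  qed
  also have "\<dots> = (\<integral>\<^sup>+\<eta>. a \<eta> \<partial>lborel) * (\<integral>\<^sup>+\<eta>. (b \<eta>)\<^sup>2 \<partial>lborel)"
    by (rule nn_integral_multc) measurable
  finally show ?thesis by (simp add: power2_eq_square mult_ac)
qed

section \<open>Gaussian regularisation and the Parseval identity\<close>

lemma cis_measurable [measurable (raw)]:
  "f \<in> borel_measurable M \<Longrightarrow> (\<lambda>x. cis (f x)) \<in> borel_measurable M"
proof -
  have "continuous_on UNIV cis" by (rule continuous_on_cis[OF continuous_on_id])
  then have "cis \<in> borel_measurable borel" by (rule borel_measurable_continuous_onI)
  then show "f \<in> borel_measurable M \<Longrightarrow> (\<lambda>x. cis (f x)) \<in> borel_measurable M"
    by (rule measurable_compose[rotated])
qed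

lemma cnj_measurable [measurable (raw)]:
  assumes "f \<in> borel_measurable M"
  shows "(\<lambda>x. cnj (f x)) \<in> borel_measurable M"
proof -
  have "cnj \<in> borel_measurable borel"
    by (intro borel_measurable_continuous_onI continuous_on_cnj continuous_on_id)
  then show ?thesis using assms by (rule measurable_compose[rotated])
qed

lemma measurable_fst_snd_borel [measurable]:
  "fst \<in> borel_measurable (borel :: ('a::second_countable_topology \<times> 'b::second_countable_topology) measure)"
  "snd \<in> borel_measurable (borel :: ('a::second_countable_topology \<times> 'b::second_countable_topology) measure)"
  by (auto intro!: borel_measurable_continuous_onI continuous_intros)

text \<open>Reduces planar Gaussians and the weight (1 + |xi|^2)^{-s} to one variable. The factor
  may depend on the basis vector because a phase has a different frequency in each
  direction.\<close>

lemma integral_lborel_prod: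
  fixes f :: "'b::euclidean_space \<Rightarrow> real \<Rightarrow> complex"
  assumes f: "\<And>b. b \<in> Basis \<Longrightarrow> integrable lborel (f b)"
  shows "integrable lborel (\<lambda>x. \<Prod>b\<in>Basis. f b (x \<bullet> b))"
    and "(LINT x|lborel. (\<Prod>b\<in>Basis. f b (x \<bullet> b))) = (\<Prod>b\<in>Basis. LINT x|lborel. f b x)"
proof -
  interpret product_sigma_finite "\<lambda>_::'b. lborel :: real measure" by standard
  have [measurable]: "f b \<in> borel_measurable borel" if "b \<in> Basis" for b
    using f[OF that] by (simp add: borel_measurable_integrable)
  have m: "(\<lambda>g. \<Sum>b\<in>Basis. g b *\<^sub>R b) \<in> (\<Pi>\<^sub>M b\<in>(Basis::'b set). lborel) \<rightarrow>\<^sub>M borel"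
    by measurable
  have m2: "(\<lambda>x::'b. \<Prod>b\<in>Basis. f b (x \<bullet> b)) \<in> borel_measurable borel"
    by (intro borel_measurable_prod) measurable
  have e: "(\<Prod>b\<in>Basis. f b ((\<Sum>c\<in>Basis. g c *\<^sub>R c) \<bullet> b)) = (\<Prod>b\<in>Basis. f b (g b))" for g :: "'b \<Rightarrow> real"
    by (intro prod.cong) auto
  show "integrable lborel (\<lambda>x. \<Prod>b\<in>Basis. f b (x \<bullet> b))"
    by (subst lborel_eq, subst integrable_distr_eq[OF m m2], unfold e)
      (intro product_integrable_prod f, auto)
  show "(LINT x|lborel. (\<Prod>b\<in>Basis. f b (x \<bullet> b))) = (\<Prod>b\<in>Basis. LINT x|lborel. f b x)"
    by (subst lborel_eq, subst integral_distr[OF m m2], unfold e)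
      (intro product_integral_prod f, auto)
qed

text \<open>This is the characteristic function of the standard normal distribution, freed of its
  normalisation 1 / sqrt (2 pi).\<close>

lemma gaussian_fourier_1:
  "integrable lborel (\<lambda>t::real. cis (z * t) * of_real (exp (- t\<^sup>2 / 2)))"
  "(LINT t|lborel. cis (z * t) * of_real (exp (- t\<^sup>2 / 2))) = of_real (sqrt (2 * pi) * exp (- z\<^sup>2 / 2))"
proof -
  have e: "cis (z * t) * of_real (exp (- t\<^sup>2 / 2)) = of_real (sqrt (2 * pi)) * (std_normal_density t *\<^sub>R cis (z * t))" for t
    by (simp add: normal_density_def scaleR_conv_of_real exp_of_real[symmetric])
  have i: "integrable lborel (\<lambda>t. std_normal_density t *\<^sub>R cis (z * t))"
    by (rule Bochner_Integration.integrable_bound[OF integrable_normal_density[of 1 0]]) auto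
  then show "integrable lborel (\<lambda>t::real. cis (z * t) * of_real (exp (- t\<^sup>2 / 2)))"
    unfolding e by (rule integrable_mult_right)
  have "(LINT t|lborel. std_normal_density t *\<^sub>R cis (z * t)) = char std_normal_distribution z"
    unfolding char_def by (subst integral_density) (auto simp: cis_conv_exp)
  also have "\<dots> = of_real (exp (- z\<^sup>2 / 2))"
    by (simp add: char_std_normal_distribution)
  finally show "(LINT t|lborel. cis (z * t) * of_real (exp (- t\<^sup>2 / 2))) = of_real (sqrt (2 * pi) * exp (- z\<^sup>2 / 2))"
    unfolding e by (subst integral_mult_right_zero) simp
qed

lemma gaussian_fourier_scaled:
  assumes e: "e > 0"
  shows "integrable lborel (\<lambda>t::real. cis (z * t) * of_real (exp (- (e * t)\<^sup>2 / 2)))"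
  "(LINT t|lborel. cis (z * t) * of_real (exp (- (e * t)\<^sup>2 / 2))) = of_real (sqrt (2 * pi) / e * exp (- (z / e)\<^sup>2 / 2))"
proof -
  let ?f = "\<lambda>t::real. cis ((z / e) * t) * complex_of_real (exp (- t\<^sup>2 / 2))"
  have *: "?f (0 + e * t) = cis (z * t) * of_real (exp (- (e * t)\<^sup>2 / 2))" for t
    using e by simp
  show "integrable lborel (\<lambda>t::real. cis (z * t) * of_real (exp (- (e * t)\<^sup>2 / 2)))"
    using lborel_integrable_real_affine[OF gaussian_fourier_1(1)[of "z / e"], of e 0] e unfolding * by simp
  show "(LINT t|lborel. cis (z * t) * of_real (exp (- (e * t)\<^sup>2 / 2))) = of_real (sqrt (2 * pi) / e * exp (- (z / e)\<^sup>2 / 2))"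
    using lborel_integral_real_affine[of e ?f 0] e unfolding * gaussian_fourier_1(2)
    by (simp add: scaleR_conv_of_real field_simps)
qed

lemma cis_sum: "finite I \<Longrightarrow> cis (\<Sum>i\<in>I. f i) = (\<Prod>i\<in>I. cis (f i))"
  by (induction I rule: finite_induct) (auto simp: cis_mult[symmetric])

text \<open>As \<open>e\<close> tends to 0, \<open>gauss e\<close> tends to 1 and regularises
  integrals over frequencies, while its transform, a multiple of \<open>gauss (1 / e)\<close>,
  concentrates at the origin. Complex values spare coercions next to \<open>cis\<close>.\<close>

definition gauss :: "real \<Rightarrow> real^2 \<Rightarrow> complex" where
  "gauss e x = of_real (exp (- (e * norm x)\<^sup>2 / 2))"

lemma gauss_measurable [measurable]: "gauss e \<in> borel_measurable borel"
  unfolding gauss_def by measurable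

lemma gauss_prod: "cis (z \<bullet> x) * gauss e x = (\<Prod>b\<in>Basis. cis ((z \<bullet> b) * (x \<bullet> b)) * of_real (exp (- (e * (x \<bullet> b))\<^sup>2 / 2)))"
proof -
  have "(norm x)\<^sup>2 = (\<Sum>b\<in>Basis. (x \<bullet> b)\<^sup>2)"
    unfolding power2_norm_eq_inner by (subst euclidean_inner) (simp add: power2_eq_square)
  then have "- (e * norm x)\<^sup>2 / 2 = (\<Sum>b\<in>Basis. - (e * (x \<bullet> b))\<^sup>2 / 2)"
    by (simp add: power_mult_distrib sum_distrib_left sum_negf sum_divide_distrib)
  then have "gauss e x = (\<Prod>b\<in>Basis. of_real (exp (- (e * (x \<bullet> b))\<^sup>2 / 2)))"
    unfolding gauss_def by (simp add: exp_sum)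
  moreover have "cis (z \<bullet> x) = (\<Prod>b\<in>Basis. cis ((z \<bullet> b) * (x \<bullet> b)))"
    by (subst euclidean_inner) (simp add: cis_sum)
  ultimately show ?thesis by (simp add: prod.distrib)
qed

lemma gauss_fourier:
  assumes e: "e > 0"
  shows "integrable lborel (\<lambda>x::real^2. cis (z \<bullet> x) * gauss e x)"
    and "(LINT x|lborel. cis (z \<bullet> x) * gauss e x) = of_real (2 * pi / e\<^sup>2) * gauss (1 / e) z"
proof -
  show "integrable lborel (\<lambda>x::real^2. cis (z \<bullet> x) * gauss e x)"
    unfolding gauss_prod by (intro integral_lborel_prod gaussian_fourier_scaled e)
  have "(LINT x|lborel. cis (z \<bullet> x) * gauss e x)
      = (\<Prod>b\<in>Basis. of_real (sqrt (2 * pi) / e * exp (- ((z \<bullet> b) / e)\<^sup>2 / 2)))"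
    unfolding gauss_prod
    by (subst integral_lborel_prod(2), rule gaussian_fourier_scaled(1)[OF e])
      (intro prod.cong refl gaussian_fourier_scaled(2)[OF e])
  \<comment> \<open>The phase at frequency 0 is inserted so that \<open>gauss_prod\<close> can be
    read backwards; the square is the number of coordinates.\<close>
  also have "\<dots> = (of_real (sqrt (2 * pi) / e))^2 * (\<Prod>b\<in>Basis. cis ((0 \<bullet> b) * (z \<bullet> b)) * of_real (exp (- ((1 / e) * (z \<bullet> b))\<^sup>2 / 2)))"
    by (simp only: of_real_mult[of "sqrt (2 * pi) / e"] prod.distrib prod_constant) simp
  also have "(\<Prod>b\<in>Basis. cis ((0 \<bullet> b) * (z \<bullet> b)) * of_real (exp (- ((1 / e) * (z \<bullet> b))\<^sup>2 / 2))) = gauss (1 / e) z"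
    by (subst gauss_prod[symmetric]) simp
  also have "(complex_of_real (sqrt (2 * pi) / e))^2 = of_real (2 * pi / e\<^sup>2)"
    by (simp only: of_real_power[symmetric] power_divide) (simp add: real_sqrt_pow2)
  finally show "(LINT x|lborel. cis (z \<bullet> x) * gauss e x) = of_real (2 * pi / e\<^sup>2) * gauss (1 / e) z" .
qed

lemma gauss_integrable: "e > 0 \<Longrightarrow> integrable lborel (gauss e)"
  using gauss_fourier(1)[of e 0] by simp

lemma gauss_integral: "e > 0 \<Longrightarrow> (LINT x|lborel. gauss e x) = of_real (2 * pi / e\<^sup>2)"
  using gauss_fourier(2)[of e 0] by (simp add: gauss_def)

lemma norm_gauss: "norm (gauss e x) = exp (- (e * norm x)\<^sup>2 / 2)"
  by (simp add: gauss_def)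

lemma norm_gauss_le: "norm (gauss e x) \<le> 1"
  by (simp add: norm_gauss)

text \<open>The counterpart of \<open>fourier_integral\<close> for complex functions: Parseval is
  applied later to functions that carry a phase \<open>cis\<close> and are no longer real.\<close>

definition fint :: "(real^2 \<Rightarrow> complex) \<Rightarrow> real^2 \<Rightarrow> complex" where
  "fint a \<xi> = (1 / (2 * pi)) *\<^sub>R (LINT x|lborel. cis (- (x \<bullet> \<xi>)) * a x)"

lemma fourier_integral_fint: "fourier_integral f = fint (\<lambda>x. of_real (f x))"
  by (simp add: fourier_integral_def fint_def fun_eq_iff)

lemma integrable_cis_mult:
  assumes "integrable lborel (a :: real^2 \<Rightarrow> complex)" and [measurable]: "p \<in> borel_measurable lborel"
  shows "integrable lborel (\<lambda>x. cis (p x) * a x)"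
proof -
  have [measurable]: "a \<in> borel_measurable lborel" using assms by auto
  show ?thesis
    by (rule Bochner_Integration.integrable_bound[OF assms(1)]) (auto simp: norm_mult)
qed

lemma fint_measurable [measurable]:
  assumes "a \<in> borel_measurable borel"
  shows "fint a \<in> borel_measurable borel"
proof -
  note [measurable] = assms
  have "(\<lambda>\<xi>. LINT x|lborel. cis (- (x \<bullet> \<xi>)) * a x) \<in> borel_measurable borel"
    by (rule lborel.borel_measurable_lebesgue_integral) measurable
  then show ?thesis unfolding fint_def by measurable
qed

lemma norm_fint_le:
  shows "norm (fint a \<xi>) \<le> (1 / (2 * pi)) * (LINT x|lborel. norm (a x))"
proof -
  have "norm (LINT x|lborel. cis (- (x \<bullet> \<xi>)) * a x) \<le> (LINT x|lborel. norm (cis (- (x \<bullet> \<xi>)) * a x))"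
    by (rule integral_norm_bound)
  then show ?thesis by (simp add: fint_def norm_mult divide_right_mono)
qed

lemma fint_diff:
  assumes "integrable lborel a" "integrable lborel b"
  shows "fint (\<lambda>x. a x - b x) \<xi> = fint a \<xi> - fint b \<xi>"
proof -
  have "(LINT x|lborel. cis (- (x \<bullet> \<xi>)) * (a x - b x)) =
     (LINT x|lborel. cis (- (x \<bullet> \<xi>)) * a x) - (LINT x|lborel. cis (- (x \<bullet> \<xi>)) * b x)"
    unfolding right_diff_distrib
    by (intro Bochner_Integration.integral_diff integrable_cis_mult assms) auto
  then show ?thesis by (simp add: fint_def scaleR_right_diff_distrib)
qed

lemma fint_add:
  assumes "integrable lborel a" "integrable lborel b"
  shows "fint (\<lambda>x. a x + b x) \<xi> = fint a \<xi> + fint b \<xi>"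
proof -
  have "(LINT x|lborel. cis (- (x \<bullet> \<xi>)) * (a x + b x)) =
     (LINT x|lborel. cis (- (x \<bullet> \<xi>)) * a x) + (LINT x|lborel. cis (- (x \<bullet> \<xi>)) * b x)"
    unfolding distrib_left
    by (intro Bochner_Integration.integral_add integrable_cis_mult assms) auto
  then show ?thesis by (simp add: fint_def scaleR_right_distrib)
qed

lemma fint_mult_left: "fint (\<lambda>x. c * a x) \<xi> = c * fint a \<xi>"
proof -
  have "(\<lambda>x. cis (- (x \<bullet> \<xi>)) * (c * a x)) = (\<lambda>x. c * (cis (- (x \<bullet> \<xi>)) * a x))" by (auto simp: mult_ac)
  then show ?thesis by (simp add: fint_def)
qed

lemma integrable_tensor:
  fixes a b :: "real^2 \<Rightarrow> complex"
  assumes a: "integrable lborel a" and b: "integrable lborel b"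
  shows "integrable lborel (\<lambda>p. a (fst p) * b (snd p))"
    and "(LINT p|lborel. norm (a (fst p) * b (snd p))) = (LINT x|lborel. norm (a x)) * (LINT x|lborel. norm (b x))"
proof -
  have [measurable]: "a \<in> borel_measurable borel" "b \<in> borel_measurable borel" using a b by auto
  have "integrable (lborel \<Otimes>\<^sub>M lborel) (\<lambda>p. a (fst p) * b (snd p))"
  proof (rule lborel_pair.Fubini_integrable)
    show "integrable lborel (\<lambda>x. LINT y|lborel. norm (a (fst (x, y)) * b (snd (x, y))))"
      using a by (simp add: norm_mult)
    show "AE x in lborel. integrable lborel (\<lambda>y. a (fst (x, y)) * b (snd (x, y)))"
      using b by simp
  qed measurable
  then show i: "integrable lborel (\<lambda>p. a (fst p) * b (snd p))" by (simp add: lborel_prod)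
  have "(LINT p|(lborel \<Otimes>\<^sub>M lborel). norm (a (fst p) * b (snd p)))
     = (LINT x|lborel. LINT y|lborel. norm (a (fst (x, y)) * b (snd (x, y))))"
    by (rule lborel_pair.integral_fst'[symmetric]) (use i in \<open>simp add: lborel_prod\<close>)
  then show "(LINT p|lborel. norm (a (fst p) * b (snd p))) = (LINT x|lborel. norm (a x)) * (LINT x|lborel. norm (b x))"
    by (simp add: lborel_prod norm_mult)
qed

text \<open>The Gaussian makes the triple integral absolutely convergent, so by Fubini the frequency
  integral can be done first. Pairing with \<open>fint b (- \<eta>)\<close> instead of a conjugate
  keeps the identity bilinear, which serves norms and convolutions alike. The constant is (2
  pi)^{-2} times 2 pi / e^2.\<close>

lemma fint_mult_fint_gauss:
  assumes a: "integrable lborel a" and b: "integrable lborel b" and e: "e > 0"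
  shows "(LINT \<eta>|lborel. gauss e \<eta> * (fint a \<eta> * fint b (- \<eta>)))
    = of_real (1 / (2 * pi * e\<^sup>2)) * (LINT p|lborel. a (fst p) * b (snd p) * gauss (1 / e) (fst p - snd p))"
proof -
  have [measurable]: "a \<in> borel_measurable borel" "b \<in> borel_measurable borel" using a b by auto
  let ?h = "\<lambda>\<eta> p. gauss e \<eta> * (cis (- ((fst p - snd p) \<bullet> \<eta>)) * (a (fst p) * b (snd p)))"
  have prod: "fint a \<eta> * fint b (- \<eta>) = of_real (1 / (2 * pi)\<^sup>2) *
      (LINT p|lborel. cis (- ((fst p - snd p) \<bullet> \<eta>)) * (a (fst p) * b (snd p)))" for \<eta>
  proof -
    let ?a = "\<lambda>x. cis (- (x \<bullet> \<eta>)) * a x" and ?b = "\<lambda>x. cis (x \<bullet> \<eta>) * b x"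
    have i: "integrable lborel ?a" "integrable lborel ?b"
      by (intro integrable_cis_mult a b; simp)+
    have eq: "cis (- ((fst p - snd p) \<bullet> \<eta>)) * (a (fst p) * b (snd p)) = ?a (fst p) * ?b (snd p)" for p
    proof -
      have "cis (- ((fst p - snd p) \<bullet> \<eta>)) = cis (- (fst p \<bullet> \<eta>)) * cis (snd p \<bullet> \<eta>)"
        by (simp add: inner_diff_left cis_mult)
      then show ?thesis by (simp add: mult_ac)
    qed
    have "(LINT p|lborel. ?a (fst p) * ?b (snd p)) = (LINT x|lborel. LINT y|lborel. ?a (fst (x, y)) * ?b (snd (x, y)))"
      using lborel_pair.integral_fst'[of "\<lambda>p. ?a (fst p) * ?b (snd p)"] integrable_tensor(1)[OF i]
      by (simp add: lborel_prod)
    also have "\<dots> = (LINT x|lborel. ?a x) * (LINT x|lborel. ?b x)" by simp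
    finally show ?thesis
      unfolding eq by (simp add: fint_def scaleR_conv_of_real power2_eq_square)
  qed
  have int: "integrable (lborel \<Otimes>\<^sub>M lborel) (\<lambda>(\<eta>, p). ?h \<eta> p)"
  proof (rule lborel_pair.Fubini_integrable)
    have "integrable lborel (\<lambda>\<eta>. norm (gauss e \<eta>) * (LINT p|lborel. norm (a (fst p) * b (snd p))))"
      using gauss_integrable[OF e] by simp
    then show "integrable lborel (\<lambda>\<eta>. LINT p|lborel. norm (case (\<eta>, p) of (\<eta>, p) \<Rightarrow> ?h \<eta> p))"
      by (simp add: norm_mult)
    show "AE \<eta> in lborel. integrable lborel (\<lambda>p. case (\<eta>, p) of (\<eta>, p) \<Rightarrow> ?h \<eta> p)"
    proof (rule AE_I2)
      fix \<eta> :: "real^2"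
      show "integrable lborel (\<lambda>p. case (\<eta>, p) of (\<eta>, p) \<Rightarrow> ?h \<eta> p)"
        unfolding prod.case
        by (rule integrable_mult_right, rule Bochner_Integration.integrable_bound[OF integrable_tensor(1)[OF a b]])
          (auto simp: norm_mult)
    qed
  qed measurable
  have "(LINT \<eta>|lborel. gauss e \<eta> * (fint a \<eta> * fint b (- \<eta>)))
     = of_real (1 / (2 * pi)\<^sup>2) * (LINT \<eta>|lborel. LINT p|lborel. ?h \<eta> p)"
  proof -
    have "(LINT p|lborel. ?h \<eta> p) = gauss e \<eta> * (LINT p|lborel. cis (- ((fst p - snd p) \<bullet> \<eta>)) * (a (fst p) * b (snd p)))" for \<eta>
      by (rule integral_mult_right_zero)
    then show ?thesis
      unfolding prod by (simp only: mult.left_commute[of "gauss e _"] integral_mult_right_zero)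
  qed
  also have "(LINT \<eta>|lborel. LINT p|lborel. ?h \<eta> p) = (LINT p|lborel. LINT \<eta>|lborel. ?h \<eta> p)"
    by (rule lborel_pair.Fubini_integral[OF int, symmetric])
  also have "\<dots> = (LINT p|lborel. (a (fst p) * b (snd p)) * (of_real (2 * pi / e\<^sup>2) * gauss (1 / e) (fst p - snd p)))"
  proof (rule Bochner_Integration.integral_cong[OF refl])
    fix p :: "(real^2) \<times> (real^2)"
    have "(LINT \<eta>|lborel. ?h \<eta> p) = (LINT \<eta>|lborel. (a (fst p) * b (snd p)) * (cis ((snd p - fst p) \<bullet> \<eta>) * gauss e \<eta>))"
      by (intro Bochner_Integration.integral_cong refl) (simp add: mult_ac inner_diff_left)
    also have "\<dots> = (a (fst p) * b (snd p)) * (of_real (2 * pi / e\<^sup>2) * gauss (1 / e) (fst p - snd p))"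
      unfolding integral_mult_right_zero gauss_fourier(2)[OF e] by (simp add: gauss_def norm_minus_commute)
    finally show "(LINT \<eta>|lborel. ?h \<eta> p) = (a (fst p) * b (snd p)) * (of_real (2 * pi / e\<^sup>2) * gauss (1 / e) (fst p - snd p))" .
  qed
  also have "\<dots> = of_real (2 * pi / e\<^sup>2) * (LINT p|lborel. a (fst p) * b (snd p) * gauss (1 / e) (fst p - snd p))"
    by (simp only: mult.left_commute[of _ "of_real (2 * pi / e\<^sup>2)"] integral_mult_right_zero)
  finally show ?thesis
    by (simp add: power2_eq_square)
qed

section \<open>Continuity of translations in L^1\<close>

lemma integrable_diff_shift:
  fixes f :: "real^2 \<Rightarrow> complex"
  assumes f: "integrable lborel f"
  shows "integrable lborel (\<lambda>x. norm (f (x + z) - f x))"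
proof -
  have "integrable lborel (\<lambda>x. f (x + z))"
    using f by (subst integral_translate(2)) auto
  then show ?thesis using f by auto
qed

text \<open>For an indicator of an open set this is dominated convergence, because the indicator is lower semicontinuous.\<close>

lemma l1_translation_continuous:
  fixes f :: "real^2 \<Rightarrow> complex"
  assumes f: "integrable lborel f" and z: "z \<longlonglongrightarrow> 0"
  shows "(\<lambda>n. LINT x|lborel. norm (f (x + z n) - f x)) \<longlonglongrightarrow> 0"
proof -
  define P :: "(real^2 \<Rightarrow> complex) \<Rightarrow> bool"
    where "P f \<longleftrightarrow> (\<lambda>n. LINT x|lborel. norm (f (x + z n) - f x)) \<longlonglongrightarrow> 0" for f
  \<comment> \<open>\<open>P\<close> survives L^1 limits because translations preserve the L^1 norm:
    the approximation error is counted twice, once shifted, and the approximant itself moves by less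
    than e/3.\<close>
  have approx: "P f" if f: "integrable lborel f"
    and ex: "\<And>e. e > 0 \<Longrightarrow> \<exists>g. integrable lborel g \<and> P g \<and> (LINT x|lborel. norm (f x - g x)) < e" for f
    unfolding P_def
  proof (rule LIMSEQ_I)
    fix e :: real assume e: "e > 0"
    obtain g where g: "integrable lborel g" "P g" "(LINT x|lborel. norm (f x - g x)) < e/3"
      using ex[of "e/3"] e by auto
    have [measurable]: "f \<in> borel_measurable borel" "g \<in> borel_measurable borel" using f g by auto
    obtain N where N: "\<And>n. n \<ge> N \<Longrightarrow> norm ((LINT x|lborel. norm (g (x + z n) - g x)) - 0) < e/3"
      using LIMSEQ_D[OF g(2)[unfolded P_def], of "e/3"] e by auto
    have "norm ((LINT x|lborel. norm (f (x + z n) - f x)) - 0) < e" if n: "n \<ge> N" for n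
    proof -
      have ifg: "integrable lborel (\<lambda>x. norm (f x - g x))" using f g by auto
      have ish: "integrable lborel (\<lambda>x. norm (f (x + z n) - g (x + z n)))"
        using integral_translate(2)[of "\<lambda>x. norm (f x - g x)" "z n"] ifg by auto
      have esh: "(LINT x|lborel. norm (f (x + z n) - g (x + z n))) = (LINT x|lborel. norm (f x - g x))"
        using integral_translate(1)[of "\<lambda>x. norm (f x - g x)" "z n"] by auto
      have "(LINT x|lborel. norm (f (x + z n) - f x)) \<le>
        (LINT x|lborel. norm (f (x + z n) - g (x + z n)) + norm (g (x + z n) - g x) + norm (f x - g x))"
      proof (rule integral_mono)
        show "integrable lborel (\<lambda>x. norm (f (x + z n) - g (x + z n)) + norm (g (x + z n) - g x) + norm (f x - g x))"
          by (intro Bochner_Integration.integrable_add ish ifg integrable_diff_shift g)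
        fix x
        show "norm (f (x + z n) - f x) \<le> norm (f (x + z n) - g (x + z n)) + norm (g (x + z n) - g x) + norm (f x - g x)"
          using norm_triangle_ineq[of "f (x + z n) - g (x + z n)" "g (x + z n) - g x"]
            norm_triangle_ineq4[of "f (x + z n) - g x" "f x - g x"] by simp
      qed (intro integrable_diff_shift f)
      also have "\<dots> = (LINT x|lborel. norm (f x - g x)) + (LINT x|lborel. norm (g (x + z n) - g x)) + (LINT x|lborel. norm (f x - g x))"
        by (simp add: ish ifg integrable_diff_shift g esh)
      also have "\<dots> < e" using g(3) N[OF n] by simp
      finally show ?thesis by (simp add: integral_nonneg_AE)
    qed
    then show "\<exists>no. \<forall>n\<ge>no. norm ((LINT x|lborel. norm (f (x + z n) - f x)) - 0) < e" by blast
  qed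
  have P_open: "P (\<lambda>x. indicator U x *\<^sub>R c)" if U: "open U" and fin: "emeasure lborel U < \<infinity>" for U c
  proof -
    have [measurable]: "U \<in> sets borel" using U by simp
    let ?u = "\<lambda>x. indicator U x :: real"
    have iu: "integrable lborel ?u" using fin by (simp add: integrable_indicator_iff)
    have ius: "integrable lborel (\<lambda>x. ?u (x + h))" for h
      using integral_translate(2)[of ?u h] iu by simp
    have eus: "(LINT x|lborel. ?u (x + h)) = (LINT x|lborel. ?u x)" for h
      using integral_translate(1)[of ?u h] by simp
    have iuu: "integrable lborel (\<lambda>x. ?u (x + h) * ?u x)" for h
      by (rule Bochner_Integration.integrable_bound[OF iu]) (auto simp: indicator_def)
    have "(\<lambda>n. LINT x|lborel. ?u (x + z n) * ?u x) \<longlonglongrightarrow> (LINT x|lborel. ?u x)"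
    proof (rule integral_dominated_convergence[where w="?u"])
      show "AE x in lborel. (\<lambda>n. ?u (x + z n) * ?u x) \<longlonglongrightarrow> ?u x"
      proof (rule AE_I2)
        fix x
        show "(\<lambda>n. ?u (x + z n) * ?u x) \<longlonglongrightarrow> ?u x"
        proof (cases "x \<in> U")
          case True
          have "(\<lambda>n. x + z n) \<longlonglongrightarrow> x + 0" by (intro tendsto_intros z)
          then have "\<forall>\<^sub>F n in sequentially. x + z n \<in> U"
            using U True by (auto dest: topological_tendstoD)
          then have "\<forall>\<^sub>F n in sequentially. ?u (x + z n) * ?u x = ?u x"
            by eventually_elim (use True in auto)
          then show ?thesis by (rule tendsto_eventually)
        qed auto
      qed
      show "AE x in lborel. norm (?u (x + z n) * ?u x) \<le> ?u x" for n
        by (auto simp: indicator_def)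
    qed (use iu in measurable)
    then have "(\<lambda>n. 2 * (LINT x|lborel. ?u x) - 2 * (LINT x|lborel. ?u (x + z n) * ?u x)) \<longlonglongrightarrow>
        2 * (LINT x|lborel. ?u x) - 2 * (LINT x|lborel. ?u x)"
      by (intro tendsto_diff tendsto_mult tendsto_const)
    then have lim: "(\<lambda>n. (2 * (LINT x|lborel. ?u x) - 2 * (LINT x|lborel. ?u (x + z n) * ?u x)) * norm c) \<longlonglongrightarrow> 0"
      by (intro tendsto_mult_left_zero) simp
    \<comment> \<open>For values 0 and 1, |u - v| = u + v - 2 u v; by translation invariance only
      the integral of the overlap depends on the shift.\<close>
    have "(LINT x|lborel. norm (indicator U (x + z n) *\<^sub>R c - indicator U x *\<^sub>R c))
       = (2 * (LINT x|lborel. ?u x) - 2 * (LINT x|lborel. ?u (x + z n) * ?u x)) * norm c" for n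
    proof -
      have "(LINT x|lborel. norm (indicator U (x + z n) *\<^sub>R c - indicator U x *\<^sub>R c))
        = (LINT x|lborel. (?u (x + z n) + ?u x - 2 * (?u (x + z n) * ?u x)) * norm c)"
        by (intro Bochner_Integration.integral_cong refl) (auto simp: indicator_def)
      also have "\<dots> = (LINT x|lborel. ?u (x + z n) + ?u x - 2 * (?u (x + z n) * ?u x)) * norm c"
        by (rule integral_mult_left_zero)
      also have "(LINT x|lborel. ?u (x + z n) + ?u x - 2 * (?u (x + z n) * ?u x))
         = (LINT x|lborel. ?u (x + z n)) + (LINT x|lborel. ?u x) - 2 * (LINT x|lborel. ?u (x + z n) * ?u x)"
        by (simp only: Bochner_Integration.integral_diff Bochner_Integration.integral_add ius iu iuu
            Bochner_Integration.integrable_add integrable_mult_right integral_mult_right_zero)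
      finally show ?thesis using eus[of "z n"] by simp
    qed
    then show ?thesis unfolding P_def using lim by simp
  qed
  have "P f"
    using f
  proof (induction rule: integrable_induct)
    case (base A c)
    have [measurable]: "A \<in> sets borel" using base by simp
    have iA: "integrable lborel (\<lambda>x. indicator A x :: real)" using base by (simp add: integrable_indicator_iff)
    show ?case
    proof (rule approx)
      show "integrable lborel (\<lambda>x. indicator A x *\<^sub>R c)" using iA by (rule integrable_scaleR_left)
      fix e :: real assume e: "e > 0"
      define d where "d = e / (norm c + 1)"
      have d: "d > 0" using e by (simp add: d_def add_nonneg_pos)
      \<comment> \<open>Outer regularity replaces the measurable set by an open one at an L^1 cost
        of at most \<open>d * norm c\<close>; the summand 1 in the denominator of \<open>d\<close>
        covers \<open>c = 0\<close>.\<close>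
      obtain U where U: "open U" "A \<subseteq> U" "emeasure lborel (U - A) < ennreal d"
        using outer_regular_lborel[of A d] d by auto
      have [measurable]: "U \<in> sets borel" using U by simp
      have "emeasure lborel U \<le> emeasure lborel A + emeasure lborel (U - A)"
      proof -
        have "A \<union> (U - A) = U" using U(2) by auto
        then show ?thesis using emeasure_subadditive[of A lborel "U - A"] by simp
      qed
      also have "\<dots> < \<infinity>"
      proof -
        have "emeasure lborel (U - A) < \<infinity>" using U(3) by (rule less_trans) simp
        then show ?thesis using base by simp
      qed
      finally have finU: "emeasure lborel U < \<infinity>" .
      have "measure lborel (U - A) < d"
      proof -
        have "emeasure lborel (U - A) \<noteq> \<infinity>" using U(3) by (auto simp: top_unique dest: order_less_imp_not_less)
        then show ?thesis using U(3) by (subst (asm) emeasure_eq_ennreal_measure) (auto simp: ennreal_less_iff)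
      qed
      moreover have "(LINT x|lborel. norm (indicator A x *\<^sub>R c - indicator U x *\<^sub>R c)) = measure lborel (U - A) * norm c"
      proof -
        have "(LINT x|lborel. norm (indicator A x *\<^sub>R c - indicator U x *\<^sub>R c)) = (LINT x|lborel. indicator (U - A) x * norm c)"
          by (intro Bochner_Integration.integral_cong refl) (use U(2) in \<open>auto simp: indicator_def\<close>)
        then show ?thesis by simp
      qed
      ultimately have "(LINT x|lborel. norm (indicator A x *\<^sub>R c - indicator U x *\<^sub>R c)) \<le> d * norm c"
        by (simp add: mult_right_mono)
      also have "\<dots> < e" using e norm_ge_zero[of c] by (simp add: d_def divide_simps del: norm_ge_zero)
      finally show "\<exists>g. integrable lborel g \<and> P g \<and> (LINT x|lborel. norm (indicator A x *\<^sub>R c - g x)) < e"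
        using P_open[OF U(1) finU] finU
        by (intro exI[of _ "\<lambda>x. indicator U x *\<^sub>R c"]) (auto simp: integrable_indicator_iff intro!: integrable_scaleR_left)
    qed
  next
    case (add f g)
    have lim: "(\<lambda>n. (LINT x|lborel. norm (f (x + z n) - f x)) + (LINT x|lborel. norm (g (x + z n) - g x))) \<longlonglongrightarrow> 0"
      using tendsto_add[OF add(3)[unfolded P_def] add(4)[unfolded P_def]] by simp
    have "norm (LINT x|lborel. norm (f (x + z n) + g (x + z n) - (f x + g x)))
       \<le> (LINT x|lborel. norm (f (x + z n) - f x)) + (LINT x|lborel. norm (g (x + z n) - g x))" for n
    proof -
      have "(LINT x|lborel. norm (f (x + z n) + g (x + z n) - (f x + g x)))
        \<le> (LINT x|lborel. norm (f (x + z n) - f x) + norm (g (x + z n) - g x))"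
      proof (rule integral_mono)
        show "integrable lborel (\<lambda>x. norm (f (x + z n) + g (x + z n) - (f x + g x)))"
          using integrable_diff_shift[OF Bochner_Integration.integrable_add[OF add(1,2)]] .
        show "integrable lborel (\<lambda>x. norm (f (x + z n) - f x) + norm (g (x + z n) - g x))"
          by (intro Bochner_Integration.integrable_add integrable_diff_shift add)
        show "norm (f (x + z n) + g (x + z n) - (f x + g x)) \<le> norm (f (x + z n) - f x) + norm (g (x + z n) - g x)" for x
          using norm_triangle_ineq[of "f (x + z n) - f x" "g (x + z n) - g x"] by (simp add: algebra_simps)
      qed
      also have "\<dots> = (LINT x|lborel. norm (f (x + z n) - f x)) + (LINT x|lborel. norm (g (x + z n) - g x))"
        by (intro Bochner_Integration.integral_add integrable_diff_shift add)
      finally show ?thesis by (simp add: integral_nonneg_AE)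
    qed
    then show ?case unfolding P_def by (intro Lim_null_comparison[OF always_eventually[OF allI] lim])
  next
    case (lim f S)
    show ?case
    proof (rule approx[OF lim.hyps(4)])
      fix e :: real assume e: "e > 0"
      have [measurable]: "f \<in> borel_measurable borel" "S i \<in> borel_measurable borel" for i
        using lim.hyps(4) lim.hyps(1)[of i] by auto
      have "(\<lambda>i. LINT x|lborel. norm (f x - S i x)) \<longlonglongrightarrow> (LINT x|(lborel :: (real^2) measure). 0)"
      proof (rule integral_dominated_convergence[where w="\<lambda>x. 3 * norm (f x)"])
        show "integrable lborel (\<lambda>x. 3 * norm (f x))" using lim.hyps(4) by auto
        show "AE x in lborel. (\<lambda>i. norm (f x - S i x)) \<longlonglongrightarrow> 0"
        proof (rule AE_I2)
          fix x
          have "(\<lambda>i. norm (f x - S i x)) \<longlonglongrightarrow> norm (f x - f x)"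
            by (intro tendsto_intros lim.hyps(2)) auto
          then show "(\<lambda>i. norm (f x - S i x)) \<longlonglongrightarrow> 0" by simp
        qed
        show "AE x in lborel. norm (norm (f x - S i x)) \<le> 3 * norm (f x)" for i
        proof (rule AE_I2)
          fix x
          show "norm (norm (f x - S i x)) \<le> 3 * norm (f x)"
            using lim.hyps(3)[of x i] norm_triangle_ineq4[of "f x" "S i x"] by simp
        qed
      qed auto
      then have "\<forall>\<^sub>F i in sequentially. (LINT x|lborel. norm (f x - S i x)) < e"
        using e by (intro order_tendstoD(2)[where a = e]) auto
      then obtain i where "(LINT x|lborel. norm (f x - S i x)) < e" by (auto simp: eventually_sequentially)
      then show "\<exists>g. integrable lborel g \<and> P g \<and> (LINT x|lborel. norm (f x - g x)) < e"
        using lim.hyps(1) lim.IH by blast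
    qed
  qed
  then show ?thesis by (simp add: P_def)
qed

section \<open>Bessel's inequality and Parseval's identity\<close>

lemma integral_scale_reflect:
  fixes h :: "real^2 \<Rightarrow> complex"
  assumes [measurable]: "h \<in> borel_measurable borel" and e: "e > 0"
  shows "(LINT y|lborel. h y) = of_real (e\<^sup>2) * (LINT w|lborel. h (x - e *\<^sub>R w))"
proof -
  have "(LINT y|lborel. h y) = (LINT y|density (distr lborel borel (\<lambda>w. x + (- e) *\<^sub>R w)) (\<lambda>_. ennreal (\<bar>- e\<bar>^DIM(real^2))). h y)"
    using lborel_affine[of "- e" x] e by simp
  also have "\<dots> = (LINT y|distr lborel borel (\<lambda>w. x + (- e) *\<^sub>R w). (\<bar>- e\<bar>^DIM(real^2)) *\<^sub>R h y)"
    by (rule integral_density) auto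
  also have "\<dots> = (LINT w|lborel. (\<bar>- e\<bar>^DIM(real^2)) *\<^sub>R h (x + (- e) *\<^sub>R w))"
    by (rule integral_distr) auto
  also have "\<dots> = of_real (e\<^sup>2) * (LINT w|lborel. h (x - e *\<^sub>R w))"
    using e by (simp add: scaleR_conv_of_real)
  finally show ?thesis .
qed

lemma fint_cnj: "fint (\<lambda>x. cnj (a x)) (- \<xi>) = cnj (fint a \<xi>)"
proof -
  have "(\<lambda>x. cis (x \<bullet> \<xi>) * cnj (a x)) = (\<lambda>x. cnj (cis (- (x \<bullet> \<xi>)) * a x))" by (simp add: cis_cnj)
  then have "cnj (LINT x|lborel. cis (- (x \<bullet> \<xi>)) * a x) = (LINT x|lborel. cis (x \<bullet> \<xi>) * cnj (a x))"
    by (simp only: Bochner_Integration.integral_cnj)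
  then show ?thesis by (simp add: fint_def)
qed

lemma nn_integral_gauss:
  assumes "e > 0"
  shows "(\<integral>\<^sup>+x. ennreal (norm (gauss e x)) \<partial>lborel) = ennreal (2 * pi / e\<^sup>2)"
proof -
  have i: "integrable lborel (\<lambda>x. norm (gauss e x))" using gauss_integrable[OF assms] by auto
  have "complex_of_real (LINT x|lborel. norm (gauss e x)) = (LINT x|lborel. gauss e x)"
    by (simp add: gauss_def[abs_def])
  also have "\<dots> = of_real (2 * pi / e\<^sup>2)" by (rule gauss_integral[OF assms])
  finally have "(LINT x|lborel. norm (gauss e x)) = 2 * pi / e\<^sup>2" by (simp only: of_real_eq_iff)
  then show ?thesis by (subst nn_integral_eq_integral[OF i]) auto
qed

lemma gauss_uminus: "gauss e (x - y) = gauss e (y - x)"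
  by (simp add: gauss_def norm_minus_commute)

text \<open>A Schur test: 2 |a(x) a(y)| <= |a(x)|^2 + |a(y)|^2, and both marginals of the Gaussian
  kernel are 2 pi e^2. This cancels the prefactor in \<open>fint_mult_fint_gauss\<close>, so the
  resulting bound does not depend on \<open>e\<close>.\<close>

lemma nn_integral_tensor_gauss_le:
  fixes a :: "real^2 \<Rightarrow> complex"
  assumes a: "square_integrable a" and e: "e > 0"
  shows "(\<integral>\<^sup>+p. ennreal (norm (a (fst p) * cnj (a (snd p)) * gauss (1 / e) (fst p - snd p))) \<partial>lborel)
     \<le> ennreal ((l2norm a)\<^sup>2 * (2 * pi * e\<^sup>2))"
proof -
  have [measurable]: "a \<in> borel_measurable borel" using a square_integrable_measurable by fastforce
  define K where "K = 2 * pi * e\<^sup>2"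
  have K: "(\<integral>\<^sup>+y. ennreal (norm (gauss (1 / e) (x - y))) \<partial>lborel) = ennreal K" for x
    using nn_integral_reflect[of "\<lambda>y. ennreal (norm (gauss (1 / e) y))" x] nn_integral_gauss[of "1 / e"] e
    by (simp add: K_def power_divide)
  let ?g = "\<lambda>p. ennreal (norm (gauss (1 / e) (fst p - snd p)))"
  have half: "(\<integral>\<^sup>+x. \<integral>\<^sup>+y. ennreal ((norm (a x))\<^sup>2 / 2) * ennreal (norm (gauss (1 / e) (x - y))) \<partial>lborel \<partial>lborel)
     = ennreal ((l2norm a)\<^sup>2 / 2 * K)"
  proof -
    have "(\<integral>\<^sup>+x. \<integral>\<^sup>+y. ennreal ((norm (a x))\<^sup>2 / 2) * ennreal (norm (gauss (1 / e) (x - y))) \<partial>lborel \<partial>lborel)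
       = (\<integral>\<^sup>+x. ennreal ((norm (a x))\<^sup>2) * ennreal (K / 2) \<partial>lborel)"
    proof (rule nn_integral_cong)
      fix x
      have "(\<integral>\<^sup>+y. ennreal ((norm (a x))\<^sup>2 / 2) * ennreal (norm (gauss (1 / e) (x - y))) \<partial>lborel)
         = ennreal ((norm (a x))\<^sup>2 / 2) * ennreal K"
        by (subst nn_integral_cmult) (auto simp: K)
      also have "\<dots> = ennreal ((norm (a x))\<^sup>2) * ennreal (K / 2)"
        using e by (simp add: ennreal_mult[symmetric] K_def)
      finally show "(\<integral>\<^sup>+y. ennreal ((norm (a x))\<^sup>2 / 2) * ennreal (norm (gauss (1 / e) (x - y))) \<partial>lborel)
         = ennreal ((norm (a x))\<^sup>2) * ennreal (K / 2)" .
    qed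
    also have "\<dots> = ennreal ((l2norm a)\<^sup>2) * ennreal (K / 2)"
      by (simp add: nn_integral_multc nn_integral_eq_l2norm[OF a])
    finally show ?thesis using e by (simp add: ennreal_mult[symmetric] K_def)
  qed
  have "(\<integral>\<^sup>+p. ennreal (norm (a (fst p) * cnj (a (snd p)) * gauss (1 / e) (fst p - snd p))) \<partial>lborel)
     \<le> (\<integral>\<^sup>+p. ennreal ((norm (a (fst p)))\<^sup>2 / 2) * ?g p + ennreal ((norm (a (snd p)))\<^sup>2 / 2) * ?g p \<partial>lborel)"
  proof (rule nn_integral_mono)
    fix p :: "(real^2) \<times> (real^2)"
    let ?c = "norm (gauss (1 / e) (fst p - snd p))"
    have "norm (a (fst p) * cnj (a (snd p)) * gauss (1 / e) (fst p - snd p))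
        \<le> (norm (a (fst p)))\<^sup>2 / 2 * ?c + (norm (a (snd p)))\<^sup>2 / 2 * ?c"
      using mult_right_mono[OF sum_squares_bound[of "norm (a (fst p))" "norm (a (snd p))"], of "?c"]
      by (simp add: norm_mult algebra_simps)
    then show "ennreal (norm (a (fst p) * cnj (a (snd p)) * gauss (1 / e) (fst p - snd p)))
        \<le> ennreal ((norm (a (fst p)))\<^sup>2 / 2) * ?g p + ennreal ((norm (a (snd p)))\<^sup>2 / 2) * ?g p"
      by (simp add: ennreal_mult[symmetric] ennreal_plus[symmetric] ennreal_leI del: ennreal_plus)
  qed
  also have "\<dots> = (\<integral>\<^sup>+p. ennreal ((norm (a (fst p)))\<^sup>2 / 2) * ?g p \<partial>(lborel \<Otimes>\<^sub>M lborel))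
      + (\<integral>\<^sup>+p. ennreal ((norm (a (snd p)))\<^sup>2 / 2) * ?g p \<partial>(lborel \<Otimes>\<^sub>M lborel))"
    unfolding lborel_prod by (rule nn_integral_add) auto
  also have "(\<integral>\<^sup>+p. ennreal ((norm (a (fst p)))\<^sup>2 / 2) * ?g p \<partial>(lborel \<Otimes>\<^sub>M lborel)) = ennreal ((l2norm a)\<^sup>2 / 2 * K)"
    using half by (subst lborel.nn_integral_fst[symmetric]) simp_all
  also have "(\<integral>\<^sup>+p. ennreal ((norm (a (snd p)))\<^sup>2 / 2) * ?g p \<partial>(lborel \<Otimes>\<^sub>M lborel)) = ennreal ((l2norm a)\<^sup>2 / 2 * K)"
  proof -
    have "(\<integral>\<^sup>+p. ennreal ((norm (a (snd p)))\<^sup>2 / 2) * ?g p \<partial>(lborel \<Otimes>\<^sub>M lborel)) =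
      (\<integral>\<^sup>+y. \<integral>\<^sup>+x. ennreal ((norm (a y))\<^sup>2 / 2) * ennreal (norm (gauss (1 / e) (x - y))) \<partial>lborel \<partial>lborel)"
      by (subst lborel_pair.nn_integral_snd[symmetric]) simp_all
    also have "\<dots> = ennreal ((l2norm a)\<^sup>2 / 2 * K)"
      using half by (subst gauss_uminus)
    finally show ?thesis .
  qed
  also have "ennreal ((l2norm a)\<^sup>2 / 2 * K) + ennreal ((l2norm a)\<^sup>2 / 2 * K) = ennreal ((l2norm a)\<^sup>2 * K)"
    using e by (subst ennreal_plus[symmetric]) (auto simp: K_def)
  finally show ?thesis unfolding K_def .
qed

lemma gauss_scale_tendsto: "(\<lambda>n. gauss (1 / real (Suc n)) x) \<longlonglongrightarrow> 1"
proof -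
  have "(\<lambda>n. gauss (1 / real (Suc n)) x) \<longlonglongrightarrow> gauss 0 x"
    unfolding gauss_def by (intro tendsto_intros LIMSEQ_Suc lim_1_over_n) auto
  then show ?thesis by (simp add: gauss_def)
qed

text \<open>With a Gaussian weight the squared norm of the transform is at most
  \<open>(l2norm a)^2\<close> for every width, and Fatou removes the weight. The inequality has to
  precede Parseval, whose limit needs it for a majorant.\<close>

lemma bessel:
  assumes ai: "integrable lborel a" and a: "square_integrable a"
  shows "square_integrable (fint a)" "l2norm (fint a) \<le> l2norm a"
proof -
  have [measurable]: "a \<in> borel_measurable borel" using ai by auto
  have reg: "(\<integral>\<^sup>+\<eta>. ennreal (norm (gauss e \<eta>) * (norm (fint a \<eta>))\<^sup>2) \<partial>lborel) \<le> ennreal ((l2norm a)\<^sup>2)"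
    if e: "e > 0" for e
  proof -
    define M where "M = (1 / (2 * pi)) * (LINT x|lborel. norm (a x))"
    have i: "integrable lborel (\<lambda>\<eta>. norm (gauss e \<eta>) * (norm (fint a \<eta>))\<^sup>2)"
    proof (rule Bochner_Integration.integrable_bound)
      show "integrable lborel (\<lambda>\<eta>. norm (gauss e \<eta>) * M\<^sup>2)" using gauss_integrable[OF e] by simp
      show "AE \<eta> in lborel. norm (norm (gauss e \<eta>) * (norm (fint a \<eta>))\<^sup>2) \<le> norm (norm (gauss e \<eta>) * M\<^sup>2)"
        using norm_fint_le[of a] unfolding M_def[symmetric]
        by (intro AE_I2) (auto intro!: mult_left_mono power_mono)
    qed measurable
    have ai': "integrable lborel (\<lambda>x. cnj (a x))" using ai by simp
    have ip: "integrable lborel (\<lambda>p. a (fst p) * cnj (a (snd p)) * gauss (1 / e) (fst p - snd p))"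
      by (rule Bochner_Integration.integrable_bound[OF integrable_tensor(1)[OF ai ai']])
        (auto simp: norm_mult norm_gauss_le mult_left_le)
    have "complex_of_real (LINT \<eta>|lborel. norm (gauss e \<eta>) * (norm (fint a \<eta>))\<^sup>2)
       = (LINT \<eta>|lborel. gauss e \<eta> * (fint a \<eta> * fint (\<lambda>x. cnj (a x)) (- \<eta>)))"
      unfolding fint_cnj complex_norm_square[symmetric]
      by (subst integral_complex_of_real[symmetric]) (simp add: gauss_def)
    also have "\<dots> = of_real (1 / (2 * pi * e\<^sup>2)) * (LINT p|lborel. a (fst p) * cnj (a (snd p)) * gauss (1 / e) (fst p - snd p))"
      by (rule fint_mult_fint_gauss[OF ai ai' e])
    finally have "norm (complex_of_real (LINT \<eta>|lborel. norm (gauss e \<eta>) * (norm (fint a \<eta>))\<^sup>2))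
      = (1 / (2 * pi * e\<^sup>2)) * norm (LINT p|lborel. a (fst p) * cnj (a (snd p)) * gauss (1 / e) (fst p - snd p))"
      using e by (simp add: norm_mult norm_divide norm_power)
    moreover have "norm (LINT p|lborel. a (fst p) * cnj (a (snd p)) * gauss (1 / e) (fst p - snd p))
       \<le> (l2norm a)\<^sup>2 * (2 * pi * e\<^sup>2)"
    proof -
      have "ennreal (norm (LINT p|lborel. a (fst p) * cnj (a (snd p)) * gauss (1 / e) (fst p - snd p)))
        \<le> (\<integral>\<^sup>+p. ennreal (norm (a (fst p) * cnj (a (snd p)) * gauss (1 / e) (fst p - snd p))) \<partial>lborel)"
        by (rule integral_norm_bound_ennreal[OF ip])
      also note nn_integral_tensor_gauss_le[OF a e]
      finally show ?thesis by (subst (asm) ennreal_le_iff) auto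
    qed
    ultimately have "(LINT \<eta>|lborel. norm (gauss e \<eta>) * (norm (fint a \<eta>))\<^sup>2) \<le> (1 / (2 * pi * e\<^sup>2)) * ((l2norm a)\<^sup>2 * (2 * pi * e\<^sup>2))"
      using e by (simp add: pos_divide_le_eq integral_nonneg_AE)
    also have "\<dots> = (l2norm a)\<^sup>2" using e by simp
    finally show ?thesis by (subst nn_integral_eq_integral[OF i]) (auto intro!: ennreal_leI)
  qed
  have "(\<integral>\<^sup>+\<eta>. ennreal ((norm (fint a \<eta>))\<^sup>2) \<partial>lborel)
     = (\<integral>\<^sup>+\<eta>. liminf (\<lambda>n. ennreal (norm (gauss (1 / real (Suc n)) \<eta>) * (norm (fint a \<eta>))\<^sup>2)) \<partial>lborel)"
  proof (rule nn_integral_cong)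
    fix \<eta>
    have "(\<lambda>n. ennreal (norm (gauss (1 / real (Suc n)) \<eta>) * (norm (fint a \<eta>))\<^sup>2)) \<longlonglongrightarrow> ennreal (norm (1::complex) * (norm (fint a \<eta>))\<^sup>2)"
      by (intro tendsto_ennrealI tendsto_mult tendsto_norm tendsto_const gauss_scale_tendsto)
    from lim_imp_Liminf[OF _ this]
    show "ennreal ((norm (fint a \<eta>))\<^sup>2) = liminf (\<lambda>n. ennreal (norm (gauss (1 / real (Suc n)) \<eta>) * (norm (fint a \<eta>))\<^sup>2))"
      by simp
  qed
  also have "\<dots> \<le> liminf (\<lambda>n. \<integral>\<^sup>+\<eta>. ennreal (norm (gauss (1 / real (Suc n)) \<eta>) * (norm (fint a \<eta>))\<^sup>2) \<partial>lborel)"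
    by (rule nn_integral_liminf) measurable
  also have "\<dots> \<le> liminf (\<lambda>n. ennreal ((l2norm a)\<^sup>2))"
    by (intro Liminf_mono always_eventually allI reg) simp
  also have "\<dots> = ennreal ((l2norm a)\<^sup>2)" by (simp add: Liminf_const)
  finally have le: "(\<integral>\<^sup>+\<eta>. ennreal ((norm (fint a \<eta>))\<^sup>2) \<partial>lborel) \<le> ennreal ((l2norm a)\<^sup>2)" .
  have "integrable lborel (\<lambda>\<eta>. (norm (fint a \<eta>))\<^sup>2)"
    by (rule integrableI_nonneg) (use le in \<open>auto simp: le_less_trans\<close>)
  then show sq: "square_integrable (fint a)" by (simp add: square_integrable_def)
  from le have "(l2norm (fint a))\<^sup>2 \<le> (l2norm a)\<^sup>2"
    by (subst (asm) nn_integral_eq_l2norm[OF sq]) simp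
  then show "l2norm (fint a) \<le> l2norm a" by (rule power2_le_imp_le) simp
qed

text \<open>A sup bound for one factor against L^1-continuity of translations of the other. This is
  why boundedness appears in \<open>parseval_bounded\<close> and in
  \<open>nice_approx\<close>.\<close>

lemma correlation_continuous:
  fixes a b :: "real^2 \<Rightarrow> complex"
  assumes am: "a \<in> borel_measurable borel" and aM: "\<And>x. norm (a x) \<le> M" and b: "integrable lborel b"
    and z: "z \<longlonglongrightarrow> 0"
  shows "(\<lambda>n. LINT x|lborel. a x * b (x - z n)) \<longlonglongrightarrow> (LINT x|lborel. a x * b x)"
proof -
  note [measurable] = am
  have [measurable]: "b \<in> borel_measurable borel" using b by auto
  have M0: "M \<ge> 0" using aM[of 0] norm_ge_zero[of "a 0"] by linarith
  have ib: "integrable lborel (\<lambda>x. b (x - h))" for h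
    using integral_translate(2)[of b "- h"] b by simp
  have iab: "integrable lborel (\<lambda>x. a x * b (x - h))" for h
  proof (rule Bochner_Integration.integrable_bound)
    show "integrable lborel (\<lambda>x. M * norm (b (x - h)))" using ib[of h] by simp
    show "AE x in lborel. norm (a x * b (x - h)) \<le> norm (M * norm (b (x - h)))"
      using aM M0 by (auto simp: norm_mult intro!: mult_right_mono)
  qed measurable
  have "(\<lambda>n. - z n) \<longlonglongrightarrow> 0" using tendsto_minus[OF z] by simp
  from tendsto_mult_right_zero[OF l1_translation_continuous[OF b this], of M]
  have lim: "(\<lambda>n. M * (LINT x|lborel. norm (b (x - z n) - b x))) \<longlonglongrightarrow> 0" by simp
  have "norm ((LINT x|lborel. a x * b (x - z n)) - (LINT x|lborel. a x * b x)) \<le> M * (LINT x|lborel. norm (b (x - z n) - b x))" for n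
  proof -
    have "(LINT x|lborel. a x * b (x - z n)) - (LINT x|lborel. a x * b x) = (LINT x|lborel. a x * b (x - z n) - a x * b x)"
      using Bochner_Integration.integral_diff[OF iab[of "z n"] iab[of 0]] by simp
    then have "norm ((LINT x|lborel. a x * b (x - z n)) - (LINT x|lborel. a x * b x)) \<le> (LINT x|lborel. norm (a x * b (x - z n) - a x * b x))"
      by (simp only: integral_norm_bound)
    also have "\<dots> \<le> (LINT x|lborel. M * norm (b (x - z n) - b x))"
    proof (rule integral_mono)
      show "integrable lborel (\<lambda>x. norm (a x * b (x - z n) - a x * b x))"
        using iab[of "z n"] iab[of 0] by simp
      show "integrable lborel (\<lambda>x. M * norm (b (x - z n) - b x))"
        using integrable_diff_shift[OF b, of "- z n"] by simp
      show "norm (a x * b (x - z n) - a x * b x) \<le> M * norm (b (x - z n) - b x)" for x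
        using aM[of x] by (auto simp: norm_mult right_diff_distrib[symmetric] intro!: mult_right_mono)
    qed
    finally show ?thesis by simp
  qed
  from Lim_null_comparison[OF always_eventually[OF allI[OF this]] lim]
  show ?thesis by (rule LIM_zero_cancel)
qed

text \<open>Both sides of \<open>fint_mult_fint_gauss\<close> are followed as the parameter tends to
  0. After the substitution y = x - e w the right side is an average of the correlation
  \<open>C\<close> at \<open>e *\<^sub>R w\<close> against a fixed Gaussian, and continuity of
  \<open>C\<close> at 0 gives the limit.\<close>

lemma parseval_bounded:
  fixes a b :: "real^2 \<Rightarrow> complex"
  assumes ai: "integrable lborel a" and aM: "\<And>x. norm (a x) \<le> M"
    and a2: "square_integrable a" and bi: "integrable lborel b" and b2: "square_integrable b"
  shows "(LINT \<eta>|lborel. fint a \<eta> * fint b (- \<eta>)) = (LINT x|lborel. a x * b x)"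
proof -
  have [measurable]: "a \<in> borel_measurable borel" "b \<in> borel_measurable borel" using ai bi by auto
  define C where "C z = (LINT x|lborel. a x * b (x - z))" for z
  have M0: "M \<ge> 0" using aM[of 0] norm_ge_zero[of "a 0"] by linarith
  have ib: "integrable lborel (\<lambda>x. b (x - h))" for h
    using integral_translate(2)[of b "- h"] bi by simp
  have eb: "(LINT x|lborel. norm (b (x - h))) = (LINT x|lborel. norm (b x))" for h
    using integral_translate(1)[of "\<lambda>x. norm (b x)" "- h"] by simp
  have [measurable]: "C \<in> borel_measurable borel"
    unfolding C_def by (rule lborel.borel_measurable_lebesgue_integral) measurable
  have iab: "integrable lborel (\<lambda>x. a x * b (x - h))" for h
  proof (rule Bochner_Integration.integrable_bound)
    show "integrable lborel (\<lambda>x. M * norm (b (x - h)))" using ib[of h] by simp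
    show "AE x in lborel. norm (a x * b (x - h)) \<le> norm (M * norm (b (x - h)))"
      using aM M0 by (auto simp: norm_mult intro!: mult_right_mono)
  qed measurable
  have nab: "(LINT x|lborel. norm (a x * b (x - h))) \<le> M * (LINT x|lborel. norm (b x))" for h
  proof -
    have "(LINT x|lborel. norm (a x * b (x - h))) \<le> (LINT x|lborel. M * norm (b (x - h)))"
    proof (rule integral_mono)
      show "integrable lborel (\<lambda>x. norm (a x * b (x - h)))" by (rule integrable_norm[OF iab])
      show "integrable lborel (\<lambda>x. M * norm (b (x - h)))" using ib[of h] by simp
      show "norm (a x * b (x - h)) \<le> M * norm (b (x - h))" for x
        using aM by (auto simp: norm_mult intro!: mult_right_mono)
    qed
    then show ?thesis by (simp add: eb)
  qed
  have C_bound: "norm (C z) \<le> M * (LINT x|lborel. norm (b x))" for z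
    unfolding C_def by (rule order_trans[OF integral_norm_bound nab])
  have reg: "(LINT \<eta>|lborel. gauss e \<eta> * (fint a \<eta> * fint b (- \<eta>)))
      = of_real (1 / (2 * pi)) * (LINT w|lborel. gauss 1 w * C (e *\<^sub>R w))" if e: "e > 0" for e
  proof -
    let ?F = "\<lambda>p. a (fst p) * b (snd p) * gauss (1 / e) (fst p - snd p)"
    have ip: "integrable lborel ?F"
      by (rule Bochner_Integration.integrable_bound[OF integrable_tensor(1)[OF ai bi]])
        (auto simp: norm_mult norm_gauss_le mult_left_le)
    have iw: "integrable (lborel \<Otimes>\<^sub>M lborel) (\<lambda>(w, x). gauss 1 w * (a x * b (x - e *\<^sub>R w)))"
    proof (rule lborel_pair.Fubini_integrable)
      show "integrable lborel (\<lambda>w. LINT x|lborel. norm (case (w, x) of (w, x) \<Rightarrow> gauss 1 w * (a x * b (x - e *\<^sub>R w))))"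
      proof (rule Bochner_Integration.integrable_bound)
        show "integrable lborel (\<lambda>w. norm (gauss 1 w) * (M * (LINT x|lborel. norm (b x))))"
          using gauss_integrable[of 1] by simp
        show "(\<lambda>w. LINT x|lborel. norm (case (w, x) of (w, x) \<Rightarrow> gauss 1 w * (a x * b (x - e *\<^sub>R w)))) \<in> borel_measurable lborel"
          by measurable
        show "AE w in lborel. norm (LINT x|lborel. norm (case (w, x) of (w, x) \<Rightarrow> gauss 1 w * (a x * b (x - e *\<^sub>R w))))
          \<le> norm (norm (gauss 1 w) * (M * (LINT x|lborel. norm (b x))))"
        proof (rule AE_I2)
          fix w :: "real^2"
          have "(LINT x|lborel. norm (case (w, x) of (w, x) \<Rightarrow> gauss 1 w * (a x * b (x - e *\<^sub>R w))))
             = norm (gauss 1 w) * (LINT x|lborel. norm (a x * b (x - e *\<^sub>R w)))"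
            by (simp add: norm_mult)
          also have "\<dots> \<le> norm (gauss 1 w) * (M * (LINT x|lborel. norm (b x)))"
            by (intro mult_left_mono nab) simp
          finally show "norm (LINT x|lborel. norm (case (w, x) of (w, x) \<Rightarrow> gauss 1 w * (a x * b (x - e *\<^sub>R w))))
             \<le> norm (norm (gauss 1 w) * (M * (LINT x|lborel. norm (b x))))"
            using M0 by (simp add: integral_nonneg_AE)
        qed
      qed
      show "AE w in lborel. integrable lborel (\<lambda>x. case (w, x) of (w, x) \<Rightarrow> gauss 1 w * (a x * b (x - e *\<^sub>R w)))"
        using iab by auto
    qed measurable
    have "(LINT p|lborel. ?F p) = (LINT x|lborel. LINT y|lborel. ?F (x, y))"
      using lborel_pair.integral_fst'[of ?F] ip by (simp add: lborel_prod)
    also have "\<dots> = (LINT x|lborel. of_real (e\<^sup>2) * (LINT w|lborel. gauss 1 w * (a x * b (x - e *\<^sub>R w))))"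
    proof (rule Bochner_Integration.integral_cong[OF refl])
      fix x :: "real^2"
      have "(LINT y|lborel. ?F (x, y)) = of_real (e\<^sup>2) * (LINT w|lborel. ?F (x, x - e *\<^sub>R w))"
        by (rule integral_scale_reflect[OF _ e]) measurable
      moreover have "?F (x, x - e *\<^sub>R w) = gauss 1 w * (a x * b (x - e *\<^sub>R w))" for w
        using e by (simp add: gauss_def)
      ultimately show "(LINT y|lborel. ?F (x, y)) = of_real (e\<^sup>2) * (LINT w|lborel. gauss 1 w * (a x * b (x - e *\<^sub>R w)))"
        by (simp only:)
    qed
    also have "\<dots> = of_real (e\<^sup>2) * (LINT x|lborel. LINT w|lborel. gauss 1 w * (a x * b (x - e *\<^sub>R w)))"
      by simp
    also have "(LINT x|lborel. LINT w|lborel. gauss 1 w * (a x * b (x - e *\<^sub>R w)))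
        = (LINT w|lborel. LINT x|lborel. gauss 1 w * (a x * b (x - e *\<^sub>R w)))"
      by (rule lborel_pair.Fubini_integral[OF iw])
    also have "\<dots> = (LINT w|lborel. gauss 1 w * C (e *\<^sub>R w))"
      by (simp add: C_def)
    finally show ?thesis
      using fint_mult_fint_gauss[OF ai bi e] e by simp
  qed
  have L: "(\<lambda>n. LINT \<eta>|lborel. gauss (1 / real (Suc n)) \<eta> * (fint a \<eta> * fint b (- \<eta>)))
      \<longlonglongrightarrow> (LINT \<eta>|lborel. fint a \<eta> * fint b (- \<eta>))"
  proof (rule integral_dominated_convergence[where w="\<lambda>\<eta>. norm (fint a \<eta> * fint b (- \<eta>))"])
    have "square_integrable (\<lambda>\<eta>. fint b (- \<eta>))"
      using square_integrable_reflect(1)[OF bessel(1)[OF bi b2], of 0] by simp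
    from square_integrable_times(1)[OF bessel(1)[OF ai a2] this]
    show "integrable lborel (\<lambda>\<eta>. norm (fint a \<eta> * fint b (- \<eta>)))" by simp
    show "AE \<eta> in lborel. (\<lambda>n. gauss (1 / real (Suc n)) \<eta> * (fint a \<eta> * fint b (- \<eta>))) \<longlonglongrightarrow> fint a \<eta> * fint b (- \<eta>)"
    proof (rule AE_I2)
      fix \<eta>
      show "(\<lambda>n. gauss (1 / real (Suc n)) \<eta> * (fint a \<eta> * fint b (- \<eta>))) \<longlonglongrightarrow> fint a \<eta> * fint b (- \<eta>)"
        using tendsto_mult_right[OF gauss_scale_tendsto[of \<eta>], of "fint a \<eta> * fint b (- \<eta>)"] by simp
    qed
    show "AE \<eta> in lborel. norm (gauss (1 / real (Suc n)) \<eta> * (fint a \<eta> * fint b (- \<eta>))) \<le> norm (fint a \<eta> * fint b (- \<eta>))" for n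
      by (intro AE_I2, subst norm_mult) (simp add: norm_gauss_le mult_left_le_one_le)
  qed measurable
  have "(\<lambda>n. LINT w|lborel. gauss 1 w * C ((1 / real (Suc n)) *\<^sub>R w)) \<longlonglongrightarrow> (LINT w|lborel. gauss 1 w * C 0)"
  proof (rule integral_dominated_convergence[where w="\<lambda>w. norm (gauss 1 w) * (M * (LINT x|lborel. norm (b x)))"])
    show "integrable lborel (\<lambda>w. norm (gauss 1 w) * (M * (LINT x|lborel. norm (b x))))"
      using gauss_integrable[of 1] by simp
    show "AE w in lborel. (\<lambda>n. gauss 1 w * C ((1 / real (Suc n)) *\<^sub>R w)) \<longlonglongrightarrow> gauss 1 w * C 0"
    proof (rule AE_I2)
      fix w :: "real^2"
      have "(\<lambda>n. (1 / real (Suc n)) *\<^sub>R w) \<longlonglongrightarrow> 0 *\<^sub>R w"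
        by (intro tendsto_intros LIMSEQ_Suc lim_1_over_n)
      then have "(\<lambda>n. C ((1 / real (Suc n)) *\<^sub>R w)) \<longlonglongrightarrow> C 0"
        unfolding C_def using correlation_continuous[of a M b] aM bi by simp
      then show "(\<lambda>n. gauss 1 w * C ((1 / real (Suc n)) *\<^sub>R w)) \<longlonglongrightarrow> gauss 1 w * C 0"
        by (rule tendsto_mult_left)
    qed
    show "AE w in lborel. norm (gauss 1 w * C ((1 / real (Suc n)) *\<^sub>R w)) \<le> norm (gauss 1 w) * (M * (LINT x|lborel. norm (b x)))" for n
      using C_bound by (intro AE_I2) (simp add: norm_mult mult_left_mono)
  qed measurable
  \<comment> \<open>The total mass 2 pi of the fixed Gaussian cancels the factor 1 / (2 pi) in
    \<open>reg\<close>.\<close>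
  also have "(LINT w|lborel. gauss 1 w * C 0) = of_real (2 * pi) * C 0"
    by (simp add: gauss_integral)
  finally have "(\<lambda>n. of_real (1 / (2 * pi)) * (LINT w|lborel. gauss 1 w * C ((1 / real (Suc n)) *\<^sub>R w))) \<longlonglongrightarrow> of_real (1 / (2 * pi)) * (of_real (2 * pi) * C 0)"
    by (rule tendsto_mult_left)
  then have "(\<lambda>n. LINT \<eta>|lborel. gauss (1 / real (Suc n)) \<eta> * (fint a \<eta> * fint b (- \<eta>))) \<longlonglongrightarrow> C 0"
    by (subst reg) (auto simp del: of_real_divide of_real_mult simp: mult.assoc[symmetric] of_real_mult[symmetric])
  from LIMSEQ_unique[OF L this] show ?thesis by (simp add: C_def)
qed

section \<open>The Fourier--Plancherel transform\<close>

text \<open>Translates the distances of the definition into \<open>l2norm\<close>; square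
  integrability of the differences excludes infinite integrals on one side and default values on the
  other.\<close>

lemma l2_tendsto_iff:
  fixes D :: "nat \<Rightarrow> real^2 \<Rightarrow> 'b::real_normed_vector"
  assumes "\<And>n. square_integrable (D n)"
  shows "(\<lambda>n. \<integral>\<^sup>+x. ennreal ((norm (D n x))\<^sup>2) \<partial>lborel) \<longlonglongrightarrow> 0 \<longleftrightarrow> (\<lambda>n. l2norm (D n)) \<longlonglongrightarrow> 0"
proof -
  have "(\<lambda>n. \<integral>\<^sup>+x. ennreal ((norm (D n x))\<^sup>2) \<partial>lborel) = (\<lambda>n. ennreal ((l2norm (D n))\<^sup>2))"
    using nn_integral_eq_l2norm[OF assms] by auto
  then have "(\<lambda>n. \<integral>\<^sup>+x. ennreal ((norm (D n x))\<^sup>2) \<partial>lborel) \<longlonglongrightarrow> 0 \<longleftrightarrow> (\<lambda>n. (l2norm (D n))\<^sup>2) \<longlonglongrightarrow> 0"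
    by (simp add: ennreal_tendsto_0_iff)
  also have "\<dots> \<longleftrightarrow> (\<lambda>n. l2norm (D n)) \<longlonglongrightarrow> 0"
  proof
    assume "(\<lambda>n. (l2norm (D n))\<^sup>2) \<longlonglongrightarrow> 0"
    from tendsto_real_sqrt[OF this] show "(\<lambda>n. l2norm (D n)) \<longlonglongrightarrow> 0" by simp
  next
    assume "(\<lambda>n. l2norm (D n)) \<longlonglongrightarrow> 0"
    from tendsto_power[OF this, of 2] show "(\<lambda>n. (l2norm (D n))\<^sup>2) \<longlonglongrightarrow> 0" by simp
  qed
  finally show ?thesis .
qed

lemma l2norm_AE_zero:
  assumes "AE x in lborel. f x = 0"
  shows "l2norm f = 0"
proof -
  have "AE x in lborel. (norm (f x))\<^sup>2 = 0" using assms by auto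
  then show ?thesis unfolding l2norm_def by (simp add: integral_eq_zero_AE)
qed

lemma square_integrable_of_real_iff:
  fixes F :: "real^2 \<Rightarrow> real"
  shows "square_integrable F \<Longrightarrow> square_integrable (\<lambda>x. complex_of_real (F x))"
  by (auto simp: square_integrable_def)

lemma l2norm_of_real: "l2norm (\<lambda>x. complex_of_real (F x)) = l2norm F"
  by (simp add: l2norm_def)

lemma bessel_real:
  assumes "integrable lborel (F :: real^2 \<Rightarrow> real)" "square_integrable F"
  shows "square_integrable (fourier_integral F)" "l2norm (fourier_integral F) \<le> l2norm F"
  using bessel[of "\<lambda>x. complex_of_real (F x)"] assms square_integrable_of_real_iff[of F]
  by (auto simp: fourier_integral_fint l2norm_of_real)

lemma fourier_integral_diff:
  assumes "integrable lborel (F :: real^2 \<Rightarrow> real)" "integrable lborel G"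
  shows "fourier_integral (\<lambda>x. F x - G x) \<xi> = fourier_integral F \<xi> - fourier_integral G \<xi>"
  using assms by (simp add: fourier_integral_fint fint_diff[symmetric])

lemma fourier_integral_diff_fun:
  assumes "integrable lborel (F :: real^2 \<Rightarrow> real)" "integrable lborel G"
  shows "fourier_integral (\<lambda>x. F x - G x) = (\<lambda>\<xi>. fourier_integral F \<xi> - fourier_integral G \<xi>)"
  using fourier_integral_diff[OF assms] by auto

lemma fourier_integral_add:
  assumes "integrable lborel (F :: real^2 \<Rightarrow> real)" "integrable lborel G"
  shows "fourier_integral (\<lambda>x. F x + G x) \<xi> = fourier_integral F \<xi> + fourier_integral G \<xi>"
  using assms by (simp add: fourier_integral_fint fint_add[symmetric])

lemma fourier_integral_mult_left:
  "fourier_integral (\<lambda>x. c * F x) \<xi> = of_real c * fourier_integral F \<xi>"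
  by (simp add: fourier_integral_fint fint_mult_left)

text \<open>Boundedness is added to L^1 and L^2 because \<open>parseval_bounded\<close> asks for it;
  the epsilon form makes sums, limits and translates easy to approximate.\<close>

definition nice_approx :: "real \<Rightarrow> (real^2 \<Rightarrow> real) \<Rightarrow> (real^2 \<Rightarrow> complex) \<Rightarrow> (real^2 \<Rightarrow> real) \<Rightarrow> bool" where
  "nice_approx e F f A \<longleftrightarrow> integrable lborel A \<and> square_integrable A \<and> (\<exists>M. \<forall>x. \<bar>A x\<bar> \<le> M) \<and>
     l2norm (\<lambda>x. A x - F x) < e \<and> l2norm (\<lambda>\<xi>. fourier_integral A \<xi> - f \<xi>) < e"

lemma has_fourier_transform_iff:
  "has_fourier_transform F f \<longleftrightarrow>
     square_integrable F \<and> square_integrable f \<and> (\<forall>e>0. \<exists>A. nice_approx e F f A)"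
proof
  assume *: "has_fourier_transform F f"
  then obtain A where F: "square_integrable F" and f: "square_integrable f"
    and A: "\<And>n. integrable lborel (A n)" "\<And>n. square_integrable (A n)"
    and lim: "(\<lambda>n. \<integral>\<^sup>+x. ennreal ((norm (A n x - F x))\<^sup>2) \<partial>lborel) \<longlonglongrightarrow> 0"
      "(\<lambda>n. \<integral>\<^sup>+\<xi>. ennreal ((norm (fourier_integral (A n) \<xi> - f \<xi>))\<^sup>2) \<partial>lborel) \<longlonglongrightarrow> 0"
    unfolding has_fourier_transform_def by blast
  have "(\<lambda>n. l2norm (\<lambda>x. A n x - F x)) \<longlonglongrightarrow> 0"
    using lim(1) by (subst (asm) l2_tendsto_iff) (intro square_integrable_diff A F)
  moreover have "(\<lambda>n. l2norm (\<lambda>\<xi>. fourier_integral (A n) \<xi> - f \<xi>)) \<longlonglongrightarrow> 0"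
    using lim(2) by (subst (asm) l2_tendsto_iff) (intro square_integrable_diff bessel_real A f)
  ultimately have ev: "\<forall>\<^sub>F n in sequentially. l2norm (\<lambda>x. A n x - F x) < e \<and> l2norm (\<lambda>\<xi>. fourier_integral (A n) \<xi> - f \<xi>) < e"
    if "e > 0" for e using that by (intro eventually_conj) (auto dest: order_tendstoD)
  have "\<exists>A. nice_approx e F f A" if e: "e > 0" for e
  proof -
    obtain n where n: "l2norm (\<lambda>x. A n x - F x) < e/2" "l2norm (\<lambda>\<xi>. fourier_integral (A n) \<xi> - f \<xi>) < e/2"
      using ev[of "e/2"] e by (auto simp: eventually_sequentially)
    have [measurable]: "A n \<in> borel_measurable borel" using A(1)[of n] by auto
    \<comment> \<open>Truncation of large values keeps L^1 and L^2, adds a bound and converges in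
      L^2 by domination; by Bessel the transforms move no more than the functions do.\<close>
    define B where "B m x = (if \<bar>A n x\<bar> \<le> real m then A n x else 0)" for m :: nat and x
    have [measurable]: "B m \<in> borel_measurable borel" for m unfolding B_def by measurable
    have Ble: "norm (B m x) \<le> norm (A n x)" for m x by (simp add: B_def)
    have Bi: "integrable lborel (B m)" for m
      by (rule Bochner_Integration.integrable_bound[OF A(1)[of n]]) (use Ble in auto)
    have B2: "square_integrable (B m)" for m
      by (rule square_integrable_bound(1)[OF A(2)[of n]]) (use Ble in auto)
    have "(\<lambda>m. l2norm (\<lambda>x. B m x - A n x)) \<longlonglongrightarrow> 0"
    proof (rule l2_dominated_convergence(2)[OF _ _ A(2)[of n]])
      show "AE x in lborel. (\<lambda>m. B m x) \<longlonglongrightarrow> A n x"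
      proof (rule AE_I2)
        fix x
        have "\<forall>\<^sub>F m in sequentially. B m x = A n x"
          using eventually_ge_at_top[of "nat \<lceil>\<bar>A n x\<bar>\<rceil>"]
          by eventually_elim (auto simp: B_def nat_le_iff ceiling_le_iff)
        then show "(\<lambda>m. B m x) \<longlonglongrightarrow> A n x" by (rule tendsto_eventually)
      qed
    qed (use Ble in auto)
    then have "\<forall>\<^sub>F m in sequentially. l2norm (\<lambda>x. B m x - A n x) < e/2"
      using e by (intro order_tendstoD) auto
    then obtain m where m: "l2norm (\<lambda>x. B m x - A n x) < e/2" by (auto simp: eventually_sequentially)
    have "l2norm (\<lambda>x. B m x - F x) \<le> l2norm (\<lambda>x. B m x - A n x) + l2norm (\<lambda>x. A n x - F x)"
      by (intro l2norm_triangle_diff B2 A F)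
    then have 1: "l2norm (\<lambda>x. B m x - F x) < e" using m n by simp
    have "l2norm (\<lambda>\<xi>. fourier_integral (B m) \<xi> - fourier_integral (A n) \<xi>) \<le> l2norm (\<lambda>x. B m x - A n x)"
      using bessel_real(2)[of "\<lambda>x. B m x - A n x"] Bi[of m] A(1)[of n] square_integrable_diff[OF B2[of m] A(2)[of n]]
      by (simp add: fourier_integral_diff_fun)
    moreover have "l2norm (\<lambda>\<xi>. fourier_integral (B m) \<xi> - f \<xi>)
       \<le> l2norm (\<lambda>\<xi>. fourier_integral (B m) \<xi> - fourier_integral (A n) \<xi>) + l2norm (\<lambda>\<xi>. fourier_integral (A n) \<xi> - f \<xi>)"
      by (intro l2norm_triangle_diff bessel_real Bi B2 A f)
    ultimately have 2: "l2norm (\<lambda>\<xi>. fourier_integral (B m) \<xi> - f \<xi>) < e" using m n by simp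
    have "\<exists>M. \<forall>x. \<bar>B m x\<bar> \<le> M" by (intro exI[of _ "real m"]) (simp add: B_def)
    with 1 2 Bi B2 show ?thesis unfolding nice_approx_def by blast
  qed
  then show "square_integrable F \<and> square_integrable f \<and> (\<forall>e>0. \<exists>A. nice_approx e F f A)"
    using F f by blast
next
  assume *: "square_integrable F \<and> square_integrable f \<and> (\<forall>e>0. \<exists>A. nice_approx e F f A)"
  then have F: "square_integrable F" and f: "square_integrable f" by auto
  from * have "\<forall>n. \<exists>A. nice_approx (1 / real (Suc n)) F f A" by simp
  then obtain A where A: "\<And>n. nice_approx (1 / real (Suc n)) F f (A n)" by metis
  have A12: "integrable lborel (A n)" "square_integrable (A n)" for n using A[of n] by (auto simp: nice_approx_def)
  have z: "(\<lambda>n. 1 / real (Suc n)) \<longlonglongrightarrow> 0" by (intro LIMSEQ_Suc lim_1_over_n)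
  have l1: "(\<lambda>n. l2norm (\<lambda>x. A n x - F x)) \<longlonglongrightarrow> 0"
    by (rule tendsto_sandwich[OF _ _ tendsto_const z]) (use A in \<open>auto simp: nice_approx_def less_imp_le intro!: always_eventually\<close>)
  have l2: "(\<lambda>n. l2norm (\<lambda>\<xi>. fourier_integral (A n) \<xi> - f \<xi>)) \<longlonglongrightarrow> 0"
    by (rule tendsto_sandwich[OF _ _ tendsto_const z]) (use A in \<open>auto simp: nice_approx_def less_imp_le intro!: always_eventually\<close>)
  have "(\<lambda>n. \<integral>\<^sup>+x. ennreal ((norm (A n x - F x))\<^sup>2) \<partial>lborel) \<longlonglongrightarrow> 0"
    by (subst l2_tendsto_iff[OF square_integrable_diff[OF A12(2) F]]) (rule l1)
  moreover have "(\<lambda>n. \<integral>\<^sup>+\<xi>. ennreal ((norm (fourier_integral (A n) \<xi> - f \<xi>))\<^sup>2) \<partial>lborel) \<longlonglongrightarrow> 0"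
    by (subst l2_tendsto_iff[OF square_integrable_diff[OF bessel_real(1)[OF A12] f]]) (rule l2)
  ultimately have "(\<lambda>n. \<integral>\<^sup>+x. ennreal ((norm (A n x - F x))\<^sup>2) \<partial>lborel) \<longlonglongrightarrow> 0"
      "(\<lambda>n. \<integral>\<^sup>+\<xi>. ennreal ((norm (fourier_integral (A n) \<xi> - f \<xi>))\<^sup>2) \<partial>lborel) \<longlonglongrightarrow> 0"
    by blast+
  then show "has_fourier_transform F f"
    unfolding has_fourier_transform_def using F f A12 by blast
qed

lemma has_ft_square_integrable:
  assumes "has_fourier_transform F f"
  shows "square_integrable F" "square_integrable f"
  using assms by (auto simp: has_fourier_transform_iff)

lemma has_ft_approx:
  assumes "has_fourier_transform F f" "e > 0"
  obtains A where "nice_approx e F f A"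
  using assms by (auto simp: has_fourier_transform_iff)

lemma has_ft_L1:
  assumes F: "integrable lborel F" "square_integrable F"
  shows "has_fourier_transform F (fourier_integral F)"
  unfolding has_fourier_transform_def using F bessel_real[OF F]
  by (auto intro!: exI[of _ "\<lambda>_. F"])

lemma has_ft_add:
  assumes F: "has_fourier_transform F f" and G: "has_fourier_transform G g"
  shows "has_fourier_transform (\<lambda>x. F x + G x) (\<lambda>\<xi>. f \<xi> + g \<xi>)"
proof -
  note sq = has_ft_square_integrable[OF F] has_ft_square_integrable[OF G]
  have "\<exists>C. nice_approx e (\<lambda>x. F x + G x) (\<lambda>\<xi>. f \<xi> + g \<xi>) C" if e: "e > 0" for e
  proof -
    obtain A where A: "nice_approx (e/2) F f A" using has_ft_approx[OF F, of "e/2"] e by auto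
    obtain B where B: "nice_approx (e/2) G g B" using has_ft_approx[OF G, of "e/2"] e by auto
    note AB = A[unfolded nice_approx_def] B[unfolded nice_approx_def]
    obtain M N where MN: "\<And>x. \<bar>A x\<bar> \<le> M" "\<And>x. \<bar>B x\<bar> \<le> N" using AB by blast
    have b: "\<exists>M. \<forall>x. \<bar>A x + B x\<bar> \<le> M"
      by (rule exI[of _ "M + N"]) (use MN in \<open>auto intro: order_trans[OF abs_triangle_ineq] add_mono\<close>)
    have "l2norm (\<lambda>x. (A x + B x) - (F x + G x)) \<le> l2norm (\<lambda>x. A x - F x) + l2norm (\<lambda>x. B x - G x)"
      using l2norm_triangle[of "\<lambda>x. A x - F x" "\<lambda>x. B x - G x"] AB sq
      by (simp add: square_integrable_diff algebra_simps)
    then have 1: "l2norm (\<lambda>x. (A x + B x) - (F x + G x)) < e" using AB by simp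
    have "l2norm (\<lambda>x. (fourier_integral A x + fourier_integral B x) - (f x + g x))
      \<le> l2norm (\<lambda>x. fourier_integral A x - f x) + l2norm (\<lambda>x. fourier_integral B x - g x)"
      using l2norm_triangle[of "\<lambda>x. fourier_integral A x - f x" "\<lambda>x. fourier_integral B x - g x"] AB sq
      by (simp add: square_integrable_diff bessel_real algebra_simps)
    then have 2: "l2norm (\<lambda>x. fourier_integral (\<lambda>x. A x + B x) x - (f x + g x)) < e"
      using AB by (simp add: fourier_integral_add)
    show ?thesis
      by (rule exI[of _ "\<lambda>x. A x + B x"])
        (use 1 2 b AB in \<open>auto simp: nice_approx_def intro: square_integrable_add\<close>)
  qed
  then show ?thesis unfolding has_fourier_transform_iff using sq by (auto intro: square_integrable_add)
qed

lemma has_ft_cmult: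
  assumes F: "has_fourier_transform F f"
  shows "has_fourier_transform (\<lambda>x. c * F x) (\<lambda>\<xi>. of_real c * f \<xi>)"
proof -
  note sq = has_ft_square_integrable[OF F]
  have "\<exists>C. nice_approx e (\<lambda>x. c * F x) (\<lambda>\<xi>. of_real c * f \<xi>) C" if e: "e > 0" for e
  proof -
    \<comment> \<open>The summand 1 allows \<open>c = 0\<close>.\<close>
    have d: "e / (\<bar>c\<bar> + 1) > 0" using e by (simp add: add_nonneg_pos)
    obtain A where A: "nice_approx (e / (\<bar>c\<bar> + 1)) F f A" using has_ft_approx[OF F d] by auto
    note AB = A[unfolded nice_approx_def]
    have small: "\<bar>c\<bar> * t < e" if "t < e / (\<bar>c\<bar> + 1)" "t \<ge> 0" for t
    proof -
      have "\<bar>c\<bar> * t \<le> (\<bar>c\<bar> + 1) * t" using that by (intro mult_right_mono) auto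
      also have "\<dots> < e" using that by (simp add: field_simps add_nonneg_pos pos_less_divide_eq)
      finally show ?thesis .
    qed
    obtain M where M: "\<And>x. \<bar>A x\<bar> \<le> M" using AB by blast
    have b: "\<exists>M. \<forall>x. \<bar>c * A x\<bar> \<le> M"
      by (rule exI[of _ "\<bar>c\<bar> * M"]) (use M in \<open>auto simp: abs_mult intro!: mult_left_mono\<close>)
    have "l2norm (\<lambda>x. c * A x - c * F x) = \<bar>c\<bar> * l2norm (\<lambda>x. A x - F x)"
      using l2norm_mult_left[of c "\<lambda>x. A x - F x"] by (simp add: algebra_simps)
    then have 1: "l2norm (\<lambda>x. c * A x - c * F x) < e" using AB small by simp
    have "l2norm (\<lambda>x. of_real c * fourier_integral A x - of_real c * f x) = \<bar>c\<bar> * l2norm (\<lambda>x. fourier_integral A x - f x)"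
      using l2norm_mult_left[of "complex_of_real c" "\<lambda>x. fourier_integral A x - f x"] by (simp add: algebra_simps)
    then have 2: "l2norm (\<lambda>x. fourier_integral (\<lambda>x. c * A x) x - of_real c * f x) < e"
      using AB small by (simp add: fourier_integral_mult_left)
    show ?thesis
      by (rule exI[of _ "\<lambda>x. c * A x"])
        (use 1 2 b AB in \<open>auto simp: nice_approx_def intro: square_integrable_mult_left\<close>)
  qed
  then show ?thesis unfolding has_fourier_transform_iff using sq by (auto intro: square_integrable_mult_left)
qed

lemma has_ft_diff:
  assumes F: "has_fourier_transform F f" and G: "has_fourier_transform G g"
  shows "has_fourier_transform (\<lambda>x. F x - G x) (\<lambda>\<xi>. f \<xi> - g \<xi>)"
  using has_ft_add[OF F has_ft_cmult[OF G, of "-1"]] by simp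

lemma fourier_integral_translate:
  assumes [measurable]: "A \<in> borel_measurable borel"
  shows "fourier_integral (\<lambda>x. A (x + h)) \<xi> = cis (h \<bullet> \<xi>) * fourier_integral A \<xi>"
proof -
  have "(LINT x|lborel. cis (- ((x + h) \<bullet> \<xi>)) * of_real (A (x + h))) = (LINT x|lborel. cis (- (x \<bullet> \<xi>)) * of_real (A x))"
    by (rule integral_translate(1)) measurable
  moreover have "cis (- (x \<bullet> \<xi>)) * of_real (A (x + h)) = cis (h \<bullet> \<xi>) * (cis (- ((x + h) \<bullet> \<xi>)) * of_real (A (x + h)))" for x
    by (simp add: cis_mult mult.assoc[symmetric] inner_add_left)
  ultimately have "(LINT x|lborel. cis (- (x \<bullet> \<xi>)) * of_real (A (x + h))) = cis (h \<bullet> \<xi>) * (LINT x|lborel. cis (- (x \<bullet> \<xi>)) * of_real (A x))"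
    by (simp only: integral_mult_right_zero)
  then show ?thesis by (simp add: fourier_integral_def)
qed

lemma has_ft_translate:
  assumes F: "has_fourier_transform F f"
  shows "has_fourier_transform (\<lambda>x. F (x + h)) (\<lambda>\<xi>. cis (h \<bullet> \<xi>) * f \<xi>)"
proof -
  note sq = has_ft_square_integrable[OF F]
  have cis_l2: "square_integrable g \<Longrightarrow> square_integrable (\<lambda>\<xi>. cis (h \<bullet> \<xi>) * g \<xi>)"
    "l2norm (\<lambda>\<xi>. cis (h \<bullet> \<xi>) * g \<xi>) = l2norm g" for g
    by (auto simp: square_integrable_def l2norm_def norm_mult)
  have "\<exists>C. nice_approx e (\<lambda>x. F (x + h)) (\<lambda>\<xi>. cis (h \<bullet> \<xi>) * f \<xi>) C" if e: "e > 0" for e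
  proof -
    obtain A where A: "nice_approx e F f A" using has_ft_approx[OF F e] by auto
    note AB = A[unfolded nice_approx_def]
    have [measurable]: "A \<in> borel_measurable borel" using AB by auto
    have 1: "l2norm (\<lambda>x. A (x + h) - F (x + h)) < e"
      using square_integrable_translate(2)[of "\<lambda>x. A x - F x" h] AB sq by (simp add: square_integrable_diff)
    have "fourier_integral (\<lambda>x. A (x + h)) \<xi> = cis (h \<bullet> \<xi>) * fourier_integral A \<xi>" for \<xi>
      by (rule fourier_integral_translate) measurable
    then have "(\<lambda>\<xi>. fourier_integral (\<lambda>x. A (x + h)) \<xi> - cis (h \<bullet> \<xi>) * f \<xi>) = (\<lambda>\<xi>. cis (h \<bullet> \<xi>) * (fourier_integral A \<xi> - f \<xi>))"
      by (simp add: right_diff_distrib)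
    then have 2: "l2norm (\<lambda>\<xi>. fourier_integral (\<lambda>x. A (x + h)) \<xi> - cis (h \<bullet> \<xi>) * f \<xi>) < e"
      using AB by (simp add: cis_l2)
    have "integrable lborel (\<lambda>x. A (x + h))" using AB by (subst integral_translate(2)) auto
    then show ?thesis
      using 1 2 AB by (intro exI[of _ "\<lambda>x. A (x + h)"]) (auto simp: nice_approx_def intro: square_integrable_translate)
  qed
  then show ?thesis unfolding has_fourier_transform_iff using sq cis_l2 by (auto intro: square_integrable_translate)
qed

lemma fourier_integral_uminus: "fourier_integral F (- \<xi>) = cnj (fourier_integral F \<xi>)"
  using fint_cnj[of "\<lambda>x. complex_of_real (F x)" \<xi>] by (simp add: fourier_integral_fint)

text \<open>The transform of a real function takes conjugate values at opposite points, so bilinear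
  Parseval with both factors equal to \<open>A\<close> is equality of the norms.\<close>

lemma plancherel_bounded:
  assumes A: "integrable lborel A" "square_integrable A" "\<And>x. \<bar>A x\<bar> \<le> M"
  shows "l2norm (fourier_integral A) = l2norm A"
proof -
  let ?a = "\<lambda>x. complex_of_real (A x)"
  have "(LINT \<eta>|lborel. fint ?a \<eta> * fint ?a (- \<eta>)) = (LINT x|lborel. ?a x * ?a x)"
    by (rule parseval_bounded[where M=M]) (use A in \<open>auto intro: square_integrable_of_real_iff\<close>)
  then have "(LINT \<eta>|lborel. complex_of_real ((norm (fourier_integral A \<eta>))\<^sup>2)) = (LINT x|lborel. complex_of_real ((norm (A x))\<^sup>2))"
    by (simp only: fourier_integral_fint[symmetric] fourier_integral_uminus complex_norm_square) (simp add: power2_eq_square)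
  then have "(LINT \<eta>|lborel. (norm (fourier_integral A \<eta>))\<^sup>2) = (LINT x|lborel. (norm (A x))\<^sup>2)"
    by (simp only: integral_complex_of_real of_real_eq_iff)
  then show ?thesis by (simp add: l2norm_def)
qed

lemma plancherel:
  assumes F: "has_fourier_transform F f"
  shows "l2norm f = l2norm F"
proof -
  note sq = has_ft_square_integrable[OF F]
  have "\<bar>l2norm f - l2norm F\<bar> \<le> e" if e: "e > 0" for e
  proof -
    obtain A where A: "nice_approx (e/2) F f A" using has_ft_approx[OF F, of "e/2"] e by auto
    note AB = A[unfolded nice_approx_def]
    have "l2norm (fourier_integral A) = l2norm A" using AB plancherel_bounded by blast
    moreover have "\<bar>l2norm A - l2norm F\<bar> \<le> l2norm (\<lambda>x. A x - F x)" using AB sq by (intro l2norm_diff_bound) auto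
    moreover have "\<bar>l2norm (fourier_integral A) - l2norm f\<bar> \<le> l2norm (\<lambda>x. fourier_integral A x - f x)"
      using AB sq by (intro l2norm_diff_bound bessel_real) auto
    ultimately show ?thesis using AB by linarith
  qed
  then have "\<bar>l2norm f - l2norm F\<bar> \<le> 0" by (rule field_le_epsilon) simp
  then show ?thesis by simp
qed

text \<open>By linearity this is Plancherel for the difference. It makes the choice in
  \<open>fourier_transform\<close> immaterial up to null sets.\<close>

lemma has_ft_unique_AE:
  assumes F: "has_fourier_transform F f" and G: "has_fourier_transform G g" and ae: "AE x in lborel. F x = G x"
  shows "AE \<xi> in lborel. f \<xi> = g \<xi>"
proof -
  have d: "has_fourier_transform (\<lambda>x. F x - G x) (\<lambda>\<xi>. f \<xi> - g \<xi>)" by (rule has_ft_diff[OF F G])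
  have "l2norm (\<lambda>x. F x - G x) = 0" by (rule l2norm_AE_zero) (use ae in auto)
  then have "l2norm (\<lambda>\<xi>. f \<xi> - g \<xi>) = 0" using plancherel[OF d] by simp
  from l2norm_eq_0D[OF has_ft_square_integrable(2)[OF d] this] show ?thesis by simp
qed

text \<open>The graph of the transform is closed in L^2 x L^2, since it was defined as a closure.
  Limits of series and of difference quotients are identified through it.\<close>

lemma has_ft_closed:
  assumes F: "\<And>n. has_fourier_transform (F n) (f n)" and G: "square_integrable G" and g: "square_integrable g"
    and lim: "(\<lambda>n. l2norm (\<lambda>x. F n x - G x)) \<longlonglongrightarrow> 0" "(\<lambda>n. l2norm (\<lambda>\<xi>. f n \<xi> - g \<xi>)) \<longlonglongrightarrow> 0"
  shows "has_fourier_transform G g"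
proof -
  have "\<exists>A. nice_approx e G g A" if e: "e > 0" for e
  proof -
    have "\<forall>\<^sub>F n in sequentially. l2norm (\<lambda>x. F n x - G x) < e/2 \<and> l2norm (\<lambda>\<xi>. f n \<xi> - g \<xi>) < e/2"
      using lim e by (intro eventually_conj) (auto dest: order_tendstoD[where a="e/2"])
    then obtain n where n: "l2norm (\<lambda>x. F n x - G x) < e/2" "l2norm (\<lambda>\<xi>. f n \<xi> - g \<xi>) < e/2"
      by (auto simp: eventually_sequentially)
    obtain A where A: "nice_approx (e/2) (F n) (f n) A" using has_ft_approx[OF F[of n], of "e/2"] e by auto
    note AB = A[unfolded nice_approx_def]
    have "l2norm (\<lambda>x. A x - G x) \<le> l2norm (\<lambda>x. A x - F n x) + l2norm (\<lambda>x. F n x - G x)"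
      using AB has_ft_square_integrable[OF F[of n]] G by (intro l2norm_triangle_diff) auto
    moreover have "l2norm (\<lambda>x. fourier_integral A x - g x) \<le> l2norm (\<lambda>x. fourier_integral A x - f n x) + l2norm (\<lambda>x. f n x - g x)"
      using AB has_ft_square_integrable[OF F[of n]] g by (intro l2norm_triangle_diff bessel_real) auto
    ultimately show ?thesis using AB n by (intro exI[of _ A]) (auto simp: nice_approx_def)
  qed
  then show ?thesis using G g by (auto simp: has_fourier_transform_iff)
qed

text \<open>Parseval for \<open>A n\<close> and for \<open>B n\<close> times the phase
  \<open>cis (- (x \<bullet> \<xi>))\<close>, whose transform at \<open>- \<eta>\<close> is that of
  \<open>B n\<close> at \<open>\<xi> - \<eta>\<close>. Both sides are continuous in L^2, so the
  identity passes to the limit.\<close>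

lemma fourier_product_formula:
  assumes F: "has_fourier_transform F f" and G: "has_fourier_transform G g"
  shows "(LINT \<eta>|lborel. f \<eta> * g (\<xi> - \<eta>)) = of_real (2 * pi) * fourier_integral (\<lambda>x. F x * G x) \<xi>"
proof -
  note sqF = has_ft_square_integrable[OF F] and sqG = has_ft_square_integrable[OF G]
  have "\<forall>n. \<exists>A. nice_approx (1 / real (Suc n)) F f A" using F by (simp add: has_fourier_transform_iff)
  then obtain A where A: "\<And>n. nice_approx (1 / real (Suc n)) F f (A n)" by metis
  have "\<forall>n. \<exists>A. nice_approx (1 / real (Suc n)) G g A" using G by (simp add: has_fourier_transform_iff)
  then obtain B where B: "\<And>n. nice_approx (1 / real (Suc n)) G g (B n)" by metis
  note A' = A[unfolded nice_approx_def] and B' = B[unfolded nice_approx_def]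
  have A12: "integrable lborel (A n)" "square_integrable (A n)" for n using A'[of n] by auto
  have B12: "integrable lborel (B n)" "square_integrable (B n)" for n using B'[of n] by auto
  have z: "(\<lambda>n. 1 / real (Suc n)) \<longlonglongrightarrow> 0" by (intro LIMSEQ_Suc lim_1_over_n)
  have Alim: "(\<lambda>n. l2norm (\<lambda>x. A n x - F x)) \<longlonglongrightarrow> 0" "(\<lambda>n. l2norm (\<lambda>\<xi>. fourier_integral (A n) \<xi> - f \<xi>)) \<longlonglongrightarrow> 0"
    by (rule tendsto_sandwich[OF _ _ tendsto_const z]; use A' in \<open>auto simp: less_imp_le intro!: always_eventually\<close>)+
  have Blim: "(\<lambda>n. l2norm (\<lambda>x. B n x - G x)) \<longlonglongrightarrow> 0" "(\<lambda>n. l2norm (\<lambda>\<xi>. fourier_integral (B n) \<xi> - g \<xi>)) \<longlonglongrightarrow> 0"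
    by (rule tendsto_sandwich[OF _ _ tendsto_const z]; use B' in \<open>auto simp: less_imp_le intro!: always_eventually\<close>)+
  have L: "(\<lambda>n. LINT \<eta>|lborel. fourier_integral (A n) \<eta> * fourier_integral (B n) (\<xi> - \<eta>)) \<longlonglongrightarrow> (LINT \<eta>|lborel. f \<eta> * g (\<xi> - \<eta>))"
  proof (rule tendsto_integral_times)
    show "(\<lambda>n. l2norm (\<lambda>\<eta>. fourier_integral (B n) (\<xi> - \<eta>) - g (\<xi> - \<eta>))) \<longlonglongrightarrow> 0"
    proof -
      have "l2norm (\<lambda>\<eta>. fourier_integral (B n) (\<xi> - \<eta>) - g (\<xi> - \<eta>)) = l2norm (\<lambda>\<eta>. fourier_integral (B n) \<eta> - g \<eta>)" for n
        using square_integrable_reflect(2)[OF square_integrable_diff[OF bessel_real(1)[OF B12[of n]] sqG(2)], of \<xi>] by simp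
      then show ?thesis using Blim(2) by simp
    qed
  qed (intro bessel_real A12 B12 sqF sqG square_integrable_reflect Alim)+
  have m: "square_integrable (\<lambda>x. cis (- (x \<bullet> \<xi>)) * complex_of_real (H x))"
    "l2norm (\<lambda>x. cis (- (x \<bullet> \<xi>)) * complex_of_real (H x)) = l2norm H" if "square_integrable H" for H
    using that by (auto simp: square_integrable_def l2norm_def norm_mult)
  have "(\<lambda>n. LINT x|lborel. complex_of_real (A n x) * (cis (- (x \<bullet> \<xi>)) * complex_of_real (B n x)))
     \<longlonglongrightarrow> (LINT x|lborel. complex_of_real (F x) * (cis (- (x \<bullet> \<xi>)) * complex_of_real (G x)))"
  proof (rule tendsto_integral_times)
    show "(\<lambda>n. l2norm (\<lambda>x. complex_of_real (A n x) - complex_of_real (F x))) \<longlonglongrightarrow> 0"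
      using Alim(1) l2norm_of_real[of "\<lambda>x. A _ x - F x"] by simp
    have "l2norm (\<lambda>x. cis (- (x \<bullet> \<xi>)) * complex_of_real (B n x) - cis (- (x \<bullet> \<xi>)) * complex_of_real (G x)) = l2norm (\<lambda>x. B n x - G x)" for n
      using m(2)[OF square_integrable_diff[OF B12(2)[of n] sqG(1)]] by (simp add: right_diff_distrib)
    then show "(\<lambda>n. l2norm (\<lambda>x. cis (- (x \<bullet> \<xi>)) * complex_of_real (B n x) - cis (- (x \<bullet> \<xi>)) * complex_of_real (G x))) \<longlonglongrightarrow> 0"
      using Blim(1) by simp
  qed (intro m A12 B12 sqF sqG square_integrable_of_real_iff)+
  moreover have "(LINT x|lborel. complex_of_real (A n x) * (cis (- (x \<bullet> \<xi>)) * complex_of_real (B n x)))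
     = (LINT \<eta>|lborel. fourier_integral (A n) \<eta> * fourier_integral (B n) (\<xi> - \<eta>))" for n
  proof -
    obtain M where M: "\<And>x. \<bar>A n x\<bar> \<le> M" using A'[of n] by blast
    let ?a = "\<lambda>x. complex_of_real (A n x)" and ?b = "\<lambda>x. cis (- (x \<bullet> \<xi>)) * complex_of_real (B n x)"
    have "(LINT \<eta>|lborel. fint ?a \<eta> * fint ?b (- \<eta>)) = (LINT x|lborel. ?a x * ?b x)"
      by (rule parseval_bounded[where M=M])
        (use A12[of n] B12[of n] M m in \<open>auto intro!: square_integrable_of_real_iff integrable_cis_mult\<close>)
    moreover have "fint ?b (- \<eta>) = fourier_integral (B n) (\<xi> - \<eta>)" for \<eta>
      by (simp add: fint_def fourier_integral_def mult.assoc[symmetric] cis_mult inner_diff_right)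
    ultimately show ?thesis by (simp add: fourier_integral_fint)
  qed
  ultimately have R: "(\<lambda>n. LINT \<eta>|lborel. fourier_integral (A n) \<eta> * fourier_integral (B n) (\<xi> - \<eta>))
     \<longlonglongrightarrow> (LINT x|lborel. complex_of_real (F x) * (cis (- (x \<bullet> \<xi>)) * complex_of_real (G x)))" by simp
  have "(LINT x|lborel. complex_of_real (F x) * (cis (- (x \<bullet> \<xi>)) * complex_of_real (G x)))
     = of_real (2 * pi) * fourier_integral (\<lambda>x. F x * G x) \<xi>"
    by (simp add: fourier_integral_def scaleR_conv_of_real mult_ac)
  then show ?thesis using LIMSEQ_unique[OF L R] by simp
qed

text \<open>Duality in place of an inversion formula: if \<open>F\<close> exceeded the bound on a
  set of positive finite measure, its pairing with the indicator would exceed bound times measure,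
  whereas the transform of the indicator is at most measure / (2 pi) everywhere.\<close>

lemma has_ft_sup_bound:
  assumes F: "has_fourier_transform F f" and fi: "integrable lborel f"
  shows "AE x in lborel. \<bar>F x\<bar> \<le> (1 / (2 * pi)) * (LINT \<xi>|lborel. norm (f \<xi>))"
proof -
  define B where "B = (1 / (2 * pi)) * (LINT \<xi>|lborel. norm (f \<xi>))"
  have one_sided: "AE x in lborel. F x \<le> B"
    if F: "has_fourier_transform F f" and fi: "integrable lborel f" and B: "B = (1 / (2 * pi)) * (LINT \<xi>|lborel. norm (f \<xi>))"
    for F f
  proof -
    note sqF = has_ft_square_integrable[OF F]
    have [measurable]: "F \<in> borel_measurable borel" using sqF(1) square_integrable_measurable by fastforce
    \<comment> \<open>The ball keeps the measure finite and the margin 1 / (m + 1) makes the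
      contradiction strict; the union over \<open>n\<close> and \<open>m\<close> is the whole
      exceptional set.\<close>
    define A where "A n m = {x \<in> ball (0::real^2) (real n). F x \<ge> B + 1 / real (Suc m)}" for n m
    have "AE x in lborel. x \<notin> A n m" for n m
    proof -
      have [measurable]: "A n m \<in> sets borel" unfolding A_def by measurable
      have fin: "emeasure lborel (A n m) < \<infinity>"
      proof (rule le_less_trans[OF emeasure_mono])
        show "A n m \<subseteq> ball 0 (real n)" by (auto simp: A_def)
        show "emeasure lborel (ball (0::real^2) (real n)) < \<infinity>" by (rule emeasure_bounded_finite) simp
      qed simp
      let ?G = "\<lambda>x. indicator (A n m) x :: real"
      have Gi: "integrable lborel ?G" using fin by (simp add: integrable_indicator_iff)
      have G2: "square_integrable ?G"
      proof -
        have "(\<lambda>x. (norm (?G x))\<^sup>2) = ?G" by (auto simp: indicator_def)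
        then show ?thesis using Gi by (simp add: square_integrable_def)
      qed
      have iFG: "integrable lborel (\<lambda>x. F x * ?G x)" by (rule square_integrable_times[OF sqF(1) G2])
      define V where "V = measure lborel (A n m)"
      have "(B + 1 / real (Suc m)) * V = (LINT x|lborel. (B + 1 / real (Suc m)) * ?G x)"
        unfolding V_def by simp
      also have "\<dots> \<le> (LINT x|lborel. F x * ?G x)"
        using Gi iFG by (intro integral_mono) (auto simp: A_def indicator_def)
      also have "\<dots> \<le> norm (complex_of_real (LINT x|lborel. F x * ?G x))" by simp
      \<comment> \<open>At frequency 0 the product formula is the pairing of the two
        functions.\<close>
      also have "complex_of_real (LINT x|lborel. F x * ?G x) = of_real (2 * pi) * fourier_integral (\<lambda>x. F x * ?G x) 0"
        by (simp add: fourier_integral_def scaleR_conv_of_real del: of_real_mult)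
      also have "\<dots> = (LINT \<eta>|lborel. f \<eta> * fourier_integral ?G (0 - \<eta>))"
        using fourier_product_formula[OF F has_ft_L1[OF Gi G2], of 0] by simp
      also have "norm \<dots> \<le> (LINT \<eta>|lborel. norm (f \<eta> * fourier_integral ?G (0 - \<eta>)))"
        by (rule integral_norm_bound)
      also have "\<dots> \<le> (LINT \<eta>|lborel. norm (f \<eta>) * ((1 / (2 * pi)) * V))"
      proof (rule integral_mono)
        show "integrable lborel (\<lambda>\<eta>. norm (f \<eta> * fourier_integral ?G (0 - \<eta>)))"
          by (intro integrable_norm square_integrable_times sqF square_integrable_reflect bessel_real Gi G2)
        show "integrable lborel (\<lambda>\<eta>. norm (f \<eta>) * ((1 / (2 * pi)) * V))" using fi by simp
        fix \<eta>
        have "norm (fourier_integral ?G (0 - \<eta>)) \<le> (1 / (2 * pi)) * V"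
          using norm_fint_le[of "\<lambda>x. complex_of_real (?G x)" "0 - \<eta>"]
          unfolding fourier_integral_fint V_def by simp
        then show "norm (f \<eta> * fourier_integral ?G (0 - \<eta>)) \<le> norm (f \<eta>) * ((1 / (2 * pi)) * V)"
          unfolding norm_mult by (rule mult_left_mono) simp
      qed
      also have "\<dots> = B * V" unfolding B by simp
      finally have "V \<le> 0" by (simp add: field_simps)
      then have "emeasure lborel (A n m) = 0"
        using fin V_def by (simp add: emeasure_eq_ennreal_measure less_top measure_le_0_iff)
      then show ?thesis by (intro AE_not_in null_setsI) auto
    qed
    then have "AE x in lborel. \<forall>n m. x \<notin> A n m" by (simp add: AE_all_countable)
    then show ?thesis
    proof eventually_elim
      case (elim x)
      obtain n where n: "norm x < real n" using reals_Archimedean2 by blast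
      have "F x < B + 1 / real (Suc m)" for m
        using elim[rule_format, of n m] n by (auto simp: A_def)
      then have lt: "F x < B + 1 / real (Suc m)" for m .
      show ?case
      proof (rule field_le_epsilon)
        fix e :: real assume "e > 0"
        then obtain m where "1 / real (Suc m) < e" by (rule nat_approx_posE)
        then show "F x \<le> B + e" using lt[of m] by simp
      qed
    qed
  qed
  have "AE x in lborel. F x \<le> B" by (rule one_sided[OF F fi B_def])
  moreover have "AE x in lborel. - F x \<le> B"
    using one_sided[OF has_ft_cmult[OF F, of "-1"]] fi B_def by simp
  ultimately show ?thesis unfolding B_def[symmetric] by eventually_elim auto
qed

text \<open>Cauchy-Schwarz puts the product into L^1 and the sup bound for \<open>G\<close> puts it
  into L^2; its transform is therefore the plain integral, which the product formula turns into a
  convolution.\<close>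

lemma has_ft_mult:
  assumes F: "has_fourier_transform F f" and G: "has_fourier_transform G g" and gi: "integrable lborel g"
  shows "has_fourier_transform (\<lambda>x. F x * G x) (\<lambda>\<xi>. of_real (1 / (2 * pi)) * (LINT \<eta>|lborel. f \<eta> * g (\<xi> - \<eta>)))"
proof -
  note sqF = has_ft_square_integrable[OF F] and sqG = has_ft_square_integrable[OF G]
  have [measurable]: "F \<in> borel_measurable lborel" "G \<in> borel_measurable lborel"
    using sqF sqG square_integrable_measurable by auto
  have i: "integrable lborel (\<lambda>x. F x * G x)" by (rule square_integrable_times[OF sqF(1) sqG(1)])
  define B where "B = (1 / (2 * pi)) * (LINT \<xi>|lborel. norm (g \<xi>))"
  have b: "AE x in lborel. \<bar>G x\<bar> \<le> B" unfolding B_def by (rule has_ft_sup_bound[OF G gi])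
  have "square_integrable (\<lambda>x. F x * G x)"
  proof (rule square_integrable_bound(1))
    show "square_integrable (\<lambda>x. B * F x)" by (rule square_integrable_mult_left[OF sqF(1)])
    show "AE x in lborel. norm (F x * G x) \<le> norm (B * F x)"
      using b
    proof eventually_elim
      case (elim x)
      then have "\<bar>F x\<bar> * \<bar>G x\<bar> \<le> \<bar>F x\<bar> * \<bar>B\<bar>" by (intro mult_left_mono) auto
      then show ?case by (simp add: abs_mult mult.commute)
    qed
  qed measurable
  from has_ft_L1[OF i this] show ?thesis
    by (simp add: fourier_product_formula[OF F G])
qed

section \<open>Sobolev spaces on the plane\<close>

text \<open>Half the exponent: \<open>sw r\<close> multiplies the transform itself, and its square
  is the weight in \<open>sobolev_plane_norm\<close>.\<close>

definition sw :: "real \<Rightarrow> real^2 \<Rightarrow> real" where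
  "sw r \<xi> = (1 + (norm \<xi>)\<^sup>2) powr (r / 2)"

lemma one_plus_square_pos [simp]: "0 < 1 + (x::real)\<^sup>2" "1 + x\<^sup>2 \<noteq> 0" "0 \<le> 1 + x\<^sup>2"
proof -
  show "0 < 1 + x\<^sup>2" using zero_le_power2[of x] by linarith
  then show "1 + x\<^sup>2 \<noteq> 0" "0 \<le> 1 + x\<^sup>2" by auto
qed

lemma sw_measurable [measurable]: "sw r \<in> borel_measurable borel"
  unfolding sw_def by measurable

lemma sw_pos [simp]: "sw r \<xi> > 0"
  by (simp add: sw_def add_pos_nonneg)

lemma sw_nonneg [simp]: "sw r \<xi> \<ge> 0"
  using sw_pos[of r \<xi>] by linarith

lemma sw_neq_0 [simp]: "sw r \<xi> \<noteq> 0"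
  using sw_pos[of r \<xi>] by linarith

lemma sw_power2: "(sw r \<xi>)\<^sup>2 = (1 + (norm \<xi>)\<^sup>2) powr r"
  by (simp add: sw_def power2_eq_square powr_add[symmetric])

lemma sw_add: "sw r \<xi> * sw s \<xi> = sw (r + s) \<xi>"
  by (simp add: sw_def powr_add[symmetric] add_divide_distrib)

lemma sw_mono: "r \<le> s \<Longrightarrow> sw r \<xi> \<le> sw s \<xi>"
  unfolding sw_def by (intro powr_mono) auto

lemma sw_norm_mono: "0 \<le> r \<Longrightarrow> norm \<xi> \<le> norm \<eta> \<Longrightarrow> sw r \<xi> \<le> sw r \<eta>"
  unfolding sw_def by (intro powr_mono2) (auto intro: add_nonneg_nonneg power_mono)

lemma norm_le_sw: "norm \<xi> \<le> sw 1 \<xi>"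
proof -
  have "sw 1 \<xi> = sqrt (1 + (norm \<xi>)\<^sup>2)" by (simp add: sw_def powr_half_sqrt)
  then show ?thesis by (simp add: real_le_rsqrt)
qed

lemma sw_le_double:
  assumes r: "0 \<le> r" and le: "norm \<xi> \<le> 2 * norm \<eta>"
  shows "sw r \<xi> \<le> 2 powr r * sw r \<eta>"
proof -
  have "(norm \<xi>)\<^sup>2 \<le> (2 * norm \<eta>)\<^sup>2" using le by (intro power_mono) auto
  then have "1 + (norm \<xi>)\<^sup>2 \<le> 4 * (1 + (norm \<eta>)\<^sup>2)" by (simp add: power_mult_distrib)
  then have "sw r \<xi> \<le> (4 * (1 + (norm \<eta>)\<^sup>2)) powr (r / 2)"
    unfolding sw_def using r by (intro powr_mono2) (auto intro: add_nonneg_nonneg)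
  also have "\<dots> = 4 powr (r / 2) * sw r \<eta>"
    unfolding sw_def by (rule powr_mult)
  also have "(4::real) = 2 powr 2" by simp
  also have "(2 powr 2) powr (r / 2) = (2::real) powr r" by (simp only: powr_powr) simp
  finally show ?thesis .
qed

text \<open>The longer of eta and xi - eta has at least half the length of xi and takes over the
  weight of order \<open>r\<close>, at the cost 2^r. If it is xi - eta, monotonicity also moves the
  remaining order \<open>s - r\<close> from eta to it. Either way a factor
  \<open>inverse (sw s _)\<close> is left over, which later makes Young's inequality
  applicable.\<close>

lemma sw_quotient:
  assumes r: "0 \<le> r" "r \<le> s"
  shows "sw r \<xi> \<le> 2 powr r * (sw r \<eta> * sw s (\<xi> - \<eta>)) * (inverse (sw s \<eta>) + inverse (sw s (\<xi> - \<eta>)))"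
proof (cases "norm \<eta> \<le> norm (\<xi> - \<eta>)")
  case True
  have "norm \<xi> \<le> norm \<eta> + norm (\<xi> - \<eta>)" using norm_triangle_ineq[of \<eta> "\<xi> - \<eta>"] by simp
  then have "sw r \<xi> \<le> 2 powr r * sw r (\<xi> - \<eta>)" using True r by (intro sw_le_double) auto
  also have "\<dots> = 2 powr r * (sw r (\<xi> - \<eta>) * sw s \<eta>) * inverse (sw s \<eta>)" by simp
  also have "sw r (\<xi> - \<eta>) * sw s \<eta> = sw r (\<xi> - \<eta>) * (sw r \<eta> * sw (s - r) \<eta>)" by (simp add: sw_add)
  also have "2 powr r * (sw r (\<xi> - \<eta>) * (sw r \<eta> * sw (s - r) \<eta>)) * inverse (sw s \<eta>) \<le>
      2 powr r * (sw r (\<xi> - \<eta>) * (sw r \<eta> * sw (s - r) (\<xi> - \<eta>))) * inverse (sw s \<eta>)"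
    using True r by (intro mult_right_mono mult_left_mono sw_norm_mono) auto
  also have "sw r (\<xi> - \<eta>) * (sw r \<eta> * sw (s - r) (\<xi> - \<eta>)) = sw r \<eta> * sw s (\<xi> - \<eta>)"
    using sw_add[of r "\<xi> - \<eta>" "s - r"] by (simp add: mult_ac)
  also have "2 powr r * (sw r \<eta> * sw s (\<xi> - \<eta>)) * inverse (sw s \<eta>) \<le>
     2 powr r * (sw r \<eta> * sw s (\<xi> - \<eta>)) * (inverse (sw s \<eta>) + inverse (sw s (\<xi> - \<eta>)))"
    by (intro mult_left_mono) (auto simp: less_imp_le)
  finally show ?thesis .
next
  case False
  have "norm \<xi> \<le> norm \<eta> + norm (\<xi> - \<eta>)" using norm_triangle_ineq[of \<eta> "\<xi> - \<eta>"] by simp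
  then have "sw r \<xi> \<le> 2 powr r * sw r \<eta>" using False r by (intro sw_le_double) auto
  also have "\<dots> = 2 powr r * (sw r \<eta> * sw s (\<xi> - \<eta>)) * inverse (sw s (\<xi> - \<eta>))" by simp
  also have "\<dots> \<le> 2 powr r * (sw r \<eta> * sw s (\<xi> - \<eta>)) * (inverse (sw s \<eta>) + inverse (sw s (\<xi> - \<eta>)))"
    by (intro mult_left_mono) (auto simp: less_imp_le)
  finally show ?thesis .
qed

text \<open>Compared, through (1 + |t|)^2 <= 2 (1 + t^2), with (1 + |t|)^{-s}, which has an
  elementary antiderivative on the half-line; the other half is its reflection.\<close>

lemma integrable_japanese_bracket:
  assumes s: "s > 1"
  shows "integrable lborel (\<lambda>t::real. (1 + t\<^sup>2) powr (- s / 2))"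
proof -
  let ?f = "\<lambda>t::real. indicator {0..} t * (1 + t) powr (- s)"
  have "(\<integral>\<^sup>+t. ennreal ((1 + t) powr (- s)) * indicator {0..} t \<partial>lborel) = ennreal (0 - (- ((1 + 0) powr (1 - s)) / (s - 1)))"
  proof (rule nn_integral_FTC_atLeast)
    show "DERIV (\<lambda>t. - ((1 + t) powr (1 - s)) / (s - 1)) x :> (1 + x) powr (- s)" if "0 \<le> x" for x :: real
    proof -
      have "DERIV (\<lambda>t. - ((1 + t) powr (1 - s)) / (s - 1)) x :> - ((1 - s) * (1 + x) powr (1 - s - 1)) / (s - 1)"
        using that s by (auto intro!: derivative_eq_intros)
      moreover have "- ((1 - s) * (1 + x) powr (1 - s - 1)) / (s - 1) = (1 + x) powr (- s)"
        using s by (simp add: field_simps)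
      ultimately show ?thesis by simp
    qed
    have "((\<lambda>t. (1 + t) powr (1 - s)) \<longlongrightarrow> 0) at_top"
      by (rule tendsto_neg_powr) (use s in \<open>auto intro!: filterlim_tendsto_add_at_top[OF tendsto_const] filterlim_ident\<close>)
    from tendsto_divide[OF tendsto_minus[OF this] tendsto_const[of "s - 1"]] s
    show "((\<lambda>t. - ((1 + t) powr (1 - s)) / (s - 1)) \<longlongrightarrow> 0) at_top" by simp
  qed auto
  also have "\<dots> < \<infinity>" by simp
  finally have fin: "(\<integral>\<^sup>+t. ennreal ((1 + t) powr (- s)) * indicator {0..} t \<partial>lborel) < \<infinity>" .
  have f: "integrable lborel ?f"
  proof (rule integrableI_nonneg)
    have "(\<integral>\<^sup>+t. ennreal (?f t) \<partial>lborel) = (\<integral>\<^sup>+t. ennreal ((1 + t) powr (- s)) * indicator {0..} t \<partial>lborel)"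
      by (intro nn_integral_cong) (auto simp: indicator_def)
    then show "(\<integral>\<^sup>+t. ennreal (?f t) \<partial>lborel) < \<infinity>" using fin by simp
  qed auto
  have f': "integrable lborel (\<lambda>t. ?f (0 + (- 1) * t))"
    by (rule lborel_integrable_real_affine[OF f]) simp
  have "integrable lborel (\<lambda>t. 2 powr (s / 2) * (?f t + ?f (0 + (- 1) * t)))"
    by (intro integrable_mult_right Bochner_Integration.integrable_add f f')
  then show ?thesis
  proof (rule Bochner_Integration.integrable_bound)
    show "AE t in lborel. norm ((1 + t\<^sup>2) powr (- s / 2)) \<le> norm (2 powr (s / 2) * (?f t + ?f (0 + (- 1) * t)))"
    proof (rule AE_I2)
      fix t :: real
      have "(1 + \<bar>t\<bar>)\<^sup>2 \<le> 2 * (1 + t\<^sup>2)"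
        using sum_squares_bound[of 1 "\<bar>t\<bar>"] by (simp add: power2_sum)
      then have "(2 * (1 + t\<^sup>2)) powr (- s / 2) \<le> ((1 + \<bar>t\<bar>)\<^sup>2) powr (- s / 2)"
        using s by (intro powr_mono2') (auto simp: add_pos_nonneg)
      also have "((1 + \<bar>t\<bar>)\<^sup>2) powr (- s / 2) = ((1 + \<bar>t\<bar>) powr 2) powr (- s / 2)"
        by (subst powr_numeral) (auto simp: add_pos_nonneg)
      also have "\<dots> = (1 + \<bar>t\<bar>) powr (- s)" by (simp only: powr_powr) simp
      finally have le: "(2 * (1 + t\<^sup>2)) powr (- s / 2) \<le> (1 + \<bar>t\<bar>) powr (- s)" .
      have "(1 + t\<^sup>2) powr (- s / 2) = 2 powr (s / 2) * (2 * (1 + t\<^sup>2)) powr (- s / 2)"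
      proof -
        have "(2 * (1 + t\<^sup>2)) powr (- s / 2) = 2 powr (- s / 2) * (1 + t\<^sup>2) powr (- s / 2)" by (rule powr_mult)
        moreover have "2 powr (s / 2) * 2 powr (- s / 2) = (1::real)" by (simp add: powr_add[symmetric])
        ultimately show ?thesis by (metis mult.assoc mult_1)
      qed
      also have "\<dots> \<le> 2 powr (s / 2) * (1 + \<bar>t\<bar>) powr (- s)" using le by (intro mult_left_mono) auto
      also have "\<dots> \<le> 2 powr (s / 2) * (?f t + ?f (0 + (- 1) * t))"
        by (intro mult_left_mono) (auto simp: indicator_def abs_if)
      finally show "norm ((1 + t\<^sup>2) powr (- s / 2)) \<le> norm (2 powr (s / 2) * (?f t + ?f (0 + (- 1) * t)))"
        by simp
    qed
  qed measurable
qed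

text \<open>The exponent \<open>s\<close> is shared between the two coordinates: each receives (1 +
  t^2)^{-s/2}, integrable on the line for s > 1. This is where the condition s > d/2 enters.\<close>

lemma inverse_sw_square_integrable:
  assumes s: "s > 1"
  shows "square_integrable (\<lambda>\<xi>. inverse (sw s \<xi>))"
proof -
  let ?p = "\<lambda>b::real^2. \<lambda>t::real. complex_of_real ((1 + t\<^sup>2) powr (- s / 2))"
  have i: "integrable lborel (\<lambda>\<xi>::real^2. \<Prod>b\<in>Basis. ?p b (\<xi> \<bullet> b))"
    by (rule integral_lborel_prod(1)) (use integrable_japanese_bracket[OF s] in simp)
  have "integrable lborel (\<lambda>\<xi>. (norm (inverse (sw s \<xi>)))\<^sup>2)"
  proof (rule Bochner_Integration.integrable_bound[OF i])
    show "AE \<xi> in lborel. norm ((norm (inverse (sw s \<xi>)))\<^sup>2) \<le> norm (\<Prod>b\<in>Basis. ?p b (\<xi> \<bullet> b))"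
    proof (rule AE_I2)
      fix \<xi> :: "real^2"
      have "norm (\<Prod>b\<in>Basis. ?p b (\<xi> \<bullet> b)) = (\<Prod>b\<in>Basis. (1 + (\<xi> \<bullet> b)\<^sup>2) powr (- s / 2))"
        by (simp add: prod_norm[symmetric])
      moreover have "(\<Prod>b\<in>(Basis :: (real^2) set). (1 + (norm \<xi>)\<^sup>2) powr (- s / 2)) \<le> (\<Prod>b\<in>Basis. (1 + (\<xi> \<bullet> b)\<^sup>2) powr (- s / 2))"
      proof (rule prod_mono)
        fix b :: "real^2" assume b: "b \<in> Basis"
        have "(\<xi> \<bullet> b)\<^sup>2 \<le> (norm \<xi>)\<^sup>2" using Basis_le_norm[OF b, of \<xi>] by (simp add: abs_le_square_iff[symmetric])
        then show "0 \<le> (1 + (norm \<xi>)\<^sup>2) powr (- s / 2) \<and> (1 + (norm \<xi>)\<^sup>2) powr (- s / 2) \<le> (1 + (\<xi> \<bullet> b)\<^sup>2) powr (- s / 2)"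
          using s by (auto intro!: powr_mono2' simp: add_pos_nonneg)
      qed
      moreover have "(\<Prod>b\<in>(Basis :: (real^2) set). (1 + (norm \<xi>)\<^sup>2) powr (- s / 2)) = (norm (inverse (sw s \<xi>)))\<^sup>2"
        by (simp add: sw_def powr_minus[symmetric] power2_eq_square)
      ultimately show "norm ((norm (inverse (sw s \<xi>)))\<^sup>2) \<le> norm (\<Prod>b\<in>Basis. ?p b (\<xi> \<bullet> b))" by simp
    qed
  qed measurable
  then show ?thesis by (simp add: square_integrable_def)
qed

text \<open>Names the transform, so that estimates do not touch the choice in
  \<open>fourier_transform\<close>; \<open>sobolev_plane_norm_eq\<close> is the bridge.\<close>

definition sob_pair :: "real \<Rightarrow> (real^2 \<Rightarrow> real) \<Rightarrow> (real^2 \<Rightarrow> complex) \<Rightarrow> bool" where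
  "sob_pair r F f \<longleftrightarrow> has_fourier_transform F f \<and> square_integrable (\<lambda>\<xi>. of_real (sw r \<xi>) * f \<xi>)"

lemma has_ft_measurable [measurable_dest]:
  "has_fourier_transform F f \<Longrightarrow> F \<in> borel_measurable lborel"
  "has_fourier_transform F f \<Longrightarrow> f \<in> borel_measurable lborel"
  using has_ft_square_integrable square_integrable_measurable by blast+

lemma norm_sw_mult: "(norm (complex_of_real (sw r \<xi>) * z))\<^sup>2 = (1 + (norm \<xi>)\<^sup>2) powr r * (norm z)\<^sup>2"
  by (simp add: norm_mult power_mult_distrib sw_power2)

lemma sobolev_plane_iff: "F \<in> sobolev_plane r \<longleftrightarrow> (\<exists>f. sob_pair r F f)"
proof -
  have "square_integrable F \<and> has_fourier_transform F f \<and> integrable lborel (\<lambda>\<xi>. (1 + (norm \<xi>)\<^sup>2) powr r * (norm (f \<xi>))\<^sup>2)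
      \<longleftrightarrow> sob_pair r F f" for f
  proof (cases "has_fourier_transform F f")
    case True
    then have [measurable]: "f \<in> borel_measurable lborel" by (rule has_ft_measurable)
    show ?thesis using True has_ft_square_integrable[OF True]
      unfolding sob_pair_def square_integrable_def norm_sw_mult by auto
  qed (simp add: sob_pair_def)
  then show ?thesis unfolding sobolev_plane_def by blast
qed

lemma sobolev_plane_norm_eq:
  assumes F: "has_fourier_transform F f"
  shows "sobolev_plane_norm r F = l2norm (\<lambda>\<xi>. of_real (sw r \<xi>) * f \<xi>)"
proof -
  have F': "has_fourier_transform F (fourier_transform F)"
    unfolding fourier_transform_def by (rule someI[of _ f]) (rule F)
  have "AE \<xi> in lborel. fourier_transform F \<xi> = f \<xi>" by (rule has_ft_unique_AE[OF F' F]) simp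
  then have "l2norm (\<lambda>\<xi>. of_real (sw r \<xi>) * fourier_transform F \<xi>) = l2norm (\<lambda>\<xi>. of_real (sw r \<xi>) * f \<xi>)"
    using has_ft_measurable[OF F] has_ft_measurable[OF F'] by (intro l2norm_cong_AE) auto
  then show ?thesis unfolding sobolev_plane_norm_def l2norm_def norm_sw_mult by simp
qed

lemma sobolev_plane_norm_nonneg: "sobolev_plane_norm r F \<ge> 0"
  unfolding sobolev_plane_norm_def by (auto intro!: integral_nonneg_AE)

lemma sob_pair_norm: "sob_pair r F f \<Longrightarrow> sobolev_plane_norm r F = l2norm (\<lambda>\<xi>. of_real (sw r \<xi>) * f \<xi>)"
  by (simp add: sob_pair_def sobolev_plane_norm_eq)

lemma sob_pairD:
  assumes "sob_pair r F f"
  shows "has_fourier_transform F f" "square_integrable (\<lambda>\<xi>. of_real (sw r \<xi>) * f \<xi>)"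
    "square_integrable F" "square_integrable f"
  using assms has_ft_square_integrable by (auto simp: sob_pair_def)

lemma sob_pair_add:
  assumes "sob_pair r F f" "sob_pair r G g"
  shows "sob_pair r (\<lambda>x. F x + G x) (\<lambda>\<xi>. f \<xi> + g \<xi>)"
  using assms square_integrable_add[of "\<lambda>\<xi>. of_real (sw r \<xi>) * f \<xi>" "\<lambda>\<xi>. of_real (sw r \<xi>) * g \<xi>"]
  by (auto simp: sob_pair_def distrib_left has_ft_add)

lemma sob_pair_cmult:
  assumes "sob_pair r F f"
  shows "sob_pair r (\<lambda>x. c * F x) (\<lambda>\<xi>. of_real c * f \<xi>)"
  using assms square_integrable_mult_left[of "\<lambda>\<xi>. of_real (sw r \<xi>) * f \<xi>" "complex_of_real c"]
  by (auto simp: sob_pair_def mult.left_commute has_ft_cmult)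

lemma sobolev_plane_add:
  assumes "F \<in> sobolev_plane r" "G \<in> sobolev_plane r"
  shows "(\<lambda>x. F x + G x) \<in> sobolev_plane r"
    and "sobolev_plane_norm r (\<lambda>x. F x + G x) \<le> sobolev_plane_norm r F + sobolev_plane_norm r G"
proof -
  obtain f g where f: "sob_pair r F f" and g: "sob_pair r G g" using assms by (auto simp: sobolev_plane_iff)
  show "(\<lambda>x. F x + G x) \<in> sobolev_plane r" using sob_pair_add[OF f g] by (auto simp: sobolev_plane_iff)
  show "sobolev_plane_norm r (\<lambda>x. F x + G x) \<le> sobolev_plane_norm r F + sobolev_plane_norm r G"
    using l2norm_triangle[OF sob_pairD(2)[OF f] sob_pairD(2)[OF g]]
    by (simp add: sob_pair_norm[OF f] sob_pair_norm[OF g] sob_pair_norm[OF sob_pair_add[OF f g]] distrib_left)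
qed

lemma sobolev_plane_cmult:
  assumes "F \<in> sobolev_plane r"
  shows "(\<lambda>x. c * F x) \<in> sobolev_plane r"
    and "sobolev_plane_norm r (\<lambda>x. c * F x) = \<bar>c\<bar> * sobolev_plane_norm r F"
proof -
  obtain f where f: "sob_pair r F f" using assms by (auto simp: sobolev_plane_iff)
  show "(\<lambda>x. c * F x) \<in> sobolev_plane r" using sob_pair_cmult[OF f] by (auto simp: sobolev_plane_iff)
  show "sobolev_plane_norm r (\<lambda>x. c * F x) = \<bar>c\<bar> * sobolev_plane_norm r F"
    using l2norm_mult_left[of "complex_of_real c" "\<lambda>\<xi>. of_real (sw r \<xi>) * f \<xi>"]
    by (simp add: sob_pair_norm[OF f] sob_pair_norm[OF sob_pair_cmult[OF f]] mult.left_commute)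
qed

lemma sob_pair_mono:
  assumes rs: "r \<le> s" and F: "sob_pair s F f"
  shows "sob_pair r F f" "sobolev_plane_norm r F \<le> sobolev_plane_norm s F"
proof -
  have [measurable]: "f \<in> borel_measurable lborel" using F has_ft_measurable sob_pair_def by blast
  have le: "AE \<xi> in lborel. norm (complex_of_real (sw r \<xi>) * f \<xi>) \<le> norm (complex_of_real (sw s \<xi>) * f \<xi>)"
    using sw_mono[OF rs] by (auto simp: norm_mult intro!: mult_right_mono)
  have m: "(\<lambda>\<xi>. complex_of_real (sw r \<xi>) * f \<xi>) \<in> borel_measurable lborel" by measurable
  show r: "sob_pair r F f"
    using F square_integrable_bound(1)[OF sob_pairD(2)[OF F] m le] by (simp add: sob_pair_def)
  show "sobolev_plane_norm r F \<le> sobolev_plane_norm s F"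
    using square_integrable_bound(2)[OF sob_pairD(2)[OF F] m le] by (simp add: sob_pair_norm[OF F] sob_pair_norm[OF r])
qed

lemma sobolev_plane_norm_0:
  assumes "sob_pair r F f" "0 \<le> r"
  shows "l2norm F \<le> sobolev_plane_norm r F"
proof -
  have "l2norm F = l2norm f" using plancherel[OF sob_pairD(1)[OF assms(1)]] by simp
  also have "\<dots> = sobolev_plane_norm 0 F"
    by (simp add: sobolev_plane_norm_eq[OF sob_pairD(1)[OF assms(1)]] sw_def add_pos_nonneg l2norm_def
        power2_eq_square[symmetric] add_nonneg_eq_0_iff)
  also have "\<dots> \<le> sobolev_plane_norm r F" by (rule sob_pair_mono(2)[OF assms(2,1)])
  finally show ?thesis .
qed

text \<open>An embedding constant, meaningful for s > 1: it bounds the L^1 norm of the transform,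
  and with it the sup norm, by the H^s norm.\<close>

definition sob_const :: "real \<Rightarrow> real" where
  "sob_const s = l2norm (\<lambda>\<xi>. inverse (sw s \<xi>))"

lemma sob_const_nonneg: "sob_const s \<ge> 0"
  by (simp add: sob_const_def)

lemma sob_pair_integrable:
  assumes F: "sob_pair s F f" and s: "s > 1"
  shows "integrable lborel f" "(LINT \<xi>|lborel. norm (f \<xi>)) \<le> sob_const s * sobolev_plane_norm s F"
proof -
  have [measurable]: "f \<in> borel_measurable lborel" using F has_ft_measurable sob_pair_def by blast
  note cs = cauchy_schwarz_norm[OF inverse_sw_square_integrable[OF s] sob_pairD(2)[OF F]]
  have e: "norm (inverse (sw s \<xi>)) * norm (complex_of_real (sw s \<xi>) * f \<xi>) = norm (f \<xi>)" for \<xi>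
    by (simp add: norm_mult)
  from cs(1) have "integrable lborel (\<lambda>\<xi>. norm (f \<xi>))" unfolding e .
  then show "integrable lborel f" by (simp add: integrable_norm_iff)
  show "(LINT \<xi>|lborel. norm (f \<xi>)) \<le> sob_const s * sobolev_plane_norm s F"
    using cs(2) unfolding e by (simp add: sob_const_def sob_pair_norm[OF F])
qed

lemma sobolev_plane_sup_bound:
  assumes F: "sob_pair s F f" and s: "s > 1"
  shows "AE x in lborel. \<bar>F x\<bar> \<le> sob_const s * sobolev_plane_norm s F"
proof -
  have "(1 / (2 * pi)) * (LINT \<xi>|lborel. norm (f \<xi>)) \<le> 1 * (LINT \<xi>|lborel. norm (f \<xi>))"
    using pi_gt3 by (intro mult_right_mono) (auto simp: integral_nonneg_AE)
  then have "(1 / (2 * pi)) * (LINT \<xi>|lborel. norm (f \<xi>)) \<le> sob_const s * sobolev_plane_norm s F"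
    using sob_pair_integrable(2)[OF F s] by simp
  note le = this
  show ?thesis
    using has_ft_sup_bound[OF sob_pairD(1)[OF F] sob_pair_integrable(1)[OF F s]]
    by eventually_elim (use le in linarith)
qed

text \<open>Divided by the weight, \<open>A\<close> lies in L^1 by Cauchy-Schwarz, with norm at most
  \<open>sob_const s * l2norm A\<close>; then L^1 * L^2 applies.\<close>

lemma young_l2:
  fixes A B :: "real^2 \<Rightarrow> real"
  assumes A: "square_integrable A" and B: "square_integrable B" and s: "s > 1"
    and A0: "\<And>x. A x \<ge> 0" and B0: "\<And>x. B x \<ge> 0"
  shows "(\<integral>\<^sup>+\<xi>. (\<integral>\<^sup>+\<eta>. ennreal (A \<eta> * inverse (sw s \<eta>)) * ennreal (B (\<xi> - \<eta>)) \<partial>lborel)\<^sup>2 \<partial>lborel)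
    \<le> ennreal ((sob_const s * l2norm A * l2norm B)\<^sup>2)"
proof -
  have [measurable]: "A \<in> borel_measurable borel" "B \<in> borel_measurable borel"
    using A B square_integrable_measurable by fastforce+
  note cs = cauchy_schwarz_norm[OF A inverse_sw_square_integrable[OF s]]
  have i: "integrable lborel (\<lambda>\<eta>. A \<eta> * inverse (sw s \<eta>))" using cs(1) A0 by simp
  have 1: "(\<integral>\<^sup>+\<eta>. ennreal (A \<eta> * inverse (sw s \<eta>)) \<partial>lborel) \<le> ennreal (sob_const s * l2norm A)"
    using cs(2) A0 by (subst nn_integral_eq_integral[OF i]) (auto simp: sob_const_def mult.commute intro!: ennreal_leI)
  have 2: "(\<integral>\<^sup>+\<eta>. (ennreal (B \<eta>))\<^sup>2 \<partial>lborel) = ennreal ((l2norm B)\<^sup>2)"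
    using nn_integral_eq_l2norm[OF B] B0 by (simp add: ennreal_power)
  have "(\<integral>\<^sup>+\<xi>. (\<integral>\<^sup>+\<eta>. ennreal (A \<eta> * inverse (sw s \<eta>)) * ennreal (B (\<xi> - \<eta>)) \<partial>lborel)\<^sup>2 \<partial>lborel)
    \<le> (\<integral>\<^sup>+\<eta>. ennreal (A \<eta> * inverse (sw s \<eta>)) \<partial>lborel)\<^sup>2 * (\<integral>\<^sup>+\<eta>. (ennreal (B \<eta>))\<^sup>2 \<partial>lborel)"
    by (rule young_nn_integral) measurable
  also have "\<dots> \<le> (ennreal (sob_const s * l2norm A))\<^sup>2 * ennreal ((l2norm B)\<^sup>2)"
    unfolding 2 by (intro mult_right_mono power_mono_ennreal 1) simp
  also have "\<dots> = ennreal ((sob_const s * l2norm A * l2norm B)\<^sup>2)"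
    by (simp add: ennreal_power ennreal_mult[symmetric] power_mult_distrib sob_const_nonneg)
  finally show ?thesis .
qed

text \<open>The transform of the product is a convolution. \<open>sw_quotient\<close> distributes
  the outer weight and splits the integral into two convolutions, in each of which one factor is
  weakened by \<open>inverse (sw s _)\<close> and so lies in L^1. The orders \<open>r = s\<close>
  and \<open>r = s - 1\<close> give the two multiplications needed later.\<close>

lemma sob_pair_mult:
  assumes F: "sob_pair r F f" and G: "sob_pair s G g" and r: "0 \<le> r" "r \<le> s" and s: "s > 1"
  shows "\<exists>h. sob_pair r (\<lambda>x. F x * G x) h"
    and "sobolev_plane_norm r (\<lambda>x. F x * G x) \<le> 2 * 2 powr r * sob_const s * sobolev_plane_norm r F * sobolev_plane_norm s G"
proof -
  note Ff = sob_pairD[OF F] and Gg = sob_pairD[OF G]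
  have [measurable]: "f \<in> borel_measurable borel" "g \<in> borel_measurable borel"
    using has_ft_measurable[OF Ff(1)] has_ft_measurable[OF Gg(1)] by auto
  define h where "h \<xi> = of_real (1 / (2 * pi)) * (LINT \<eta>|lborel. f \<eta> * g (\<xi> - \<eta>))" for \<xi>
  have ft: "has_fourier_transform (\<lambda>x. F x * G x) h"
    unfolding h_def[abs_def] by (rule has_ft_mult[OF Ff(1) Gg(1) sob_pair_integrable(1)[OF G s]])
  then have [measurable]: "h \<in> borel_measurable lborel" by (rule has_ft_measurable)
  define A where "A \<xi> = norm (complex_of_real (sw r \<xi>) * f \<xi>)" for \<xi>
  define B where "B \<xi> = norm (complex_of_real (sw s \<xi>) * g \<xi>)" for \<xi>
  have [measurable]: "A \<in> borel_measurable borel" "B \<in> borel_measurable borel"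
    unfolding A_def[abs_def] B_def[abs_def] by measurable
  have A2: "square_integrable A" and B2: "square_integrable B"
    unfolding A_def[abs_def] B_def[abs_def] by (intro square_integrable_norm Ff Gg)+
  have lA: "l2norm A = sobolev_plane_norm r F" and lB: "l2norm B = sobolev_plane_norm s G"
    unfolding A_def[abs_def] B_def[abs_def] l2norm_norm by (simp_all add: sob_pair_norm[OF F] sob_pair_norm[OF G])
  have A0: "A x \<ge> 0" and B0: "B x \<ge> 0" for x by (auto simp: A_def B_def)
  define U where "U \<xi> = (\<integral>\<^sup>+\<eta>. ennreal (A \<eta> * inverse (sw s \<eta>)) * ennreal (B (\<xi> - \<eta>)) \<partial>lborel)" for \<xi>
  define V where "V \<xi> = (\<integral>\<^sup>+\<eta>. ennreal (B \<eta> * inverse (sw s \<eta>)) * ennreal (A (\<xi> - \<eta>)) \<partial>lborel)" for \<xi>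
  have [measurable]: "U \<in> borel_measurable borel" "V \<in> borel_measurable borel"
    unfolding U_def[abs_def] V_def[abs_def] by measurable
  define c where "c = sob_const s * l2norm A * l2norm B"
  have c0: "c \<ge> 0" by (simp add: c_def sob_const_nonneg)
  have U2: "(\<integral>\<^sup>+\<xi>. (U \<xi>)\<^sup>2 \<partial>lborel) \<le> ennreal (c\<^sup>2)"
    unfolding U_def c_def by (rule young_l2[OF A2 B2 s A0 B0])
  have V2: "(\<integral>\<^sup>+\<xi>. (V \<xi>)\<^sup>2 \<partial>lborel) \<le> ennreal (c\<^sup>2)"
    using young_l2[OF B2 A2 s B0 A0] unfolding V_def c_def by (simp add: mult_ac)
  define K where "K = 2 powr r * (1 / (2 * pi))"
  have K0: "K \<ge> 0" by (simp add: K_def)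
  have bound: "ennreal (norm (complex_of_real (sw r \<xi>) * h \<xi>)) \<le> ennreal K * (U \<xi> + V \<xi>)" for \<xi>
  proof -
    \<comment> \<open>The reflection gives both convolutions the same integration variable, so that
      they can be compared pointwise with the integrand of \<open>h\<close>.\<close>
    have Vr: "V \<xi> = (\<integral>\<^sup>+\<eta>. ennreal (B (\<xi> - \<eta>) * inverse (sw s (\<xi> - \<eta>))) * ennreal (A \<eta>) \<partial>lborel)"
      unfolding V_def
      by (subst nn_integral_reflect[of _ \<xi>, symmetric]) auto
    have ifg: "integrable lborel (\<lambda>\<eta>. f \<eta> * g (\<xi> - \<eta>))"
      by (rule square_integrable_times(1)[OF Ff(4) square_integrable_reflect(1)[OF Gg(4)]])
    have "ennreal (norm (LINT \<eta>|lborel. f \<eta> * g (\<xi> - \<eta>))) \<le> (\<integral>\<^sup>+\<eta>. ennreal (norm (f \<eta> * g (\<xi> - \<eta>))) \<partial>lborel)"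
      by (rule integral_norm_bound_ennreal[OF ifg])
    then have "ennreal (sw r \<xi>) * ennreal (norm (LINT \<eta>|lborel. f \<eta> * g (\<xi> - \<eta>)))
        \<le> ennreal (sw r \<xi>) * (\<integral>\<^sup>+\<eta>. ennreal (norm (f \<eta> * g (\<xi> - \<eta>))) \<partial>lborel)"
      by (rule mult_left_mono) simp
    also have "\<dots> = (\<integral>\<^sup>+\<eta>. ennreal (sw r \<xi> * norm (f \<eta> * g (\<xi> - \<eta>))) \<partial>lborel)"
      by (subst nn_integral_cmult[symmetric]) (auto simp: ennreal_mult)
    also have "\<dots> \<le> (\<integral>\<^sup>+\<eta>. ennreal (2 powr r) * (ennreal (A \<eta> * inverse (sw s \<eta>)) * ennreal (B (\<xi> - \<eta>))
        + ennreal (B (\<xi> - \<eta>) * inverse (sw s (\<xi> - \<eta>))) * ennreal (A \<eta>)) \<partial>lborel)"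
    proof (rule nn_integral_mono)
      fix \<eta>
      have "sw r \<xi> * norm (f \<eta> * g (\<xi> - \<eta>)) \<le>
         2 powr r * (sw r \<eta> * sw s (\<xi> - \<eta>)) * (inverse (sw s \<eta>) + inverse (sw s (\<xi> - \<eta>))) * norm (f \<eta> * g (\<xi> - \<eta>))"
        by (rule mult_right_mono[OF sw_quotient[OF r]]) simp
      also have "\<dots> = 2 powr r * (A \<eta> * inverse (sw s \<eta>) * B (\<xi> - \<eta>) + B (\<xi> - \<eta>) * inverse (sw s (\<xi> - \<eta>)) * A \<eta>)"
        by (simp add: A_def B_def norm_mult algebra_simps)
      finally have le: "sw r \<xi> * norm (f \<eta> * g (\<xi> - \<eta>)) \<le> \<dots>" .
      have e: "ennreal (2 powr r) * (ennreal (A \<eta> * inverse (sw s \<eta>)) * ennreal (B (\<xi> - \<eta>))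
        + ennreal (B (\<xi> - \<eta>) * inverse (sw s (\<xi> - \<eta>))) * ennreal (A \<eta>))
        = ennreal (2 powr r * (A \<eta> * inverse (sw s \<eta>) * B (\<xi> - \<eta>) + B (\<xi> - \<eta>) * inverse (sw s (\<xi> - \<eta>)) * A \<eta>))"
        using A0 B0 by (simp add: ennreal_mult[symmetric] ennreal_plus[symmetric] del: ennreal_plus)
      show "ennreal (sw r \<xi> * norm (f \<eta> * g (\<xi> - \<eta>))) \<le> ennreal (2 powr r) * (ennreal (A \<eta> * inverse (sw s \<eta>)) * ennreal (B (\<xi> - \<eta>))
        + ennreal (B (\<xi> - \<eta>) * inverse (sw s (\<xi> - \<eta>))) * ennreal (A \<eta>))"
        unfolding e by (rule ennreal_leI[OF le])
    qed
    also have "\<dots> = ennreal (2 powr r) * (U \<xi> + V \<xi>)"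
      unfolding Vr U_def by (subst nn_integral_cmult) (auto simp: nn_integral_add)
    finally have *: "ennreal (sw r \<xi>) * ennreal (norm (LINT \<eta>|lborel. f \<eta> * g (\<xi> - \<eta>))) \<le> ennreal (2 powr r) * (U \<xi> + V \<xi>)" .
    have "ennreal (norm (complex_of_real (sw r \<xi>) * h \<xi>)) = ennreal (1 / (2 * pi)) * (ennreal (sw r \<xi>) * ennreal (norm (LINT \<eta>|lborel. f \<eta> * g (\<xi> - \<eta>))))"
      by (simp add: h_def norm_mult norm_divide ennreal_mult[symmetric] mult_ac)
    also have "\<dots> \<le> ennreal (1 / (2 * pi)) * (ennreal (2 powr r) * (U \<xi> + V \<xi>))"
      by (intro mult_left_mono *) simp
    also have "\<dots> = ennreal K * (U \<xi> + V \<xi>)"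
    proof -
      have "ennreal K = ennreal (1 / (2 * pi)) * ennreal (2 powr r)"
        unfolding K_def by (subst ennreal_mult[symmetric]) (auto simp: mult.commute)
      then show ?thesis by (simp only: mult.assoc)
    qed
    finally show ?thesis .
  qed
  have "(\<integral>\<^sup>+\<xi>. ennreal ((norm (complex_of_real (sw r \<xi>) * h \<xi>))\<^sup>2) \<partial>lborel)
      \<le> (\<integral>\<^sup>+\<xi>. ennreal (2 * K\<^sup>2) * ((U \<xi>)\<^sup>2 + (V \<xi>)\<^sup>2) \<partial>lborel)"
  proof (rule nn_integral_mono)
    fix \<xi>
    have sq: "(u + v)\<^sup>2 \<le> 2 * (u\<^sup>2 + v\<^sup>2)" for u v :: ennreal
    proof (cases "u = \<top> \<or> v = \<top>")
      case True
      then show ?thesis by (auto simp: power2_eq_square ennreal_top_mult ennreal_mult_top ennreal_add_eq_top)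
    next
      case False
      then obtain a b where ab: "u = ennreal a" "v = ennreal b" "a \<ge> 0" "b \<ge> 0"
        by (metis ennreal_cases)
      have "(a + b)\<^sup>2 \<le> 2 * (a\<^sup>2 + b\<^sup>2)" using sum_squares_bound[of a b] by (simp add: power2_sum)
      then have "ennreal ((a + b)\<^sup>2) \<le> ennreal (2 * (a\<^sup>2 + b\<^sup>2))" by (rule ennreal_leI)
      moreover have "ennreal (2 * (a\<^sup>2 + b\<^sup>2)) = 2 * (ennreal (a\<^sup>2) + ennreal (b\<^sup>2))"
        by (subst ennreal_mult, simp, simp, subst ennreal_plus) auto
      moreover have "(ennreal a + ennreal b)\<^sup>2 = ennreal ((a + b)\<^sup>2)"
        using ab by (simp add: ennreal_plus[symmetric] ennreal_power del: ennreal_plus)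
      moreover have "(ennreal a)\<^sup>2 = ennreal (a\<^sup>2)" "(ennreal b)\<^sup>2 = ennreal (b\<^sup>2)"
        using ab by (simp_all add: ennreal_power)
      ultimately show ?thesis unfolding ab by (simp only:)
    qed
    have "ennreal ((norm (complex_of_real (sw r \<xi>) * h \<xi>))\<^sup>2) = (ennreal (norm (complex_of_real (sw r \<xi>) * h \<xi>)))\<^sup>2"
      by (simp add: ennreal_power)
    also have "\<dots> \<le> (ennreal K * (U \<xi> + V \<xi>))\<^sup>2" by (rule power_mono_ennreal[OF bound])
    also have "\<dots> = ennreal (K\<^sup>2) * (U \<xi> + V \<xi>)\<^sup>2" using K0 by (simp add: power_mult_distrib ennreal_power)
    also have "\<dots> \<le> ennreal (K\<^sup>2) * (2 * ((U \<xi>)\<^sup>2 + (V \<xi>)\<^sup>2))" by (intro mult_left_mono sq) simp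
    also have "\<dots> = ennreal (2 * K\<^sup>2) * ((U \<xi>)\<^sup>2 + (V \<xi>)\<^sup>2)"
    proof -
      have "ennreal (2 * K\<^sup>2) = 2 * ennreal (K\<^sup>2)" by (subst ennreal_mult) auto
      then show ?thesis by (simp only: mult.assoc mult.left_commute)
    qed
    finally show "ennreal ((norm (complex_of_real (sw r \<xi>) * h \<xi>))\<^sup>2) \<le> ennreal (2 * K\<^sup>2) * ((U \<xi>)\<^sup>2 + (V \<xi>)\<^sup>2)" .
  qed
  also have "\<dots> = ennreal (2 * K\<^sup>2) * ((\<integral>\<^sup>+\<xi>. (U \<xi>)\<^sup>2 \<partial>lborel) + (\<integral>\<^sup>+\<xi>. (V \<xi>)\<^sup>2 \<partial>lborel))"
    by (subst nn_integral_cmult) (auto simp: nn_integral_add)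
  also have "\<dots> \<le> ennreal (2 * K\<^sup>2) * (ennreal (c\<^sup>2) + ennreal (c\<^sup>2))"
    by (intro mult_left_mono add_mono U2 V2) simp
  \<comment> \<open>2 K^2 (c^2 + c^2) = (2 K c)^2, the first factor 2 coming from (u + v)^2 <= 2
    (u^2 + v^2).\<close>
  also have "\<dots> = ennreal ((2 * K * c)\<^sup>2)"
    by (simp add: ennreal_mult[symmetric] ennreal_plus[symmetric] power_mult_distrib del: ennreal_plus)
  finally have le: "(\<integral>\<^sup>+\<xi>. ennreal ((norm (complex_of_real (sw r \<xi>) * h \<xi>))\<^sup>2) \<partial>lborel) \<le> ennreal ((2 * K * c)\<^sup>2)" .
  have "integrable lborel (\<lambda>\<xi>. (norm (complex_of_real (sw r \<xi>) * h \<xi>))\<^sup>2)"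
    by (rule integrableI_nonneg) (use le in \<open>auto simp: le_less_trans\<close>)
  then have sq: "square_integrable (\<lambda>\<xi>. complex_of_real (sw r \<xi>) * h \<xi>)" by (simp add: square_integrable_def)
  then have pair: "sob_pair r (\<lambda>x. F x * G x) h" using ft by (simp add: sob_pair_def)
  then show "\<exists>h. sob_pair r (\<lambda>x. F x * G x) h" by blast
  have "(sobolev_plane_norm r (\<lambda>x. F x * G x))\<^sup>2 \<le> (2 * K * c)\<^sup>2"
    using le unfolding nn_integral_eq_l2norm[OF sq] sob_pair_norm[OF pair] by simp
  then have "sobolev_plane_norm r (\<lambda>x. F x * G x) \<le> 2 * K * c"
    by (rule power2_le_imp_le) (use K0 c0 in simp)
  also have "2 * K * c \<le> 2 * 2 powr r * c"
    using c0 pi_gt3 unfolding K_def by (intro mult_right_mono) (auto simp: field_simps)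
  also have "\<dots> = 2 * 2 powr r * sob_const s * sobolev_plane_norm r F * sobolev_plane_norm s G"
    by (simp add: c_def lA lB)
  finally show "sobolev_plane_norm r (\<lambda>x. F x * G x) \<le> 2 * 2 powr r * sob_const s * sobolev_plane_norm r F * sobolev_plane_norm s G" .
qed

section \<open>Series and derivatives in the Sobolev spaces of the plane\<close>

lemma has_ft_sum:
  assumes "\<And>i. has_fourier_transform (F i) (f i)"
  shows "has_fourier_transform (\<lambda>x. \<Sum>i<(n::nat). F i x) (\<lambda>\<xi>. \<Sum>i<n. f i \<xi>)"
proof (induction n)
  case 0
  then show ?case using has_ft_cmult[OF assms[of 0], of 0] by simp
next
  case (Suc n)
  then show ?case using has_ft_add[OF Suc assms[of n]] by simp
qed

text \<open>Completeness of L^2 is used three times, for the functions, their transforms and the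
  weighted transforms; closedness of the transform and a.e. convergence tie the three limits
  together.\<close>

lemma sob_pair_series:
  assumes F: "\<And>n. sob_pair s (F n) (f n)" and s0: "0 \<le> s"
    and sum: "summable (\<lambda>n. sobolev_plane_norm s (F n))"
  shows "AE x in lborel. summable (\<lambda>n. norm (F n x))"
    and "\<exists>g. sob_pair s (\<lambda>x. \<Sum>n. F n x) g"
    and "sobolev_plane_norm s (\<lambda>x. \<Sum>n. F n x) \<le> (\<Sum>n. sobolev_plane_norm s (F n))"
proof -
  note FD = sob_pairD[OF F]
  have sF: "summable (\<lambda>n. l2norm (F n))"
    by (rule summable_comparison_test'[OF sum]) (use sobolev_plane_norm_0[OF F s0] in auto)
  have sf: "summable (\<lambda>n. l2norm (f n))"
    using sF plancherel[OF FD(1)] by simp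
  have sW: "summable (\<lambda>n. l2norm (\<lambda>\<xi>. of_real (sw s \<xi>) * f n \<xi>))"
    using sum sob_pair_norm[OF F] by simp
  note serF = l2_series[OF FD(3) sF] and serf = l2_series[OF FD(4) sf] and serW = l2_series[OF FD(2) sW]
  show "AE x in lborel. summable (\<lambda>n. norm (F n x))" by (rule serF(1))
  have ft: "has_fourier_transform (\<lambda>x. \<Sum>n. F n x) (\<lambda>\<xi>. \<Sum>n. f n \<xi>)"
    by (rule has_ft_closed[OF has_ft_sum[OF FD(1)] serF(2) serf(2) serF(3) serf(3)])
  have [measurable]: "(\<lambda>\<xi>. \<Sum>n. f n \<xi>) \<in> borel_measurable lborel" using ft by (rule has_ft_measurable)
  have [measurable]: "(\<lambda>\<xi>. \<Sum>n. of_real (sw s \<xi>) * f n \<xi>) \<in> borel_measurable lborel"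
    using serW(2) by (rule square_integrable_measurable)
  have eq: "AE \<xi> in lborel. of_real (sw s \<xi>) * (\<Sum>n. f n \<xi>) = (\<Sum>n. of_real (sw s \<xi>) * f n \<xi>)"
    using serf(1) by eventually_elim (auto intro!: suminf_mult[symmetric] summable_norm_cancel)
  have sq: "square_integrable (\<lambda>\<xi>. of_real (sw s \<xi>) * (\<Sum>n. f n \<xi>))"
    by (rule square_integrable_cong_AE[OF serW(2) _ eq]) measurable
  then have pair: "sob_pair s (\<lambda>x. \<Sum>n. F n x) (\<lambda>\<xi>. \<Sum>n. f n \<xi>)" using ft by (simp add: sob_pair_def)
  then show "\<exists>g. sob_pair s (\<lambda>x. \<Sum>n. F n x) g" by blast
  have "l2norm (\<lambda>\<xi>. of_real (sw s \<xi>) * (\<Sum>n. f n \<xi>)) = l2norm (\<lambda>\<xi>. \<Sum>n. of_real (sw s \<xi>) * f n \<xi>)"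
    using eq by (intro l2norm_cong_AE) auto
  then show "sobolev_plane_norm s (\<lambda>x. \<Sum>n. F n x) \<le> (\<Sum>n. sobolev_plane_norm s (F n))"
    using serW(4) by (simp add: sob_pair_norm[OF pair] sob_pair_norm[OF F])
qed

lemma norm_cis_minus_1_le: "norm (cis t - 1) \<le> \<bar>t\<bar>"
  using iexp_approx1[of t 0] by (simp add: cis_conv_exp)

lemma difference_quotient_cis_tendsto: "(\<lambda>n. of_nat (Suc n) * (cis (t / real (Suc n)) - 1)) \<longlonglongrightarrow> \<i> * of_real t"
proof -
  have b: "norm (of_nat (Suc n) * (cis (t / real (Suc n)) - 1) - \<i> * of_real t) \<le> t\<^sup>2 / 2 * (1 / real (Suc n))" for n
  proof -
    let ?h = "1 / real (Suc n)"
    have "norm (cis (t * ?h) - 1 - \<i> * of_real (t * ?h)) \<le> (t * ?h)\<^sup>2 / 2"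
      using iexp_approx1[of "t * ?h" 1] by (simp add: cis_conv_exp power2_eq_square algebra_simps)
    then have "real (Suc n) * norm (cis (t * ?h) - 1 - \<i> * of_real (t * ?h)) \<le> real (Suc n) * ((t * ?h)\<^sup>2 / 2)"
      by (rule mult_left_mono) simp
    moreover have "real (Suc n) * ((t * ?h)\<^sup>2 / 2) = t\<^sup>2 / 2 * ?h"
      by (simp add: power2_eq_square field_simps del: of_nat_Suc)
    moreover have "of_nat (Suc n) * (cis (t / real (Suc n)) - 1) - \<i> * of_real t
        = of_nat (Suc n) * (cis (t * ?h) - 1 - \<i> * of_real (t * ?h))"
    proof -
      have "complex_of_nat (Suc n) * (\<i> * of_real (t * ?h)) = \<i> * of_real t"
        by (simp add: field_simps del: of_nat_Suc)
      then show ?thesis by (simp add: right_diff_distrib del: of_nat_Suc)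
    qed
    ultimately show ?thesis by (simp only: norm_mult norm_of_nat)
  qed
  have "(\<lambda>n. t\<^sup>2 / 2 * (1 / real (Suc n))) \<longlonglongrightarrow> t\<^sup>2 / 2 * 0"
    by (intro tendsto_mult tendsto_const LIMSEQ_Suc lim_1_over_n)
  then have "(\<lambda>n. of_nat (Suc n) * (cis (t / real (Suc n)) - 1) - \<i> * of_real t) \<longlonglongrightarrow> 0"
    by (intro Lim_null_comparison[OF always_eventually[OF allI[OF b]]]) simp
  then show ?thesis by (rule LIM_zero_cancel)
qed

definition diff_quot :: "2 \<Rightarrow> nat \<Rightarrow> (real^2 \<Rightarrow> real) \<Rightarrow> real^2 \<Rightarrow> real" where
  "diff_quot k n F x = real (Suc n) * (F (x + axis k (1 / real (Suc n))) - F x)"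

lemma axis_inner: "axis k h \<bullet> \<xi> = h * \<xi> $ k" for \<xi> :: "real^2"
  by (simp add: inner_axis' mult.commute)

lemma has_ft_diff_quot:
  assumes F: "has_fourier_transform F f"
  shows "has_fourier_transform (diff_quot k n F) (\<lambda>\<xi>. of_nat (Suc n) * (cis (\<xi> $ k / real (Suc n)) - 1) * f \<xi>)"
proof -
  have "has_fourier_transform (\<lambda>x. real (Suc n) * (F (x + axis k (1 / real (Suc n))) - F x))
     (\<lambda>\<xi>. of_real (real (Suc n)) * (cis (axis k (1 / real (Suc n)) \<bullet> \<xi>) * f \<xi> - f \<xi>))"
    by (intro has_ft_cmult has_ft_diff has_ft_translate F)
  then show ?thesis unfolding diff_quot_def[abs_def] axis_inner
    by (simp add: algebra_simps del: of_nat_Suc)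
qed

text \<open>The derivative is an L^2 limit of difference quotients. Their transforms converge by
  domination, and Plancherel carries the Cauchy property back to the functions, so that no inverse
  transform has to be constructed.\<close>

lemma sob_pair_deriv:
  assumes F: "sob_pair s F f" and s: "s \<ge> 1"
  obtains G where "sob_pair (s - 1) G (\<lambda>\<xi>. \<i> * of_real (\<xi> $ k) * f \<xi>)"
    and "sobolev_plane_norm (s - 1) G \<le> sobolev_plane_norm s F"
    and "(\<lambda>n. l2norm (\<lambda>x. diff_quot k n F x - G x)) \<longlonglongrightarrow> 0"
proof -
  note FD = sob_pairD[OF F]
  have [measurable]: "f \<in> borel_measurable lborel" using FD(1) by (rule has_ft_measurable)
  define q where "q n \<xi> = of_nat (Suc n) * (cis (\<xi> $ k / real (Suc n)) - 1) * f \<xi>" for n and \<xi> :: "real^2"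
  define g where "g \<xi> = \<i> * of_real (\<xi> $ k) * f \<xi>" for \<xi> :: "real^2"
  have [measurable]: "(\<lambda>\<xi>::real^2. \<xi> $ k) \<in> borel_measurable borel"
    by (intro borel_measurable_continuous_onI continuous_intros)
  have [measurable]: "q n \<in> borel_measurable lborel" "g \<in> borel_measurable lborel" for n
    unfolding q_def[abs_def] g_def[abs_def] by measurable
  have s1: "square_integrable (\<lambda>\<xi>. of_real (sw 1 \<xi>) * f \<xi>)"
    using sob_pair_mono(1)[OF s F] by (rule sob_pairD)
  have comp: "\<bar>\<xi> $ k\<bar> \<le> sw 1 \<xi>" for \<xi> :: "real^2"
    using component_le_norm_cart[of \<xi> k] norm_le_sw[of \<xi>] by linarith
  \<comment> \<open>|cis t - 1| <= |t| makes the majorant independent of the step.\<close>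
  have qle: "norm (q n \<xi>) \<le> norm (complex_of_real (sw 1 \<xi>) * f \<xi>)" for n \<xi>
  proof -
    have "norm (q n \<xi>) = real (Suc n) * norm (cis (\<xi> $ k / real (Suc n)) - 1) * norm (f \<xi>)"
      by (simp add: q_def norm_mult del: of_nat_Suc)
    also have "\<dots> \<le> real (Suc n) * \<bar>\<xi> $ k / real (Suc n)\<bar> * norm (f \<xi>)"
      by (intro mult_right_mono mult_left_mono norm_cis_minus_1_le) auto
    also have "\<dots> = \<bar>\<xi> $ k\<bar> * norm (f \<xi>)" by (simp add: abs_divide del: of_nat_Suc)
    also have "\<dots> \<le> sw 1 \<xi> * norm (f \<xi>)" by (intro mult_right_mono comp) simp
    finally show ?thesis by (simp add: norm_mult)
  qed
  have qg: "AE \<xi> in lborel. (\<lambda>n. q n \<xi>) \<longlonglongrightarrow> g \<xi>"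
    unfolding q_def g_def by (intro AE_I2 tendsto_mult_right difference_quotient_cis_tendsto)
  have gsq: "square_integrable g" and lim: "(\<lambda>n. l2norm (\<lambda>\<xi>. q n \<xi> - g \<xi>)) \<longlonglongrightarrow> 0"
    by (rule l2_dominated_convergence[OF _ _ s1 _ qg]; use qle in simp)+
  have ft: "has_fourier_transform (diff_quot k n F) (q n)" for n
    unfolding q_def[abs_def] by (rule has_ft_diff_quot[OF FD(1)])
  note sqQ = has_ft_square_integrable[OF ft]
  have "\<exists>N. \<forall>m\<ge>N. \<forall>n\<ge>N. l2norm (\<lambda>x. diff_quot k m F x - diff_quot k n F x) < e" if e: "e > 0" for e
  proof -
    obtain N where N: "\<And>n. n \<ge> N \<Longrightarrow> l2norm (\<lambda>\<xi>. q n \<xi> - g \<xi>) < e/2"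
      using LIMSEQ_D[OF lim, of "e/2"] e by auto
    have "l2norm (\<lambda>x. diff_quot k m F x - diff_quot k n F x) < e" if "m \<ge> N" "n \<ge> N" for m n
    proof -
      have "l2norm (\<lambda>x. diff_quot k m F x - diff_quot k n F x) = l2norm (\<lambda>\<xi>. q m \<xi> - q n \<xi>)"
        by (rule plancherel[OF has_ft_diff[OF ft ft], symmetric])
      also have "\<dots> \<le> l2norm (\<lambda>\<xi>. q m \<xi> - g \<xi>) + l2norm (\<lambda>\<xi>. g \<xi> - q n \<xi>)"
        by (intro l2norm_triangle_diff sqQ gsq)
      also have "\<dots> < e" using N[OF that(1)] N[OF that(2)] l2norm_minus_commute[of g "q n"] by simp
      finally show ?thesis .
    qed
    then show ?thesis by blast
  qed
  from l2_complete[OF sqQ(1) this] obtain G where G: "square_integrable G"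
    and Glim: "(\<lambda>n. l2norm (\<lambda>x. diff_quot k n F x - G x)) \<longlonglongrightarrow> 0" by blast
  have ftG: "has_fourier_transform G g" by (rule has_ft_closed[OF ft G gsq Glim lim])
  have le: "AE \<xi> in lborel. norm (complex_of_real (sw (s - 1) \<xi>) * g \<xi>) \<le> norm (complex_of_real (sw s \<xi>) * f \<xi>)"
  proof (rule AE_I2)
    fix \<xi>
    have "norm (complex_of_real (sw (s - 1) \<xi>) * g \<xi>) = sw (s - 1) \<xi> * (\<bar>\<xi> $ k\<bar> * norm (f \<xi>))"
      by (simp add: g_def norm_mult)
    also have "\<dots> \<le> sw (s - 1) \<xi> * (sw 1 \<xi> * norm (f \<xi>))"
      by (intro mult_left_mono mult_right_mono comp) auto
    also have "\<dots> = norm (complex_of_real (sw s \<xi>) * f \<xi>)"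
      using sw_add[of "s - 1" \<xi> 1] by (simp add: norm_mult mult.assoc[symmetric])
    finally show "norm (complex_of_real (sw (s - 1) \<xi>) * g \<xi>) \<le> norm (complex_of_real (sw s \<xi>) * f \<xi>)" .
  qed
  have m: "(\<lambda>\<xi>. complex_of_real (sw (s - 1) \<xi>) * g \<xi>) \<in> borel_measurable lborel" by measurable
  have pair: "sob_pair (s - 1) G g"
    using ftG square_integrable_bound(1)[OF FD(2) m le] by (simp add: sob_pair_def)
  moreover have "sobolev_plane_norm (s - 1) G \<le> sobolev_plane_norm s F"
    using square_integrable_bound(2)[OF FD(2) m le] by (simp add: sob_pair_norm[OF F] sob_pair_norm[OF pair])
  ultimately show thesis using Glim that unfolding g_def[abs_def] by blast
qed

text \<open>The L^1 counterpart of \<open>sob_pair_deriv\<close>, for test functions: there the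
  limit of the difference quotients is known and its transform is wanted.\<close>

lemma fourier_integral_deriv:
  assumes F: "integrable lborel F" and G: "integrable lborel G"
    and lim: "(\<lambda>n. LINT x|lborel. \<bar>diff_quot k n F x - G x\<bar>) \<longlonglongrightarrow> 0"
  shows "fourier_integral G \<xi> = \<i> * of_real (\<xi> $ k) * fourier_integral F \<xi>"
proof -
  have [measurable]: "F \<in> borel_measurable borel" using F by auto
  have iT: "integrable lborel (\<lambda>x. F (x + h))" for h using F by (subst integral_translate(2)) auto
  have iQ: "integrable lborel (diff_quot k n F)" for n
    unfolding diff_quot_def[abs_def] by (intro integrable_mult_right Bochner_Integration.integrable_diff iT F)
  have e: "fourier_integral (diff_quot k n F) \<xi> = of_nat (Suc n) * (cis (\<xi> $ k / real (Suc n)) - 1) * fourier_integral F \<xi>" for n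
  proof -
    have "fourier_integral (diff_quot k n F) \<xi>
       = of_real (real (Suc n)) * (fourier_integral (\<lambda>x. F (x + axis k (1 / real (Suc n)))) \<xi> - fourier_integral F \<xi>)"
      unfolding diff_quot_def[abs_def] by (subst fourier_integral_mult_left, subst fourier_integral_diff[OF iT F]) simp
    also have "\<dots> = of_nat (Suc n) * (cis (\<xi> $ k / real (Suc n)) - 1) * fourier_integral F \<xi>"
      by (subst fourier_integral_translate) (auto simp: axis_inner algebra_simps simp del: of_nat_Suc)
    finally show ?thesis .
  qed
  have "norm (fourier_integral (diff_quot k n F) \<xi> - fourier_integral G \<xi>) \<le> (1 / (2 * pi)) * (LINT x|lborel. \<bar>diff_quot k n F x - G x\<bar>)" for n
    using norm_fint_le[of "\<lambda>x. complex_of_real (diff_quot k n F x - G x)" \<xi>]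
    by (subst fourier_integral_diff[OF iQ G, symmetric]) (simp add: fourier_integral_fint del: of_real_diff)
  note b = this
  have "(\<lambda>n. fourier_integral (diff_quot k n F) \<xi> - fourier_integral G \<xi>) \<longlonglongrightarrow> 0"
    by (rule Lim_null_comparison[OF always_eventually[OF allI[OF b]]]) (rule tendsto_mult_right_zero[OF lim])
  then have "(\<lambda>n. fourier_integral (diff_quot k n F) \<xi>) \<longlonglongrightarrow> fourier_integral G \<xi>" by (rule LIM_zero_cancel)
  moreover have "(\<lambda>n. fourier_integral (diff_quot k n F) \<xi>) \<longlonglongrightarrow> \<i> * of_real (\<xi> $ k) * fourier_integral F \<xi>"
    unfolding e by (intro tendsto_mult_right difference_quotient_cis_tendsto)
  ultimately show ?thesis by (rule LIMSEQ_unique)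
qed

section \<open>Test functions\<close>

definition pd :: "2 \<Rightarrow> (real^2 \<Rightarrow> real) \<Rightarrow> real^2 \<Rightarrow> real" where
  "pd k f x = frechet_derivative f (at x) (axis k 1)"

lemma Ck_Suc: "Ck (Suc n) f \<longleftrightarrow> (\<forall>x. f differentiable (at x)) \<and> (\<forall>i. Ck n (pd i f))"
  by (simp add: pd_def[abs_def])

declare Ck.simps(2) [simp del]

lemma Ck_Suc_imp: "Ck (Suc n) f \<Longrightarrow> Ck n f"
proof (induction n arbitrary: f)
  case 0
  then have "f differentiable (at x)" for x by (simp add: Ck_Suc)
  then show ?case by (auto intro!: continuous_at_imp_continuous_on differentiable_imp_continuous_within)
next
  case (Suc n)
  then show ?case unfolding Ck_Suc[of "Suc n"] Ck_Suc[of n] by blast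
qed

lemma pd_eq: "(f has_derivative f') (at x) \<Longrightarrow> pd k f x = f' (axis k 1)"
  unfolding pd_def by (drule frechet_derivative_at) simp

lemma has_derivative_frechet: "Ck (Suc n) f \<Longrightarrow> (f has_derivative frechet_derivative f (at x)) (at x)"
  by (simp add: Ck_Suc frechet_derivative_works)

lemma Ck_add: "Ck n f \<Longrightarrow> Ck n g \<Longrightarrow> Ck n (\<lambda>x. f x + g x)"
proof (induction n arbitrary: f g)
  case (Suc n)
  note d = has_derivative_add[OF has_derivative_frechet[OF Suc.prems(1)] has_derivative_frechet[OF Suc.prems(2)]]
  have "pd i (\<lambda>x. f x + g x) = (\<lambda>x. pd i f x + pd i g x)" for i
    using pd_eq[OF d] by (auto simp: pd_def)
  then show ?case
    using d Suc by (auto simp: Ck_Suc differentiable_def)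
qed (auto intro: continuous_intros)

lemma Ck_mult: "Ck n f \<Longrightarrow> Ck n g \<Longrightarrow> Ck n (\<lambda>x. f x * g x)"
proof (induction n arbitrary: f g)
  case (Suc n)
  note d = has_derivative_mult[OF has_derivative_frechet[OF Suc.prems(1)] has_derivative_frechet[OF Suc.prems(2)]]
  have e: "pd i (\<lambda>x. f x * g x) = (\<lambda>x. f x * pd i g x + pd i f x * g x)" for i
    using pd_eq[OF d] by (auto simp: pd_def)
  have "Ck n f" "Ck n g" using Suc.prems by (auto intro: Ck_Suc_imp)
  then have "Ck n (pd i (\<lambda>x. f x * g x))" for i
    unfolding e using Suc.prems by (intro Ck_add Suc.IH) (auto simp: Ck_Suc)
  then show ?case
    using d by (auto simp: Ck_Suc differentiable_def)
qed (auto intro: continuous_intros)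

lemma Ck_const: "Ck n (\<lambda>x. c)"
proof (induction n arbitrary: c)
  case (Suc n)
  have "pd i (\<lambda>x. c) = (\<lambda>x. 0)" for i
    using pd_eq[OF has_derivative_const] by auto
  then show ?case using Suc by (auto simp: Ck_Suc)
qed auto

lemma Ck_inverse: "Ck n f \<Longrightarrow> (\<And>x. f x \<noteq> 0) \<Longrightarrow> Ck n (\<lambda>x. inverse (f x))"
proof (induction n)
  case (Suc n)
  note d = Deriv.has_derivative_inverse[OF Suc.prems(2) has_derivative_frechet[OF Suc.prems(1)]]
  have e: "pd i (\<lambda>x. inverse (f x)) = (\<lambda>x. (- 1) * (inverse (f x) * pd i f x * inverse (f x)))" for i
    using pd_eq[OF d] by (auto simp: pd_def)
  have "Ck n (\<lambda>x. inverse (f x))" using Suc by (auto intro: Ck_Suc_imp)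
  then have "Ck n (pd i (\<lambda>x. inverse (f x)))" for i
    unfolding e using Suc.prems(1) by (intro Ck_mult Ck_const) (auto simp: Ck_Suc)
  then show ?case
    using d by (auto simp: Ck_Suc differentiable_def)
qed (auto intro: continuous_intros)

text \<open>Taking the whole sequence of derivatives as data lets the induction step pass from
  \<open>d n\<close> to \<open>d (Suc n)\<close>.\<close>

lemma Ck_coordinate:
  assumes d: "\<And>n t. (d n has_real_derivative d (Suc n) t) (at t)"
  shows "Ck m (\<lambda>x::real^2. d n (c * x $ i + e))"
proof (induction m arbitrary: n)
  case 0
  have "isCont (d n) t" for t using d DERIV_isCont by blast
  then have "continuous_on UNIV (d n)" by (simp add: continuous_at_imp_continuous_on)
  then have "continuous_on UNIV (\<lambda>x::real^2. d n (c * x $ i + e))"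
    by (rule continuous_on_compose2) (auto intro!: continuous_intros)
  then show ?case by simp
next
  case (Suc m)
  have D: "((\<lambda>x::real^2. d n (c * x $ i + e)) has_derivative (\<lambda>h. (c * h $ i) * d (Suc n) (c * x $ i + e))) (at x)" for x
  proof -
    have "((\<lambda>x::real^2. c * x $ i + e) has_derivative (\<lambda>h. c * h $ i)) (at x)"
      by (auto intro!: derivative_eq_intros bounded_linear.has_derivative[OF bounded_linear_vec_nth])
    from DERIV_compose_FDERIV[OF d this] show ?thesis by simp
  qed
  have "pd j (\<lambda>x::real^2. d n (c * x $ i + e)) = (\<lambda>x. (c * axis j 1 $ i) * d (Suc n) (c * x $ i + e))" for j
    using pd_eq[OF D] by auto
  then have "Ck m (pd j (\<lambda>x::real^2. d n (c * x $ i + e)))" for j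
    using Ck_mult[OF Ck_const Suc.IH] by simp
  then show ?case using D by (auto simp: Ck_Suc differentiable_def)
qed

section \<open>Flat functions and bumps on boxes\<close>

definition flat_exp :: "real poly \<Rightarrow> real \<Rightarrow> real" where
  "flat_exp p t = (if t > 0 then poly p (inverse t) * exp (- inverse t) else 0)"

lemma poly_exp_tendsto_0: "((\<lambda>y::real. y ^ k * poly p y * exp (- y)) \<longlongrightarrow> 0) at_top"
proof (induction p arbitrary: k)
  case (pCons a p)
  have "((\<lambda>y::real. a * (y ^ k / exp y) + y ^ Suc k * poly p y * exp (- y)) \<longlongrightarrow> a * 0 + 0) at_top"
    by (intro tendsto_add tendsto_mult tendsto_const tendsto_power_div_exp_0 pCons.IH)
  then show ?case by (simp add: algebra_simps exp_minus divide_inverse)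
qed simp

text \<open>The functions p(1/t) exp(-1/t) are closed under differentiation, the new polynomial
  being X^2 (p - p'). Only t = 0 is delicate: there (1/h) p(1/h) exp(-1/h) tends to 0 from the
  right.\<close>

lemma flat_exp_deriv:
  "(flat_exp p has_real_derivative flat_exp ([:0, 0, 1:] * (p - pderiv p)) t) (at t)"
proof -
  consider "t > 0" | "t < 0" | "t = 0" by linarith
  then show ?thesis
  proof cases
    case 1
    have "((\<lambda>t. poly p (inverse t) * exp (- inverse t)) has_real_derivative flat_exp ([:0, 0, 1:] * (p - pderiv p)) t) (at t)"
      using 1 by (auto intro!: derivative_eq_intros poly_DERIV[THEN DERIV_chain2] simp: flat_exp_def algebra_simps power2_eq_square)
    then show ?thesis
      by (rule has_field_derivative_transform_within_open[of _ _ _ "{0<..}"]) (use 1 in \<open>auto simp: flat_exp_def\<close>)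
  next
    case 2
    have "((\<lambda>t. 0) has_real_derivative flat_exp ([:0, 0, 1:] * (p - pderiv p)) t) (at t)"
      using 2 by (simp add: flat_exp_def)
    then show ?thesis
      by (rule has_field_derivative_transform_within_open[of _ _ _ "{..<0}"]) (use 2 in \<open>auto simp: flat_exp_def\<close>)
  next
    case 3
    have "((\<lambda>h. flat_exp p h / h) \<longlongrightarrow> 0) (at_right 0)"
    proof (rule Lim_transform_eventually)
      show "((\<lambda>h. inverse h ^ 1 * poly p (inverse h) * exp (- inverse h)) \<longlongrightarrow> 0) (at_right 0)"
        by (rule filterlim_compose[OF poly_exp_tendsto_0 filterlim_inverse_at_top_right])
      show "\<forall>\<^sub>F h in at_right 0. inverse h ^ 1 * poly p (inverse h) * exp (- inverse h) = flat_exp p h / h"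
        by (rule eventually_mono[OF eventually_at_right_less]) (simp add: flat_exp_def divide_inverse)
    qed
    moreover have "((\<lambda>h. flat_exp p h / h) \<longlongrightarrow> 0) (at_left 0)"
      by (rule tendsto_eventually)
        (rule eventually_mono[OF eventually_at_left_real[of "-1" 0]], auto simp: flat_exp_def)
    ultimately have "((\<lambda>h. flat_exp p h / h) \<longlongrightarrow> 0) (at 0)"
      by (rule filterlim_split_at[rotated])
    then show ?thesis using 3 by (simp add: has_field_derivative_iff flat_exp_def)
  qed
qed

primrec flat_poly :: "nat \<Rightarrow> real poly" where
  "flat_poly 0 = 1"
| "flat_poly (Suc n) = [:0, 0, 1:] * (flat_poly n - pderiv (flat_poly n))"

definition flat_fun :: "real \<Rightarrow> real" where
  "flat_fun t = (if t > 0 then exp (- inverse t) else 0)"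

lemma Ck_flat: "Ck m (\<lambda>x::real^2. flat_fun (c * x $ i + e))"
proof -
  have "Ck m (\<lambda>x::real^2. flat_exp (flat_poly 0) (c * x $ i + e))"
    by (rule Ck_coordinate[of "\<lambda>n. flat_exp (flat_poly n)"]) (auto simp del: mult_pCons_left intro: flat_exp_deriv)
  moreover have "flat_exp (flat_poly 0) = flat_fun" by (auto simp: flat_exp_def flat_fun_def)
  ultimately show ?thesis by simp
qed

lemma flat_pos_iff: "flat_fun t > 0 \<longleftrightarrow> t > 0" and flat_nonneg: "flat_fun t \<ge> 0" and flat_le_1: "flat_fun t \<le> 1"
  and flat_eq_0: "t \<le> 0 \<Longrightarrow> flat_fun t = 0"
  by (auto simp: flat_fun_def)

text \<open>For every \<open>m \<ge> 0\<close> it vanishes outside the box, and it tends to the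
  indicator of the open box as the steepness \<open>m\<close> grows, so indicators are reached
  without mollification.\<close>

definition box_bump :: "real \<Rightarrow> real^2 \<Rightarrow> real^2 \<Rightarrow> real^2 \<Rightarrow> real" where
  "box_bump m a b x = (\<Prod>i\<in>UNIV. flat_fun (m * x $ i + - (m * a $ i)) * flat_fun (- m * x $ i + m * b $ i))"

lemma Ck_prod:
  assumes "\<And>i. i \<in> I \<Longrightarrow> Ck n (f i)"
  shows "Ck n (\<lambda>x. \<Prod>i\<in>I. f i x)"
  using assms by (induction I rule: infinite_finite_induct) (auto intro: Ck_const Ck_mult)

lemma Ck_box_bump: "Ck n (\<lambda>x. box_bump m a b x)"
  unfolding box_bump_def by (intro Ck_prod Ck_mult Ck_flat)

lemma box_bump_eq_0:
  assumes "x \<notin> box a b" "m \<ge> 0"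
  shows "box_bump m a b x = 0"
proof -
  obtain i where i: "x $ i \<le> a $ i \<or> b $ i \<le> x $ i"
    using assms(1) unfolding mem_box_cart by (meson not_le)
  have "flat_fun (m * x $ i + - (m * a $ i)) * flat_fun (- m * x $ i + m * b $ i) = 0"
    using i
  proof
    assume "x $ i \<le> a $ i"
    then have "m * x $ i \<le> m * a $ i" using assms(2) by (rule mult_left_mono)
    then show ?thesis by (simp add: flat_eq_0)
  next
    assume "b $ i \<le> x $ i"
    then have "m * b $ i \<le> m * x $ i" using assms(2) by (rule mult_left_mono)
    then show ?thesis by (simp add: flat_eq_0)
  qed
  then show ?thesis unfolding box_bump_def by (intro prod_zero) auto
qed

lemma box_bump_bounds: "0 \<le> box_bump m a b x" "box_bump m a b x \<le> 1"
proof -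
  show "0 \<le> box_bump m a b x" unfolding box_bump_def by (intro prod_nonneg mult_nonneg_nonneg flat_nonneg)
  show "box_bump m a b x \<le> 1"
    unfolding box_bump_def by (intro prod_le_1) (auto simp: flat_nonneg flat_le_1 mult_le_one)
qed

lemma flat_scale_tendsto:
  assumes "t > 0"
  shows "(\<lambda>n. flat_fun (real (Suc n) * t)) \<longlonglongrightarrow> 1"
proof -
  have "(\<lambda>n. exp (- (1 / real (Suc n) * inverse t))) \<longlonglongrightarrow> exp (- (0 * inverse t))"
    by (intro tendsto_exp tendsto_minus tendsto_mult tendsto_const LIMSEQ_Suc lim_1_over_n)
  moreover have "exp (- (1 / real (Suc n) * inverse t)) = flat_fun (real (Suc n) * t)" for n
    using assms by (simp add: flat_fun_def field_simps del: of_nat_Suc)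
  ultimately show ?thesis by simp
qed

lemma box_bump_tendsto: "(\<lambda>n. box_bump (real (Suc n)) a b x) \<longlonglongrightarrow> indicator (box a b) x"
proof (cases "x \<in> box a b")
  case True
  have "(\<lambda>n. box_bump (real (Suc n)) a b x) \<longlonglongrightarrow> (\<Prod>i\<in>(UNIV::2 set). 1 * 1)"
    unfolding box_bump_def
  proof (intro tendsto_prod tendsto_mult)
    fix i :: 2
    have "a $ i < x $ i" "x $ i < b $ i" using True by (auto simp: mem_box_cart)
    then show "(\<lambda>n. flat_fun (real (Suc n) * x $ i + - (real (Suc n) * a $ i))) \<longlonglongrightarrow> 1"
      "(\<lambda>n. flat_fun (- real (Suc n) * x $ i + real (Suc n) * b $ i)) \<longlonglongrightarrow> 1"
      using flat_scale_tendsto[of "x $ i - a $ i"] flat_scale_tendsto[of "b $ i - x $ i"]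
      by (simp_all add: algebra_simps del: of_nat_Suc)
  qed
  then show ?thesis using True by (simp add: box_bump_def)
next
  case False
  then show ?thesis using box_bump_eq_0[OF False] by simp
qed

lemma test_function_box_bump:
  assumes "cbox a b \<subseteq> D" "m \<ge> 0"
  shows "test_function D (\<lambda>x. box_bump m a b x)"
  unfolding test_function_def
proof (intro conjI allI exI[of _ "cbox a b"] impI)
  show "box_bump m a b x = 0" if "x \<notin> cbox a b" for x
    using that box_subset_cbox[of a b] by (intro box_bump_eq_0 assms) auto
qed (use assms Ck_box_bump in auto)

text \<open>Open boxes form an intersection-stable generator of the Borel sets, so vanishing
  integrals spread from boxes to all Borel sets by a Dynkin argument.\<close>

lemma density_zero_boxes:
  fixes g :: "real^2 \<Rightarrow> real"
  assumes g: "integrable lborel g" and z: "\<And>x. x \<notin> cbox c d \<Longrightarrow> g x = 0"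
    and b: "\<And>a b. cbox a b \<subseteq> cbox c d \<Longrightarrow> (LINT x|lborel. indicator (box a b) x * g x) = 0"
  shows "AE x in lborel. g x = 0"
proof -
  have gbox: "(LINT x|lborel. indicator (box a b) x * g x) = 0" for a b
  proof (cases "box a b = {}")
    case False
    \<comment> \<open>An arbitrary box is intersected with the one that carries \<open>g\<close>, to
      meet the hypothesis \<open>b\<close>; the boundary of \<open>cbox c d\<close> is a null
      set.\<close>
    define a' where "a' = (\<chi> i. max (a $ i) (c $ i))"
    define b' where "b' = (\<chi> i. min (b $ i) (d $ i))"
    have i: "box a b \<inter> box c d = box a' b'" "cbox a' b' \<subseteq> cbox c d"
      by (auto simp: a'_def b'_def mem_box_cart)
    have "AE x in lborel. indicator (box a b) x * g x = indicator (box a' b') x * g x"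
    proof -
      have "cbox c d - box c d \<in> null_sets lborel"
        by (rule null_setsI) (auto simp: emeasure_Diff emeasure_lborel_box_eq emeasure_lborel_cbox_eq box_subset_cbox split: if_splits)
      then have "AE x in lborel. x \<notin> cbox c d - box c d" by (rule AE_not_in)
      then show ?thesis
        by eventually_elim (use z i in \<open>auto simp: indicator_def\<close>)
    qed
    then have "(LINT x|lborel. indicator (box a b) x * g x) = (LINT x|lborel. indicator (box a' b') x * g x)"
      using g by (intro integral_cong_AE) auto
    then show ?thesis using b[OF i(2)] by simp
  qed simp
  have "set_lebesgue_integral lborel A g = 0" if A: "A \<in> sets lborel" for A
  proof -
    let ?G = "range (\<lambda>(a, b). box a b :: (real^2) set)"
    have A': "A \<in> sigma_sets UNIV ?G" using A by (simp add: borel_eq_box)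
    have st: "Int_stable ?G"
    proof (rule Int_stableI)
      fix X Y assume "X \<in> ?G" "Y \<in> ?G"
      then obtain a b c d where "X = box a b" "Y = box c d" by auto
      then have "X \<inter> Y = box (\<chi> i. max (a $ i) (c $ i)) (\<chi> i. min (b $ i) (d $ i))"
        by (auto simp: mem_box_cart)
      then show "X \<inter> Y \<in> ?G" by auto
    qed
    have sub: "B \<in> sets lborel" if "B \<in> sigma_sets UNIV ?G" for B
      using that by (simp add: borel_eq_box)
    have total: "(LINT x|lborel. g x) = 0"
    proof -
      have "AE x in lborel. g x = indicator (box c d) x * g x"
      proof -
        have "cbox c d - box c d \<in> null_sets lborel"
          by (rule null_setsI) (auto simp: emeasure_Diff emeasure_lborel_box_eq emeasure_lborel_cbox_eq box_subset_cbox split: if_splits)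
        then have "AE x in lborel. x \<notin> cbox c d - box c d" by (rule AE_not_in)
        then show ?thesis by eventually_elim (use z in \<open>auto simp: indicator_def\<close>)
      qed
      then have "(LINT x|lborel. g x) = (LINT x|lborel. indicator (box c d) x * g x)"
        using g by (intro integral_cong_AE) auto
      then show ?thesis using gbox by simp
    qed
    have si: "set_integrable lborel B g" if "B \<in> sets lborel" for B
      unfolding set_integrable_def using g that by (intro integrable_mult_indicator)
    have "?G \<subseteq> Pow UNIV" by simp
    from st this A' show ?thesis
    proof (induction rule: sigma_sets_induct_disjoint)
      case (basic B)
      then show ?case using gbox by (auto simp: set_lebesgue_integral_def)
    next
      case empty
      then show ?case by (simp add: set_lebesgue_integral_def)
    next
      case (compl B)
      have "set_lebesgue_integral lborel (B \<union> (UNIV - B)) g = set_lebesgue_integral lborel B g + set_lebesgue_integral lborel (UNIV - B) g"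
        by (rule set_integral_Un) (use sub[OF compl(1)] in \<open>auto intro!: si\<close>)
      moreover have "B \<union> (UNIV - B) = UNIV" by auto
      ultimately show ?case using compl(2) total by (simp add: set_lebesgue_integral_def)
    next
      case (union B)
      have "set_lebesgue_integral lborel (\<Union>i. B i) g = (\<Sum>i. set_lebesgue_integral lborel (B i) g)"
      proof (rule lebesgue_integral_countable_add)
        show "B i \<in> sets lborel" for i using union(2) sub by auto
        then show "set_integrable lborel (\<Union>i. B i) g" by (intro si) auto
        show "B i \<inter> B j = {}" if "i \<noteq> j" for i j using union(1) that by (auto simp: disjoint_family_on_def)
      qed
      then show ?case using union(3) by simp
    qed
  qed
  then show ?thesis by (rule sigma_finite_measure.density_zero[OF sigma_finite_lborel g])
qed

text \<open>On a closed box inside \<open>D\<close> the bumps converge to indicators of smaller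
  boxes, so that \<open>density_zero_boxes\<close> applies; countably many closed boxes exhaust
  \<open>D\<close>.\<close>

lemma fundamental_lemma:
  assumes D: "open D" and g: "locally_integrable D g"
    and z: "\<And>\<phi>. test_function D \<phi> \<Longrightarrow> (LINT x:D|lebesgue. g x * \<phi> x) = 0"
  shows "AE x in lborel. x \<in> D \<longrightarrow> g x = 0"
proof -
  have cb: "AE x in lborel. x \<in> cbox c d \<longrightarrow> g x = 0" if cd: "cbox c d \<subseteq> D" for c d
  proof -
    define G where "G x = indicator (cbox c d) x * g x" for x
    have iG: "integrable lebesgue G"
      using g cd compact_cbox[of c d] unfolding locally_integrable_def set_integrable_def G_def[abs_def] by auto
    \<comment> \<open>Local integrability gives Lebesgue measurability only, while the box argument
      runs over Borel functions, so a Borel representative stands in.\<close>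
    obtain G' where G': "G' \<in> borel_measurable lborel" "AE x in lborel. G x = G' x"
      using completion_ex_borel_measurable_real[OF borel_measurable_integrable[OF iG]] by auto
    define H where "H x = indicator (cbox c d) x * G' x" for x
    have [measurable]: "H \<in> borel_measurable lborel" unfolding H_def[abs_def] using G'(1) by measurable
    have GH: "AE x in lborel. G x = H x"
      using G'(2) by eventually_elim (auto simp: G_def H_def indicator_def)
    have GHl: "AE x in lebesgue. G x = H x" using GH by (rule AE_completion)
    have Hm: "H \<in> borel_measurable lebesgue" by (rule measurable_completion) measurable
    have "integrable lebesgue H" using integrable_cong_AE_imp[OF iG Hm] GHl by (auto elim: eventually_mono)
    then have iH: "integrable lborel H" by (subst (asm) integrable_completion) auto
    have "AE x in lborel. H x = 0"
    proof (rule density_zero_boxes[OF iH])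
      show "H x = 0" if "x \<notin> cbox c d" for x using that by (simp add: H_def)
      fix a b assume ab: "cbox a b \<subseteq> cbox c d"
      let ?\<phi> = "\<lambda>n x. box_bump (real (Suc n)) a b x"
      have [measurable]: "box_bump m a b \<in> borel_measurable borel" for m
        using Ck_box_bump[of 0 m a b] by (intro borel_measurable_continuous_onI) simp
      have zero: "(LINT x|lborel. ?\<phi> n x * H x) = 0" for n
      proof -
        have "(LINT x|lborel. ?\<phi> n x * H x) = (LINT x|lebesgue. ?\<phi> n x * H x)"
          by (rule integral_completion[symmetric]) measurable
        also have "\<dots> = (LINT x|lebesgue. ?\<phi> n x * G x)"
        proof (rule integral_cong_AE)
          show "(\<lambda>x. ?\<phi> n x * H x) \<in> borel_measurable lebesgue" by (rule measurable_completion) measurable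
          have "?\<phi> n \<in> borel_measurable lebesgue" by (rule measurable_completion) measurable
          then show "(\<lambda>x. ?\<phi> n x * G x) \<in> borel_measurable lebesgue" using iG by (intro borel_measurable_times) auto
          show "AE x in lebesgue. ?\<phi> n x * H x = ?\<phi> n x * G x" using GHl by eventually_elim simp
        qed
        also have "\<dots> = (LINT x:D|lebesgue. g x * ?\<phi> n x)"
          unfolding set_lebesgue_integral_def
        proof (intro Bochner_Integration.integral_cong refl)
          fix x
          have "?\<phi> n x = 0" if "x \<notin> cbox c d"
            using that ab box_subset_cbox[of a b] by (intro box_bump_eq_0) auto
          then show "?\<phi> n x * G x = indicator D x *\<^sub>R (g x * ?\<phi> n x)"
            using cd by (auto simp: G_def indicator_def)
        qed
        also have "\<dots> = 0"
          using test_function_box_bump[of a b D "real (Suc n)"] ab cd by (intro z) auto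
        finally show ?thesis .
      qed
      have "(\<lambda>n. LINT x|lborel. ?\<phi> n x * H x) \<longlonglongrightarrow> (LINT x|lborel. indicator (box a b) x * H x)"
      proof (rule integral_dominated_convergence[where w="\<lambda>x. \<bar>H x\<bar>"])
        show "AE x in lborel. (\<lambda>n. ?\<phi> n x * H x) \<longlonglongrightarrow> indicator (box a b) x * H x"
          by (intro AE_I2 tendsto_mult_right box_bump_tendsto)
        show "AE x in lborel. norm (?\<phi> n x * H x) \<le> \<bar>H x\<bar>" for n
        proof (rule AE_I2)
          fix x
          have "norm (?\<phi> n x * H x) = ?\<phi> n x * \<bar>H x\<bar>"
            using box_bump_bounds(1)[of "real (Suc n)" a b x] by (simp add: abs_mult)
          also have "\<dots> \<le> 1 * \<bar>H x\<bar>" by (rule mult_right_mono[OF box_bump_bounds(2)]) simp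
          finally show "norm (?\<phi> n x * H x) \<le> \<bar>H x\<bar>" by simp
        qed
      qed (use iH in auto)
      then show "(LINT x|lborel. indicator (box a b) x * H x) = 0"
        unfolding zero by (simp add: LIMSEQ_const_iff)
    qed
    then show ?thesis using GH by eventually_elim (auto simp: G_def)
  qed
  obtain \<D> where \<D>: "countable \<D>" "\<D> \<subseteq> Pow D" "\<And>X. X \<in> \<D> \<Longrightarrow> \<exists>a b. X = cbox a b" "\<Union>\<D> = D"
    using open_countable_Union_open_cbox[OF D] by blast
  have "AE x in lborel. \<forall>X\<in>\<D>. x \<in> X \<longrightarrow> g x = 0"
    unfolding AE_ball_countable[OF \<D>(1)]
  proof
    fix X assume X: "X \<in> \<D>"
    then obtain a b where "X = cbox a b" using \<D>(3) by blast
    then show "AE x in lborel. x \<in> X \<longrightarrow> g x = 0" using cb[of a b] \<D>(2) X by auto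
  qed
  then show ?thesis by eventually_elim (use \<D>(4) in blast)
qed

section \<open>Test functions in Sobolev spaces\<close>

lemma pd_outside_support:
  assumes K: "compact K" "\<And>x. x \<notin> K \<Longrightarrow> \<phi> x = (0::real)" and x: "x \<notin> K"
  shows "pd k \<phi> x = 0"
proof -
  have "((\<lambda>x. 0) has_derivative (\<lambda>h. 0)) (at x)" by simp
  then have "(\<phi> has_derivative (\<lambda>h. 0)) (at x)"
    by (rule has_derivative_transform_within_open[OF _ open_Compl[OF compact_imp_closed[OF K(1)]]])
      (use K x in auto)
  then show ?thesis using pd_eq by force
qed

lemma test_function_pd:
  assumes "test_function D \<phi>"
  shows "test_function D (pd k \<phi>)"
proof -
  obtain K where K: "compact K" "K \<subseteq> D" "\<And>x. x \<notin> K \<Longrightarrow> \<phi> x = 0" and C: "\<And>n. Ck n \<phi>"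
    using assms by (auto simp: test_function_def)
  have "Ck n (pd k \<phi>)" for n using C[of "Suc n"] by (simp add: Ck_Suc)
  then show ?thesis using K pd_outside_support[OF K(1,3)] by (auto simp: test_function_def)
qed

lemma test_function_continuous: "test_function D \<phi> \<Longrightarrow> continuous_on UNIV \<phi>"
  by (auto simp: test_function_def dest: spec[of _ 0])

lemma test_function_measurable: "test_function D \<phi> \<Longrightarrow> \<phi> \<in> borel_measurable borel"
  by (rule borel_measurable_continuous_onI) (rule test_function_continuous)

lemma test_function_bound:
  assumes "test_function D \<phi>"
  obtains C R where "C \<ge> 0" "R > 0" "\<And>x. \<bar>\<phi> x\<bar> \<le> C" "\<And>x. norm x > R \<Longrightarrow> \<phi> x = 0"
proof -
  obtain K where K: "compact K" "\<And>x. x \<notin> K \<Longrightarrow> \<phi> x = 0" using assms by (auto simp: test_function_def)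
  obtain R where R: "R > 0" "\<And>x. x \<in> K \<Longrightarrow> norm x \<le> R"
    using compact_imp_bounded[OF K(1)] by (auto simp: bounded_pos)
  have "compact (\<phi> ` K)"
    by (intro compact_continuous_image K continuous_on_subset[OF test_function_continuous[OF assms]]) auto
  then obtain C where C: "C > 0" "\<And>y. y \<in> \<phi> ` K \<Longrightarrow> norm y \<le> C"
    using compact_imp_bounded bounded_pos by metis
  have "\<bar>\<phi> x\<bar> \<le> C" for x using C K(2)[of x] by (cases "x \<in> K") auto
  moreover have "\<phi> x = 0" if "norm x > R" for x using R(2)[of x] K(2)[of x] that by force
  ultimately show thesis using that[of C R] C R by auto
qed

lemma square_integrable_indicator_cball: "square_integrable (\<lambda>x. c * indicator (cball (0::real^2) R) x :: real)"
  and integrable_indicator_cball: "integrable lborel (\<lambda>x. c * indicator (cball (0::real^2) R) x :: real)"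
proof -
  have "emeasure lborel (cball (0::real^2) R) < \<infinity>" by (rule emeasure_bounded_finite) simp
  then have i: "integrable lborel (\<lambda>x. indicator (cball (0::real^2) R) x :: real)"
    by (simp add: integrable_indicator_iff)
  then show "integrable lborel (\<lambda>x. c * indicator (cball (0::real^2) R) x :: real)" by simp
  have "(\<lambda>x. (norm (c * indicator (cball (0::real^2) R) x))\<^sup>2) = (\<lambda>x. c\<^sup>2 * indicator (cball 0 R) x)"
    by (auto simp: indicator_def)
  then show "square_integrable (\<lambda>x. c * indicator (cball (0::real^2) R) x :: real)"
    using i by (simp add: square_integrable_def)
qed

lemma test_function_integrable:
  assumes "test_function D \<phi>"
  shows "integrable lborel \<phi>" "square_integrable \<phi>"
proof -
  obtain C R where CR: "C \<ge> 0" "\<And>x. \<bar>\<phi> x\<bar> \<le> C" "\<And>x. norm x > R \<Longrightarrow> \<phi> x = 0"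
    using test_function_bound[OF assms] by metis
  note [measurable] = test_function_measurable[OF assms]
  have le: "norm (\<phi> x) \<le> norm (C * indicator (cball 0 R) x :: real)" for x
    by (cases "norm x > R") (use CR(1) CR(2)[of x] CR(3)[of x] in \<open>auto simp: indicator_def\<close>)
  show "integrable lborel \<phi>"
    by (rule Bochner_Integration.integrable_bound[OF integrable_indicator_cball[where c=C and R=R]]) (use le in auto)
  show "square_integrable \<phi>"
    by (rule square_integrable_bound(1)[OF square_integrable_indicator_cball[where c=C and R=R]]) (use le in auto)
qed

lemma test_function_line_deriv:
  assumes "test_function D \<phi>"
  shows "((\<lambda>t. \<phi> (x + axis k t)) has_real_derivative pd k \<phi> (x + axis k t)) (at t)"
proof -
  have ax: "x + axis k t = x + t *\<^sub>R axis k 1" for t :: real by (simp add: vec_eq_iff axis_def)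
  have "Ck (Suc 0) \<phi>" using assms unfolding test_function_def by blast
  then have "(\<phi> has_derivative frechet_derivative \<phi> (at (x + t *\<^sub>R axis k 1))) (at (x + t *\<^sub>R axis k 1))"
    by (rule has_derivative_frechet)
  then have d: "(\<phi> has_derivative frechet_derivative \<phi> (at (x + t *\<^sub>R axis k 1))) (at (x + t *\<^sub>R axis k 1))" .
  have "((\<lambda>t. x + t *\<^sub>R axis k 1) has_derivative (\<lambda>h. h *\<^sub>R axis k 1)) (at t)"
    by (auto intro!: derivative_eq_intros)
  from has_derivative_compose[OF this d]
  have "((\<lambda>t. \<phi> (x + t *\<^sub>R axis k 1)) has_derivative (\<lambda>h. frechet_derivative \<phi> (at (x + t *\<^sub>R axis k 1)) (h *\<^sub>R axis k 1))) (at t)" .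
  moreover have "frechet_derivative \<phi> (at (x + t *\<^sub>R axis k 1)) (h *\<^sub>R axis k 1) = pd k \<phi> (x + t *\<^sub>R axis k 1) * h" for h
    using linear_scale[OF has_derivative_linear[OF d]] by (simp add: pd_def)
  ultimately show ?thesis unfolding ax has_field_derivative_def by simp
qed

text \<open>The mean value theorem bounds the quotients by the sup of the derivative, and steps of
  length at most 1 keep their supports in one ball; dominated convergence does the rest.\<close>

lemma test_function_quotient:
  assumes \<phi>: "test_function D \<phi>" and h: "h \<longlonglongrightarrow> 0" "\<And>n. h n \<noteq> 0" "\<And>n. \<bar>h n\<bar> \<le> 1"
  shows "(\<lambda>n. l2norm (\<lambda>x. (\<phi> (x + axis k (h n)) - \<phi> x) / h n - pd k \<phi> x)) \<longlonglongrightarrow> 0"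
    and "(\<lambda>n. LINT x|lborel. \<bar>(\<phi> (x + axis k (h n)) - \<phi> x) / h n - pd k \<phi> x\<bar>) \<longlonglongrightarrow> 0"
proof -
  let ?q = "\<lambda>n x. (\<phi> (x + axis k (h n)) - \<phi> x) / h n"
  note [measurable] = test_function_measurable[OF \<phi>] test_function_measurable[OF test_function_pd[OF \<phi>]]
  obtain C R where C: "C \<ge> 0" "\<And>x. \<bar>pd k \<phi> x\<bar> \<le> C" "\<And>x. norm x > R \<Longrightarrow> pd k \<phi> x = 0"
    using test_function_bound[OF test_function_pd[OF \<phi>, of k]] by metis
  obtain R' where R': "\<And>x. norm x > R' \<Longrightarrow> \<phi> x = 0"
    using test_function_bound[OF \<phi>] by metis
  define r where "r = max R R' + 1"
  let ?g = "\<lambda>x. C * indicator (cball (0::real^2) r) x :: real"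
  have ax: "axis k (0::real) = 0" by (simp add: vec_eq_iff axis_def)
  have nax: "norm (axis k (t::real)) = \<bar>t\<bar>" for t
  proof -
    have "axis k t = t *\<^sub>R axis k 1" by (simp add: vec_eq_iff axis_def)
    then show ?thesis by (simp add: norm_axis_1)
  qed
  have qle: "norm (?q n x) \<le> norm (?g x)" for n x
  proof (cases "norm x > r")
    case True
    have "norm x \<le> norm (x + axis k (h n)) + norm (axis k (h n))"
      using norm_triangle_ineq4[of "x + axis k (h n)" "axis k (h n)"] by simp
    then have "norm (x + axis k (h n)) > R'" using True h(3)[of n] by (simp add: r_def nax)
    then show ?thesis using R' True by (simp add: r_def)
  next
    case False
    have "norm (\<phi> (x + axis k (h n)) - \<phi> (x + axis k 0)) \<le> C * norm (h n - 0)"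
      by (rule field_differentiable_bound[of UNIV _ "\<lambda>t. pd k \<phi> (x + axis k t)"])
        (use test_function_line_deriv[OF \<phi>] C in auto)
    then have "norm (?q n x) \<le> C" using h(2)[of n] by (simp add: ax abs_divide pos_divide_le_eq)
    then show ?thesis using False C(1) by simp
  qed
  have lim: "(\<lambda>n. ?q n x) \<longlonglongrightarrow> pd k \<phi> x" for x
  proof -
    have "((\<lambda>t. (\<phi> (x + axis k (0 + t)) - \<phi> (x + axis k 0)) / t) \<longlongrightarrow> pd k \<phi> (x + axis k 0)) (at 0)"
      using test_function_line_deriv[OF \<phi>, of x k 0] unfolding DERIV_def .
    moreover have "filterlim h (at 0) sequentially"
      using h(1,2) by (auto simp: filterlim_at)
    ultimately have "(\<lambda>n. (\<phi> (x + axis k (0 + h n)) - \<phi> (x + axis k 0)) / h n) \<longlonglongrightarrow> pd k \<phi> (x + axis k 0)"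
      by (rule filterlim_compose)
    then show ?thesis by (simp add: ax)
  qed
  have pdle: "norm (pd k \<phi> x) \<le> norm (?g x)" for x
    by (cases "norm x > r") (use C(1) C(2)[of x] C(3)[of x] in \<open>auto simp: r_def\<close>)
  show "(\<lambda>n. l2norm (\<lambda>x. ?q n x - pd k \<phi> x)) \<longlonglongrightarrow> 0"
    by (rule l2_dominated_convergence(2)[OF _ _ square_integrable_indicator_cball[where c=C and R=r]])
      (use qle lim in auto)
  have "(\<lambda>n. LINT x|lborel. \<bar>?q n x - pd k \<phi> x\<bar>) \<longlonglongrightarrow> (LINT x|(lborel :: (real^2) measure). 0)"
  proof (rule integral_dominated_convergence[where w="\<lambda>x. 2 * ?g x"])
    show "integrable lborel (\<lambda>x. 2 * ?g x)" using integrable_indicator_cball[where c=C and R=r] by simp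
    show "AE x in lborel. (\<lambda>n. \<bar>?q n x - pd k \<phi> x\<bar>) \<longlonglongrightarrow> 0"
      using tendsto_rabs_zero[OF LIM_zero[OF lim]] by auto
    show "AE x in lborel. norm \<bar>?q n x - pd k \<phi> x\<bar> \<le> 2 * ?g x" for n
    proof (rule AE_I2)
      fix x
      have "?g x \<ge> 0" using C(1) by simp
      then show "norm \<bar>?q n x - pd k \<phi> x\<bar> \<le> 2 * ?g x"
        using qle[of x n] pdle[of x] by (auto simp: abs_if split: if_splits)
    qed
  qed measurable
  then show "(\<lambda>n. LINT x|lborel. \<bar>?q n x - pd k \<phi> x\<bar>) \<longlonglongrightarrow> 0" by simp
qed

lemma fourier_integral_pd:
  assumes \<phi>: "test_function D \<phi>"
  shows "fourier_integral (pd k \<phi>) \<xi> = \<i> * of_real (\<xi> $ k) * fourier_integral \<phi> \<xi>"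
proof (rule fourier_integral_deriv)
  have "(\<lambda>n. LINT x|lborel. \<bar>(\<phi> (x + axis k (1 / real (Suc n))) - \<phi> x) / (1 / real (Suc n)) - pd k \<phi> x\<bar>) \<longlonglongrightarrow> 0"
    by (rule test_function_quotient(2)[OF \<phi>]) (rule LIMSEQ_Suc[OF lim_1_over_n], auto)
  then show "(\<lambda>n. LINT x|lborel. \<bar>diff_quot k n \<phi> x - pd k \<phi> x\<bar>) \<longlonglongrightarrow> 0"
    by (simp add: diff_quot_def mult.commute del: of_nat_Suc)
qed (use test_function_integrable[OF \<phi>] test_function_integrable[OF test_function_pd[OF \<phi>]] in auto)

lemma sw_1_le: "sw 1 \<xi> \<le> 1 + \<bar>\<xi> $ 1\<bar> + \<bar>\<xi> $ 2\<bar>"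
proof -
  have "sw 1 \<xi> = sqrt (1 + (norm \<xi>)\<^sup>2)" by (simp add: sw_def powr_half_sqrt)
  also have "\<dots> \<le> 1 + norm \<xi>"
    by (rule real_le_lsqrt) (auto simp: power2_sum)
  also have "norm \<xi> \<le> \<bar>\<xi> $ 1\<bar> + \<bar>\<xi> $ 2\<bar>"
    using norm_le_l1_cart[of \<xi>] by (simp add: sum_2)
  finally show ?thesis by simp
qed

text \<open>\<open>sw 1\<close> is at most 1 + |xi_1| + |xi_2|, and multiplication by xi_k is a
  derivative of the test function up to a factor of modulus 1, so each order costs one
  derivative.\<close>

lemma test_function_sobolev_nat:
  "test_function D \<phi> \<Longrightarrow> square_integrable (\<lambda>\<xi>. complex_of_real (sw (real m) \<xi>) * fourier_integral \<phi> \<xi>)"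
proof (induction m arbitrary: \<phi>)
  case 0
  have "(\<lambda>\<xi>. complex_of_real (sw (real 0) \<xi>) * fourier_integral \<phi> \<xi>) = fourier_integral \<phi>"
    by (simp add: sw_def)
  then show ?case using bessel_real(1)[OF test_function_integrable[OF 0]] by simp
next
  case (Suc m)
  note \<phi> = Suc.prems
  have [measurable]: "fourier_integral \<phi> \<in> borel_measurable lborel"
    using bessel_real(1)[OF test_function_integrable[OF \<phi>]] by (rule square_integrable_measurable)
  let ?w = "\<lambda>\<xi>. norm (complex_of_real (sw (real m) \<xi>) * fourier_integral \<phi> \<xi>)"
  let ?v = "\<lambda>k \<xi>. norm (complex_of_real (sw (real m) \<xi>) * fourier_integral (pd k \<phi>) \<xi>)"
  have sq: "square_integrable (\<lambda>\<xi>. ?w \<xi> + ?v 1 \<xi> + ?v 2 \<xi>)"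
    by (intro square_integrable_add square_integrable_norm Suc.IH \<phi> test_function_pd[OF \<phi>])
  show ?case
  proof (rule square_integrable_bound(1)[OF sq])
    show "AE \<xi> in lborel. norm (complex_of_real (sw (real (Suc m)) \<xi>) * fourier_integral \<phi> \<xi>) \<le> norm (?w \<xi> + ?v 1 \<xi> + ?v 2 \<xi>)"
    proof (rule AE_I2)
      fix \<xi>
      have "norm (complex_of_real (sw (real (Suc m)) \<xi>) * fourier_integral \<phi> \<xi>) = sw 1 \<xi> * ?w \<xi>"
        using sw_add[of 1 \<xi> "real m"] by (simp add: norm_mult mult.assoc[symmetric])
      also have "\<dots> \<le> (1 + \<bar>\<xi> $ 1\<bar> + \<bar>\<xi> $ 2\<bar>) * ?w \<xi>" by (rule mult_right_mono[OF sw_1_le]) simp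
      also have "\<dots> = ?w \<xi> + ?v 1 \<xi> + ?v 2 \<xi>"
        by (simp add: fourier_integral_pd[OF \<phi>] norm_mult algebra_simps)
      finally show "norm (complex_of_real (sw (real (Suc m)) \<xi>) * fourier_integral \<phi> \<xi>) \<le> norm (?w \<xi> + ?v 1 \<xi> + ?v 2 \<xi>)"
        by simp
    qed
  qed measurable
qed

lemma test_function_sobolev:
  assumes "test_function D \<phi>"
  shows "\<phi> \<in> sobolev_plane r"
proof -
  obtain m where m: "r \<le> real m" using real_arch_simple by blast
  have "sob_pair (real m) \<phi> (fourier_integral \<phi>)"
    unfolding sob_pair_def using has_ft_L1[OF test_function_integrable[OF assms]] test_function_sobolev_nat[OF assms] by blast
  from sob_pair_mono(1)[OF m this] show ?thesis by (auto simp: sobolev_plane_iff)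
qed

text \<open>Needed to see that constants belong to H^s(D). In each coordinate the plateau is A / (A
  + B), with \<open>A\<close> positive for |t| < R + 1 and \<open>B\<close> positive for |t| > R, so
  the denominator never vanishes.\<close>

lemma plateau_test_function:
  assumes "bounded D"
  obtains plat where "test_function UNIV plat" "\<And>x. x \<in> D \<Longrightarrow> plat x = 1"
proof -
  obtain R where R: "\<And>x. x \<in> D \<Longrightarrow> norm x \<le> R" using assms by (auto simp: bounded_iff)
  define A where "A i x = flat_fun ((-1) * x $ i + (R + 1)) * flat_fun (1 * x $ i + (R + 1))" for i and x :: "real^2"
  define B where "B i x = flat_fun (1 * x $ i + (- R)) + flat_fun ((-1) * x $ i + (- R))" for i and x :: "real^2"
  have A_pos: "A i x > 0 \<longleftrightarrow> \<bar>x $ i\<bar> < R + 1" for i and x :: "real^2"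
    unfolding A_def zero_less_mult_iff flat_pos_iff using flat_nonneg not_le by (auto simp: abs_if)
  have A_nonneg: "A i x \<ge> 0" for i x by (simp add: A_def flat_nonneg)
  have B_nonneg: "B i x \<ge> 0" for i x by (simp add: B_def flat_nonneg)
  have B_pos: "B i x > 0" if "\<bar>x $ i\<bar> > R" for i and x :: "real^2"
  proof -
    have "flat_fun (1 * x $ i + (- R)) > 0 \<or> flat_fun ((-1) * x $ i + (- R)) > 0"
      using that unfolding flat_pos_iff by (auto simp: abs_if split: if_splits)
    then show ?thesis unfolding B_def by (auto intro: add_pos_nonneg add_nonneg_pos flat_nonneg)
  qed
  have pos: "A i x + B i x \<noteq> 0" for i x
  proof -
    have "A i x > 0 \<or> B i x > 0" using A_pos[of i x] B_pos[where i=i and x=x] by force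
    then show ?thesis using A_nonneg[of i x] B_nonneg[of i x] by linarith
  qed
  define plat where "plat x = (\<Prod>i\<in>UNIV. A i x * inverse (A i x + B i x))" for x
  have "Ck n plat" for n
    unfolding plat_def[abs_def]
    by (intro Ck_prod Ck_mult Ck_inverse Ck_add pos) (unfold A_def B_def, (intro Ck_mult Ck_add Ck_flat)+)
  moreover have "plat x = 0" if "x \<notin> cbox (\<chi> i. - (R + 1)) (\<chi> i. R + 1)" for x :: "real^2"
  proof -
    have "\<exists>i. \<not> \<bar>x $ i\<bar> < R + 1"
    proof (rule ccontr)
      assume "\<not> ?thesis"
      then have "\<bar>x $ i\<bar> < R + 1" for i by blast
      then have "- (R + 1) \<le> x $ i \<and> x $ i \<le> R + 1" for i using abs_less_iff[of "x $ i" "R + 1"] by force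
      then show False using that by (auto simp: mem_box_cart)
    qed
    then obtain i where "\<not> \<bar>x $ i\<bar> < R + 1" by blast
    then have "A i x = 0" using A_pos[of i x] A_nonneg[of i x] by linarith
    then show ?thesis unfolding plat_def by (intro prod_zero) auto
  qed
  ultimately have "test_function UNIV plat"
    unfolding test_function_def by (auto intro!: exI[of _ "cbox (\<chi> i. - (R + 1)) (\<chi> i. R + 1) :: (real^2) set"])
  moreover have "plat x = 1" if "x \<in> D" for x
  proof -
    have "A i x * inverse (A i x + B i x) = 1" for i
    proof -
      have le: "\<bar>x $ i\<bar> \<le> R" using R[OF that] component_le_norm_cart[of x i] by linarith
      then have "B i x = 0" unfolding B_def by (auto simp: flat_eq_0 abs_le_iff)
      moreover have "A i x > 0" using A_pos le by auto
      ultimately show ?thesis by simp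
    qed
    then show ?thesis by (simp add: plat_def)
  qed
  ultimately show thesis by (rule that)
qed

section \<open>Sobolev spaces on a domain\<close>

abbreviation AE_on :: "(real^2) set \<Rightarrow> (real^2 \<Rightarrow> bool) \<Rightarrow> bool" where
  "AE_on D P \<equiv> AE x in lborel. x \<in> D \<longrightarrow> P x"

lemma AE_on_all_nat:
  assumes "\<And>n::nat. AE_on D (P n)"
  shows "AE_on D (\<lambda>x. \<forall>n. P n x)"
proof -
  have "AE x in lborel. \<forall>n. x \<in> D \<longrightarrow> P n x" unfolding AE_all_countable using assms by blast
  then show ?thesis by eventually_elim blast
qed

lemma sobolev_extensions_cong:
  assumes "AE_on D (\<lambda>x. f x = g x)"
  shows "sobolev_extensions r D f = sobolev_extensions r D g"
proof -
  have "(AE_on D (\<lambda>x. F x = f x)) \<longleftrightarrow> (AE_on D (\<lambda>x. F x = g x))" for F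
    using assms by (auto elim!: eventually_elim2)
  then show ?thesis by (simp add: sobolev_extensions_def)
qed

lemma sobolev_cong:
  assumes "AE_on D (\<lambda>x. f x = g x)"
  shows "f \<in> sobolev r D \<longleftrightarrow> g \<in> sobolev r D" "sobolev_norm r D f = sobolev_norm r D g"
  using sobolev_extensions_cong[OF assms] by (simp_all add: sobolev_def sobolev_norm_def)

lemma sobolev_extension_le:
  "F \<in> sobolev_extensions r D f \<Longrightarrow> sobolev_norm r D f \<le> sobolev_plane_norm r F"
  unfolding sobolev_norm_def
  by (rule cInf_lower) (auto intro!: bdd_belowI[of _ 0] sobolev_plane_norm_nonneg)

lemma sobolev_norm_nonneg: "f \<in> sobolev r D \<Longrightarrow> 0 \<le> sobolev_norm r D f"
  unfolding sobolev_norm_def sobolev_def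
  by (rule cInf_greatest) (auto intro!: sobolev_plane_norm_nonneg)

text \<open>The quotient norm is an infimum that need not be attained, so the estimates on
  \<open>D\<close> are proved for nearly optimal extensions and an arbitrarily small error.\<close>

lemma sobolev_extension_approx:
  assumes "f \<in> sobolev r D" "e > 0"
  obtains F where "F \<in> sobolev_extensions r D f" "sobolev_plane_norm r F < sobolev_norm r D f + e"
proof -
  have "sobolev_plane_norm r ` sobolev_extensions r D f \<noteq> {}" using assms(1) by (simp add: sobolev_def)
  moreover have "Inf (sobolev_plane_norm r ` sobolev_extensions r D f) < sobolev_norm r D f + e"
    using assms(2) by (simp add: sobolev_norm_def)
  ultimately have "\<exists>y\<in>sobolev_plane_norm r ` sobolev_extensions r D f. y < sobolev_norm r D f + e"
    by (rule cInf_lessD)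
  then show thesis using that by blast
qed

lemma sobolev_extensionI:
  "F \<in> sobolev_plane r \<Longrightarrow> AE_on D (\<lambda>x. F x = f x) \<Longrightarrow> F \<in> sobolev_extensions r D f"
  by (simp add: sobolev_extensions_def)

lemma sobolev_extensionD:
  assumes "F \<in> sobolev_extensions r D f"
  shows "F \<in> sobolev_plane r" "AE_on D (\<lambda>x. F x = f x)" "f \<in> sobolev r D"
  using assms by (auto simp: sobolev_extensions_def sobolev_def)

lemma sobolev_add:
  assumes f: "f \<in> sobolev r D" and g: "g \<in> sobolev r D"
  shows "(\<lambda>x. f x + g x) \<in> sobolev r D"
    and "sobolev_norm r D (\<lambda>x. f x + g x) \<le> sobolev_norm r D f + sobolev_norm r D g"
proof -
  have ext: "(\<lambda>x. F x + G x) \<in> sobolev_extensions r D (\<lambda>x. f x + g x)"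
    if "F \<in> sobolev_extensions r D f" "G \<in> sobolev_extensions r D g" for F G
    using sobolev_extensionD[OF that(1)] sobolev_extensionD[OF that(2)]
    by (intro sobolev_extensionI sobolev_plane_add) (auto elim: eventually_elim2)
  show "(\<lambda>x. f x + g x) \<in> sobolev r D"
    using f g ext sobolev_extensionD(3) by (auto simp: sobolev_def)
  show "sobolev_norm r D (\<lambda>x. f x + g x) \<le> sobolev_norm r D f + sobolev_norm r D g"
  proof (rule field_le_epsilon)
    fix e :: real assume "e > 0"
    then have e2: "e / 2 > 0" by simp
    obtain F where F: "F \<in> sobolev_extensions r D f" "sobolev_plane_norm r F < sobolev_norm r D f + e / 2"
      by (rule sobolev_extension_approx[OF f e2])
    obtain G where G: "G \<in> sobolev_extensions r D g" "sobolev_plane_norm r G < sobolev_norm r D g + e / 2"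
      by (rule sobolev_extension_approx[OF g e2])
    have "sobolev_norm r D (\<lambda>x. f x + g x) \<le> sobolev_plane_norm r (\<lambda>x. F x + G x)"
      by (rule sobolev_extension_le[OF ext[OF F(1) G(1)]])
    also have "\<dots> \<le> sobolev_plane_norm r F + sobolev_plane_norm r G"
      by (intro sobolev_plane_add sobolev_extensionD[OF F(1)] sobolev_extensionD[OF G(1)])
    finally show "sobolev_norm r D (\<lambda>x. f x + g x) \<le> sobolev_norm r D f + sobolev_norm r D g + e"
      using F(2) G(2) by simp
  qed
qed

lemma sobolev_cmult:
  assumes f: "f \<in> sobolev r D"
  shows "(\<lambda>x. c * f x) \<in> sobolev r D"
    and "sobolev_norm r D (\<lambda>x. c * f x) \<le> \<bar>c\<bar> * sobolev_norm r D f"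
proof -
  have ext: "(\<lambda>x. c * F x) \<in> sobolev_extensions r D (\<lambda>x. c * f x)"
    if "F \<in> sobolev_extensions r D f" for F
    using sobolev_extensionD[OF that]
    by (intro sobolev_extensionI sobolev_plane_cmult) (auto elim: eventually_mono)
  show "(\<lambda>x. c * f x) \<in> sobolev r D"
    using f ext sobolev_extensionD(3) by (auto simp: sobolev_def)
  show "sobolev_norm r D (\<lambda>x. c * f x) \<le> \<bar>c\<bar> * sobolev_norm r D f"
  proof (rule field_le_epsilon)
    fix e :: real assume e: "e > 0"
    then have e2: "e / (\<bar>c\<bar> + 1) > 0" by (simp add: add_nonneg_pos)
    obtain F where F: "F \<in> sobolev_extensions r D f" "sobolev_plane_norm r F < sobolev_norm r D f + e / (\<bar>c\<bar> + 1)"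
      by (rule sobolev_extension_approx[OF f e2])
    have "sobolev_norm r D (\<lambda>x. c * f x) \<le> sobolev_plane_norm r (\<lambda>x. c * F x)"
      by (rule sobolev_extension_le[OF ext[OF F(1)]])
    also have "\<dots> = \<bar>c\<bar> * sobolev_plane_norm r F"
      by (intro sobolev_plane_cmult sobolev_extensionD[OF F(1)])
    also have "\<dots> \<le> \<bar>c\<bar> * (sobolev_norm r D f + e / (\<bar>c\<bar> + 1))"
      using F(2) by (intro mult_left_mono) auto
    also have "\<bar>c\<bar> * (e / (\<bar>c\<bar> + 1)) \<le> e" using e by (simp add: pos_divide_le_eq add_nonneg_pos distrib_left mult.commute)
    then have "\<bar>c\<bar> * (sobolev_norm r D f + e / (\<bar>c\<bar> + 1)) \<le> \<bar>c\<bar> * sobolev_norm r D f + e" by (simp add: distrib_left)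
    finally show "sobolev_norm r D (\<lambda>x. c * f x) \<le> \<bar>c\<bar> * sobolev_norm r D f + e" .
  qed
qed

lemma sobolev_diff:
  assumes f: "f \<in> sobolev r D" and g: "g \<in> sobolev r D"
  shows "(\<lambda>x. f x - g x) \<in> sobolev r D"
    and "sobolev_norm r D (\<lambda>x. f x - g x) \<le> sobolev_norm r D f + sobolev_norm r D g"
  using sobolev_add[OF f sobolev_cmult(1)[OF g, of "-1"]] sobolev_cmult(2)[OF g, of "-1"] by simp_all

lemma sobolev_mono:
  assumes f: "f \<in> sobolev s D" and rs: "r \<le> s"
  shows "f \<in> sobolev r D" "sobolev_norm r D f \<le> sobolev_norm s D f"
proof -
  have ext: "F \<in> sobolev_extensions r D f \<and> sobolev_plane_norm r F \<le> sobolev_plane_norm s F"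
    if F: "F \<in> sobolev_extensions s D f" for F
  proof -
    obtain h where h: "sob_pair s F h" using sobolev_extensionD(1)[OF F] by (auto simp: sobolev_plane_iff)
    show ?thesis using sob_pair_mono[OF rs h] sobolev_extensionD(2)[OF F]
      by (auto simp: sobolev_plane_iff intro!: sobolev_extensionI)
  qed
  show "f \<in> sobolev r D" using f ext sobolev_extensionD(3) by (auto simp: sobolev_def)
  show "sobolev_norm r D f \<le> sobolev_norm s D f"
  proof (rule field_le_epsilon)
    fix e :: real assume e: "e > 0"
    obtain F where F: "F \<in> sobolev_extensions s D f" "sobolev_plane_norm s F < sobolev_norm s D f + e"
      by (rule sobolev_extension_approx[OF f e])
    show "sobolev_norm r D f \<le> sobolev_norm s D f + e"
      using sobolev_extension_le[of F r D f] ext[OF F(1)] F(2) by linarith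
  qed
qed

text \<open>The exponent \<open>s\<close> in place of \<open>r\<close> makes one constant serve all
  orders up to \<open>s\<close>, and the summand 1 makes it positive.\<close>

definition mult_const :: "real \<Rightarrow> real" where
  "mult_const s = 2 * 2 powr s * sob_const s + 1"

lemma mult_const_ge_1: "mult_const s \<ge> 1"
  by (simp add: mult_const_def sob_const_nonneg)

lemma sobolev_mult:
  assumes f: "f \<in> sobolev r D" and g: "g \<in> sobolev s D" and r: "0 \<le> r" "r \<le> s" and s: "s > 1"
  shows "(\<lambda>x. f x * g x) \<in> sobolev r D"
    and "sobolev_norm r D (\<lambda>x. f x * g x) \<le> mult_const s * sobolev_norm r D f * sobolev_norm s D g"
proof -
  have ext: "(\<lambda>x. F x * G x) \<in> sobolev_extensions r D (\<lambda>x. f x * g x) \<and>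
      sobolev_plane_norm r (\<lambda>x. F x * G x) \<le> mult_const s * sobolev_plane_norm r F * sobolev_plane_norm s G"
    if FG: "F \<in> sobolev_extensions r D f" "G \<in> sobolev_extensions s D g" for F G
  proof -
    obtain h k where hk: "sob_pair r F h" "sob_pair s G k"
      using sobolev_extensionD(1)[OF FG(1)] sobolev_extensionD(1)[OF FG(2)] by (auto simp: sobolev_plane_iff)
    have "2 * 2 powr r * sob_const s * sobolev_plane_norm r F * sobolev_plane_norm s G
        \<le> mult_const s * sobolev_plane_norm r F * sobolev_plane_norm s G"
    proof (intro mult_right_mono sobolev_plane_norm_nonneg)
      have "2 * 2 powr r * sob_const s \<le> 2 * 2 powr s * sob_const s"
        using r by (intro mult_right_mono mult_left_mono powr_mono sob_const_nonneg) auto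
      then show "2 * 2 powr r * sob_const s \<le> mult_const s" by (simp add: mult_const_def)
    qed
    then show ?thesis
      using sob_pair_mult[OF hk r s] sobolev_extensionD(2)[OF FG(1)] sobolev_extensionD(2)[OF FG(2)]
      by (auto intro!: sobolev_extensionI elim: eventually_elim2 simp: sobolev_plane_iff)
  qed
  show "(\<lambda>x. f x * g x) \<in> sobolev r D"
    using f g ext sobolev_extensionD(3) by (auto simp: sobolev_def)
  show "sobolev_norm r D (\<lambda>x. f x * g x) \<le> mult_const s * sobolev_norm r D f * sobolev_norm s D g"
  \<comment> \<open>The error enters both factors of a product, so the bound is taken to the limit
    along 1 / (n + 1) instead of being split off additively.\<close>
  proof (rule LIMSEQ_le_const)
    show "(\<lambda>n. mult_const s * (sobolev_norm r D f + 1 / real (Suc n)) * (sobolev_norm s D g + 1 / real (Suc n)))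
      \<longlonglongrightarrow> mult_const s * sobolev_norm r D f * sobolev_norm s D g"
    proof -
      have z: "(\<lambda>n. 1 / real (Suc n)) \<longlonglongrightarrow> 0" by (rule LIMSEQ_Suc[OF lim_1_over_n])
      have "(\<lambda>n. mult_const s * (sobolev_norm r D f + 1 / real (Suc n)) * (sobolev_norm s D g + 1 / real (Suc n)))
        \<longlonglongrightarrow> mult_const s * (sobolev_norm r D f + 0) * (sobolev_norm s D g + 0)"
        by (intro tendsto_mult tendsto_add tendsto_const z)
      then show ?thesis by simp
    qed
    have "sobolev_norm r D (\<lambda>x. f x * g x) \<le> mult_const s * (sobolev_norm r D f + e) * (sobolev_norm s D g + e)"
      if e: "e > 0" for e
    proof -
      obtain F where F: "F \<in> sobolev_extensions r D f" "sobolev_plane_norm r F < sobolev_norm r D f + e"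
        by (rule sobolev_extension_approx[OF f e])
      obtain G where G: "G \<in> sobolev_extensions s D g" "sobolev_plane_norm s G < sobolev_norm s D g + e"
        by (rule sobolev_extension_approx[OF g e])
      note x = ext[OF F(1) G(1)]
      have "sobolev_norm r D (\<lambda>x. f x * g x) \<le> sobolev_plane_norm r (\<lambda>x. F x * G x)"
        using x by (intro sobolev_extension_le) auto
      also have "\<dots> \<le> mult_const s * sobolev_plane_norm r F * sobolev_plane_norm s G" using x by auto
      also have "\<dots> \<le> mult_const s * (sobolev_norm r D f + e) * (sobolev_norm s D g + e)"
        using F(2) G(2) mult_const_ge_1[of s] sobolev_norm_nonneg[OF f] e
        by (intro mult_mono mult_nonneg_nonneg sobolev_plane_norm_nonneg) auto
      finally show ?thesis .
    qed
    then show "\<exists>N. \<forall>n\<ge>N. sobolev_norm r D (\<lambda>x. f x * g x)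
      \<le> mult_const s * (sobolev_norm r D f + 1 / real (Suc n)) * (sobolev_norm s D g + 1 / real (Suc n))"
      by (auto simp del: of_nat_Suc)
  qed
qed

lemma sobolev_sup_bound:
  assumes f: "f \<in> sobolev s D" and s: "s > 1"
  shows "AE_on D (\<lambda>x. \<bar>f x\<bar> \<le> sob_const s * sobolev_norm s D f)"
proof -
  have "AE_on D (\<lambda>x. \<bar>f x\<bar> \<le> sob_const s * (sobolev_norm s D f + 1 / real (Suc n)))" for n
  proof -
    have e: "1 / real (Suc n) > 0" by simp
    obtain F where F: "F \<in> sobolev_extensions s D f" "sobolev_plane_norm s F < sobolev_norm s D f + 1 / real (Suc n)"
      by (rule sobolev_extension_approx[OF f e])
    obtain h where h: "sob_pair s F h" using sobolev_extensionD(1)[OF F(1)] by (auto simp: sobolev_plane_iff)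
    have "sob_const s * sobolev_plane_norm s F \<le> sob_const s * (sobolev_norm s D f + 1 / real (Suc n))"
      using F(2) by (intro mult_left_mono sob_const_nonneg) auto
    then show ?thesis
      using sobolev_plane_sup_bound[OF h s] sobolev_extensionD(2)[OF F(1)] by (auto elim!: eventually_elim2)
  qed
  then have "AE_on D (\<lambda>x. \<forall>n. \<bar>f x\<bar> \<le> sob_const s * (sobolev_norm s D f + 1 / real (Suc n)))"
    by (rule AE_on_all_nat)
  then show ?thesis
  proof eventually_elim
    case (elim x)
    show ?case
    proof
      assume x: "x \<in> D"
      show "\<bar>f x\<bar> \<le> sob_const s * sobolev_norm s D f"
      proof (rule LIMSEQ_le_const)
        have "(\<lambda>n. sob_const s * (sobolev_norm s D f + 1 / real (Suc n))) \<longlonglongrightarrow> sob_const s * (sobolev_norm s D f + 0)"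
          by (intro tendsto_mult tendsto_add tendsto_const LIMSEQ_Suc[OF lim_1_over_n])
        then show "(\<lambda>n. sob_const s * (sobolev_norm s D f + 1 / real (Suc n))) \<longlonglongrightarrow> sob_const s * sobolev_norm s D f" by simp
        show "\<exists>N. \<forall>n\<ge>N. \<bar>f x\<bar> \<le> sob_const s * (sobolev_norm s D f + 1 / real (Suc n))"
          using elim x by blast
      qed
    qed
  qed
qed

text \<open>Nearly optimal extensions change with the error but agree on \<open>D\<close>; one fixed
  extension, cut off to \<open>D\<close>, is therefore bounded in L^2 by all of them. Uniqueness of
  time derivatives depends on this.\<close>

lemma sobolev_norm_eq_0D:
  assumes f: "f \<in> sobolev r D" and r: "0 \<le> r" and D: "open D" and z: "sobolev_norm r D f = 0"
  shows "AE_on D (\<lambda>x. f x = 0)"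
proof -
  have [measurable]: "D \<in> sets borel" using D by simp
  have ex: "\<exists>F. F \<in> sobolev_extensions r D f \<and> square_integrable F \<and> l2norm F \<le> e" if e: "e > 0" for e
  proof -
    obtain F where F: "F \<in> sobolev_extensions r D f" "sobolev_plane_norm r F < sobolev_norm r D f + e"
      by (rule sobolev_extension_approx[OF f e])
    obtain h where h: "sob_pair r F h" using sobolev_extensionD(1)[OF F(1)] by (auto simp: sobolev_plane_iff)
    show ?thesis using sobolev_plane_norm_0[OF h r] F z sob_pairD(3)[OF h] by (intro exI[of _ F]) auto
  qed
  obtain F where F: "F \<in> sobolev_extensions r D f" "square_integrable F" using ex[of 1] by auto
  let ?g = "\<lambda>x. indicator D x * F x"
  have [measurable]: "F \<in> borel_measurable lborel" using F(2) by (rule square_integrable_measurable)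
  have gm: "?g \<in> borel_measurable lborel" by measurable
  have sg: "square_integrable ?g"
    by (rule square_integrable_bound(1)[OF F(2) gm]) (auto simp: indicator_def)
  have "l2norm ?g \<le> e" if e: "e > 0" for e
  proof -
    obtain G where G: "G \<in> sobolev_extensions r D f" "square_integrable G" "l2norm G \<le> e" using ex[OF e] by auto
    have "AE x in lborel. norm (?g x) \<le> norm (G x)"
      using sobolev_extensionD(2)[OF F(1)] sobolev_extensionD(2)[OF G(1)]
      by eventually_elim (auto simp: indicator_def)
    from square_integrable_bound(2)[OF G(2) gm this] G(3) show ?thesis by simp
  qed
  then have "l2norm ?g \<le> 0" by (intro field_le_epsilon[of _ 0]) simp
  then have "l2norm ?g = 0" by (intro antisym) auto
  from l2norm_eq_0D[OF sg this] sobolev_extensionD(2)[OF F(1)]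
  show ?thesis by eventually_elim (auto simp: indicator_def)
qed

lemma sobolev_series:
  assumes f: "\<And>n. f n \<in> sobolev s D" and s: "0 \<le> s" and sum: "summable (\<lambda>n. sobolev_norm s D (f n))"
  shows "AE_on D (\<lambda>x. summable (\<lambda>n. norm (f n x)))"
    and "(\<lambda>x. \<Sum>n. f n x) \<in> sobolev s D"
    and "sobolev_norm s D (\<lambda>x. \<Sum>n. f n x) \<le> (\<Sum>n. sobolev_norm s D (f n))"
proof -
  have main: "AE_on D (\<lambda>x. summable (\<lambda>n. norm (f n x))) \<and> (\<lambda>x. \<Sum>n. f n x) \<in> sobolev s D \<and>
     sobolev_norm s D (\<lambda>x. \<Sum>n. f n x) \<le> (\<Sum>n. sobolev_norm s D (f n)) + 2 * e" if e: "e > 0" for e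
  proof -
    \<comment> \<open>The errors e (1/2)^n add up to 2 e.\<close>
    have "\<exists>F. F \<in> sobolev_extensions s D (f n) \<and> sobolev_plane_norm s F < sobolev_norm s D (f n) + e * (1/2)^n" for n
    proof -
      have "e * (1/2)^n > 0" using e by simp
      from sobolev_extension_approx[OF f[of n] this] show ?thesis by blast
    qed
    then obtain F where F: "\<And>n. F n \<in> sobolev_extensions s D (f n)"
      "\<And>n. sobolev_plane_norm s (F n) < sobolev_norm s D (f n) + e * (1/2)^n" by metis
    have "\<forall>n. \<exists>h. sob_pair s (F n) h" using sobolev_extensionD(1)[OF F(1)] by (auto simp: sobolev_plane_iff)
    then obtain h where h: "\<And>n. sob_pair s (F n) (h n)" by metis
    have sg: "summable (\<lambda>n. e * (1/2::real)^n)" by (intro summable_mult summable_geometric) auto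
    have sb: "summable (\<lambda>n. sobolev_norm s D (f n) + e * (1/2)^n)" by (rule summable_add[OF sum sg])
    have sF: "summable (\<lambda>n. sobolev_plane_norm s (F n))"
      by (rule summable_comparison_test'[OF sb, of 0]) (use F(2) sobolev_plane_norm_nonneg in \<open>auto simp: less_imp_le\<close>)
    note ser = sob_pair_series[OF h s sF]
    have eq: "AE_on D (\<lambda>x. \<forall>n. F n x = f n x)"
      by (rule AE_on_all_nat[OF sobolev_extensionD(2)[OF F(1)]])
    have 1: "AE_on D (\<lambda>x. summable (\<lambda>n. norm (f n x)))"
      using eq ser(1) by eventually_elim auto
    have ext: "(\<lambda>x. \<Sum>n. F n x) \<in> sobolev_extensions s D (\<lambda>x. \<Sum>n. f n x)"
      using eq ser(2) by (intro sobolev_extensionI) (auto simp: sobolev_plane_iff elim: eventually_mono)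
    have "sobolev_norm s D (\<lambda>x. \<Sum>n. f n x) \<le> (\<Sum>n. sobolev_plane_norm s (F n))"
      using sobolev_extension_le[OF ext] ser(3) by simp
    also have "\<dots> \<le> (\<Sum>n. sobolev_norm s D (f n) + e * (1/2)^n)"
      using F(2) by (intro suminf_le sF sb) (auto simp: less_imp_le)
    also have "\<dots> = (\<Sum>n. sobolev_norm s D (f n)) + (\<Sum>n. e * (1/2)^n)"
      by (rule suminf_add[OF sum sg, symmetric])
    also have "(\<Sum>n. e * (1/2::real)^n) = 2 * e"
      by (subst suminf_mult) (auto simp: suminf_geometric)
    finally show ?thesis using 1 sobolev_extensionD(3)[OF ext] by simp
  qed
  show "AE_on D (\<lambda>x. summable (\<lambda>n. norm (f n x)))" "(\<lambda>x. \<Sum>n. f n x) \<in> sobolev s D"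
    using main[of 1] by auto
  show "sobolev_norm s D (\<lambda>x. \<Sum>n. f n x) \<le> (\<Sum>n. sobolev_norm s D (f n))"
  proof (rule field_le_epsilon)
    fix e :: real assume "e > 0"
    then show "sobolev_norm s D (\<lambda>x. \<Sum>n. f n x) \<le> (\<Sum>n. sobolev_norm s D (f n)) + e"
      using main[of "e/2"] by simp
  qed
qed

lemma sobolev_const:
  assumes "bounded D"
  shows "(\<lambda>x. c) \<in> sobolev s D"
proof -
  obtain p where p: "test_function UNIV p" "\<And>x. x \<in> D \<Longrightarrow> p x = 1"
    using plateau_test_function[OF assms] by metis
  have "p \<in> sobolev_extensions s D (\<lambda>x. 1)"
    using test_function_sobolev[OF p(1)] p(2) by (intro sobolev_extensionI) auto
  then have "(\<lambda>x. 1) \<in> sobolev s D" by (rule sobolev_extensionD)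
  from sobolev_cmult(1)[OF this, of c] show ?thesis by simp
qed

section \<open>Entire functions and time derivatives\<close>

text \<open>The divided difference (a^n - b^n) / (a - b), written as a recursion so that a = b is no
  exception; \<open>pow_quot2\<close> below is its analogue of second order.\<close>

primrec pow_quot :: "nat \<Rightarrow> real \<Rightarrow> real \<Rightarrow> real" where
  "pow_quot 0 a b = 0"
| "pow_quot (Suc n) a b = pow_quot n a b * b + a ^ n"

primrec pow_quot2 :: "nat \<Rightarrow> real \<Rightarrow> real \<Rightarrow> real" where
  "pow_quot2 0 a b = 0"
| "pow_quot2 (Suc n) a b = pow_quot2 n a b * b + pow_quot n a b"

lemma pow_quot: "a ^ n - b ^ n = (a - b) * pow_quot n a b"
proof (induction n)
  case (Suc n)
  have "a ^ Suc n - b ^ Suc n = (a ^ n - b ^ n) * b + (a - b) * a ^ n" by (simp add: algebra_simps)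
  then show ?case unfolding Suc by (simp add: algebra_simps)
qed simp

lemma pow_quot2: "pow_quot n a b - real n * b ^ (n - 1) = (a - b) * pow_quot2 n a b"
proof (induction n)
  case (Suc n)
  have "real n * b ^ n = (real n * b ^ (n - 1)) * b" by (cases n) auto
  then have "pow_quot (Suc n) a b - real (Suc n) * b ^ (Suc n - 1)
      = (pow_quot n a b - real n * b ^ (n - 1)) * b + (a ^ n - b ^ n)"
    by (simp add: distrib_right left_diff_distrib)
  then show ?case unfolding Suc pow_quot by (simp add: algebra_simps)
qed simp

lemma pow_quot_bound:
  assumes "1 \<le> R" "\<bar>a\<bar> \<le> R" "\<bar>b\<bar> \<le> R"
  shows "\<bar>pow_quot n a b\<bar> \<le> real n * R ^ n" "\<bar>pow_quot2 n a b\<bar> \<le> (real n)\<^sup>2 * R ^ n"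
proof -
  have pa: "\<bar>a ^ n\<bar> \<le> R ^ n" for n using assms by (simp add: power_abs power_mono)
  have R: "R ^ n \<le> R * R ^ n" for n using assms by (simp add: mult_le_cancel_right1)
  show 1: "\<bar>pow_quot n a b\<bar> \<le> real n * R ^ n" for n
  proof (induction n)
    case (Suc n)
    have "\<bar>pow_quot (Suc n) a b\<bar> \<le> \<bar>pow_quot n a b\<bar> * \<bar>b\<bar> + \<bar>a ^ n\<bar>"
      using abs_triangle_ineq[of "pow_quot n a b * b" "a ^ n"] by (simp add: abs_mult)
    also have "\<dots> \<le> (real n * R ^ n) * R + R * R ^ n"
      using assms Suc order_trans[OF pa R, of n] by (intro add_mono mult_mono) auto
    finally show ?case by (simp add: algebra_simps)
  qed simp
  show "\<bar>pow_quot2 n a b\<bar> \<le> (real n)\<^sup>2 * R ^ n"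
  proof (induction n)
    case (Suc n)
    have "\<bar>pow_quot2 (Suc n) a b\<bar> \<le> \<bar>pow_quot2 n a b\<bar> * \<bar>b\<bar> + \<bar>pow_quot n a b\<bar>"
      using abs_triangle_ineq[of "pow_quot2 n a b * b" "pow_quot n a b"] by (simp add: abs_mult)
    also have "\<dots> \<le> ((real n)\<^sup>2 * R ^ n) * R + real n * (R * R ^ n)"
      using assms Suc order_trans[OF 1[of n] mult_left_mono[OF R[of n], of "real n"]]
      by (intro add_mono mult_mono) auto
    also have "\<dots> = ((real n)\<^sup>2 + real n) * R ^ Suc n" by (simp add: algebra_simps)
    also have "\<dots> \<le> (real (Suc n))\<^sup>2 * R ^ Suc n"
      using assms by (intro mult_right_mono) (auto simp: power2_eq_square algebra_simps)
    finally show ?case .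
  qed simp
qed

definition entire_coeffs :: "(nat \<Rightarrow> real) \<Rightarrow> bool" where
  "entire_coeffs c \<longleftrightarrow> (\<forall>x. summable (\<lambda>n. c n * x ^ n))"

definition ps :: "(nat \<Rightarrow> real) \<Rightarrow> real \<Rightarrow> real" where
  "ps c x = (\<Sum>n. c n * x ^ n)"

definition ps_quot :: "(nat \<Rightarrow> real) \<Rightarrow> real \<Rightarrow> real \<Rightarrow> real" where
  "ps_quot c a b = (\<Sum>n. c n * pow_quot n a b)"

definition ps_quot2 :: "(nat \<Rightarrow> real) \<Rightarrow> real \<Rightarrow> real \<Rightarrow> real" where
  "ps_quot2 c a b = (\<Sum>n. c n * pow_quot2 n a b)"

lemma entire_coeffs_diffs: "entire_coeffs c \<Longrightarrow> entire_coeffs (diffs c)"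
  unfolding entire_coeffs_def using termdiff_converges_all by blast

lemma entire_coeffs_abs:
  assumes "entire_coeffs c"
  shows "summable (\<lambda>n. \<bar>c n\<bar> * R ^ n)"
proof -
  have "summable (\<lambda>n. norm (c n * R ^ n))"
    using assms by (intro powser_insidea[of c "\<bar>R\<bar> + 1"]) (auto simp: entire_coeffs_def)
  then have "summable (\<lambda>n. \<bar>c n\<bar> * \<bar>R\<bar> ^ n)" by (simp add: abs_mult power_abs)
  then have "summable (\<lambda>n. norm (\<bar>c n\<bar> * R ^ n))" by (simp add: abs_mult power_abs)
  then show ?thesis by (rule summable_norm_cancel)
qed

text \<open>Absorbs the polynomial growth of the divided differences into the radius, n^2 R^n <= (4
  R)^n; hence the factor 4 in the later bounds.\<close>

lemma square_le_4_power: "(real n)\<^sup>2 \<le> 4 ^ n" and nat_le_4_power: "real n \<le> 4 ^ n"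
proof -
  have "real n \<le> 2 ^ n" using of_nat_less_two_power[of n, where ?'a=real] by simp
  then have "(real n)\<^sup>2 \<le> (2 ^ n)\<^sup>2" by (intro power_mono) auto
  then show "(real n)\<^sup>2 \<le> 4 ^ n" by (simp add: power_mult[symmetric] mult.commute[of n] power_mult)
  have "(2::real) ^ n \<le> 4 ^ n" by (intro power_mono) auto
  then show "real n \<le> 4 ^ n" using \<open>real n \<le> 2 ^ n\<close> by linarith
qed

text \<open>Taylor's formula in factored form, f(a) - f(b) = (a - b) (f'(b) + (a - b) S) with S
  bounded on bounded sets. Both chain rules use it: in space with the numerical bound given here, in
  time with the H^s bound of \<open>ps_quot_V\<close>.\<close>

lemma ps_identities:
  assumes c: "entire_coeffs c"
  shows "ps c a - ps c b = (a - b) * ps_quot c a b"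
    and "ps_quot c a b - ps (diffs c) b = (a - b) * ps_quot2 c a b"
    and "\<lbrakk>1 \<le> R; \<bar>a\<bar> \<le> R; \<bar>b\<bar> \<le> R\<rbrakk> \<Longrightarrow> \<bar>ps_quot2 c a b\<bar> \<le> (\<Sum>n. \<bar>c n\<bar> * (4 * R) ^ n)"
proof -
  have bnd: "norm (c n * pow_quot n a b) \<le> \<bar>c n\<bar> * (4 * R) ^ n"
    "norm (c n * pow_quot2 n a b) \<le> \<bar>c n\<bar> * (4 * R) ^ n"
    if R: "1 \<le> R" "\<bar>a\<bar> \<le> R" "\<bar>b\<bar> \<le> R" for R n
  proof -
    have "R ^ n \<ge> 0" using R by simp
    then have "\<bar>pow_quot n a b\<bar> \<le> 4 ^ n * R ^ n" "\<bar>pow_quot2 n a b\<bar> \<le> 4 ^ n * R ^ n"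
      using pow_quot_bound[OF R, of n] mult_right_mono[OF nat_le_4_power[of n], of "R ^ n"]
        mult_right_mono[OF square_le_4_power[of n], of "R ^ n"] by linarith+
    then show "norm (c n * pow_quot n a b) \<le> \<bar>c n\<bar> * (4 * R) ^ n" "norm (c n * pow_quot2 n a b) \<le> \<bar>c n\<bar> * (4 * R) ^ n"
      by (simp_all add: abs_mult power_mult_distrib mult_left_mono)
  qed
  define R0 where "R0 = max 1 (max \<bar>a\<bar> \<bar>b\<bar>)"
  have R0: "1 \<le> R0" "\<bar>a\<bar> \<le> R0" "\<bar>b\<bar> \<le> R0" by (auto simp: R0_def)
  have s1: "summable (\<lambda>n. c n * pow_quot n a b)"
    by (rule summable_comparison_test'[OF entire_coeffs_abs[OF c, of "4 * R0"], of 0]) (use bnd[OF R0] in auto)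
  have s2: "summable (\<lambda>n. c n * pow_quot2 n a b)"
    by (rule summable_comparison_test'[OF entire_coeffs_abs[OF c, of "4 * R0"], of 0]) (use bnd[OF R0] in auto)
  have sa: "summable (\<lambda>n. c n * x ^ n)" for x using c by (simp add: entire_coeffs_def)
  have "ps c a - ps c b = (\<Sum>n. c n * a ^ n - c n * b ^ n)"
    unfolding ps_def by (rule suminf_diff[OF sa sa])
  also have "\<dots> = (\<Sum>n. (a - b) * (c n * pow_quot n a b))"
    by (simp add: right_diff_distrib[symmetric] pow_quot mult.left_commute)
  also have "\<dots> = (a - b) * ps_quot c a b" unfolding ps_quot_def by (rule suminf_mult[OF s1])
  finally show "ps c a - ps c b = (a - b) * ps_quot c a b" .
  have d: "(\<lambda>n. real n * c n * b ^ (n - 1)) sums ps (diffs c) b"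
    using diffs_equiv[of c b] entire_coeffs_diffs[OF c] unfolding ps_def entire_coeffs_def by simp
  have "ps_quot c a b - ps (diffs c) b = (\<Sum>n. c n * pow_quot n a b - real n * c n * b ^ (n - 1))"
    unfolding ps_quot_def using suminf_diff[OF s1 sums_summable[OF d]] sums_unique[OF d] by simp
  also have "\<dots> = (\<Sum>n. c n * (pow_quot n a b - real n * b ^ (n - 1)))"
    by (simp add: algebra_simps)
  also have "\<dots> = (\<Sum>n. (a - b) * (c n * pow_quot2 n a b))"
    unfolding pow_quot2 by (simp add: mult.left_commute)
  also have "\<dots> = (a - b) * ps_quot2 c a b" unfolding ps_quot2_def by (rule suminf_mult[OF s2])
  finally show "ps_quot c a b - ps (diffs c) b = (a - b) * ps_quot2 c a b" .
  show "\<bar>ps_quot2 c a b\<bar> \<le> (\<Sum>n. \<bar>c n\<bar> * (4 * R) ^ n)" if R: "1 \<le> R" "\<bar>a\<bar> \<le> R" "\<bar>b\<bar> \<le> R"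
  proof -
    have sn: "summable (\<lambda>n. norm (c n * pow_quot2 n a b))"
      by (rule summable_comparison_test'[OF entire_coeffs_abs[OF c, of "4 * R"], of 0]) (use bnd[OF R] in auto)
    have "\<bar>ps_quot2 c a b\<bar> \<le> (\<Sum>n. norm (c n * pow_quot2 n a b))"
      unfolding ps_quot2_def real_norm_def[symmetric] by (rule summable_norm[OF sn])
    also have "\<dots> \<le> (\<Sum>n. \<bar>c n\<bar> * (4 * R) ^ n)"
      by (rule suminf_le[OF bnd(2)[OF R] sn entire_coeffs_abs[OF c]])
    finally show ?thesis .
  qed
qed

section \<open>Power series acting on H^s(D)\<close>

locale sob_domain =
  fixes s :: real and D :: "(real^2) set"
  assumes s: "s > 1" and open_D: "open D" and bounded_D: "bounded D"
begin

abbreviation "V r \<equiv> sobolev r D"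
abbreviation "N r \<equiv> sobolev_norm r D"
abbreviation "K \<equiv> mult_const s"

lemma s_ineqs: "0 \<le> s - 1" "s - 1 \<le> s" "0 \<le> s" "s \<le> s"
  using s by auto

lemma K_pos: "0 < K" "0 \<le> K"
  using mult_const_ge_1[of s] by linarith+

lemma mult_s: "f \<in> V s \<Longrightarrow> g \<in> V s \<Longrightarrow> (\<lambda>x. f x * g x) \<in> V s"
    "f \<in> V s \<Longrightarrow> g \<in> V s \<Longrightarrow> N s (\<lambda>x. f x * g x) \<le> K * N s f * N s g"
  using sobolev_mult[OF _ _ s_ineqs(3,4) s] by blast+

lemma mult_s1: "f \<in> V (s - 1) \<Longrightarrow> g \<in> V s \<Longrightarrow> (\<lambda>x. f x * g x) \<in> V (s - 1)"
    "f \<in> V (s - 1) \<Longrightarrow> g \<in> V s \<Longrightarrow> N (s - 1) (\<lambda>x. f x * g x) \<le> K * N (s - 1) f * N s g"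
  using sobolev_mult[OF _ _ s_ineqs(1,2) s] by blast+

lemma const_V: "(\<lambda>x. c) \<in> V r"
  by (rule sobolev_const[OF bounded_D])

lemma mono_s1: "f \<in> V s \<Longrightarrow> f \<in> V (s - 1)" "f \<in> V s \<Longrightarrow> N (s - 1) f \<le> N s f"
  using sobolev_mono[OF _ s_ineqs(2)] by blast+

text \<open>\<open>K\<close> is the constant of the product estimate, so \<open>K * N s b\<close>
  plays the part of a submultiplicative norm and \<open>R\<close> bounds it.\<close>

lemma power_V:
  assumes b: "b \<in> V s" and R: "K * N s b \<le> R" "1 \<le> R"
  shows "(\<lambda>x. b x ^ n) \<in> V s \<and> N s (\<lambda>x. b x ^ n) \<le> N s (\<lambda>x. 1) * R ^ n"
proof (induction n)
  case 0
  show ?case using const_V[of 1] by simp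
next
  case (Suc n)
  have "N s (\<lambda>x. b x * b x ^ n) \<le> (K * N s b) * N s (\<lambda>x. b x ^ n)"
    using mult_s(2)[OF b, of "\<lambda>x. b x ^ n"] Suc by simp
  also have "\<dots> \<le> R * (N s (\<lambda>x. 1) * R ^ n)"
    using Suc R by (intro mult_mono) (auto intro!: sobolev_norm_nonneg)
  finally show ?case using mult_s(1)[OF b, of "\<lambda>x. b x ^ n"] Suc by (simp add: mult_ac)
qed

text \<open>The recursions are run in the algebra H^s(D) and give the same growth as for numbers in
  \<open>pow_quot_bound\<close>.\<close>

lemma pow_quot_V:
  assumes a: "a \<in> V s" and b: "b \<in> V s" and R: "K * N s a \<le> R" "K * N s b \<le> R" "1 \<le> R"
  shows "(\<lambda>x. pow_quot n (a x) (b x)) \<in> V s \<and> N s (\<lambda>x. pow_quot n (a x) (b x)) \<le> N s (\<lambda>x. 1) * (real n * R ^ n)"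
    and "(\<lambda>x. pow_quot2 n (a x) (b x)) \<in> V s \<and> N s (\<lambda>x. pow_quot2 n (a x) (b x)) \<le> N s (\<lambda>x. 1) * ((real n)\<^sup>2 * R ^ n)"
proof -
  let ?E = "N s (\<lambda>x. 1)"
  have E: "?E \<ge> 0" by (rule sobolev_norm_nonneg[OF const_V])
  have RR: "R ^ n \<le> R * R ^ n" for n using R by (simp add: mult_le_cancel_right1)
  have zero: "N s (\<lambda>x. 0) \<le> 0" using sobolev_cmult(2)[OF const_V[of 1 s], of 0] by simp
  have step: "(\<lambda>x. f x * b x + g x) \<in> V s \<and> N s (\<lambda>x. f x * b x + g x) \<le> R * N s f + N s g"
    if f: "f \<in> V s" and g: "g \<in> V s" for f g
  proof -
    note m = mult_s[OF f b]
    have "N s (\<lambda>x. f x * b x) \<le> N s f * R"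
      using m(2) mult_left_mono[OF R(2) sobolev_norm_nonneg[OF f]] by (simp add: mult_ac)
    then show ?thesis using sobolev_add[OF m(1) g] by (simp add: mult.commute)
  qed
  show 1: "(\<lambda>x. pow_quot n (a x) (b x)) \<in> V s \<and> N s (\<lambda>x. pow_quot n (a x) (b x)) \<le> ?E * (real n * R ^ n)" for n
  proof (induction n)
    case 0
    show ?case using const_V[of 0] zero by simp
  next
    case (Suc n)
    have p: "(\<lambda>x. a x ^ n) \<in> V s" "N s (\<lambda>x. a x ^ n) \<le> ?E * R ^ n" using power_V[OF a R(1,3), of n] by auto
    have "R * N s (\<lambda>x. pow_quot n (a x) (b x)) + N s (\<lambda>x. a x ^ n) \<le> R * (?E * (real n * R ^ n)) + ?E * (R * R ^ n)"
      using Suc R p order_trans[OF p(2) mult_left_mono[OF RR E]] by (intro add_mono mult_left_mono) auto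
    then show ?case using step[OF conjunct1[OF Suc] p(1)] by (simp add: algebra_simps)
  qed
  show "(\<lambda>x. pow_quot2 n (a x) (b x)) \<in> V s \<and> N s (\<lambda>x. pow_quot2 n (a x) (b x)) \<le> ?E * ((real n)\<^sup>2 * R ^ n)"
  proof (induction n)
    case 0
    show ?case using const_V[of 0] zero by simp
  next
    case (Suc n)
    note p = 1[of n]
    have "R * N s (\<lambda>x. pow_quot2 n (a x) (b x)) + N s (\<lambda>x. pow_quot n (a x) (b x))
       \<le> R * (?E * ((real n)\<^sup>2 * R ^ n)) + ?E * (real n * (R * R ^ n))"
    proof (intro add_mono mult_left_mono)
      have "?E * (real n * R ^ n) \<le> ?E * (real n * (R * R ^ n))"
        by (intro mult_left_mono RR E) auto
      then show "N s (\<lambda>x. pow_quot n (a x) (b x)) \<le> ?E * (real n * (R * R ^ n))" using p by linarith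
    qed (use Suc R in auto)
    also have "\<dots> = ?E * (((real n)\<^sup>2 + real n) * R ^ Suc n)" by (simp add: algebra_simps)
    also have "\<dots> \<le> ?E * ((real (Suc n))\<^sup>2 * R ^ Suc n)"
      using R E by (intro mult_left_mono mult_right_mono) (auto simp: power2_eq_square algebra_simps)
    finally show ?case using step[OF conjunct1[OF Suc] conjunct1[OF p]] by simp
  qed
qed

lemma coeff_series:
  assumes c: "entire_coeffs c" and X: "\<And>n. X n \<in> V s" "\<And>n. N s (X n) \<le> E * L ^ n" and E: "E \<ge> 0" and L: "L \<ge> 0"
  shows "(\<lambda>x. \<Sum>n. c n * X n x) \<in> V s" "N s (\<lambda>x. \<Sum>n. c n * X n x) \<le> E * (\<Sum>n. \<bar>c n\<bar> * L ^ n)"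
proof -
  have le: "N s (\<lambda>x. c n * X n x) \<le> E * (\<bar>c n\<bar> * L ^ n)" for n
    using sobolev_cmult(2)[OF X(1)[of n], of "c n"] mult_left_mono[OF X(2)[of n], of "\<bar>c n\<bar>"] by (simp add: mult_ac)
  have cX: "(\<lambda>x. c n * X n x) \<in> V s" for n by (rule sobolev_cmult(1)[OF X(1)])
  have sE: "summable (\<lambda>n. E * (\<bar>c n\<bar> * L ^ n))" by (intro summable_mult entire_coeffs_abs c)
  have sm: "summable (\<lambda>n. N s (\<lambda>x. c n * X n x))"
    by (rule summable_comparison_test'[OF sE, of 0]) (use le sobolev_norm_nonneg[OF cX] in auto)
  note ser = sobolev_series[OF cX s_ineqs(3) sm]
  show "(\<lambda>x. \<Sum>n. c n * X n x) \<in> V s" by (rule ser(2))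
  have "N s (\<lambda>x. \<Sum>n. c n * X n x) \<le> (\<Sum>n. E * (\<bar>c n\<bar> * L ^ n))"
    using ser(3) suminf_le[OF le sm sE] by linarith
  also have "\<dots> = E * (\<Sum>n. \<bar>c n\<bar> * L ^ n)" by (rule suminf_mult[OF entire_coeffs_abs[OF c]])
  finally show "N s (\<lambda>x. \<Sum>n. c n * X n x) \<le> E * (\<Sum>n. \<bar>c n\<bar> * L ^ n)" .
qed

lemma ps_V:
  assumes c: "entire_coeffs c" and a: "a \<in> V s"
  shows "(\<lambda>x. ps c (a x)) \<in> V s"
proof -
  define R where "R = max 1 (K * N s a)"
  have R: "K * N s a \<le> R" "1 \<le> R" by (auto simp: R_def)
  show ?thesis unfolding ps_def
    by (rule coeff_series(1)[OF c, of _ "N s (\<lambda>x. 1)" R])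
      (use power_V[OF a R] R sobolev_norm_nonneg[OF const_V] in auto)
qed

text \<open>Depends on the argument through \<open>R\<close> alone, hence is uniform over all times
  at which \<open>K\<close> times the norm stays below \<open>R\<close>.\<close>

definition ps_bound :: "(nat \<Rightarrow> real) \<Rightarrow> real \<Rightarrow> real" where
  "ps_bound c R = N s (\<lambda>x. 1) * (\<Sum>n. \<bar>c n\<bar> * (4 * R) ^ n)"

lemma ps_quot_V:
  assumes c: "entire_coeffs c" and a: "a \<in> V s" and b: "b \<in> V s"
    and R: "K * N s a \<le> R" "K * N s b \<le> R" "1 \<le> R"
  shows "(\<lambda>x. ps_quot c (a x) (b x)) \<in> V s" "N s (\<lambda>x. ps_quot c (a x) (b x)) \<le> ps_bound c R"
    "(\<lambda>x. ps_quot2 c (a x) (b x)) \<in> V s" "N s (\<lambda>x. ps_quot2 c (a x) (b x)) \<le> ps_bound c R"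
proof -
  let ?E = "N s (\<lambda>x. 1)"
  have E: "?E \<ge> 0" by (rule sobolev_norm_nonneg[OF const_V])
  have R0: "4 * R \<ge> 0" using R by simp
  have p: "R ^ n \<ge> 0" for n using R by simp
  have 1: "?E * (real n * R ^ n) \<le> ?E * (4 * R) ^ n" for n
    using mult_left_mono[OF mult_right_mono[OF nat_le_4_power[of n] p[of n]] E] by (simp add: power_mult_distrib)
  have 2: "?E * ((real n)\<^sup>2 * R ^ n) \<le> ?E * (4 * R) ^ n" for n
    using mult_left_mono[OF mult_right_mono[OF square_le_4_power[of n] p[of n]] E] by (simp add: power_mult_distrib)
  note q1 = pow_quot_V(1)[OF a b R] and q2 = pow_quot_V(2)[OF a b R]
  show "(\<lambda>x. ps_quot c (a x) (b x)) \<in> V s" "N s (\<lambda>x. ps_quot c (a x) (b x)) \<le> ps_bound c R"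
    unfolding ps_quot_def ps_bound_def
    using coeff_series[OF c conjunct1[OF q1] order_trans[OF conjunct2[OF q1] 1] E R0] by blast+
  show "(\<lambda>x. ps_quot2 c (a x) (b x)) \<in> V s" "N s (\<lambda>x. ps_quot2 c (a x) (b x)) \<le> ps_bound c R"
    unfolding ps_quot2_def ps_bound_def
    using coeff_series[OF c conjunct1[OF q2] order_trans[OF conjunct2[OF q2] 2] E R0] by blast+
qed

end

section \<open>Continuity and differentiability in time\<close>

lemma tendsto_0_on:
  fixes f g :: "real \<Rightarrow> real"
  assumes "(g \<longlongrightarrow> 0) (at t within S)" "\<And>\<tau>. \<tau> \<in> S \<Longrightarrow> 0 \<le> f \<tau>" "\<And>\<tau>. \<tau> \<in> S \<Longrightarrow> f \<tau> \<le> g \<tau>"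
  shows "(f \<longlongrightarrow> 0) (at t within S)"
proof (rule Lim_null_comparison[OF _ assms(1)])
  show "\<forall>\<^sub>F \<tau> in at t within S. norm (f \<tau>) \<le> g \<tau>"
    using assms(2,3) by (auto simp: eventually_at_filter)
qed

lemma tendsto_0_on_eventually:
  fixes f g :: "real \<Rightarrow> real"
  assumes "(g \<longlongrightarrow> 0) (at t within S)" "\<forall>\<^sub>F \<tau> in at t within S. \<tau> \<in> S \<longrightarrow> P \<tau>"
    and "\<And>\<tau>. \<tau> \<in> S \<Longrightarrow> 0 \<le> f \<tau>" "\<And>\<tau>. \<tau> \<in> S \<Longrightarrow> P \<tau> \<Longrightarrow> f \<tau> \<le> g \<tau>"
  shows "(f \<longlongrightarrow> 0) (at t within S)"
proof (rule Lim_null_comparison[OF _ assms(1)])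
  have "\<forall>\<^sub>F \<tau> in at t within S. \<tau> \<in> S" by (auto simp: eventually_at_filter)
  with assms(2) show "\<forall>\<^sub>F \<tau> in at t within S. norm (f \<tau>) \<le> g \<tau>"
    by eventually_elim (use assms(3,4) in auto)
qed

locale sob_time = sob_domain +
  fixes T :: real
  assumes T: "T > 0"
begin

abbreviation "C0 r \<equiv> C0_sobolev T r D"

lemma C0D:
  assumes "v \<in> C0 r" "t \<in> {0..T}"
  shows "v t \<in> V r" "((\<lambda>\<tau>. N r (\<lambda>x. v \<tau> x - v t x)) \<longlongrightarrow> 0) (at t within {0..T})"
  using assms by (auto simp: C0_sobolev_def)

lemma C0I:
  assumes "\<And>t. t \<in> {0..T} \<Longrightarrow> v t \<in> V r"
    "\<And>t. t \<in> {0..T} \<Longrightarrow> ((\<lambda>\<tau>. N r (\<lambda>x. v \<tau> x - v t x)) \<longlongrightarrow> 0) (at t within {0..T})"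
  shows "v \<in> C0 r"
  using assms by (auto simp: C0_sobolev_def)

lemma C0_cong:
  assumes v: "v \<in> C0 r" and eq: "\<And>t. t \<in> {0..T} \<Longrightarrow> AE_on D (\<lambda>x. w t x = v t x)"
  shows "w \<in> C0 r"
proof (rule C0I)
  fix t assume t: "t \<in> {0..T}"
  show "w t \<in> V r" using sobolev_cong(1)[OF eq[OF t]] C0D(1)[OF v t] by simp
  have e: "N r (\<lambda>x. w \<tau> x - w t x) = N r (\<lambda>x. v \<tau> x - v t x)" if "\<tau> \<in> {0..T}" for \<tau>
    by (rule sobolev_cong(2)) (use eq[OF t] eq[OF that] in \<open>auto elim!: eventually_elim2\<close>)
  show "((\<lambda>\<tau>. N r (\<lambda>x. w \<tau> x - w t x)) \<longlongrightarrow> 0) (at t within {0..T})"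
    by (rule tendsto_0_on[OF C0D(2)[OF v t]])
      (use e sobolev_norm_nonneg[OF sobolev_diff(1)[OF C0D(1)[OF v] C0D(1)[OF v t]]] in auto)
qed

lemma C0_add:
  assumes v: "v \<in> C0 r" and w: "w \<in> C0 r"
  shows "(\<lambda>t x. v t x + w t x) \<in> C0 r"
proof (rule C0I)
  fix t assume t: "t \<in> {0..T}"
  show "(\<lambda>x. v t x + w t x) \<in> V r" by (intro sobolev_add C0D v w t)
  show "((\<lambda>\<tau>. N r (\<lambda>x. (v \<tau> x + w \<tau> x) - (v t x + w t x))) \<longlongrightarrow> 0) (at t within {0..T})"
  proof (rule tendsto_0_on)
    show "((\<lambda>\<tau>. N r (\<lambda>x. v \<tau> x - v t x) + N r (\<lambda>x. w \<tau> x - w t x)) \<longlongrightarrow> 0) (at t within {0..T})"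
      using tendsto_add[OF C0D(2)[OF v t] C0D(2)[OF w t]] by simp
    fix \<tau> assume \<tau>: "\<tau> \<in> {0..T}"
    show "0 \<le> N r (\<lambda>x. (v \<tau> x + w \<tau> x) - (v t x + w t x))"
      by (intro sobolev_norm_nonneg sobolev_diff sobolev_add C0D v w t \<tau>)
    have "N r (\<lambda>x. (v \<tau> x - v t x) + (w \<tau> x - w t x)) \<le> N r (\<lambda>x. v \<tau> x - v t x) + N r (\<lambda>x. w \<tau> x - w t x)"
      by (intro sobolev_add sobolev_diff C0D v w t \<tau>)
    then show "N r (\<lambda>x. (v \<tau> x + w \<tau> x) - (v t x + w t x)) \<le> N r (\<lambda>x. v \<tau> x - v t x) + N r (\<lambda>x. w \<tau> x - w t x)"
      by (simp add: algebra_simps)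
  qed
qed

lemma C0_mult_gen:
  assumes v: "v \<in> C0 r" and w: "w \<in> C0 s" and r: "0 \<le> r" "r \<le> s"
  shows "(\<lambda>t x. v t x * w t x) \<in> C0 r"
proof (rule C0I)
  note m = sobolev_mult[OF _ _ r s]
  fix t assume t: "t \<in> {0..T}"
  show "(\<lambda>x. v t x * w t x) \<in> V r" by (intro m C0D v w t)
  show "((\<lambda>\<tau>. N r (\<lambda>x. v \<tau> x * w \<tau> x - v t x * w t x)) \<longlongrightarrow> 0) (at t within {0..T})"
  proof (rule tendsto_0_on)
    let ?a = "\<lambda>\<tau>. N r (\<lambda>x. v \<tau> x - v t x)" and ?b = "\<lambda>\<tau>. N s (\<lambda>x. w \<tau> x - w t x)"
    have "((\<lambda>\<tau>. K * ?a \<tau> * (?b \<tau> + N s (w t)) + K * N r (v t) * ?b \<tau>)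
        \<longlongrightarrow> K * 0 * (0 + N s (w t)) + K * N r (v t) * 0) (at t within {0..T})"
      by (intro tendsto_add tendsto_mult tendsto_const C0D v w t)
    then show "((\<lambda>\<tau>. K * ?a \<tau> * (?b \<tau> + N s (w t)) + K * N r (v t) * ?b \<tau>) \<longlongrightarrow> 0) (at t within {0..T})" by simp
    fix \<tau> assume \<tau>: "\<tau> \<in> {0..T}"
    show "0 \<le> N r (\<lambda>x. v \<tau> x * w \<tau> x - v t x * w t x)"
      by (intro sobolev_norm_nonneg sobolev_diff m C0D v w t \<tau>)
    have vd: "(\<lambda>x. v \<tau> x - v t x) \<in> V r" and wd: "(\<lambda>x. w \<tau> x - w t x) \<in> V s"
      by (intro sobolev_diff C0D v w t \<tau>)+
    have "N s (w \<tau>) \<le> ?b \<tau> + N s (w t)"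
      using sobolev_add(2)[OF wd C0D(1)[OF w t]] by simp
    then have "K * ?a \<tau> * N s (w \<tau>) \<le> K * ?a \<tau> * (?b \<tau> + N s (w t))"
      using K_pos sobolev_norm_nonneg[OF vd] by (intro mult_left_mono) auto
    moreover have "N r (\<lambda>x. (v \<tau> x - v t x) * w \<tau> x + v t x * (w \<tau> x - w t x))
      \<le> N r (\<lambda>x. (v \<tau> x - v t x) * w \<tau> x) + N r (\<lambda>x. v t x * (w \<tau> x - w t x))"
      by (intro sobolev_add m vd wd C0D v w t \<tau>)
    moreover have "N r (\<lambda>x. (v \<tau> x - v t x) * w \<tau> x) \<le> K * ?a \<tau> * N s (w \<tau>)"
      by (intro m vd C0D w \<tau>)
    moreover have "N r (\<lambda>x. v t x * (w \<tau> x - w t x)) \<le> K * N r (v t) * ?b \<tau>"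
      by (intro m wd C0D v t)
    ultimately show "N r (\<lambda>x. v \<tau> x * w \<tau> x - v t x * w t x) \<le> K * ?a \<tau> * (?b \<tau> + N s (w t)) + K * N r (v t) * ?b \<tau>"
      by (simp add: algebra_simps)
  qed
qed

lemmas C0_mult = C0_mult_gen[OF _ _ s_ineqs(3,4)] and C0_mult1 = C0_mult_gen[OF _ _ s_ineqs(1,2)]

lemma C0_const: "(\<lambda>t x. c) \<in> C0 r"
proof (rule C0I)
  have "N r (\<lambda>x. 0) = 0"
    using sobolev_cmult(2)[OF const_V[of 1 r], of 0] sobolev_norm_nonneg[OF const_V[of 0 r]] by simp
  then show "((\<lambda>\<tau>. N r (\<lambda>x. c - c)) \<longlongrightarrow> 0) (at t within {0..T})" for t by simp
qed (rule const_V)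

lemma C0_cmult: "v \<in> C0 r \<Longrightarrow> r = s \<or> r = s - 1 \<Longrightarrow> (\<lambda>t x. c * v t x) \<in> C0 r"
  using C0_mult[OF _ C0_const[of c]] C0_mult1[OF _ C0_const[of c]] by (auto simp: mult.commute)

lemma C0_diff: "v \<in> C0 r \<Longrightarrow> w \<in> C0 r \<Longrightarrow> r = s \<or> r = s - 1 \<Longrightarrow> (\<lambda>t x. v t x - w t x) \<in> C0 r"
  using C0_add[of v r "\<lambda>t x. (-1) * w t x"] C0_cmult[of w r "-1"] by auto

lemma C0_eventually_bounded:
  assumes v: "v \<in> C0 r" and t: "t \<in> {0..T}"
  shows "\<forall>\<^sub>F \<tau> in at t within {0..T}. \<tau> \<in> {0..T} \<longrightarrow> N r (v \<tau>) \<le> N r (v t) + 1"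
proof -
  have "\<forall>\<^sub>F \<tau> in at t within {0..T}. N r (\<lambda>x. v \<tau> x - v t x) < 1"
    using C0D(2)[OF v t] by (rule order_tendstoD) simp
  then show ?thesis
  proof eventually_elim
    case (elim \<tau>)
    show ?case
      using sobolev_add(2)[OF sobolev_diff(1)[OF C0D(1)[OF v, of \<tau>] C0D(1)[OF v t]] C0D(1)[OF v t]] elim by auto
  qed
qed

text \<open>Near \<open>t\<close> the norms stay below \<open>N s (v t) + 1\<close>, so the divided
  difference is bounded uniformly in H^s and the increment of the composition is controlled by that
  of \<open>v\<close>.\<close>

lemma C0_ps:
  assumes c: "entire_coeffs c" and v: "v \<in> C0 s"
  shows "(\<lambda>t x. ps c (v t x)) \<in> C0 s"
proof (rule C0I)
  fix t assume t: "t \<in> {0..T}"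
  show "(\<lambda>x. ps c (v t x)) \<in> V s" by (intro ps_V c C0D v t)
  define R where "R = max 1 (K * (N s (v t) + 1))"
  have R1: "1 \<le> R" by (simp add: R_def)
  have Rt: "K * N s (v t) \<le> R" unfolding R_def using K_pos by (intro max.coboundedI2 mult_left_mono) auto
  show "((\<lambda>\<tau>. N s (\<lambda>x. ps c (v \<tau> x) - ps c (v t x))) \<longlongrightarrow> 0) (at t within {0..T})"
  proof (rule tendsto_0_on_eventually[OF _ C0_eventually_bounded[OF v t]])
    have "((\<lambda>\<tau>. K * N s (\<lambda>x. v \<tau> x - v t x) * ps_bound c R) \<longlongrightarrow> K * 0 * ps_bound c R) (at t within {0..T})"
      by (intro tendsto_mult tendsto_const C0D v t)
    then show "((\<lambda>\<tau>. K * N s (\<lambda>x. v \<tau> x - v t x) * ps_bound c R) \<longlongrightarrow> 0) (at t within {0..T})" by simp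
    fix \<tau> assume \<tau>: "\<tau> \<in> {0..T}"
    show "0 \<le> N s (\<lambda>x. ps c (v \<tau> x) - ps c (v t x))"
      by (intro sobolev_norm_nonneg sobolev_diff ps_V c C0D v t \<tau>)
    assume "N s (v \<tau>) \<le> N s (v t) + 1"
    then have R\<tau>: "K * N s (v \<tau>) \<le> R" unfolding R_def using K_pos by (intro max.coboundedI2 mult_left_mono) auto
    note q = ps_quot_V[OF c C0D(1)[OF v \<tau>] C0D(1)[OF v t] R\<tau> Rt R1]
    have vd: "(\<lambda>x. v \<tau> x - v t x) \<in> V s" by (intro sobolev_diff C0D v t \<tau>)
    have "N s (\<lambda>x. (v \<tau> x - v t x) * ps_quot c (v \<tau> x) (v t x)) \<le> K * N s (\<lambda>x. v \<tau> x - v t x) * N s (\<lambda>x. ps_quot c (v \<tau> x) (v t x))"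
      by (rule mult_s(2)[OF vd q(1)])
    also have "\<dots> \<le> K * N s (\<lambda>x. v \<tau> x - v t x) * ps_bound c R"
      using K_pos sobolev_norm_nonneg[OF vd] by (intro mult_left_mono q(2)) auto
    finally show "N s (\<lambda>x. ps c (v \<tau> x) - ps c (v t x)) \<le> K * N s (\<lambda>x. v \<tau> x - v t x) * ps_bound c R"
      by (simp add: ps_identities(1)[OF c])
  qed
qed

text \<open>The derivative is an explicit second argument, so that the rules can be proved without
  \<open>SOME\<close>; \<open>tpair_time_deriv\<close> leads back to
  \<open>time_deriv\<close>.\<close>

definition tpair :: "(real \<Rightarrow> real^2 \<Rightarrow> real) \<Rightarrow> (real \<Rightarrow> real^2 \<Rightarrow> real) \<Rightarrow> bool" where
  "tpair v w \<longleftrightarrow> v \<in> C0 s \<and> w \<in> C0 (s - 1) \<and> has_time_deriv T (s - 1) D v w"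

abbreviation quot :: "(real \<Rightarrow> real^2 \<Rightarrow> real) \<Rightarrow> (real \<Rightarrow> real^2 \<Rightarrow> real) \<Rightarrow> real \<Rightarrow> real \<Rightarrow> real^2 \<Rightarrow> real" where
  "quot v w t \<tau> x \<equiv> (v \<tau> x - v t x) / (\<tau> - t) - w t x"

lemma tpairD:
  assumes "tpair v w"
  shows "v \<in> C0 s" "w \<in> C0 (s - 1)"
    "t \<in> {0..T} \<Longrightarrow> ((\<lambda>\<tau>. N (s - 1) (quot v w t \<tau>)) \<longlongrightarrow> 0) (at t within {0..T})"
  using assms by (auto simp: tpair_def has_time_deriv_def)

lemma tpairI:
  assumes v: "v \<in> C0 s" and w: "w \<in> C0 (s - 1)"
    and lim: "\<And>t. t \<in> {0..T} \<Longrightarrow> ((\<lambda>\<tau>. N (s - 1) (quot v w t \<tau>)) \<longlongrightarrow> 0) (at t within {0..T})"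
  shows "tpair v w"
  unfolding tpair_def has_time_deriv_def using v w lim C0D(1)[OF v] C0D(1)[OF w] mono_s1(1) by blast

lemma calH_iff: "v \<in> calH T s D \<longleftrightarrow> (\<exists>w. tpair v w)"
  by (auto simp: calH_def C1_sobolev_def tpair_def)

lemma quotient_V:
  assumes "f \<in> V (s - 1)" "g \<in> V (s - 1)" "h \<in> V (s - 1)"
  shows "(\<lambda>x. (f x - g x) / c) \<in> V (s - 1)" "(\<lambda>x. (f x - g x) / c - h x) \<in> V (s - 1)"
proof -
  show 1: "(\<lambda>x. (f x - g x) / c) \<in> V (s - 1)"
    using sobolev_cmult(1)[OF sobolev_diff(1)[OF assms(1,2)], of "1 / c"] by simp
  show "(\<lambda>x. (f x - g x) / c - h x) \<in> V (s - 1)" by (rule sobolev_diff(1)[OF 1 assms(3)])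
qed

lemma tpair_quot_V:
  assumes "tpair v w" "t \<in> {0..T}" "\<tau> \<in> {0..T}"
  shows "(\<lambda>x. (v \<tau> x - v t x) / (\<tau> - t)) \<in> V (s - 1)" "quot v w t \<tau> \<in> V (s - 1)"
  using tpairD[OF assms(1)] assms(2,3) quotient_V[OF mono_s1(1)[OF C0D(1)] mono_s1(1)[OF C0D(1)] C0D(1)] by blast+

text \<open>Both are limits of the same quotients in H^{s-1}, and a difference of norm zero vanishes
  a.e. on \<open>D\<close>.\<close>

lemma time_deriv_unique:
  assumes w: "has_time_deriv T (s - 1) D v w" and w': "has_time_deriv T (s - 1) D v w'" and t: "t \<in> {0..T}"
  shows "AE_on D (\<lambda>x. w t x = w' t x)"
proof -
  note wt = w[unfolded has_time_deriv_def, rule_format] w'[unfolded has_time_deriv_def, rule_format]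
  have d: "(\<lambda>x. w t x - w' t x) \<in> V (s - 1)" using wt[of t] t by (intro sobolev_diff) auto
  have "((\<lambda>\<tau>. N (s - 1) (\<lambda>x. w t x - w' t x)) \<longlongrightarrow> 0) (at t within {0..T})"
  proof (rule tendsto_0_on)
    show "((\<lambda>\<tau>. N (s - 1) (quot v w' t \<tau>) + N (s - 1) (quot v w t \<tau>)) \<longlongrightarrow> 0) (at t within {0..T})"
      using tendsto_add[of "\<lambda>\<tau>. N (s - 1) (quot v w' t \<tau>)" 0 _ "\<lambda>\<tau>. N (s - 1) (quot v w t \<tau>)" 0] wt[of t] t by simp
    fix \<tau> assume \<tau>: "\<tau> \<in> {0..T}"
    have q: "quot v w t \<tau> \<in> V (s - 1)" "quot v w' t \<tau> \<in> V (s - 1)"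
      using wt[of t] wt[of \<tau>] t \<tau> by (auto intro!: quotient_V)
    show "N (s - 1) (\<lambda>x. w t x - w' t x) \<le> N (s - 1) (quot v w' t \<tau>) + N (s - 1) (quot v w t \<tau>)"
      using sobolev_diff(2)[OF q(2,1)] by simp
  qed (rule sobolev_norm_nonneg[OF d])
  \<comment> \<open>\<open>T > 0\<close> makes every time a limit point of the interval; at an
    isolated time any function would be a derivative.\<close>
  moreover have "at t within {0..T} \<noteq> bot"
  proof -
    have "{0..T} \<noteq> {a}" for a using T by (metis atLeastAtMost_iff less_eq_real_def order_refl singletonD less_irrefl)
    then have "t islimpt {0..T}" using t by (intro connected_imp_perfect) auto
    then show ?thesis by (simp add: trivial_limit_within)
  qed
  ultimately have "N (s - 1) (\<lambda>x. w t x - w' t x) = 0" by (simp add: tendsto_const_iff)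
  from sobolev_norm_eq_0D[OF d s_ineqs(1) open_D this] show ?thesis by simp
qed

lemma tpair_time_deriv:
  assumes "tpair v w"
  shows "tpair v (time_deriv T (s - 1) D v)" "t \<in> {0..T} \<Longrightarrow> AE_on D (\<lambda>x. time_deriv T (s - 1) D v t x = w t x)"
proof -
  have h: "has_time_deriv T (s - 1) D v w" using assms by (simp add: tpair_def)
  then have h': "has_time_deriv T (s - 1) D v (time_deriv T (s - 1) D v)"
    unfolding time_deriv_def by (rule someI[of "has_time_deriv T (s - 1) D v" w])
  show ae: "t \<in> {0..T} \<Longrightarrow> AE_on D (\<lambda>x. time_deriv T (s - 1) D v t x = w t x)" for t
    by (rule time_deriv_unique[OF h' h])
  show "tpair v (time_deriv T (s - 1) D v)"
    using h' C0_cong[OF tpairD(2)[OF assms] ae] assms by (simp add: tpair_def)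
qed

lemma tpair_cong:
  assumes vw: "tpair v w" and eq: "\<And>t. t \<in> {0..T} \<Longrightarrow> AE_on D (\<lambda>x. v' t x = v t x)"
  shows "tpair v' w"
proof (rule tpairI)
  note d = tpairD[OF vw]
  show "v' \<in> C0 s" by (rule C0_cong[OF d(1) eq])
  show "w \<in> C0 (s - 1)" by (rule d)
  fix t assume t: "t \<in> {0..T}"
  have e: "N (s - 1) (quot v' w t \<tau>) = N (s - 1) (quot v w t \<tau>)" if "\<tau> \<in> {0..T}" for \<tau>
    by (rule sobolev_cong(2)) (use eq[OF t] eq[OF that] in \<open>auto elim!: eventually_elim2\<close>)
  show "((\<lambda>\<tau>. N (s - 1) (quot v' w t \<tau>)) \<longlongrightarrow> 0) (at t within {0..T})"
    by (rule tendsto_0_on[OF d(3)[OF t]]) (use e sobolev_norm_nonneg[OF tpair_quot_V(2)[OF vw t]] in auto)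
qed

lemma tpair_add:
  assumes "tpair v w" "tpair v' w'"
  shows "tpair (\<lambda>t x. v t x + v' t x) (\<lambda>t x. w t x + w' t x)"
proof (rule tpairI)
  note d = tpairD[OF assms(1)] and d' = tpairD[OF assms(2)]
  show "(\<lambda>t x. v t x + v' t x) \<in> C0 s" "(\<lambda>t x. w t x + w' t x) \<in> C0 (s - 1)" by (intro C0_add d d')+
  fix t assume t: "t \<in> {0..T}"
  have e: "quot (\<lambda>t x. v t x + v' t x) (\<lambda>t x. w t x + w' t x) t \<tau> = (\<lambda>x. quot v w t \<tau> x + quot v' w' t \<tau> x)" for \<tau>
    by (auto simp: add_divide_distrib diff_divide_distrib)
  show "((\<lambda>\<tau>. N (s - 1) (quot (\<lambda>t x. v t x + v' t x) (\<lambda>t x. w t x + w' t x) t \<tau>)) \<longlongrightarrow> 0) (at t within {0..T})"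
    unfolding e
  proof (rule tendsto_0_on)
    show "((\<lambda>\<tau>. N (s - 1) (quot v w t \<tau>) + N (s - 1) (quot v' w' t \<tau>)) \<longlongrightarrow> 0) (at t within {0..T})"
      using tendsto_add[OF d(3)[OF t] d'(3)[OF t]] by simp
    fix \<tau> assume \<tau>: "\<tau> \<in> {0..T}"
    note q = tpair_quot_V(2)[OF assms(1) t \<tau>] tpair_quot_V(2)[OF assms(2) t \<tau>]
    show "0 \<le> N (s - 1) (\<lambda>x. quot v w t \<tau> x + quot v' w' t \<tau> x)" by (intro sobolev_norm_nonneg sobolev_add q)
    show "N (s - 1) (\<lambda>x. quot v w t \<tau> x + quot v' w' t \<tau> x) \<le> N (s - 1) (quot v w t \<tau>) + N (s - 1) (quot v' w' t \<tau>)"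
      by (rule sobolev_add(2)[OF q])
  qed
qed

lemma tpair_const: "tpair (\<lambda>t x. c) (\<lambda>t x. 0)"
proof (rule tpairI)
  show "((\<lambda>\<tau>. N (s - 1) (quot (\<lambda>t x. c) (\<lambda>t x. 0) t \<tau>)) \<longlongrightarrow> 0) (at t within {0..T})" if "t \<in> {0..T}" for t
    using C0D(2)[OF C0_const[of c "s - 1"] that] by simp
qed (rule C0_const)+

lemma tpair_mult:
  assumes "tpair v w" "tpair v' w'"
  shows "tpair (\<lambda>t x. v t x * v' t x) (\<lambda>t x. w t x * v' t x + w' t x * v t x)"
proof (rule tpairI)
  note d = tpairD[OF assms(1)] and d' = tpairD[OF assms(2)]
  show "(\<lambda>t x. v t x * v' t x) \<in> C0 s" by (intro C0_mult d d')
  show "(\<lambda>t x. w t x * v' t x + w' t x * v t x) \<in> C0 (s - 1)" by (intro C0_add C0_mult1 d d')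
  fix t assume t: "t \<in> {0..T}"
  let ?n = "N (s - 1)"
  \<comment> \<open>Each summand has one factor in H^{s-1} and one in H^s, and one of the two tends
    to 0; the difference quotients are never measured in H^s.\<close>
  have e: "quot (\<lambda>t x. v t x * v' t x) (\<lambda>t x. w t x * v' t x + w' t x * v t x) t \<tau>
     = (\<lambda>x. quot v w t \<tau> x * v' \<tau> x + (w t x * (v' \<tau> x - v' t x) + quot v' w' t \<tau> x * v t x))" for \<tau>
    by (auto simp: algebra_simps add_divide_distrib diff_divide_distrib)
  show "((\<lambda>\<tau>. ?n (quot (\<lambda>t x. v t x * v' t x) (\<lambda>t x. w t x * v' t x + w' t x * v t x) t \<tau>)) \<longlongrightarrow> 0) (at t within {0..T})"
    unfolding e
  proof (rule tendsto_0_on_eventually[OF _ C0_eventually_bounded[OF d'(1) t]])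
    let ?g = "\<lambda>\<tau>. K * ?n (quot v w t \<tau>) * (N s (v' t) + 1) + (K * ?n (w t) * N s (\<lambda>x. v' \<tau> x - v' t x) + K * ?n (quot v' w' t \<tau>) * N s (v t))"
    have "(?g \<longlongrightarrow> K * 0 * (N s (v' t) + 1) + (K * ?n (w t) * 0 + K * 0 * N s (v t))) (at t within {0..T})"
      by (intro tendsto_add tendsto_mult tendsto_const d(3) d'(3) C0D(2)[OF d'(1)] t)
    then show "(?g \<longlongrightarrow> 0) (at t within {0..T})" by simp
    fix \<tau> assume \<tau>: "\<tau> \<in> {0..T}"
    note q = tpair_quot_V(2)[OF assms(1) t \<tau>] tpair_quot_V(2)[OF assms(2) t \<tau>]
    have vd: "(\<lambda>x. v' \<tau> x - v' t x) \<in> V s" by (intro sobolev_diff C0D[OF d'(1)] t \<tau>)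
    have p: "(\<lambda>x. quot v w t \<tau> x * v' \<tau> x) \<in> V (s - 1)" "(\<lambda>x. w t x * (v' \<tau> x - v' t x)) \<in> V (s - 1)"
      "(\<lambda>x. quot v' w' t \<tau> x * v t x) \<in> V (s - 1)"
      by (intro mult_s1 q vd C0D[OF d(1)] C0D[OF d'(1)] C0D[OF d(2)] t \<tau>)+
    have p23: "(\<lambda>x. w t x * (v' \<tau> x - v' t x) + quot v' w' t \<tau> x * v t x) \<in> V (s - 1)" by (intro sobolev_add p)
    show "0 \<le> ?n (\<lambda>x. quot v w t \<tau> x * v' \<tau> x + (w t x * (v' \<tau> x - v' t x) + quot v' w' t \<tau> x * v t x))"
      by (intro sobolev_norm_nonneg sobolev_add p p23)
    assume b: "N s (v' \<tau>) \<le> N s (v' t) + 1"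
    have "?n (\<lambda>x. quot v w t \<tau> x * v' \<tau> x) \<le> K * ?n (quot v w t \<tau>) * N s (v' \<tau>)"
      by (rule mult_s1(2)[OF q(1) C0D(1)[OF d'(1) \<tau>]])
    also have "\<dots> \<le> K * ?n (quot v w t \<tau>) * (N s (v' t) + 1)"
      using K_pos sobolev_norm_nonneg[OF q(1)] b by (intro mult_left_mono) auto
    finally have 1: "?n (\<lambda>x. quot v w t \<tau> x * v' \<tau> x) \<le> K * ?n (quot v w t \<tau>) * (N s (v' t) + 1)" .
    have 2: "?n (\<lambda>x. w t x * (v' \<tau> x - v' t x)) \<le> K * ?n (w t) * N s (\<lambda>x. v' \<tau> x - v' t x)"
      by (rule mult_s1(2)[OF C0D(1)[OF d(2) t] vd])
    have 3: "?n (\<lambda>x. quot v' w' t \<tau> x * v t x) \<le> K * ?n (quot v' w' t \<tau>) * N s (v t)"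
      by (rule mult_s1(2)[OF q(2) C0D(1)[OF d(1) t]])
    show "?n (\<lambda>x. quot v w t \<tau> x * v' \<tau> x + (w t x * (v' \<tau> x - v' t x) + quot v' w' t \<tau> x * v t x)) \<le> ?g \<tau>"
      using sobolev_add(2)[OF p(1) p23] sobolev_add(2)[OF p(2,3)] 1 2 3 by linarith
  qed
qed

text \<open>With d the increment of \<open>v\<close> and h that of time, the error is (d/h - w)
  f'(v) + (d/h) (d S). The quotient d/h is bounded in H^{s-1} only; the second term vanishes because
  d S tends to 0 in H^s.\<close>

lemma tpair_ps:
  assumes c: "entire_coeffs c" and "tpair v w"
  shows "tpair (\<lambda>t x. ps c (v t x)) (\<lambda>t x. w t x * ps (diffs c) (v t x))"
proof (rule tpairI)
  note d = tpairD[OF assms(2)] and c' = entire_coeffs_diffs[OF c]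
  show "(\<lambda>t x. ps c (v t x)) \<in> C0 s" by (intro C0_ps c d)
  show "(\<lambda>t x. w t x * ps (diffs c) (v t x)) \<in> C0 (s - 1)" by (intro C0_mult1 C0_ps c' d)
  fix t assume t: "t \<in> {0..T}"
  let ?n = "N (s - 1)" and ?d = "\<lambda>\<tau> x. v \<tau> x - v t x" and ?S = "\<lambda>\<tau> x. ps_quot2 c (v \<tau> x) (v t x)"
  have e: "quot (\<lambda>t x. ps c (v t x)) (\<lambda>t x. w t x * ps (diffs c) (v t x)) t \<tau>
     = (\<lambda>x. quot v w t \<tau> x * ps (diffs c) (v t x) + (?d \<tau> x / (\<tau> - t)) * (?d \<tau> x * ?S \<tau> x))" for \<tau>
  proof
    fix x
    have "ps c (v \<tau> x) - ps c (v t x) = ?d \<tau> x * (ps (diffs c) (v t x) + ?d \<tau> x * ?S \<tau> x)"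
    proof -
      have "ps_quot c (v \<tau> x) (v t x) = ps (diffs c) (v t x) + ?d \<tau> x * ?S \<tau> x"
        using ps_identities(2)[OF c, of "v \<tau> x" "v t x"] by linarith
      then show ?thesis unfolding ps_identities(1)[OF c] by simp
    qed
    moreover have "d * (p + d * S) / h - w * p = (d / h - w) * p + d / h * (d * S)" for d p S h w :: real
      by (simp add: algebra_simps add_divide_distrib)
    ultimately show "quot (\<lambda>t x. ps c (v t x)) (\<lambda>t x. w t x * ps (diffs c) (v t x)) t \<tau> x
       = quot v w t \<tau> x * ps (diffs c) (v t x) + (?d \<tau> x / (\<tau> - t)) * (?d \<tau> x * ?S \<tau> x)"
      by (simp only:)
  qed
  define R where "R = max 1 (K * (N s (v t) + 1))"
  have R1: "1 \<le> R" by (simp add: R_def)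
  have Rt: "K * N s (v t) \<le> R" unfolding R_def using K_pos by (intro max.coboundedI2 mult_left_mono) auto
  show "((\<lambda>\<tau>. ?n (quot (\<lambda>t x. ps c (v t x)) (\<lambda>t x. w t x * ps (diffs c) (v t x)) t \<tau>)) \<longlongrightarrow> 0) (at t within {0..T})"
    unfolding e
  proof (rule tendsto_0_on_eventually[OF _ C0_eventually_bounded[OF d(1) t]])
    let ?g = "\<lambda>\<tau>. K * ?n (quot v w t \<tau>) * N s (\<lambda>x. ps (diffs c) (v t x))
      + K * (?n (quot v w t \<tau>) + ?n (w t)) * (K * N s (?d \<tau>) * ps_bound c R)"
    have "(?g \<longlongrightarrow> K * 0 * N s (\<lambda>x. ps (diffs c) (v t x)) + K * (0 + ?n (w t)) * (K * 0 * ps_bound c R)) (at t within {0..T})"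
      by (intro tendsto_add tendsto_mult tendsto_const d(3) C0D(2)[OF d(1)] t)
    then show "(?g \<longlongrightarrow> 0) (at t within {0..T})" by simp
    fix \<tau> assume \<tau>: "\<tau> \<in> {0..T}"
    note q = tpair_quot_V[OF assms(2) t \<tau>]
    have vd: "?d \<tau> \<in> V s" by (intro sobolev_diff C0D[OF d(1)] t \<tau>)
    \<comment> \<open>Only membership is wanted here, so the radius is any number that fits both
      norms; the uniform bound with \<open>R\<close> comes below.\<close>
    have SV: "?S \<tau> \<in> V s"
      by (rule ps_quot_V(3)[OF c C0D(1)[OF d(1) \<tau>] C0D(1)[OF d(1) t], of "max 1 (max (K * N s (v \<tau>)) (K * N s (v t)))"]) auto
    have dS: "(\<lambda>x. ?d \<tau> x * ?S \<tau> x) \<in> V s" by (rule mult_s(1)[OF vd SV])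
    have p: "(\<lambda>x. quot v w t \<tau> x * ps (diffs c) (v t x)) \<in> V (s - 1)"
       "(\<lambda>x. (?d \<tau> x / (\<tau> - t)) * (?d \<tau> x * ?S \<tau> x)) \<in> V (s - 1)"
      by (intro mult_s1 q dS ps_V c' C0D[OF d(1)] t)+
    show "0 \<le> ?n (\<lambda>x. quot v w t \<tau> x * ps (diffs c) (v t x) + (?d \<tau> x / (\<tau> - t)) * (?d \<tau> x * ?S \<tau> x))"
      by (intro sobolev_norm_nonneg sobolev_add p)
    assume "N s (v \<tau>) \<le> N s (v t) + 1"
    then have R\<tau>: "K * N s (v \<tau>) \<le> R" unfolding R_def using K_pos by (intro max.coboundedI2 mult_left_mono) auto
    note Sb = ps_quot_V(4)[OF c C0D(1)[OF d(1) \<tau>] C0D(1)[OF d(1) t] R\<tau> Rt R1]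
    have "N s (\<lambda>x. ?d \<tau> x * ?S \<tau> x) \<le> K * N s (?d \<tau>) * N s (?S \<tau>)" by (rule mult_s(2)[OF vd SV])
    also have "\<dots> \<le> K * N s (?d \<tau>) * ps_bound c R"
      using K_pos sobolev_norm_nonneg[OF vd] by (intro mult_left_mono Sb) auto
    finally have dSb: "N s (\<lambda>x. ?d \<tau> x * ?S \<tau> x) \<le> K * N s (?d \<tau>) * ps_bound c R" .
    have qb: "?n (\<lambda>x. ?d \<tau> x / (\<tau> - t)) \<le> ?n (quot v w t \<tau>) + ?n (w t)"
      using sobolev_add(2)[OF q(2) C0D(1)[OF d(2) t]] by simp
    have "?n (\<lambda>x. (?d \<tau> x / (\<tau> - t)) * (?d \<tau> x * ?S \<tau> x)) \<le> K * ?n (\<lambda>x. ?d \<tau> x / (\<tau> - t)) * N s (\<lambda>x. ?d \<tau> x * ?S \<tau> x)"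
      by (rule mult_s1(2)[OF q(1) dS])
    also have "\<dots> \<le> K * (?n (quot v w t \<tau>) + ?n (w t)) * (K * N s (?d \<tau>) * ps_bound c R)"
      using K_pos qb dSb sobolev_norm_nonneg[OF q(1)] sobolev_norm_nonneg[OF dS] by (intro mult_mono) auto
    finally have 2: "?n (\<lambda>x. (?d \<tau> x / (\<tau> - t)) * (?d \<tau> x * ?S \<tau> x)) \<le> K * (?n (quot v w t \<tau>) + ?n (w t)) * (K * N s (?d \<tau>) * ps_bound c R)" .
    have 1: "?n (\<lambda>x. quot v w t \<tau> x * ps (diffs c) (v t x)) \<le> K * ?n (quot v w t \<tau>) * N s (\<lambda>x. ps (diffs c) (v t x))"
      by (intro mult_s1 q ps_V c' C0D[OF d(1)] t)
    show "?n (\<lambda>x. quot v w t \<tau> x * ps (diffs c) (v t x) + (?d \<tau> x / (\<tau> - t)) * (?d \<tau> x * ?S \<tau> x)) \<le> ?g \<tau>"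
      using sobolev_add(2)[OF p] 1 2 by linarith
  qed
qed

end

section \<open>Weak derivatives\<close>

text \<open>Elements of \<open>sobolev\<close> are arbitrary representatives that agree a.e. on
  \<open>D\<close> with Borel functions; completeness of Lebesgue measure makes the integrals in
  \<open>has_weak_partial\<close> meaningful for them.\<close>

lemma lebesgue_measurable_AE:
  fixes f h :: "real^2 \<Rightarrow> real"
  assumes h: "h \<in> borel_measurable lborel" and eq: "AE x in lborel. f x = h x"
  shows "f \<in> borel_measurable lebesgue"
proof (rule measurableI)
  fix A :: "real set" assume A: "A \<in> sets borel"
  have hA: "h -` A \<inter> space lebesgue \<in> sets lebesgue"
    using measurable_sets[OF measurable_completion[OF h] A] .
  have "AE x in lebesgue. f x = h x" using eq by (rule AE_completion)
  then have "AE x in lebesgue. x \<in> h -` A \<inter> space lebesgue \<longleftrightarrow> x \<in> f -` A \<inter> space lebesgue"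
    by eventually_elim auto
  from completion.in_sets_AE[OF this hA] show "f -` A \<inter> space lebesgue \<in> sets lebesgue" by simp
qed simp

text \<open>Integrability on balls rather than on the plane: a power series in a bounded L^2
  function is bounded, but need not decay.\<close>

definition L1loc :: "(real^2 \<Rightarrow> real) \<Rightarrow> bool" where
  "L1loc F \<longleftrightarrow> F \<in> borel_measurable lborel \<and> (\<forall>R. integrable lborel (\<lambda>x. indicator (cball 0 R) x * F x))"

lemma L1locD:
  assumes "L1loc F"
  shows "F \<in> borel_measurable lborel" "integrable lborel (\<lambda>x. indicator (cball 0 R) x * F x)"
  using assms by (auto simp: L1loc_def)

lemma L1loc_integrable: "integrable lborel F \<Longrightarrow> L1loc F"
  unfolding L1loc_def using integrable_mult_indicator[of _ lborel F] by auto

lemma L1loc_square_integrable: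
  assumes F: "square_integrable F"
  shows "L1loc F"
  unfolding L1loc_def
  using square_integrable_times(1)[OF square_integrable_indicator_cball[where c=1] F] square_integrable_measurable[OF F]
  by auto

lemma L1loc_bounded_mult:
  assumes F: "L1loc F" and b: "AE x in lborel. \<bar>b x\<bar> \<le> C" and bm: "b \<in> borel_measurable lborel"
  shows "L1loc (\<lambda>x. b x * F x)"
  unfolding L1loc_def
proof (intro conjI allI)
  note [measurable] = bm L1locD(1)[OF F]
  show "(\<lambda>x. b x * F x) \<in> borel_measurable lborel" by measurable
  fix R
  have [measurable]: "cball (0::real^2) R \<in> sets borel" by simp
  have "integrable lborel (\<lambda>x. C * (indicator (cball 0 R) x * F x))" using L1locD(2)[OF F] by simp
  then show "integrable lborel (\<lambda>x. indicator (cball 0 R) x * (b x * F x))"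
  proof (rule Bochner_Integration.integrable_bound)
    show "AE x in lborel. norm (indicator (cball 0 R) x * (b x * F x)) \<le> norm (C * (indicator (cball 0 R) x * F x))"
      using b by eventually_elim (auto simp: indicator_def abs_mult intro!: mult_right_mono)
  qed measurable
qed

lemma L1loc_const: "L1loc (\<lambda>x. c)"
  unfolding L1loc_def using integrable_indicator_cball[of c] by (auto simp: mult.commute)

lemma L1loc_add: "L1loc F \<Longrightarrow> L1loc G \<Longrightarrow> L1loc (\<lambda>x. F x + G x)"
  unfolding L1loc_def by (auto simp: distrib_left)

lemma L1loc_times_bounded_support:
  assumes F: "L1loc F" and m: "p \<in> borel_measurable lborel" and p: "\<And>x. \<bar>p x\<bar> \<le> C * indicator (cball 0 R) x"
  shows "integrable lborel (\<lambda>x. F x * p x)"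
proof -
  note [measurable] = m L1locD(1)[OF F]
  have "integrable lborel (\<lambda>x. C * (indicator (cball 0 R) x * F x))" using L1locD(2)[OF F] by simp
  then show ?thesis
  proof (rule Bochner_Integration.integrable_bound)
    show "AE x in lborel. norm (F x * p x) \<le> norm (C * (indicator (cball 0 R) x * F x))"
    proof (rule AE_I2)
      fix x
      have "\<bar>F x\<bar> * \<bar>p x\<bar> \<le> \<bar>F x\<bar> * \<bar>C * indicator (cball 0 R) x\<bar>"
        using p[of x] by (intro mult_left_mono) auto
      then show "norm (F x * p x) \<le> norm (C * (indicator (cball 0 R) x * F x))" by (simp add: abs_mult mult_ac)
    qed
  qed measurable
qed

text \<open>Local L^1 convergence is weak enough to hold for products and compositions of L^2
  functions, and strong enough to yield weak derivatives, since test functions have compact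
  support.\<close>

definition dqlim :: "2 \<Rightarrow> (real^2 \<Rightarrow> real) \<Rightarrow> (real^2 \<Rightarrow> real) \<Rightarrow> bool" where
  "dqlim k F G \<longleftrightarrow> (\<forall>R. (\<lambda>n. LINT x|lborel. indicator (cball 0 R) x * \<bar>diff_quot k n F x - G x\<bar>) \<longlonglongrightarrow> 0)"

lemma test_function_bound2:
  assumes "test_function D \<phi>"
  obtains C R where "C \<ge> 0" "R \<ge> 0" "\<And>x. \<bar>\<phi> x\<bar> \<le> C * indicator (cball 0 R) x"
proof -
  obtain C R where CR: "C \<ge> 0" "R > 0" "\<And>x. \<bar>\<phi> x\<bar> \<le> C" "\<And>x. norm x > R \<Longrightarrow> \<phi> x = 0"
    using test_function_bound[OF assms] by metis
  have "\<bar>\<phi> x\<bar> \<le> C * indicator (cball 0 R) x" for x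
    by (cases "norm x > R") (use CR(3)[of x] CR(4)[of x] in \<open>auto simp: indicator_def\<close>)
  then show thesis using that[of C R] CR(1,2) by auto
qed

lemma L1loc_translate:
  assumes F: "L1loc F"
  shows "L1loc (\<lambda>x. F (x + h))"
  unfolding L1loc_def
proof (intro conjI allI)
  have [measurable]: "F \<in> borel_measurable borel" using L1locD(1)[OF F] by simp
  show "(\<lambda>x. F (x + h)) \<in> borel_measurable lborel" by measurable
  fix R
  have [measurable]: "cball (0::real^2) R \<in> sets borel" by simp
  have "integrable lborel (\<lambda>x. indicator (cball 0 (R + norm h)) (x + h) * F (x + h))"
    using L1locD(2)[OF F, of "R + norm h"] by (subst integral_translate(2)[of "\<lambda>x. indicator (cball 0 (R + norm h)) x * F x"]) auto
  then show "integrable lborel (\<lambda>x. indicator (cball 0 R) x * F (x + h))"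
  proof (rule Bochner_Integration.integrable_bound)
    show "AE x in lborel. norm (indicator (cball 0 R) x * F (x + h)) \<le> norm (indicator (cball 0 (R + norm h)) (x + h) * F (x + h))"
    proof (rule AE_I2)
      fix x :: "real^2"
      show "norm (indicator (cball 0 R) x * F (x + h)) \<le> norm (indicator (cball 0 (R + norm h)) (x + h) * F (x + h))"
        using norm_triangle_ineq[of x h] by (auto simp: indicator_def)
    qed
  qed measurable
qed

lemma L1loc_diff_quot: "L1loc F \<Longrightarrow> L1loc (diff_quot k n F)"
  using L1loc_add[OF L1loc_bounded_mult[OF L1loc_translate, of F "\<lambda>x. real (Suc n)" "real (Suc n)" "axis k (1 / real (Suc n))"]
      L1loc_bounded_mult[of F "\<lambda>x. - real (Suc n)" "real (Suc n)"]]
  by (simp add: diff_quot_def[abs_def] right_diff_distrib del: of_nat_Suc)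

text \<open>Discrete integration by parts, moving the difference quotient from \<open>F\<close> to the test function.\<close>

lemma dqlim_weak_partial:
  assumes F: "L1loc F" and G: "L1loc G" and lim: "dqlim k F G" and \<phi>: "test_function D \<phi>"
  shows "(LINT x|lborel. F x * pd k \<phi> x) = - (LINT x|lborel. G x * \<phi> x)"
proof -
  have [measurable]: "F \<in> borel_measurable borel" "G \<in> borel_measurable borel"
    using L1locD(1)[OF F] L1locD(1)[OF G] by auto
  note [measurable] = test_function_measurable[OF \<phi>] test_function_measurable[OF test_function_pd[OF \<phi>]]
  \<comment> \<open>Moving the shift onto the test function reverses its sign, hence the backward
    step.\<close>
  define h where "h n = - (1 / real (Suc n))" for n
  let ?e = "\<lambda>n. axis k (1 / real (Suc n)) :: real^2"
  let ?q = "\<lambda>n x. (\<phi> (x + axis k (h n)) - \<phi> x) / h n"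
  have ax: "axis k (h n) = - ?e n" for n by (simp add: h_def vec_eq_iff axis_def)
  have hlim: "h \<longlonglongrightarrow> 0" "h n \<noteq> 0" "\<bar>h n\<bar> \<le> 1" for n
    using tendsto_minus[OF LIMSEQ_Suc[OF lim_1_over_n[where ?'a=real]]] by (auto simp: h_def[abs_def] simp del: of_nat_Suc)
  obtain C R where C: "C \<ge> 0" "R \<ge> 0" "\<And>x. \<bar>pd k \<phi> x\<bar> \<le> C * indicator (cball 0 R) x"
    using test_function_bound2[OF test_function_pd[OF \<phi>]] by metis
  obtain C' R' where C': "C' \<ge> 0" "R' \<ge> 0" "\<And>x. \<bar>\<phi> x\<bar> \<le> C' * indicator (cball 0 R') x"
    using test_function_bound2[OF \<phi>] by metis
  define r where "r = max R R' + 1"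
  have qb: "\<bar>?q n x\<bar> \<le> C * indicator (cball 0 r) x" for n x
  proof (cases "norm x > r")
    case True
    have "axis k (h n) = h n *\<^sub>R (axis k 1 :: real^2)" by (simp add: vec_eq_iff axis_def)
    then have "norm (axis k (h n) :: real^2) \<le> 1" using hlim(3)[of n] by (simp add: norm_axis_1)
    then have "norm (x + axis k (h n)) > R'"
      using True norm_triangle_ineq4[of "x + axis k (h n)" "axis k (h n)"] by (simp add: r_def)
    moreover have "norm x > R'" using True by (simp add: r_def)
    moreover have "\<phi> y = 0" if "norm y > R'" for y using C'(3)[of y] that by simp
    ultimately show ?thesis using C(1) by simp
  next
    case False
    have ax0: "axis k (0::real) = (0 :: real^2)" by (simp add: vec_eq_iff axis_def)
    have "\<bar>pd k \<phi> y\<bar> \<le> C" for y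
      by (cases "norm y \<le> R") (use C(3)[of y] C(1) in auto)
    then have "norm (\<phi> (x + axis k (h n)) - \<phi> (x + axis k 0)) \<le> C * norm (h n - 0)"
      by (intro field_differentiable_bound[of UNIV _ "\<lambda>t. pd k \<phi> (x + axis k t)"])
        (use test_function_line_deriv[OF \<phi>] in auto)
    then have "\<bar>?q n x\<bar> \<le> C" using hlim(2)[of n] by (simp add: ax0 abs_divide pos_divide_le_eq)
    then show ?thesis using False C(1) by simp
  qed
  have [measurable]: "cball (0::real^2) r \<in> sets borel" by simp
  have L: "(\<lambda>n. LINT x|lborel. F x * ?q n x) \<longlonglongrightarrow> (LINT x|lborel. F x * pd k \<phi> x)"
  proof (rule integral_dominated_convergence[where w="\<lambda>x. \<bar>F x * (C * indicator (cball 0 r) x)\<bar>"])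
    show "integrable lborel (\<lambda>x. \<bar>F x * (C * indicator (cball 0 r) x)\<bar>)"
      by (intro integrable_abs L1loc_times_bounded_support[OF F, of _ C r]) (use C(1) in \<open>auto simp: abs_mult\<close>)
    show "AE x in lborel. norm (F x * ?q n x) \<le> \<bar>F x * (C * indicator (cball 0 r) x)\<bar>" for n
    proof (rule AE_I2)
      fix x
      have "\<bar>F x\<bar> * \<bar>?q n x\<bar> \<le> \<bar>F x\<bar> * \<bar>C * indicator (cball 0 r) x\<bar>"
        using qb[of x n] by (intro mult_left_mono) auto
      then show "norm (F x * ?q n x) \<le> \<bar>F x * (C * indicator (cball 0 r) x)\<bar>" by (simp add: abs_mult)
    qed
    have "(\<lambda>n. ?q n x) \<longlonglongrightarrow> pd k \<phi> x" for x
    proof -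
      have "((\<lambda>t. (\<phi> (x + axis k (0 + t)) - \<phi> (x + axis k 0)) / t) \<longlongrightarrow> pd k \<phi> (x + axis k 0)) (at 0)"
        using test_function_line_deriv[OF \<phi>, of x k 0] unfolding DERIV_def .
      moreover have "filterlim h (at 0) sequentially" using hlim by (auto simp: filterlim_at)
      ultimately have "(\<lambda>n. (\<phi> (x + axis k (0 + h n)) - \<phi> (x + axis k 0)) / h n) \<longlonglongrightarrow> pd k \<phi> (x + axis k 0)"
        by (rule filterlim_compose)
      moreover have "axis k (0::real) = (0 :: real^2)" by (simp add: vec_eq_iff axis_def)
      ultimately show ?thesis by simp
    qed
    then show "AE x in lborel. (\<lambda>n. F x * ?q n x) \<longlonglongrightarrow> F x * pd k \<phi> x"
      by (intro AE_I2 tendsto_mult_left)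
  qed measurable
  have parts: "(LINT x|lborel. F x * ?q n x) = - (LINT x|lborel. diff_quot k n F x * \<phi> x)" for n
  proof -
    have i1: "integrable lborel (\<lambda>x. F x * \<phi> x)" by (rule L1loc_times_bounded_support[OF F _ C'(3)]) measurable
    have i2: "integrable lborel (\<lambda>x. F (x + ?e n) * \<phi> x)"
      by (rule L1loc_times_bounded_support[OF L1loc_translate[OF F] _ C'(3)]) measurable
    have i3: "integrable lborel (\<lambda>x. F x * \<phi> (x - ?e n))"
      using i2 integral_translate(2)[of "\<lambda>x. F x * \<phi> (x - ?e n)" "?e n"] by simp
    have e: "(LINT x|lborel. F x * \<phi> (x - ?e n)) = (LINT x|lborel. F (x + ?e n) * \<phi> x)"
      using integral_translate(1)[of "\<lambda>x. F x * \<phi> (x - ?e n)" "?e n"] by simp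
    have "(LINT x|lborel. F x * ?q n x) = (LINT x|lborel. - real (Suc n) * (F x * \<phi> (x - ?e n) - F x * \<phi> x))"
      by (intro Bochner_Integration.integral_cong refl, unfold ax) (simp add: h_def field_simps del: of_nat_Suc)
    also have "\<dots> = - real (Suc n) * ((LINT x|lborel. F (x + ?e n) * \<phi> x) - (LINT x|lborel. F x * \<phi> x))"
      using i1 i3 e by simp
    also have "\<dots> = - (LINT x|lborel. real (Suc n) * (F (x + ?e n) * \<phi> x - F x * \<phi> x))"
      using i1 i2 by (simp del: of_nat_Suc)
    finally show ?thesis by (simp add: diff_quot_def algebra_simps del: of_nat_Suc)
  qed
  have "(\<lambda>n. LINT x|lborel. diff_quot k n F x * \<phi> x) \<longlonglongrightarrow> (LINT x|lborel. G x * \<phi> x)"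
  proof -
    have b: "norm ((LINT x|lborel. diff_quot k n F x * \<phi> x) - (LINT x|lborel. G x * \<phi> x))
      \<le> C' * (LINT x|lborel. indicator (cball 0 R') x * \<bar>diff_quot k n F x - G x\<bar>)" for n
    proof -
      have i1: "integrable lborel (\<lambda>x. diff_quot k n F x * \<phi> x)"
        by (rule L1loc_times_bounded_support[OF L1loc_diff_quot[OF F] _ C'(3)]) measurable
      have i2: "integrable lborel (\<lambda>x. G x * \<phi> x)"
        by (rule L1loc_times_bounded_support[OF G _ C'(3)]) measurable
      have ld: "L1loc (\<lambda>x. diff_quot k n F x - G x)"
        using L1loc_add[OF L1loc_diff_quot[OF F] L1loc_bounded_mult[OF G, of "\<lambda>x. -1" 1]] by simp
      have "(LINT x|lborel. diff_quot k n F x * \<phi> x) - (LINT x|lborel. G x * \<phi> x) = (LINT x|lborel. (diff_quot k n F x - G x) * \<phi> x)"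
        using i1 i2 by (simp add: left_diff_distrib)
      then have "norm ((LINT x|lborel. diff_quot k n F x * \<phi> x) - (LINT x|lborel. G x * \<phi> x)) \<le> (LINT x|lborel. norm ((diff_quot k n F x - G x) * \<phi> x))"
        by (simp only: integral_norm_bound)
      also have "\<dots> \<le> (LINT x|lborel. C' * \<bar>indicator (cball 0 R') x * (diff_quot k n F x - G x)\<bar>)"
      proof (rule integral_mono)
        show "integrable lborel (\<lambda>x. norm ((diff_quot k n F x - G x) * \<phi> x))"
          by (intro integrable_norm L1loc_times_bounded_support[OF ld _ C'(3)]) measurable
        show "integrable lborel (\<lambda>x. C' * \<bar>indicator (cball 0 R') x * (diff_quot k n F x - G x)\<bar>)"
          by (intro integrable_mult_right integrable_abs L1locD(2)[OF ld])
        show "norm ((diff_quot k n F x - G x) * \<phi> x) \<le> C' * \<bar>indicator (cball 0 R') x * (diff_quot k n F x - G x)\<bar>" for x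
          using mult_left_mono[OF C'(3)[of x], of "\<bar>diff_quot k n F x - G x\<bar>"] by (simp add: abs_mult mult_ac)
      qed
      finally show ?thesis by (simp add: abs_mult)
    qed
    have "(\<lambda>n. (LINT x|lborel. diff_quot k n F x * \<phi> x) - (LINT x|lborel. G x * \<phi> x)) \<longlonglongrightarrow> 0"
      by (rule Lim_null_comparison[OF always_eventually[OF allI[OF b]]])
        (rule tendsto_mult_right_zero, use lim in \<open>simp add: dqlim_def\<close>)
    then show ?thesis by (rule LIM_zero_cancel)
  qed
  from LIMSEQ_unique[OF L[unfolded parts] tendsto_minus[OF this]] show ?thesis .
qed

lemma locally_integrable_L1loc:
  assumes F: "L1loc F" and eq: "AE_on D (\<lambda>x. f x = F x)"
  shows "locally_integrable D f"
  unfolding locally_integrable_def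
proof (intro allI impI)
  fix C assume C: "compact C \<and> C \<subseteq> D"
  then have "bounded C" using compact_imp_bounded by blast
  then obtain R where R: "\<And>x. x \<in> C \<Longrightarrow> norm x \<le> R" by (auto simp: bounded_iff)
  have [measurable]: "C \<in> sets borel" using C by (simp add: borel_closed compact_imp_closed)
  note [measurable] = L1locD(1)[OF F]
  have iF: "integrable lborel (\<lambda>x. indicator C x * F x)"
    by (rule Bochner_Integration.integrable_bound[OF L1locD(2)[OF F, of R]]) (use R in \<open>auto simp: indicator_def\<close>)
  have m: "(\<lambda>x. indicator C x * F x) \<in> borel_measurable lborel" by measurable
  have ae: "AE x in lborel. indicator C x *\<^sub>R f x = indicator C x * F x"
    using eq by eventually_elim (use C in \<open>auto simp: indicator_def\<close>)
  have "integrable lebesgue (\<lambda>x. indicator C x * F x)" using iF m by (subst integrable_completion) auto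
  then show "set_integrable lebesgue C f"
    unfolding set_integrable_def
    by (rule integrable_cong_AE_imp[OF _ lebesgue_measurable_AE[OF m ae]])
      (use AE_completion[OF ae] in \<open>auto elim: eventually_mono\<close>)
qed

lemma set_integral_test_function:
  assumes F: "L1loc F" and eq: "AE_on D (\<lambda>x. f x = F x)" and \<phi>: "test_function D \<phi>"
  shows "(LINT x:D|lebesgue. f x * \<phi> x) = (LINT x|lborel. F x * \<phi> x)"
proof -
  note [measurable] = L1locD(1)[OF F] test_function_measurable[OF \<phi>]
  have z: "\<phi> x = 0" if "x \<notin> D" for x using \<phi> that by (auto simp: test_function_def)
  have m: "(\<lambda>x. F x * \<phi> x) \<in> borel_measurable lborel" by measurable
  have ae: "AE x in lborel. indicator D x *\<^sub>R (f x * \<phi> x) = F x * \<phi> x"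
    using eq by eventually_elim (auto simp: indicator_def z)
  have "(LINT x:D|lebesgue. f x * \<phi> x) = (LINT x|lebesgue. F x * \<phi> x)"
    unfolding set_lebesgue_integral_def
    by (rule integral_cong_AE[OF lebesgue_measurable_AE[OF m ae] measurable_completion[OF m] AE_completion[OF ae]])
  then show ?thesis by (simp add: integral_completion[OF m])
qed

lemma dqlim_has_weak_partial:
  assumes F: "L1loc F" and G: "L1loc G" and lim: "dqlim k F G"
    and f: "AE_on D (\<lambda>x. f x = F x)" and g: "AE_on D (\<lambda>x. g x = G x)"
  shows "has_weak_partial D k f g"
  unfolding has_weak_partial_def
proof (intro conjI allI impI)
  show "locally_integrable D f" "locally_integrable D g"
    by (rule locally_integrable_L1loc[OF F f] locally_integrable_L1loc[OF G g])+
  fix \<phi> assume \<phi>: "test_function D \<phi>"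
  show "(LINT x:D|lebesgue. f x * frechet_derivative \<phi> (at x) (axis k 1)) = - (LINT x:D|lebesgue. g x * \<phi> x)"
    using dqlim_weak_partial[OF F G lim \<phi>] set_integral_test_function[OF F f test_function_pd[OF \<phi>, of k]]
      set_integral_test_function[OF G g \<phi>] by (simp add: pd_def)
qed

lemma locally_integrable_test:
  assumes f: "locally_integrable D f" and \<phi>: "test_function D \<phi>"
  shows "set_integrable lebesgue D (\<lambda>x. f x * \<phi> x)"
proof -
  obtain C where C: "compact C" "C \<subseteq> D" "\<And>x. x \<notin> C \<Longrightarrow> \<phi> x = 0" using \<phi> by (auto simp: test_function_def)
  obtain B R where B: "B \<ge> 0" "\<And>x. \<bar>\<phi> x\<bar> \<le> B" using test_function_bound[OF \<phi>] by metis
  have i: "integrable lebesgue (\<lambda>x. indicator C x * f x)"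
    using f C by (auto simp: locally_integrable_def set_integrable_def)
  have pm: "\<phi> \<in> borel_measurable lebesgue" by (rule measurable_completion) (use test_function_measurable[OF \<phi>] in simp)
  have e: "indicator D x *\<^sub>R (f x * \<phi> x) = (indicator C x * f x) * \<phi> x" for x
    using C(2) C(3)[of x] by (auto simp: indicator_def)
  show ?thesis
    unfolding set_integrable_def e
  proof (rule Bochner_Integration.integrable_bound)
    show "integrable lebesgue (\<lambda>x. B * (indicator C x * f x))" using i by (rule integrable_mult_right)
    show "(\<lambda>x. indicator C x * f x * \<phi> x) \<in> borel_measurable lebesgue" by (rule borel_measurable_times[OF borel_measurable_integrable[OF i] pm])
    show "AE x in lebesgue. norm (indicator C x * f x * \<phi> x) \<le> norm (B * (indicator C x * f x))"
    proof (rule AE_I2)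
      fix x
      have "\<bar>indicator C x * f x\<bar> * \<bar>\<phi> x\<bar> \<le> \<bar>indicator C x * f x\<bar> * B" by (intro mult_left_mono B) simp
      then show "norm (indicator C x * f x * \<phi> x) \<le> norm (B * (indicator C x * f x))" using B(1) by (simp add: abs_mult mult_ac)
    qed
  qed
qed

lemma locally_integrable_lincomb:
  assumes "locally_integrable D f" "locally_integrable D g"
  shows "locally_integrable D (\<lambda>x. a * f x + b * g x)"
  using assms unfolding locally_integrable_def by (auto intro!: set_integral_add)

lemma has_weak_partial_lincomb:
  assumes f: "has_weak_partial D k f f'" and g: "has_weak_partial D k g g'"
  shows "has_weak_partial D k (\<lambda>x. a * f x + b * g x) (\<lambda>x. a * f' x + b * g' x)"
proof -
  note l = f[unfolded has_weak_partial_def] g[unfolded has_weak_partial_def]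
  have e: "(LINT x:D|lebesgue. (a * f x + b * g x) * \<phi> x) = a * (LINT x:D|lebesgue. f x * \<phi> x) + b * (LINT x:D|lebesgue. g x * \<phi> x)"
    if "locally_integrable D f" "locally_integrable D g" "test_function D \<phi>" for f g \<phi>
  proof -
    have "set_integrable lebesgue D (\<lambda>x. a * (f x * \<phi> x))" "set_integrable lebesgue D (\<lambda>x. b * (g x * \<phi> x))"
      using locally_integrable_test[OF that(1,3)] locally_integrable_test[OF that(2,3)] by auto
    from set_integral_add(2)[OF this] show ?thesis by (simp add: algebra_simps)
  qed
  have p: "test_function D (\<lambda>x. frechet_derivative \<phi> (at x) (axis k 1))" if "test_function D \<phi>" for \<phi>
    using test_function_pd[OF that, of k] by (simp add: pd_def[abs_def])
  show ?thesis
    unfolding has_weak_partial_def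
  proof (intro conjI allI impI)
    show "locally_integrable D (\<lambda>x. a * f x + b * g x)" "locally_integrable D (\<lambda>x. a * f' x + b * g' x)"
      using l by (auto intro: locally_integrable_lincomb)
    fix \<phi> assume \<phi>: "test_function D \<phi>"
    show "(LINT x:D|lebesgue. (a * f x + b * g x) * frechet_derivative \<phi> (at x) (axis k 1)) = - (LINT x:D|lebesgue. (a * f' x + b * g' x) * \<phi> x)"
      using e[of f g, OF _ _ p[OF \<phi>]] e[of f' g', OF _ _ \<phi>] l \<phi> by simp
  qed
qed

text \<open>The difference of the two derivatives integrates to zero against every test function,
  which is the situation of the fundamental lemma.\<close>

lemma weak_partial_unique:
  assumes D: "open D" and g: "has_weak_partial D k f g" and g': "has_weak_partial D k f g'"
  shows "AE_on D (\<lambda>x. g x = g' x)"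
proof -
  have h: "has_weak_partial D k (\<lambda>x. 1 * f x + (-1) * f x) (\<lambda>x. 1 * g x + (-1) * g' x)"
    by (rule has_weak_partial_lincomb[OF g g'])
  have "AE_on D (\<lambda>x. g x - g' x = 0)"
  proof (rule fundamental_lemma[OF D])
    show "locally_integrable D (\<lambda>x. g x - g' x)" using h by (simp add: has_weak_partial_def)
    show "(LINT x:D|lebesgue. (g x - g' x) * \<phi> x) = 0" if "test_function D \<phi>" for \<phi>
      using h that by (simp add: has_weak_partial_def set_lebesgue_integral_def)
  qed
  then show ?thesis by simp
qed

section \<open>Leibniz and chain rules through difference quotients\<close>

definition dq2 :: "2 \<Rightarrow> (real^2 \<Rightarrow> real) \<Rightarrow> (real^2 \<Rightarrow> real) \<Rightarrow> bool" where
  "dq2 k F G \<longleftrightarrow> square_integrable F \<and> square_integrable G \<and> (\<lambda>n. l2norm (\<lambda>x. diff_quot k n F x - G x)) \<longlonglongrightarrow> 0"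

lemma square_integrable_diff_quot: "square_integrable F \<Longrightarrow> square_integrable (diff_quot k n F)"
  unfolding diff_quot_def[abs_def] by (intro square_integrable_mult_left square_integrable_diff square_integrable_translate)

lemma l1_product_bound:
  assumes "square_integrable f" "square_integrable g"
  shows "integrable lborel (\<lambda>x. \<bar>f x * g x\<bar>)" "(LINT x|lborel. \<bar>f x * g x\<bar>) \<le> l2norm f * l2norm (g :: real^2 \<Rightarrow> real)"
  using cauchy_schwarz_norm[OF assms] by (simp_all add: abs_mult)

text \<open>The increment is the step 1 / (n + 1) times the difference quotient, and the quotients
  are bounded in L^2 because they converge.\<close>

lemma dq2_translate_tendsto:
  assumes "dq2 k F G"
  shows "(\<lambda>n. l2norm (\<lambda>x. F (x + axis k (1 / real (Suc n))) - F x)) \<longlonglongrightarrow> 0"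
proof -
  have F: "square_integrable F" and G: "square_integrable G" and lim: "(\<lambda>n. l2norm (\<lambda>x. diff_quot k n F x - G x)) \<longlonglongrightarrow> 0"
    using assms by (auto simp: dq2_def)
  have e: "l2norm (\<lambda>x. F (x + axis k (1 / real (Suc n))) - F x) = 1 / real (Suc n) * l2norm (diff_quot k n F)" for n
  proof -
    have "(\<lambda>x. F (x + axis k (1 / real (Suc n))) - F x) = (\<lambda>x. (1 / real (Suc n)) * diff_quot k n F x)"
      by (simp add: diff_quot_def fun_eq_iff del: of_nat_Suc)
    then show ?thesis using l2norm_mult_left[of "1 / real (Suc n)" "diff_quot k n F"] by simp
  qed
  have le: "l2norm (diff_quot k n F) \<le> l2norm (\<lambda>x. diff_quot k n F x - G x) + l2norm G" for n
    using l2norm_triangle[OF square_integrable_diff[OF square_integrable_diff_quot[OF F, of k n] G] G] by simp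
  have "(\<lambda>n. 1 / real (Suc n) * (l2norm (\<lambda>x. diff_quot k n F x - G x) + l2norm G)) \<longlonglongrightarrow> 0 * (0 + l2norm G)"
    by (intro tendsto_mult tendsto_add tendsto_const lim LIMSEQ_Suc[OF lim_1_over_n])
  then have z: "(\<lambda>n. 1 / real (Suc n) * (l2norm (\<lambda>x. diff_quot k n F x - G x) + l2norm G)) \<longlonglongrightarrow> 0" by simp
  show ?thesis
    unfolding e
    by (rule tendsto_sandwich[OF _ _ tendsto_const z])
      (auto intro!: always_eventually divide_right_mono le mult_left_mono simp del: of_nat_Suc)
qed

lemma dqlimI:
  assumes F: "L1loc F" and G: "L1loc G"
    and b: "\<And>R n. \<exists>p. integrable lborel p \<and> (AE x in lborel. indicator (cball 0 R) x * \<bar>diff_quot k n F x - G x\<bar> \<le> p x) \<and>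
      (LINT x|lborel. p x) \<le> q R n"
    and q: "\<And>R. q R \<longlonglongrightarrow> 0"
  shows "dqlim k F G"
  unfolding dqlim_def
proof
  fix R
  have ld: "L1loc (\<lambda>x. diff_quot k n F x - G x)" for n
    using L1loc_add[OF L1loc_diff_quot[OF F] L1loc_bounded_mult[OF G, of "\<lambda>x. -1" 1]] by simp
  have ii: "integrable lborel (\<lambda>x. indicator (cball 0 R) x * \<bar>diff_quot k n F x - G x\<bar>)" for n
    using integrable_abs[OF L1locD(2)[OF ld[of n], of R]] by (simp add: abs_mult)
  have "(LINT x|lborel. indicator (cball 0 R) x * \<bar>diff_quot k n F x - G x\<bar>) \<le> q R n" for n
  proof -
    obtain p where p: "integrable lborel p" "AE x in lborel. indicator (cball 0 R) x * \<bar>diff_quot k n F x - G x\<bar> \<le> p x"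
      "(LINT x|lborel. p x) \<le> q R n" using b[of R n] by blast
    from integral_mono_AE[OF ii[of n] p(1,2)] p(3) show ?thesis by linarith
  qed
  then show "(\<lambda>n. LINT x|lborel. indicator (cball 0 R) x * \<bar>diff_quot k n F x - G x\<bar>) \<longlonglongrightarrow> 0"
    by (intro tendsto_sandwich[OF _ _ tendsto_const q[of R]]) (auto intro!: always_eventually)
qed

lemma dq2_dqlim:
  assumes "dq2 k F G"
  shows "dqlim k F G"
proof -
  have F: "square_integrable F" and G: "square_integrable G" and lim: "(\<lambda>n. l2norm (\<lambda>x. diff_quot k n F x - G x)) \<longlonglongrightarrow> 0"
    using assms by (auto simp: dq2_def)
  let ?i = "\<lambda>R x. 1 * indicator (cball (0::real^2) R) x :: real"
  show ?thesis
  proof (rule dqlimI[where q="\<lambda>R n. l2norm (?i R) * l2norm (\<lambda>x. diff_quot k n F x - G x)"])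
    fix R n
    note p = l1_product_bound[OF square_integrable_indicator_cball[where c=1 and R=R] square_integrable_diff[OF square_integrable_diff_quot[OF F, of k n] G]]
    show "\<exists>p. integrable lborel p \<and> (AE x in lborel. indicator (cball 0 R) x * \<bar>diff_quot k n F x - G x\<bar> \<le> p x) \<and>
      (LINT x|lborel. p x) \<le> l2norm (?i R) * l2norm (\<lambda>x. diff_quot k n F x - G x)"
      by (intro exI[of _ "\<lambda>x. \<bar>?i R x * (diff_quot k n F x - G x)\<bar>"] conjI p) (auto simp: abs_mult)
  qed (use L1loc_square_integrable F G tendsto_mult_right_zero[OF lim] in auto)
qed

text \<open>The discrete Leibniz rule with one factor shifted. Each error term is a product of a
  bounded and a vanishing L^2 sequence, so it vanishes in L^1; the L^2 convergence of
  \<open>dq2\<close> is in general lost.\<close>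

lemma dq2_mult_dqlim:
  assumes FF: "dq2 k F F'" and GG: "dq2 k G G'"
  shows "dqlim k (\<lambda>x. F x * G x) (\<lambda>x. F' x * G x + G' x * F x)"
proof -
  have F: "square_integrable F" "square_integrable F'" and G: "square_integrable G" "square_integrable G'"
    and limF: "(\<lambda>n. l2norm (\<lambda>x. diff_quot k n F x - F' x)) \<longlonglongrightarrow> 0"
    and limG: "(\<lambda>n. l2norm (\<lambda>x. diff_quot k n G x - G' x)) \<longlonglongrightarrow> 0"
    using assms by (auto simp: dq2_def)
  let ?h = "\<lambda>n. axis k (1 / real (Suc n)) :: real^2"
  let ?q = "\<lambda>R n. l2norm (\<lambda>x. diff_quot k n F x - F' x) * l2norm G
     + l2norm F' * l2norm (\<lambda>x. G (x + ?h n) - G x) + l2norm (\<lambda>x. diff_quot k n G x - G' x) * l2norm F"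
  show ?thesis
  proof (rule dqlimI[where q="\<lambda>R. ?q R"])
    show "L1loc (\<lambda>x. F x * G x)" by (intro L1loc_integrable square_integrable_times F G)
    show "L1loc (\<lambda>x. F' x * G x + G' x * F x)" by (intro L1loc_add L1loc_integrable square_integrable_times F G)
    have "?q R \<longlonglongrightarrow> 0 * l2norm G + l2norm F' * 0 + 0 * l2norm F" for R :: real
      by (intro tendsto_add tendsto_mult tendsto_const limF limG dq2_translate_tendsto[OF GG])
    then show "?q R \<longlonglongrightarrow> 0" for R :: real by simp
    fix R :: real and n
    have Gt: "square_integrable (\<lambda>x. G (x + ?h n))" "l2norm (\<lambda>x. G (x + ?h n)) = l2norm G"
      by (rule square_integrable_translate[OF G(1)])+
    note 1 = l1_product_bound[OF square_integrable_diff[OF square_integrable_diff_quot[OF F(1), of k n] F(2)] Gt(1)]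
      and 2 = l1_product_bound[OF F(2) square_integrable_diff[OF Gt(1) G(1)]]
      and 3 = l1_product_bound[OF square_integrable_diff[OF square_integrable_diff_quot[OF G(1), of k n] G(2)] F(1)]
    let ?p1 = "\<lambda>x. \<bar>(diff_quot k n F x - F' x) * G (x + ?h n)\<bar>" and ?p2 = "\<lambda>x. \<bar>F' x * (G (x + ?h n) - G x)\<bar>"
      and ?p3 = "\<lambda>x. \<bar>(diff_quot k n G x - G' x) * F x\<bar>"
    have "(LINT x|lborel. ?p1 x + ?p2 x + ?p3 x) = (LINT x|lborel. ?p1 x) + (LINT x|lborel. ?p2 x) + (LINT x|lborel. ?p3 x)"
      by (simp only: Bochner_Integration.integral_add Bochner_Integration.integrable_add 1(1) 2(1) 3(1))
    then have le: "(LINT x|lborel. ?p1 x + ?p2 x + ?p3 x) \<le> ?q R n" using 1(2)[unfolded Gt(2)] 2(2) 3(2) by linarith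
    have pt: "indicator (cball 0 R) x * \<bar>diff_quot k n (\<lambda>x. F x * G x) x - (F' x * G x + G' x * F x)\<bar> \<le> ?p1 x + ?p2 x + ?p3 x" for x
    proof -
      have "diff_quot k n (\<lambda>x. F x * G x) x - (F' x * G x + G' x * F x)
        = (diff_quot k n F x - F' x) * G (x + ?h n) + F' x * (G (x + ?h n) - G x) + (diff_quot k n G x - G' x) * F x"
        by (simp add: diff_quot_def algebra_simps del: of_nat_Suc)
      then have "\<bar>diff_quot k n (\<lambda>x. F x * G x) x - (F' x * G x + G' x * F x)\<bar> \<le> ?p1 x + ?p2 x + ?p3 x"
        by linarith
      then show ?thesis by (auto simp: indicator_def)
    qed
    show "\<exists>p. integrable lborel p \<and> (AE x in lborel. indicator (cball 0 R) x * \<bar>diff_quot k n (\<lambda>x. F x * G x) x - (F' x * G x + G' x * F x)\<bar> \<le> p x) \<and>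
        (LINT x|lborel. p x) \<le> ?q R n"
      by (intro exI[of _ "\<lambda>x. ?p1 x + ?p2 x + ?p3 x"] conjI Bochner_Integration.integrable_add 1 2 3 le AE_I2 pt)
  qed
qed

lemma ps_continuous:
  assumes "entire_coeffs c"
  shows "continuous_on UNIV (ps c)"
proof -
  have "isCont (ps c) x" for x
    unfolding ps_def[abs_def] using assms by (intro isCont_powser_converges_everywhere) (auto simp: entire_coeffs_def)
  then show ?thesis by (simp add: continuous_at_imp_continuous_on)
qed

lemma ps_abs_le:
  assumes c: "entire_coeffs c" and x: "\<bar>x\<bar> \<le> R"
  shows "\<bar>ps c x\<bar> \<le> (\<Sum>n. \<bar>c n\<bar> * R ^ n)"
proof -
  have b: "norm (c n * x ^ n) \<le> \<bar>c n\<bar> * R ^ n" for n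
    using x by (auto simp: abs_mult power_abs intro!: mult_left_mono power_mono)
  have sn: "summable (\<lambda>n. norm (c n * x ^ n))"
    by (rule summable_comparison_test'[OF entire_coeffs_abs[OF c, of R], of 0]) (use b in auto)
  have "\<bar>ps c x\<bar> \<le> (\<Sum>n. norm (c n * x ^ n))"
    unfolding ps_def real_norm_def[symmetric] by (rule summable_norm[OF sn])
  also have "\<dots> \<le> (\<Sum>n. \<bar>c n\<bar> * R ^ n)" by (rule suminf_le[OF b sn entire_coeffs_abs[OF c]])
  finally show ?thesis .
qed

text \<open>By the factored Taylor formula the error is f'(F) times the error for \<open>F\<close>,
  plus S times quotient times increment. The essential bound on \<open>F\<close> bounds f'(F) and S;
  quotient times increment tends to 0 in L^1.\<close>

lemma dq2_ps_dqlim: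
  assumes c: "entire_coeffs c" and FF: "dq2 k F F'" and b: "AE x in lborel. \<bar>F x\<bar> \<le> M"
  shows "L1loc (\<lambda>x. ps c (F x))" "L1loc (\<lambda>x. ps (diffs c) (F x) * F' x)"
    "dqlim k (\<lambda>x. ps c (F x)) (\<lambda>x. ps (diffs c) (F x) * F' x)"
proof -
  have F: "square_integrable F" "square_integrable F'"
    and limF: "(\<lambda>n. l2norm (\<lambda>x. diff_quot k n F x - F' x)) \<longlonglongrightarrow> 0"
    using FF by (auto simp: dq2_def)
  note c' = entire_coeffs_diffs[OF c]
  have [measurable]: "F \<in> borel_measurable lborel" using F(1) by (rule square_integrable_measurable)
  have [measurable]: "ps c \<in> borel_measurable borel" "ps (diffs c) \<in> borel_measurable borel"
    by (intro borel_measurable_continuous_onI ps_continuous c c')+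
  define R where "R = max 1 M"
  have R1: "1 \<le> R" by (simp add: R_def)
  have bR: "AE x in lborel. \<bar>F x\<bar> \<le> R" using b by eventually_elim (simp add: R_def)
  define A where "A = (\<Sum>n. \<bar>c n\<bar> * R ^ n)"
  define A' where "A' = (\<Sum>n. \<bar>diffs c n\<bar> * R ^ n)"
  define B where "B = (\<Sum>n. \<bar>c n\<bar> * (4 * R) ^ n)"
  have bA: "AE x in lborel. \<bar>ps c (F x)\<bar> \<le> A" using bR by eventually_elim (simp add: A_def ps_abs_le[OF c])
  have bA': "AE x in lborel. \<bar>ps (diffs c) (F x)\<bar> \<le> A'" using bR by eventually_elim (simp add: A'_def ps_abs_le[OF c'])
  show l1: "L1loc (\<lambda>x. ps c (F x))" using L1loc_bounded_mult[OF L1loc_const[of 1] bA] by simp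
  show l2: "L1loc (\<lambda>x. ps (diffs c) (F x) * F' x)"
    by (rule L1loc_bounded_mult[OF L1loc_square_integrable[OF F(2)] bA']) measurable
  let ?h = "\<lambda>n. axis k (1 / real (Suc n)) :: real^2"
  let ?i = "\<lambda>R x. 1 * indicator (cball (0::real^2) R) x :: real"
  \<comment> \<open>The norm of the indicator enters the first term alone: that term is controlled
    in L^2 and becomes L^1 only on a ball.\<close>
  let ?q = "\<lambda>\<rho> n. A' * (l2norm (?i \<rho>) * l2norm (\<lambda>x. diff_quot k n F x - F' x))
     + B * ((l2norm (\<lambda>x. diff_quot k n F x - F' x) + l2norm F') * l2norm (\<lambda>x. F (x + ?h n) - F x))"
  have AB: "A' \<ge> 0" "B \<ge> 0"
    unfolding A'_def B_def using R1 by (intro suminf_nonneg entire_coeffs_abs c c'; simp)+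
  show "dqlim k (\<lambda>x. ps c (F x)) (\<lambda>x. ps (diffs c) (F x) * F' x)"
  proof (rule dqlimI[OF l1 l2, where q="\<lambda>\<rho>. ?q \<rho>"])
    have "?q \<rho> \<longlonglongrightarrow> A' * (l2norm (?i \<rho>) * 0) + B * ((0 + l2norm F') * 0)" for \<rho> :: real
      by (intro tendsto_add tendsto_mult tendsto_const limF dq2_translate_tendsto[OF FF])
    then show "?q \<rho> \<longlonglongrightarrow> 0" for \<rho> :: real by simp
    fix \<rho> :: real and n
    have sqd: "square_integrable (\<lambda>x. diff_quot k n F x - F' x)" by (intro square_integrable_diff square_integrable_diff_quot F)
    have sqt: "square_integrable (\<lambda>x. F (x + ?h n) - F x)" by (intro square_integrable_diff square_integrable_translate F)
    note 1 = l1_product_bound[OF square_integrable_indicator_cball[where c=1 and R=\<rho>] sqd]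
      and 2 = l1_product_bound[OF square_integrable_diff_quot[OF F(1), of k n] sqt]
    let ?p1 = "\<lambda>x. \<bar>?i \<rho> x * (diff_quot k n F x - F' x)\<bar>" and ?p2 = "\<lambda>x. \<bar>diff_quot k n F x * (F (x + ?h n) - F x)\<bar>"
    have ldq: "l2norm (diff_quot k n F) \<le> l2norm (\<lambda>x. diff_quot k n F x - F' x) + l2norm F'"
      using l2norm_triangle[OF sqd F(2)] by simp
    have "(LINT x|lborel. A' * ?p1 x + B * ?p2 x) = A' * (LINT x|lborel. ?p1 x) + B * (LINT x|lborel. ?p2 x)"
      by (simp only: Bochner_Integration.integral_add integrable_mult_right 1(1) 2(1) integral_mult_right_zero)
    also have "\<dots> \<le> ?q \<rho> n"
      using AB order_trans[OF 2(2) mult_right_mono[OF ldq l2norm_nonneg]]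
      by (intro add_mono mult_left_mono 1) auto
    finally have le: "(LINT x|lborel. A' * ?p1 x + B * ?p2 x) \<le> ?q \<rho> n" .
    have pt: "AE x in lborel. indicator (cball 0 \<rho>) x * \<bar>diff_quot k n (\<lambda>x. ps c (F x)) x - ps (diffs c) (F x) * F' x\<bar> \<le> A' * ?p1 x + B * ?p2 x"
      using bR AE_translate[OF bR, of "?h n"] bA'
    proof eventually_elim
      case (elim x)
      let ?a = "F (x + ?h n)" and ?b = "F x"
      have S: "\<bar>ps_quot2 c ?a ?b\<bar> \<le> B" unfolding B_def by (rule ps_identities(3)[OF c R1 elim(2,1)])
      have *: "ps c ?a - ps c ?b = (?a - ?b) * (ps (diffs c) ?b + (?a - ?b) * ps_quot2 c ?a ?b)"
      proof -
        have "ps_quot c ?a ?b = ps (diffs c) ?b + (?a - ?b) * ps_quot2 c ?a ?b"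
          using ps_identities(2)[OF c, of ?a ?b] by linarith
        then show ?thesis unfolding ps_identities(1)[OF c] by simp
      qed
      have e: "diff_quot k n (\<lambda>x. ps c (F x)) x - ps (diffs c) ?b * F' x
         = ps (diffs c) ?b * (diff_quot k n F x - F' x) + ps_quot2 c ?a ?b * (diff_quot k n F x * (?a - ?b))"
      proof -
        have "m * (d * (p + d * S)) - p * w = p * (m * d - w) + S * ((m * d) * d)" for m d p S w :: real
          by (simp add: algebra_simps)
        then show ?thesis unfolding diff_quot_def by (simp only: *)
      qed
      have "\<bar>diff_quot k n (\<lambda>x. ps c (F x)) x - ps (diffs c) ?b * F' x\<bar>
         \<le> \<bar>ps (diffs c) ?b\<bar> * \<bar>diff_quot k n F x - F' x\<bar> + \<bar>ps_quot2 c ?a ?b\<bar> * ?p2 x"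
        unfolding e abs_mult[symmetric] by (rule abs_triangle_ineq)
      also have "\<dots> \<le> A' * \<bar>diff_quot k n F x - F' x\<bar> + B * ?p2 x"
        by (intro add_mono mult_right_mono elim S) auto
      finally have le: "\<bar>diff_quot k n (\<lambda>x. ps c (F x)) x - ps (diffs c) ?b * F' x\<bar> \<le> A' * \<bar>diff_quot k n F x - F' x\<bar> + B * ?p2 x" .
      show ?case
        by (cases "x \<in> cball 0 \<rho>") (use le AB in \<open>auto simp: abs_mult\<close>)
    qed
    show "\<exists>p. integrable lborel p \<and> (AE x in lborel. indicator (cball 0 \<rho>) x * \<bar>diff_quot k n (\<lambda>x. ps c (F x)) x - ps (diffs c) (F x) * F' x\<bar> \<le> p x) \<and>
        (LINT x|lborel. p x) \<le> ?q \<rho> n"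
      by (intro exI[of _ "\<lambda>x. A' * ?p1 x + B * ?p2 x"] conjI Bochner_Integration.integrable_add integrable_mult_right 1 2 le pt)
  qed
qed

section \<open>Weak derivatives of elements of H^s(D)\<close>

context sob_domain
begin

text \<open>One nearly optimal extension supplies everything at once: L^2 difference quotients, an
  essential bound, and a derivative whose norm is close to that of \<open>v\<close>.\<close>

lemma extension_dq2:
  assumes v: "v \<in> V s" and e: "e > 0"
  obtains F G M where "dq2 k F G" "AE_on D (\<lambda>x. v x = F x)" "AE x in lborel. \<bar>F x\<bar> \<le> M"
    "G \<in> V (s - 1)" "N (s - 1) G \<le> N s v + e" "has_weak_partial D k v G"
proof -
  obtain F where F: "F \<in> sobolev_extensions s D v" "sobolev_plane_norm s F < N s v + e"
    by (rule sobolev_extension_approx[OF v e])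
  obtain f where f: "sob_pair s F f" using sobolev_extensionD(1)[OF F(1)] by (auto simp: sobolev_plane_iff)
  have s1: "1 \<le> s" using s by simp
  obtain G where G: "sob_pair (s - 1) G (\<lambda>\<xi>. \<i> * of_real (\<xi> $ k) * f \<xi>)"
    "sobolev_plane_norm (s - 1) G \<le> sobolev_plane_norm s F"
    "(\<lambda>n. l2norm (\<lambda>x. diff_quot k n F x - G x)) \<longlonglongrightarrow> 0"
    by (rule sob_pair_deriv[OF f s1, of k])
  have dq: "dq2 k F G" using sob_pairD(3)[OF f] sob_pairD(3)[OF G(1)] G(3) by (simp add: dq2_def)
  have GG: "G \<in> sobolev_extensions (s - 1) D G" using G(1) by (auto intro!: sobolev_extensionI simp: sobolev_plane_iff)
  have vF: "AE_on D (\<lambda>x. v x = F x)" using sobolev_extensionD(2)[OF F(1)] by eventually_elim auto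
  have "has_weak_partial D k v G"
    by (rule dqlim_has_weak_partial[OF _ _ dq2_dqlim[OF dq] vF])
      (use dq L1loc_square_integrable in \<open>auto simp: dq2_def\<close>)
  then show thesis
    using that[OF dq vF sobolev_plane_sup_bound[OF f s] sobolev_extensionD(3)[OF GG]] sobolev_extension_le[OF GG] G(2) F(2) by simp
qed

abbreviation "wp k v \<equiv> weak_partial D k v"

lemma wp_has:
  assumes "has_weak_partial D k v w"
  shows "has_weak_partial D k v (wp k v)" "AE_on D (\<lambda>x. wp k v x = w x)"
proof -
  show 1: "has_weak_partial D k v (wp k v)"
    unfolding weak_partial_def using assms by (rule someI[of "has_weak_partial D k v"])
  show "AE_on D (\<lambda>x. wp k v x = w x)" by (rule weak_partial_unique[OF open_D 1 assms])
qed

lemma wp_V: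
  assumes v: "v \<in> V s"
  shows "has_weak_partial D k v (wp k v)" "wp k v \<in> V (s - 1)" "N (s - 1) (wp k v) \<le> N s v"
proof -
  have ex: "\<exists>G. G \<in> V (s - 1) \<and> N (s - 1) G \<le> N s v + e \<and> has_weak_partial D k v G" if "e > 0" for e
    by (rule extension_dq2[OF v that, of k]) blast
  from ex[of 1] obtain G where G: "G \<in> V (s - 1)" "has_weak_partial D k v G" by auto
  show "has_weak_partial D k v (wp k v)" by (rule wp_has(1)[OF G(2)])
  show "wp k v \<in> V (s - 1)" using sobolev_cong(1)[OF wp_has(2)[OF G(2)]] G(1) by simp
  show "N (s - 1) (wp k v) \<le> N s v"
  proof (rule field_le_epsilon)
    fix e :: real assume "e > 0"
    from ex[OF this] obtain H where H: "N (s - 1) H \<le> N s v + e" "has_weak_partial D k v H" by blast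
    then show "N (s - 1) (wp k v) \<le> N s v + e" using sobolev_cong(2)[OF wp_has(2)[OF H(2)]] by simp
  qed
qed

lemma wp_lincomb:
  assumes "v \<in> V s" "w \<in> V s"
  shows "AE_on D (\<lambda>x. wp k (\<lambda>x. a * v x + b * w x) x = a * wp k v x + b * wp k w x)"
  by (rule wp_has(2)[OF has_weak_partial_lincomb[OF wp_V(1) wp_V(1)]]) fact+

lemma wp_mult:
  assumes v: "v \<in> V s" and w: "w \<in> V s"
  shows "AE_on D (\<lambda>x. wp k (\<lambda>x. v x * w x) x = wp k v x * w x + wp k w x * v x)"
proof -
  obtain F F' where F: "dq2 k F F'" "AE_on D (\<lambda>x. v x = F x)" "has_weak_partial D k v F'"
    by (rule extension_dq2[OF v zero_less_one, of k])
  obtain G G' where G: "dq2 k G G'" "AE_on D (\<lambda>x. w x = G x)" "has_weak_partial D k w G'"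
    by (rule extension_dq2[OF w zero_less_one, of k])
  show ?thesis
  proof (rule wp_has(2)[OF dqlim_has_weak_partial[OF _ _ dq2_mult_dqlim[OF F(1) G(1)]]])
    show "L1loc (\<lambda>x. F x * G x)" "L1loc (\<lambda>x. F' x * G x + G' x * F x)"
      using F(1) G(1) unfolding dq2_def by (auto intro!: L1loc_add L1loc_integrable square_integrable_times)
    show "AE_on D (\<lambda>x. v x * w x = F x * G x)" using F(2) G(2) by eventually_elim auto
    show "AE_on D (\<lambda>x. wp k v x * w x + wp k w x * v x = F' x * G x + G' x * F x)"
      using F(2) G(2) wp_has(2)[OF F(3)] wp_has(2)[OF G(3)] by eventually_elim auto
  qed
qed

lemma wp_ps:
  assumes c: "entire_coeffs c" and v: "v \<in> V s"
  shows "AE_on D (\<lambda>x. wp k (\<lambda>x. ps c (v x)) x = wp k v x * ps (diffs c) (v x))"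
proof -
  obtain F F' M where F: "dq2 k F F'" "AE_on D (\<lambda>x. v x = F x)" "AE x in lborel. \<bar>F x\<bar> \<le> M" "has_weak_partial D k v F'"
    by (rule extension_dq2[OF v zero_less_one, of k])
  note p = dq2_ps_dqlim[OF c F(1,3)]
  show ?thesis
  proof (rule wp_has(2)[OF dqlim_has_weak_partial[OF p]])
    show "AE_on D (\<lambda>x. ps c (v x) = ps c (F x))" using F(2) by eventually_elim auto
    show "AE_on D (\<lambda>x. wp k v x * ps (diffs c) (v x) = ps (diffs c) (F x) * F' x)"
      using F(2) wp_has(2)[OF F(4)] by eventually_elim auto
  qed
qed

text \<open>\<open>wp\<close> acts on functions, not on classes, so the passage from the matrix
  exponential to its closed form, valid only a.e. on \<open>D\<close>, has to be justified under the
  derivative.\<close>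

lemma wp_cong:
  assumes v: "v \<in> V s" and eq: "AE_on D (\<lambda>x. w x = v x)"
  shows "AE_on D (\<lambda>x. wp k w x = wp k v x)"
proof -
  obtain F F' where F: "dq2 k F F'" "AE_on D (\<lambda>x. v x = F x)" "has_weak_partial D k v F'"
    by (rule extension_dq2[OF v zero_less_one, of k])
  have wF: "AE_on D (\<lambda>x. w x = F x)" using eq F(2) by eventually_elim auto
  have "has_weak_partial D k w F'"
    by (rule dqlim_has_weak_partial[OF _ _ dq2_dqlim[OF F(1)] wF]) (use F(1) L1loc_square_integrable in \<open>auto simp: dq2_def\<close>)
  from wp_has(2)[OF this] wp_has(2)[OF F(3)] show ?thesis by eventually_elim auto
qed

end

context sob_time
begin

text \<open>By linearity and \<open>wp_V\<close>, differentiation is a contraction from H^s to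
  H^{s-1}, so it preserves continuity in time.\<close>

lemma C0_wp:
  assumes v: "v \<in> C0 s"
  shows "(\<lambda>t. wp k (v t)) \<in> C0 (s - 1)"
proof (rule C0I)
  fix t assume t: "t \<in> {0..T}"
  show "wp k (v t) \<in> V (s - 1)" by (intro wp_V C0D v t)
  show "((\<lambda>\<tau>. N (s - 1) (\<lambda>x. wp k (v \<tau>) x - wp k (v t) x)) \<longlongrightarrow> 0) (at t within {0..T})"
  proof (rule tendsto_0_on[OF C0D(2)[OF v t]])
    fix \<tau> assume \<tau>: "\<tau> \<in> {0..T}"
    note V2 = C0D(1)[OF v \<tau>] C0D(1)[OF v t]
    show "0 \<le> N (s - 1) (\<lambda>x. wp k (v \<tau>) x - wp k (v t) x)" by (intro sobolev_norm_nonneg sobolev_diff wp_V V2)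
    have "AE_on D (\<lambda>x. wp k (v \<tau>) x - wp k (v t) x = wp k (\<lambda>x. v \<tau> x - v t x) x)"
      using wp_lincomb[OF V2, of k 1 "-1"] by eventually_elim simp
    from sobolev_cong(2)[OF this, of "s - 1"] wp_V(3)[OF sobolev_diff(1)[OF V2], of k]
    show "N (s - 1) (\<lambda>x. wp k (v \<tau>) x - wp k (v t) x) \<le> N s (\<lambda>x. v \<tau> x - v t x)" by simp
  qed
qed

end

section \<open>Functions of symmetric two-by-two matrices\<close>

definition exp_coeff :: "nat \<Rightarrow> real" where
  "exp_coeff n = inverse (fact n)"

text \<open>Only even powers of the root occur, so the series is one in z itself and no square root
  of the discriminant is ever differentiated.\<close>

definition cosh_coeff :: "nat \<Rightarrow> real" where
  "cosh_coeff n = inverse (fact (2 * n))"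

definition sinhc_coeff :: "nat \<Rightarrow> real" where
  "sinhc_coeff n = inverse (fact (2 * n + 1))"

lemma entire_exp_coeff: "entire_coeffs exp_coeff"
  unfolding entire_coeffs_def exp_coeff_def using summable_exp by blast

lemma entire_coeffs_le:
  assumes "\<And>n. \<bar>c n\<bar> \<le> inverse (fact n)"
  shows "entire_coeffs c"
  unfolding entire_coeffs_def
proof
  fix x :: real
  show "summable (\<lambda>n. c n * x ^ n)"
  proof (rule summable_comparison_test')
    show "summable (\<lambda>n. inverse (fact n) * \<bar>x\<bar> ^ n)" by (rule summable_exp)
    show "norm (c n * x ^ n) \<le> inverse (fact n) * \<bar>x\<bar> ^ n" for n
      using assms[of n] by (auto simp: abs_mult power_abs intro!: mult_right_mono)
  qed
qed

lemma entire_cosh_coeff: "entire_coeffs cosh_coeff"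
  by (rule entire_coeffs_le) (auto simp: cosh_coeff_def intro!: le_imp_inverse_le fact_mono)

lemma entire_sinhc_coeff: "entire_coeffs sinhc_coeff"
proof (rule entire_coeffs_le)
  fix n
  have "(fact n :: real) \<le> fact (2 * n + 1)" by (rule fact_mono) simp
  then show "\<bar>sinhc_coeff n\<bar> \<le> inverse (fact n)"
    unfolding sinhc_coeff_def by (simp add: le_imp_inverse_le del: fact_Suc)
qed

lemma ps_exp: "ps exp_coeff x = exp x"
  unfolding ps_def exp_coeff_def exp_def by (simp add: field_simps)

lemma inverse_eq_mult_inverse: "x = k * y \<Longrightarrow> k \<noteq> 0 \<Longrightarrow> inverse y = k * inverse x" for k x y :: real
  by simp

lemma diffs_exp: "diffs exp_coeff = exp_coeff"
proof
  fix n
  show "diffs exp_coeff n = exp_coeff n"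
    using inverse_eq_mult_inverse[OF fact_Suc[of n]] by (simp add: diffs_def exp_coeff_def del: fact_Suc of_nat_Suc)
qed

lemma diffs_cosh: "diffs cosh_coeff n = sinhc_coeff n / 2"
proof -
  have "(fact (2 * Suc n) :: real) = 2 * (real n + 1) * fact (2 * n + 1)" by (simp add: field_simps)
  from inverse_eq_mult_inverse[OF this] have "sinhc_coeff n = 2 * (real n + 1) * cosh_coeff (Suc n)"
    unfolding cosh_coeff_def sinhc_coeff_def by (simp del: fact_Suc)
  then show ?thesis unfolding diffs_def by (simp add: algebra_simps)
qed

lemma ps_diffs_cosh: "ps (diffs cosh_coeff) x = ps sinhc_coeff x / 2"
proof -
  have "summable (\<lambda>n. sinhc_coeff n * x ^ n)" using entire_sinhc_coeff by (simp add: entire_coeffs_def)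
  from suminf_divide[OF this, of 2] show ?thesis unfolding ps_def diffs_cosh by (simp add: mult.commute)
qed

text \<open>Comparison of coefficients: the constant terms on the right cancel, and keeping the
  factor \<open>x\<close> on the left makes 0 no exception.\<close>

lemma ps_diffs_sinhc: "2 * x * ps (diffs sinhc_coeff) x = ps cosh_coeff x - ps sinhc_coeff x"
proof -
  have sC: "summable (\<lambda>n. cosh_coeff n * x ^ n)" and sS: "summable (\<lambda>n. sinhc_coeff n * x ^ n)"
    and sD: "summable (\<lambda>n. diffs sinhc_coeff n * x ^ n)"
    using entire_cosh_coeff entire_sinhc_coeff entire_coeffs_diffs[OF entire_sinhc_coeff] by (simp_all add: entire_coeffs_def)
  let ?f = "\<lambda>n. (cosh_coeff n - sinhc_coeff n) * x ^ n"
  have f: "?f (Suc n) = 2 * x * (diffs sinhc_coeff n * x ^ n)" for n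
  proof -
    have "(fact (2 * Suc n + 1) :: real) = (2 * real (Suc n) + 1) * fact (2 * Suc n)" by (simp add: algebra_simps)
    from inverse_eq_mult_inverse[OF this] have "cosh_coeff (Suc n) = (2 * real (Suc n) + 1) * sinhc_coeff (Suc n)"
      unfolding cosh_coeff_def sinhc_coeff_def by linarith
    then have "cosh_coeff (Suc n) - sinhc_coeff (Suc n) = 2 * (real (Suc n) * sinhc_coeff (Suc n))"
      by (simp add: algebra_simps)
    then show ?thesis by (simp add: diffs_def del: of_nat_Suc)
  qed
  have f0: "?f 0 = 0" by (simp add: cosh_coeff_def sinhc_coeff_def)
  have sf: "summable ?f" using summable_diff[OF sC sS] by (simp add: algebra_simps)
  have "ps cosh_coeff x - ps sinhc_coeff x = (\<Sum>n. ?f n)"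
    unfolding ps_def using suminf_diff[OF sC sS] by (simp add: left_diff_distrib)
  also have "\<dots> = (\<Sum>n. ?f (Suc n))" using suminf_split_head[OF sf] f0 by simp
  also have "\<dots> = 2 * x * ps (diffs sinhc_coeff) x" unfolding f ps_def by (rule suminf_mult[OF sD])
  finally show ?thesis by simp
qed

lemma ps_cosh: "ps cosh_coeff (r\<^sup>2) = cosh r"
proof -
  \<comment> \<open>The library series carries zeros at odd positions; reindexing along 2 n drops
    them.\<close>
  have "(\<lambda>n. (\<lambda>n. if even n then r ^ n /\<^sub>R fact n else 0) (2 * n)) sums cosh r"
    using cosh_converges[of r] by (subst sums_mono_reindex) (auto simp: strict_mono_def elim!: evenE)
  then have "(\<lambda>n. cosh_coeff n * (r\<^sup>2) ^ n) sums cosh r"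
    by (simp add: cosh_coeff_def power_mult)
  then show ?thesis unfolding ps_def by (rule sums_unique[symmetric])
qed

lemma ps_sinhc: "r * ps sinhc_coeff (r\<^sup>2) = sinh r"
proof -
  have "(\<lambda>n. (\<lambda>n. if even n then 0 else r ^ n /\<^sub>R fact n) (2 * n + 1)) sums sinh r"
    using sinh_converges[of r] by (subst sums_mono_reindex) (auto simp: strict_mono_def elim!: oddE)
  then have "(\<lambda>n. r * (sinhc_coeff n * (r\<^sup>2) ^ n)) sums sinh r"
    by (simp add: sinhc_coeff_def power_mult[symmetric] mult_ac del: fact_Suc)
  moreover have "summable (\<lambda>n. sinhc_coeff n * (r\<^sup>2) ^ n)" using entire_sinhc_coeff by (simp add: entire_coeffs_def)
  then have "(\<lambda>n. r * (sinhc_coeff n * (r\<^sup>2) ^ n)) sums (r * ps sinhc_coeff (r\<^sup>2))"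
    unfolding ps_def by (intro sums_mult summable_sums)
  ultimately show ?thesis using sums_unique2 by blast
qed

lemma ps_cosh_sinhc: "z \<ge> 0 \<Longrightarrow> (ps cosh_coeff z)\<^sup>2 - z * (ps sinhc_coeff z)\<^sup>2 = 1"
proof -
  assume z: "z \<ge> 0"
  have "(ps cosh_coeff z)\<^sup>2 - z * (ps sinhc_coeff z)\<^sup>2 = (ps cosh_coeff ((sqrt z)\<^sup>2))\<^sup>2 - (sqrt z * ps sinhc_coeff ((sqrt z)\<^sup>2))\<^sup>2"
    using z by (simp add: power_mult_distrib)
  also have "\<dots> = 1" unfolding ps_cosh ps_sinhc by (simp add: cosh_square_eq)
  finally show ?thesis .
qed

lemma ps_at_0: "ps c 0 = c 0"
  unfolding ps_def by (subst suminf_finite[of "{0}"]) auto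

text \<open>With r = sqrt z the bracket in \<open>h_fun\<close> is r coth r - 1, so both sides equal
  (r cosh r - sinh r) / r^3. At 0 the prescribed value 1/3 agrees with 2 Sh'(0) = 2/6.\<close>

lemma h_fun_sinhc:
  assumes z: "z \<ge> 0"
  shows "h_fun z * ps sinhc_coeff z = 2 * ps (diffs sinhc_coeff) z"
proof (cases "z = 0")
  case True
  then show ?thesis by (simp add: h_fun_def ps_at_0 diffs_def sinhc_coeff_def)
next
  case False
  define r where "r = sqrt z"
  have r: "r > 0" "z = r\<^sup>2" using z False by (auto simp: r_def)
  have e: "exp (2 * r) \<noteq> 1" "exp (2 * r) = exp r * exp r" using r by (auto simp: exp_add[symmetric])
  have S: "ps sinhc_coeff z = sinh r / r" using ps_sinhc[of r] r by (simp add: field_simps)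
  have "r\<^sup>2 * (2 * ps (diffs sinhc_coeff) z) = cosh r - sinh r / r"
    using ps_diffs_sinhc[of z] ps_cosh[of r] S r(2) by (simp add: mult_ac)
  then have T: "2 * ps (diffs sinhc_coeff) z = (cosh r - sinh r / r) / r\<^sup>2"
    using r(1) by (metis nonzero_mult_div_cancel_left less_irrefl zero_eq_power2)
  have "(r + 2 * r / (exp (2 * r) - 1)) * sinh r = r * cosh r"
  proof -
    have x: "exp r * exp r - 1 \<noteq> 0" using e by simp
    have "exp (- r) = 1 / exp r" by (simp add: exp_minus field_simps)
    then show ?thesis unfolding sinh_field_def cosh_field_def e(2) using x by (simp add: field_simps)
  qed
  moreover have "h_fun z * sinh r = ((r + 2 * r / (exp (2 * r) - 1)) * sinh r - sinh r) / r\<^sup>2"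
    using r unfolding h_fun_def by (simp add: left_diff_distrib)
  ultimately have "h_fun z * sinh r = (r * cosh r - sinh r) / r\<^sup>2" by simp
  then have "h_fun z * ps sinhc_coeff z = (r * cosh r - sinh r) / r\<^sup>2 / r" unfolding S by (simp add: field_simps)
  also have "\<dots> = (cosh r - sinh r / r) / r\<^sup>2" using r by (simp add: field_simps)
  finally show ?thesis using T by simp
qed

section \<open>The exponential of a symmetric matrix\<close>

definition dev :: "real^2^2 \<Rightarrow> real^2^2" where
  "dev A = vector [vector [gam A, A $ 1 $ 2], vector [A $ 1 $ 2, - gam A]]"

definition tr2 :: "real^2^2 \<Rightarrow> real" where
  "tr2 A = (A $ 1 $ 1 + A $ 2 $ 2) / 2"

text \<open>The square of \<open>dev A\<close> is this number times the identity. It is also the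
  argument of \<open>h_fun\<close> in \<open>f_fun\<close>, which is how the correction term and the
  exponential come to match.\<close>

definition disc :: "real^2^2 \<Rightarrow> real" where
  "disc A = (gam A)\<^sup>2 + (A $ 1 $ 2)\<^sup>2"

lemma disc_nonneg: "disc A \<ge> 0"
  by (simp add: disc_def)

lemma mat2_eq_iff: "A = B \<longleftrightarrow> A $ 1 $ 1 = B $ 1 $ 1 \<and> A $ 1 $ 2 = B $ 1 $ 2 \<and> A $ 2 $ 1 = B $ 2 $ 1 \<and> A $ 2 $ 2 = B $ 2 $ 2"
  for A B :: "'a^2^2"
proof -
  have "A = B \<longleftrightarrow> (\<forall>i j. A $ i $ j = B $ i $ j)" by (metis vec_eq_iff)
  then show ?thesis unfolding forall_2 by blast
qed

lemma matmul2: "(A ** B) $ i $ j = A $ i $ 1 * B $ 1 $ j + A $ i $ 2 * B $ 2 $ j"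
  for A B :: "'a::semiring_1^2^2"
  by (simp add: matrix_matrix_mult_def sum_2)

lemma mat1_entries: "(mat c :: 'a::zero^2^2) $ 1 $ 1 = c" "(mat c :: 'a^2^2) $ 1 $ 2 = 0" "(mat c :: 'a^2^2) $ 2 $ 1 = 0" "(mat c :: 'a^2^2) $ 2 $ 2 = c"
  by (auto simp: mat_def)

lemma dev_entries: "dev A $ 1 $ 1 = gam A" "dev A $ 1 $ 2 = A $ 1 $ 2" "dev A $ 2 $ 1 = A $ 1 $ 2" "dev A $ 2 $ 2 = - gam A"
  by (auto simp: dev_def vector_2)

lemma sym_decomp:
  assumes "A $ 2 $ 1 = A $ 1 $ 2"
  shows "A = tr2 A *\<^sub>R mat 1 + dev A"
  using assms by (auto simp: mat2_eq_iff mat1_entries dev_entries tr2_def gam_def field_simps)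

text \<open>If the discriminant vanishes, so does the deviatoric part, and the division by \<open>r = 0\<close> is harmless.\<close>

lemma mexp_sym:
  assumes A: "A $ 2 $ 1 = A $ 1 $ 2"
  shows "mexp A = exp (tr2 A) *\<^sub>R (ps cosh_coeff (disc A) *\<^sub>R mat 1 + ps sinhc_coeff (disc A) *\<^sub>R dev A)"
proof -
  define m where "m = tr2 A"
  define r where "r = sqrt (disc A)"
  have r2: "r\<^sup>2 = disc A" using disc_nonneg[of A] by (simp add: r_def)
  have Ad: "A = m *\<^sub>R mat 1 + dev A" unfolding m_def by (rule sym_decomp[OF A])
  \<comment> \<open>The eigenvalues are m + r and m - r; the power of order \<open>n\<close> is
    interpolated between them by a scalar part \<alpha> and a deviatoric part \<beta>.\<close>
  define \<alpha> where "\<alpha> n = ((m + r) ^ n + (m - r) ^ n) / 2" for n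
  define \<beta> where "\<beta> n = ((m + r) ^ n - (m - r) ^ n) / (2 * r)" for n
  have dev0: "dev A = 0" if "r = 0"
  proof -
    have "(gam A)\<^sup>2 + (A $ 1 $ 2)\<^sup>2 = 0" using r2 that by (simp add: disc_def)
    then have "gam A = 0" "A $ 1 $ 2 = 0" by (auto simp: sum_power2_eq_zero_iff)
    then show ?thesis by (auto simp: mat2_eq_iff dev_entries)
  qed
  have pw: "((**) A ^^ n) (mat 1) = \<alpha> n *\<^sub>R mat 1 + \<beta> n *\<^sub>R dev A" for n
  proof (induction n)
    case 0
    show ?case by (simp add: \<alpha>_def \<beta>_def)
  next
    case (Suc n)
    have "((**) A ^^ Suc n) (mat 1) = (m *\<^sub>R mat 1 + dev A) ** (\<alpha> n *\<^sub>R mat 1 + \<beta> n *\<^sub>R dev A)"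
      using Suc Ad by simp
    also have "\<dots> = (m * \<alpha> n + disc A * \<beta> n) *\<^sub>R mat 1 + (m * \<beta> n + \<alpha> n) *\<^sub>R dev A"
      by (auto simp: mat2_eq_iff matmul2 mat1_entries dev_entries disc_def power2_eq_square algebra_simps)
    also have "m * \<alpha> n + disc A * \<beta> n = \<alpha> (Suc n)"
      unfolding r2[symmetric] by (cases "r = 0") (auto simp: \<alpha>_def \<beta>_def field_simps power2_eq_square)
    also have "(m * \<beta> n + \<alpha> n) *\<^sub>R dev A = \<beta> (Suc n) *\<^sub>R dev A"
    proof (cases "r = 0")
      case False
      then have "m * \<beta> n + \<alpha> n = \<beta> (Suc n)" by (simp add: \<alpha>_def \<beta>_def field_simps)
      then show ?thesis by simp
    qed (simp add: dev0)
    finally show ?case .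
  qed
  have ex: "(\<lambda>n. (1 / fact n) * x ^ n) sums exp x" for x :: real
    using exp_converges[of x] by (simp add: field_simps)
  have sa: "(\<lambda>n. (1 / fact n) * \<alpha> n) sums (exp m * cosh r)"
  proof -
    have "(\<lambda>n. ((1 / fact n) * (m + r) ^ n + (1 / fact n) * (m - r) ^ n) / 2) sums ((exp (m + r) + exp (m - r)) / 2)"
      by (intro sums_divide sums_add ex)
    moreover have "(exp (m + r) + exp (m - r)) / 2 = exp m * cosh r"
      by (simp add: cosh_field_def exp_add exp_diff exp_minus field_simps)
    ultimately show ?thesis by (simp add: \<alpha>_def field_simps)
  qed
  have sb: "(\<lambda>n. (1 / fact n) * \<beta> n) sums (exp m * sinh r / r)"
  proof -
    have "(\<lambda>n. ((1 / fact n) * (m + r) ^ n - (1 / fact n) * (m - r) ^ n) / (2 * r)) sums ((exp (m + r) - exp (m - r)) / (2 * r))"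
      by (intro sums_divide sums_diff ex)
    moreover have "(exp (m + r) - exp (m - r)) / (2 * r) = exp m * sinh r / r"
      by (simp add: sinh_field_def exp_add exp_diff exp_minus field_simps)
    moreover have "((1 / fact n) * (m + r) ^ n - (1 / fact n) * (m - r) ^ n) / (2 * r) = (1 / fact n) * \<beta> n" for n
      by (simp add: \<beta>_def right_diff_distrib)
    ultimately show ?thesis by simp
  qed
  have "(\<lambda>n. (1 / fact n) *\<^sub>R (((**) A ^^ n) (mat 1))) sums ((exp m * cosh r) *\<^sub>R mat 1 + (exp m * sinh r / r) *\<^sub>R dev A)"
    unfolding pw scaleR_add_right scaleR_scaleR by (intro sums_add sums_scaleR_left sa sb)
  then have "mexp A = (exp m * cosh r) *\<^sub>R mat 1 + (exp m * sinh r / r) *\<^sub>R dev A"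
    unfolding mexp_def by (rule sums_unique[symmetric])
  also have "(exp m * sinh r / r) *\<^sub>R dev A = (exp m * ps sinhc_coeff (disc A)) *\<^sub>R dev A"
  proof (cases "r = 0")
    case False
    then show ?thesis using ps_sinhc[of r] by (simp add: r2[symmetric] field_simps)
  qed (simp add: dev0)
  also have "cosh r = ps cosh_coeff (disc A)" using ps_cosh[of r] r2 by simp
  finally show ?thesis by (simp add: m_def scaleR_add_right)
qed

section \<open>The functional calculus at a point\<close>

definition charp :: "real^2^2 \<Rightarrow> complex \<Rightarrow> complex" where
  "charp A w = (w - of_real (A $ 1 $ 1)) * (w - of_real (A $ 2 $ 2)) - of_real (A $ 1 $ 2) * of_real (A $ 2 $ 1)"

lemma det_mat_cmat: "det (mat w - cmat A) = charp A w"
  by (simp add: det_2 charp_def cmat_def mat1_entries)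

lemma not_invertible_iff: "\<not> invertible (mat w - cmat A) \<longleftrightarrow> charp A w = 0"
  by (simp add: invertible_det_nz det_mat_cmat)

lemma finite_charp_roots: "finite {w. charp A w = 0}"
proof -
  define p where "p = [: of_real (A $ 1 $ 1 * A $ 2 $ 2 - A $ 1 $ 2 * A $ 2 $ 1), - of_real (A $ 1 $ 1 + A $ 2 $ 2), 1 :: complex :]"
  have "poly p w = charp A w" for w by (simp add: p_def charp_def algebra_simps)
  moreover have "p \<noteq> 0" by (simp add: p_def)
  ultimately show ?thesis using poly_roots_finite[of p] by simp
qed

text \<open>In dimension two the adjugate of w - A is (w - trace) + A, hence affine in
  \<open>A\<close>.\<close>

lemma matrix_inv_mat_cmat:
  assumes q: "charp A w \<noteq> 0"
  shows "matrix_inv (mat w - cmat A) $ i $ j =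
    ((if i = j then w - of_real (A $ 1 $ 1 + A $ 2 $ 2) else 0) + of_real (A $ i $ j)) / charp A w"
proof -
  let ?M = "mat w - cmat A"
  define X where "X = (\<chi> i j. ((if i = j then w - of_real (A $ 1 $ 1 + A $ 2 $ 2) else 0) + of_real (A $ i $ j)) / charp A w)"
  have M: "?M $ 1 $ 1 = w - of_real (A $ 1 $ 1)" "?M $ 1 $ 2 = - of_real (A $ 1 $ 2)"
    "?M $ 2 $ 1 = - of_real (A $ 2 $ 1)" "?M $ 2 $ 2 = w - of_real (A $ 2 $ 2)"
    by (auto simp: mat1_entries cmat_def)
  have 1: "?M ** X = mat 1"
    using q unfolding mat2_eq_iff matmul2 M mat1_entries by (simp add: X_def field_simps) (simp add: charp_def algebra_simps)
  have 2: "X ** ?M = mat 1" using 1 by (rule matrix_left_right_inverse[THEN iffD1])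
  have "?M ** matrix_inv ?M = mat 1 \<and> matrix_inv ?M ** ?M = mat 1"
    unfolding matrix_inv_def by (rule someI[of _ X]) (use 1 2 in simp)
  then have "matrix_inv ?M ** ?M = mat 1" ..
  then have "matrix_inv ?M = matrix_inv ?M ** (?M ** X)" using 1 by (simp add: matrix_mul_rid)
  also have "\<dots> = X" unfolding matrix_mul_assoc \<open>matrix_inv ?M ** ?M = mat 1\<close> by (simp add: matrix_mul_lid)
  finally show ?thesis by (simp add: X_def)
qed

text \<open>Since the resolvent is affine in \<open>A\<close> over the characteristic polynomial,
  every residue splits into two scalar residues common to all entries, one multiplying the identity
  and one multiplying \<open>A\<close>. Only this form matters afterwards, not the values.\<close>

lemma matfun_eq:
  assumes S: "open S" and P: "P holomorphic_on S" and roots: "\<And>z. charp A z = 0 \<Longrightarrow> z \<in> S"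
  shows "\<exists>a b. matfun P A = a *\<^sub>R mat 1 + b *\<^sub>R A"
proof -
  let ?Z = "{z. charp A z = 0}"
  let ?c = "complex_of_real (A $ 1 $ 1 + A $ 2 $ 2)"
  define R1 where "R1 z = residue (\<lambda>w. P w * (w - ?c) / charp A w) z" for z
  define R0 where "R0 z = residue (\<lambda>w. P w / charp A w) z" for z
  have res: "residue (\<lambda>w. P w * matrix_inv (mat w - cmat A) $ i $ j) z = (if i = j then 1 else 0) * R1 z + of_real (A $ i $ j) * R0 z"
    if z: "z \<in> ?Z" for z i j
  proof -
    \<comment> \<open>Additivity of residues is applied to functions holomorphic on a punctured
      neighbourhood, so any other eigenvalue is taken out.\<close>
    define U where "U = S - (?Z - {z})"
    have U: "open U" "z \<in> U"
      using S roots[of z] z finite_charp_roots[of A] unfolding U_def by (auto intro!: open_Diff finite_imp_closed)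
    have h: "(\<lambda>w. P w * (w - ?c) / charp A w) holomorphic_on U - {z}" "(\<lambda>w. P w / charp A w) holomorphic_on U - {z}"
      unfolding charp_def
      by (rule holomorphic_intros holomorphic_on_subset[OF P] | auto simp: U_def charp_def)+
    have ev: "eventually (\<lambda>w. P w * matrix_inv (mat w - cmat A) $ i $ j =
       (if i = j then 1 else 0) * (P w * (w - ?c) / charp A w) + of_real (A $ i $ j) * (P w / charp A w)) (at z)"
    proof -
      have "eventually (\<lambda>w. w \<in> U - {z}) (at z)" using eventually_at_in_open[OF U] .
      then show ?thesis
      proof eventually_elim
        case (elim w)
        then have "charp A w \<noteq> 0" by (auto simp: U_def)
        then show ?case by (simp add: matrix_inv_mat_cmat add_divide_distrib distrib_left mult_ac)
      qed
    qed
    have h': "(\<lambda>w. d * (P w * (w - ?c) / charp A w)) holomorphic_on U - {z}" "(\<lambda>w. d * (P w / charp A w)) holomorphic_on U - {z}" for d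
      by (intro holomorphic_on_mult holomorphic_on_const h)+
    have "residue (\<lambda>w. P w * matrix_inv (mat w - cmat A) $ i $ j) z
       = residue (\<lambda>w. (if i = j then 1 else 0) * (P w * (w - ?c) / charp A w) + of_real (A $ i $ j) * (P w / charp A w)) z"
      by (rule residue_cong[OF ev refl])
    also have "\<dots> = (if i = j then 1 else 0) * R1 z + of_real (A $ i $ j) * R0 z"
      unfolding residue_add[OF U h'] R1_def R0_def residue_lmul[OF U h(1)] residue_lmul[OF U h(2)] ..
    finally show ?thesis .
  qed
  have "matfun P A $ i $ j = Re (\<Sum>z\<in>?Z. (if i = j then 1 else 0) * R1 z + of_real (A $ i $ j) * R0 z)" for i j
    unfolding matfun_def not_invertible_iff using sum.cong[OF refl res, of ?Z] by simp
  then have e: "matfun P A $ i $ j = (if i = j then 1 else 0) * Re (\<Sum>z\<in>?Z. R1 z) + A $ i $ j * Re (\<Sum>z\<in>?Z. R0 z)" for i j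
    by (simp add: sum.distrib sum_distrib_left[symmetric])
  show ?thesis
    by (intro exI[of _ "Re (\<Sum>z\<in>?Z. R1 z)"] exI[of _ "Re (\<Sum>z\<in>?Z. R0 z)"])
      (simp add: mat2_eq_iff e mat1_entries mult.commute)
qed

text \<open>The diagonal entries have modulus at least 3/4 and the others at most 1/4, so the two
  products cannot cancel: 9/16 > 1/16.\<close>

lemma det_perturb_nonzero:
  fixes Y :: "complex^2^2"
  assumes b: "\<And>i j. norm (e * Y $ i $ j) \<le> 1 / 4"
  shows "(1 + e * Y $ 1 $ 1) * (1 + e * Y $ 2 $ 2) - (e * Y $ 1 $ 2) * (e * Y $ 2 $ 1) \<noteq> 0"
proof
  assume "(1 + e * Y $ 1 $ 1) * (1 + e * Y $ 2 $ 2) - (e * Y $ 1 $ 2) * (e * Y $ 2 $ 1) = 0"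
  then have "norm (1 + e * Y $ 1 $ 1) * norm (1 + e * Y $ 2 $ 2) = norm (e * Y $ 1 $ 2) * norm (e * Y $ 2 $ 1)"
    by (simp add: norm_mult[symmetric])
  also have "\<dots> \<le> 1 / 4 * (1 / 4)" by (intro mult_mono b) auto
  finally have 1: "norm (1 + e * Y $ 1 $ 1) * norm (1 + e * Y $ 2 $ 2) \<le> 1 / 16" by simp
  have l: "norm (1 + e * Y $ i $ i) \<ge> 3 / 4" for i
    using norm_triangle_ineq4[of "1 + e * Y $ i $ i" "e * Y $ i $ i"] b[of i i] by simp
  have "3 / 4 * (3 / 4) \<le> norm (1 + e * Y $ 1 $ 1) * norm (1 + e * Y $ 2 $ 2)"
    by (intro mult_mono l) auto
  with 1 show False by simp
qed

section \<open>Pointwise eigenvalues and the spectrum in H\<close>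

context sob_time
begin

lemma matHD:
  assumes "X \<in> matH T s D" "t \<in> {0..T}"
  shows "(\<lambda>x. X t x $ i $ j) \<in> V s"
proof -
  obtain w where "tpair (\<lambda>t x. X t x $ i $ j) w" using assms(1) unfolding matH_def calH_iff by blast
  from C0D(1)[OF tpairD(1)[OF this] assms(2)] show ?thesis .
qed

text \<open>An inverse in H has essentially bounded entries because s > 1. With bound B, moving z0
  by less than 1 / (4 B) perturbs the identity by entries of at most 1/4. One null set serves the
  whole disc, as the countable covering later requires.\<close>

lemma resolvent_neighbourhood:
  assumes z0: "z0 \<notin> spectrum_matH T s D X" and t: "t \<in> {0..T}"
  shows "\<exists>d>0. AE_on D (\<lambda>x. \<forall>z. dist z z0 < d \<longrightarrow> charp (X t x) z \<noteq> 0)"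
proof -
  obtain Y where Y: "Y \<in> cmatH T s D"
    and "\<forall>t\<in>{0..T}. AE_on D (\<lambda>x. (mat z0 - cmat (X t x)) ** Y t x = mat 1 \<and> Y t x ** (mat z0 - cmat (X t x)) = mat 1)"
    using z0 by (auto simp: spectrum_matH_def)
  then have "AE_on D (\<lambda>x. (mat z0 - cmat (X t x)) ** Y t x = mat 1 \<and> Y t x ** (mat z0 - cmat (X t x)) = mat 1)" using t by blast
  then have inv: "AE_on D (\<lambda>x. (mat z0 - cmat (X t x)) ** Y t x = mat 1)" by eventually_elim blast
  have ex: "\<exists>M. AE_on D (\<lambda>x. norm (Y t x $ i $ j) \<le> M)" for i j
  proof -
    have "(\<lambda>x. map_matrix Re (Y t x) $ i $ j) \<in> V s" "(\<lambda>x. map_matrix Im (Y t x) $ i $ j) \<in> V s"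
      using Y t matHD[of "\<lambda>t x. map_matrix Re (Y t x)"] matHD[of "\<lambda>t x. map_matrix Im (Y t x)"] by (auto simp: cmatH_def)
    then have V2: "(\<lambda>x. Re (Y t x $ i $ j)) \<in> V s" "(\<lambda>x. Im (Y t x $ i $ j)) \<in> V s" by simp_all
    have "AE_on D (\<lambda>x. norm (Y t x $ i $ j) \<le> sob_const s * N s (\<lambda>x. Re (Y t x $ i $ j)) + sob_const s * N s (\<lambda>x. Im (Y t x $ i $ j)))"
      using sobolev_sup_bound[OF V2(1) s] sobolev_sup_bound[OF V2(2) s]
    proof eventually_elim
      case (elim x)
      then show ?case using cmod_le[of "Y t x $ i $ j"] by (auto intro: order_trans)
    qed
    then show ?thesis by blast
  qed
  define M where "M i j = (SOME M. AE_on D (\<lambda>x. norm (Y t x $ i $ j) \<le> M))" for i j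
  have M: "AE_on D (\<lambda>x. norm (Y t x $ i $ j) \<le> M i j)" for i j
    unfolding M_def by (rule someI_ex[OF ex])
  \<comment> \<open>The summand 1 keeps the radius 1 / (4 B) positive and finite.\<close>
  define B where "B = (\<Sum>i\<in>UNIV. \<Sum>j\<in>UNIV. \<bar>M i j\<bar>) + 1"
  have B: "B > 0" "M i j \<le> B" for i j
  proof -
    show "B > 0" unfolding B_def by (intro add_nonneg_pos sum_nonneg) auto
    have "\<bar>M i j\<bar> \<le> (\<Sum>j\<in>UNIV. \<bar>M i j\<bar>)" by (rule member_le_sum) auto
    also have "\<dots> \<le> (\<Sum>i\<in>UNIV. \<Sum>j\<in>UNIV. \<bar>M i j\<bar>)"
      by (rule member_le_sum[of i UNIV "\<lambda>i. \<Sum>j\<in>UNIV. \<bar>M i j\<bar>"]) (auto intro: sum_nonneg)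
    finally show "M i j \<le> B" unfolding B_def by linarith
  qed
  have all: "AE_on D (\<lambda>x. \<forall>i j. norm (Y t x $ i $ j) \<le> B)"
  proof -
    have "AE x in lborel. \<forall>i\<in>(UNIV::2 set). \<forall>j\<in>(UNIV::2 set). x \<in> D \<longrightarrow> norm (Y t x $ i $ j) \<le> M i j"
      using M by (intro AE_finite_allI) auto
    then show ?thesis by eventually_elim (use B(2) order_trans in blast)
  qed
  show ?thesis
  proof (intro exI[of _ "1 / (4 * B)"] conjI)
    show "0 < 1 / (4 * B)" using B(1) by simp
    show "AE_on D (\<lambda>x. \<forall>z. dist z z0 < 1 / (4 * B) \<longrightarrow> charp (X t x) z \<noteq> 0)"
      using inv all
    proof eventually_elim
      case (elim x)
      show ?case
      proof (intro impI allI)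
        fix z assume x: "x \<in> D" and z: "dist z z0 < 1 / (4 * B)"
        define e where "e = z - z0"
        let ?Y = "Y t x"
        have e: "norm (e * ?Y $ i $ j) \<le> 1 / 4" for i j
        proof -
          have "norm (e * ?Y $ i $ j) \<le> 1 / (4 * B) * B"
            unfolding norm_mult using z elim(2) x less_imp_le[OF B(1)] by (intro mult_mono) (auto simp: e_def dist_norm)
          then show ?thesis using B(1) by simp
        qed
        have "mat z - cmat (X t x) = mat e + (mat z0 - cmat (X t x))"
          by (auto simp: mat2_eq_iff mat1_entries e_def)
        moreover have "(mat e + B) ** ?Y = mat e ** ?Y + B ** ?Y" for B
          by (simp add: mat2_eq_iff matmul2 algebra_simps)
        ultimately have "(mat z - cmat (X t x)) ** ?Y = mat e ** ?Y + mat 1"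
          using elim(1) x by metis
        \<comment> \<open>Multiplication by the inverse at z0 turns the determinant at z into that
          of 1 + e Y, which is nonzero, hence so is the factor \<open>charp\<close>.\<close>
        then have "charp (X t x) z * det ?Y = det (mat e ** ?Y + mat 1)"
          unfolding det_mat_cmat[symmetric] det_mul[symmetric] by simp
        also have "\<dots> = (1 + e * ?Y $ 1 $ 1) * (1 + e * ?Y $ 2 $ 2) - (e * ?Y $ 1 $ 2) * (e * ?Y $ 2 $ 1)"
          by (simp add: det_2 matmul2 mat1_entries add.commute)
        finally show "charp (X t x) z \<noteq> 0" using det_perturb_nonzero[of e ?Y, OF e] by auto
      qed
    qed
  qed
qed

text \<open>Places almost all pointwise eigenvalues where \<open>P\<close> is holomorphic.
  Collecting one null set for each point outside \<open>S\<close> could exceed countability; by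
  Lindelof countably many resolvent discs cover the complement.\<close>

lemma eigenvalues_in_spectrum:
  assumes S: "spectrum_matH T s D X \<subseteq> S" and t: "t \<in> {0..T}"
  shows "AE_on D (\<lambda>x. \<forall>z. charp (X t x) z = 0 \<longrightarrow> z \<in> S)"
proof -
  have ex: "\<exists>d. d > 0 \<and> AE_on D (\<lambda>x. \<forall>z. dist z z0 < d \<longrightarrow> charp (X t x) z \<noteq> 0)" if "z0 \<in> - S" for z0
    using resolvent_neighbourhood[OF _ t, of z0 X] S that by auto
  define d where "d z0 = (SOME d. d > 0 \<and> AE_on D (\<lambda>x. \<forall>z. dist z z0 < d \<longrightarrow> charp (X t x) z \<noteq> 0))" for z0
  have d: "d z0 > 0" "AE_on D (\<lambda>x. \<forall>z. dist z z0 < d z0 \<longrightarrow> charp (X t x) z \<noteq> 0)" if "z0 \<in> - S" for z0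
    using someI_ex[OF ex[OF that]] unfolding d_def by blast+
  let ?F = "(\<lambda>z0. ball z0 (d z0)) ` (- S)"
  obtain F' where F': "F' \<subseteq> ?F" "countable F'" "\<Union>F' = \<Union>?F"
    by (rule Lindelof[of ?F]) auto
  have "AE x in lborel. \<forall>B\<in>F'. x \<in> D \<longrightarrow> (\<forall>z\<in>B. charp (X t x) z \<noteq> 0)"
    unfolding AE_ball_countable[OF F'(2)]
  proof
    fix B assume "B \<in> F'"
    then obtain z0 where z0: "z0 \<in> - S" "B = ball z0 (d z0)" using F'(1) by auto
    show "AE_on D (\<lambda>x. \<forall>z\<in>B. charp (X t x) z \<noteq> 0)"
      using d(2)[OF z0(1)] by eventually_elim (auto simp: z0(2) dist_commute)
  qed
  then show ?thesis
  proof eventually_elim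
    case (elim x)
    show ?case
    proof (intro impI allI)
      fix z assume x: "x \<in> D" and z: "charp (X t x) z = 0"
      show "z \<in> S"
      proof (rule ccontr)
        assume "z \<notin> S"
        then have "z \<in> \<Union>?F" using d(1)[of z] by (auto intro!: bexI[of _ z])
        then obtain B where "B \<in> F'" "z \<in> B" using F'(3) by blast
        then show False using elim x z by blast
      qed
    qed
  qed
qed

end

section \<open>The transport equation for the matrix exponential\<close>

locale transport = sob_time +
  fixes u :: "real \<Rightarrow> real^2 \<Rightarrow> real^2"
  assumes u: "\<And>i. (\<lambda>t x. u t x $ i) \<in> C0 s"
begin

abbreviation "dt v \<equiv> time_deriv T (s - 1) D v"

text \<open>Time derivative and advection enter the equations only through their sum and obey the
  same linearity, Leibniz and chain rules, so they are treated as a single derivation.\<close>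

definition mder :: "(real \<Rightarrow> real^2 \<Rightarrow> real) \<Rightarrow> real \<Rightarrow> real^2 \<Rightarrow> real" where
  "mder v t x = dt v t x + (\<Sum>k\<in>UNIV. u t x $ k * wp k (v t) x)"

lemma mder_2: "mder v t x = dt v t x + (u t x $ 1 * wp 1 (v t) x + u t x $ 2 * wp 2 (v t) x)"
  by (simp add: mder_def sum_2)

lemma calH_C0: "v \<in> calH T s D \<Longrightarrow> v \<in> C0 s"
  by (simp add: calH_def)

lemma calH_dt: "v \<in> calH T s D \<Longrightarrow> tpair v (dt v)"
  using calH_iff tpair_time_deriv(1) by blast

lemma calH_mult: "v \<in> calH T s D \<Longrightarrow> w \<in> calH T s D \<Longrightarrow> (\<lambda>t x. v t x * w t x) \<in> calH T s D"
  using calH_iff tpair_mult by blast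

lemma tpair_lincomb:
  assumes "tpair v v'" "tpair w w'"
  shows "tpair (\<lambda>t x. a * v t x + b * w t x) (\<lambda>t x. a * v' t x + b * w' t x)"
  using tpair_add[OF tpair_mult[OF tpair_const[of a] assms(1)] tpair_mult[OF tpair_const[of b] assms(2)]]
  by (simp add: mult.commute)

lemma calH_lincomb:
  "v \<in> calH T s D \<Longrightarrow> w \<in> calH T s D \<Longrightarrow> (\<lambda>t x. a * v t x + b * w t x) \<in> calH T s D"
  using calH_iff tpair_lincomb by blast

lemma calH_ps: "entire_coeffs c \<Longrightarrow> v \<in> calH T s D \<Longrightarrow> (\<lambda>t x. ps c (v t x)) \<in> calH T s D"
  using calH_iff tpair_ps by blast

lemma calH_cong:
  "v \<in> calH T s D \<Longrightarrow> \<forall>t\<in>{0..T}. AE_on D (\<lambda>x. w t x = v t x) \<Longrightarrow> w \<in> calH T s D"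
  using calH_iff tpair_cong by blast

lemma mder_C0: "v \<in> calH T s D \<Longrightarrow> mder v \<in> C0 (s - 1)"
proof -
  assume v: "v \<in> calH T s D"
  have "(\<lambda>t x. dt v t x + (wp 1 (v t) x * u t x $ 1 + wp 2 (v t) x * u t x $ 2)) \<in> C0 (s - 1)"
    by (intro C0_add C0_mult1 C0_wp calH_C0 v u tpairD(2)[OF calH_dt])
  then show ?thesis by (simp add: mder_2[abs_def] mult.commute)
qed

lemma mder_lincomb:
  assumes v: "v \<in> calH T s D" and w: "w \<in> calH T s D" and t: "t \<in> {0..T}"
  shows "AE_on D (\<lambda>x. mder (\<lambda>t x. a * v t x + b * w t x) t x = a * mder v t x + b * mder w t x)"
proof -
  note V = C0D(1)[OF calH_C0[OF v] t] C0D(1)[OF calH_C0[OF w] t]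
  show ?thesis
    using tpair_time_deriv(2)[OF tpair_lincomb[OF calH_dt[OF v] calH_dt[OF w]] t, of a b]
      wp_lincomb[OF V, of 1 a b] wp_lincomb[OF V, of 2 a b]
    by eventually_elim (auto simp: mder_2 algebra_simps)
qed

lemma mder_mult:
  assumes v: "v \<in> calH T s D" and w: "w \<in> calH T s D" and t: "t \<in> {0..T}"
  shows "AE_on D (\<lambda>x. mder (\<lambda>t x. v t x * w t x) t x = mder v t x * w t x + mder w t x * v t x)"
proof -
  note V = C0D(1)[OF calH_C0[OF v] t] C0D(1)[OF calH_C0[OF w] t]
  show ?thesis
    using tpair_time_deriv(2)[OF tpair_mult[OF calH_dt[OF v] calH_dt[OF w]] t] wp_mult[OF V, of 1] wp_mult[OF V, of 2]
    by eventually_elim (auto simp: mder_2 algebra_simps)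
qed

lemma mder_ps:
  assumes c: "entire_coeffs c" and v: "v \<in> calH T s D" and t: "t \<in> {0..T}"
  shows "AE_on D (\<lambda>x. mder (\<lambda>t x. ps c (v t x)) t x = mder v t x * ps (diffs c) (v t x))"
proof -
  note V = C0D(1)[OF calH_C0[OF v] t]
  show ?thesis
    using tpair_time_deriv(2)[OF tpair_ps[OF c calH_dt[OF v]] t] wp_ps[OF c V, of 1] wp_ps[OF c V, of 2]
    by eventually_elim (auto simp: mder_2 algebra_simps)
qed

lemma mder_cong:
  assumes v: "v \<in> calH T s D" and eq: "\<forall>t\<in>{0..T}. AE_on D (\<lambda>x. w t x = v t x)" and t: "t \<in> {0..T}"
  shows "AE_on D (\<lambda>x. mder w t x = mder v t x)"
proof -
  note V = C0D(1)[OF calH_C0[OF v] t]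
  have "tpair w (dt v)" using tpair_cong[OF calH_dt[OF v]] eq by blast
  from tpair_time_deriv(2)[OF this t] wp_cong[OF V bspec[OF eq t], of 1] wp_cong[OF V bspec[OF eq t], of 2]
  show ?thesis by eventually_elim (auto simp: mder_2)
qed

end

text \<open>The derivative of the closed form in \<open>mexp_sym\<close> in the direction
  \<open>X\<close>: \<open>z'\<close> is the derivative of \<open>disc\<close>, \<open>tr2 X\<close>
  that of the trace part, and Ch' = Sh / 2 has been inserted. As a function of two matrices it turns
  the rest into pointwise algebra.\<close>

definition mexp_deriv :: "real^2^2 \<Rightarrow> real^2^2 \<Rightarrow> real^2^2" where
  "mexp_deriv A X = (let z = disc A; z' = 2 * (gam A * gam X + A $ 1 $ 2 * X $ 1 $ 2); E = exp (tr2 A) in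
     (tr2 X * E) *\<^sub>R (ps cosh_coeff z *\<^sub>R mat 1 + ps sinhc_coeff z *\<^sub>R dev A)
     + E *\<^sub>R ((z' * ps sinhc_coeff z / 2) *\<^sub>R mat 1 + (z' * ps (diffs sinhc_coeff) z) *\<^sub>R dev A
        + ps sinhc_coeff z *\<^sub>R dev X))"

lemma mexp_entries:
  assumes "A $ 2 $ 1 = A $ 1 $ 2"
  shows "mexp A $ 1 $ 1 = exp (tr2 A) * (ps cosh_coeff (disc A) + ps sinhc_coeff (disc A) * gam A)"
    "mexp A $ 1 $ 2 = exp (tr2 A) * (ps sinhc_coeff (disc A) * A $ 1 $ 2)"
    "mexp A $ 2 $ 1 = exp (tr2 A) * (ps sinhc_coeff (disc A) * A $ 1 $ 2)"
    "mexp A $ 2 $ 2 = exp (tr2 A) * (ps cosh_coeff (disc A) - ps sinhc_coeff (disc A) * gam A)"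
  by (simp_all add: mexp_sym[OF assms] mat1_entries dev_entries)

section \<open>The material derivative of the exponential\<close>

context transport
begin

context
  fixes \<Psi> :: "real \<Rightarrow> real^2 \<Rightarrow> real^2^2"
  assumes \<Psi>: "\<Psi> \<in> matH_sym T s D"
begin

lemma \<Psi>_sym: "t \<in> {0..T} \<Longrightarrow> AE_on D (\<lambda>x. \<Psi> t x $ 2 $ 1 = \<Psi> t x $ 1 $ 2)"
proof -
  assume "t \<in> {0..T}"
  then have "AE_on D (\<lambda>x. transpose (\<Psi> t x) = \<Psi> t x)" using \<Psi> by (simp add: matH_sym_def)
  then show ?thesis
  proof eventually_elim
    case (elim x)
    show ?case
    proof
      assume "x \<in> D"
      with elim have "transpose (\<Psi> t x) $ 1 $ 2 = \<Psi> t x $ 1 $ 2" by simp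
      then show "\<Psi> t x $ 2 $ 1 = \<Psi> t x $ 1 $ 2" by (simp add: transpose_def)
    qed
  qed
qed

lemma \<Psi>_calH: "(\<lambda>t x. \<Psi> t x $ i $ j) \<in> calH T s D"
  using \<Psi> by (auto simp: matH_sym_def matH_def)

lemma tr2_calH: "(\<lambda>t x. tr2 (\<Psi> t x)) \<in> calH T s D"
  and mder_tr2: "t \<in> {0..T} \<Longrightarrow> AE_on D (\<lambda>x. mder (\<lambda>t x. tr2 (\<Psi> t x)) t x
    = tr2 (\<chi> i j. mder (\<lambda>t x. \<Psi> t x $ i $ j) t x))"
proof -
  have e: "(\<lambda>t x. tr2 (\<Psi> t x)) = (\<lambda>t x. 1 / 2 * \<Psi> t x $ 1 $ 1 + 1 / 2 * \<Psi> t x $ 2 $ 2)"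
    by (simp add: tr2_def fun_eq_iff)
  show "(\<lambda>t x. tr2 (\<Psi> t x)) \<in> calH T s D" unfolding e by (intro calH_lincomb \<Psi>_calH)
  show "AE_on D (\<lambda>x. mder (\<lambda>t x. tr2 (\<Psi> t x)) t x = tr2 (\<chi> i j. mder (\<lambda>t x. \<Psi> t x $ i $ j) t x))" if "t \<in> {0..T}"
    unfolding e using mder_lincomb[OF \<Psi>_calH[of 1 1] \<Psi>_calH[of 2 2] that, of "1/2" "1/2"]
    by eventually_elim (simp add: tr2_def)
qed

lemma gam_calH: "(\<lambda>t x. gam (\<Psi> t x)) \<in> calH T s D"
  and mder_gam: "t \<in> {0..T} \<Longrightarrow> AE_on D (\<lambda>x. mder (\<lambda>t x. gam (\<Psi> t x)) t x
    = gam (\<chi> i j. mder (\<lambda>t x. \<Psi> t x $ i $ j) t x))"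
proof -
  have e: "(\<lambda>t x. gam (\<Psi> t x)) = (\<lambda>t x. 1 / 2 * \<Psi> t x $ 1 $ 1 + (-1 / 2) * \<Psi> t x $ 2 $ 2)"
    by (simp add: gam_def fun_eq_iff diff_divide_distrib)
  show "(\<lambda>t x. gam (\<Psi> t x)) \<in> calH T s D" unfolding e by (intro calH_lincomb \<Psi>_calH)
  show "AE_on D (\<lambda>x. mder (\<lambda>t x. gam (\<Psi> t x)) t x = gam (\<chi> i j. mder (\<lambda>t x. \<Psi> t x $ i $ j) t x))" if "t \<in> {0..T}"
    unfolding e using mder_lincomb[OF \<Psi>_calH[of 1 1] \<Psi>_calH[of 2 2] that, of "1/2" "-1/2"]
    by eventually_elim (simp add: gam_def diff_divide_distrib)
qed

lemma disc_calH: "(\<lambda>t x. disc (\<Psi> t x)) \<in> calH T s D"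
  and mder_disc: "t \<in> {0..T} \<Longrightarrow> AE_on D (\<lambda>x. mder (\<lambda>t x. disc (\<Psi> t x)) t x
    = 2 * (gam (\<Psi> t x) * gam (\<chi> i j. mder (\<lambda>t x. \<Psi> t x $ i $ j) t x) + \<Psi> t x $ 1 $ 2 * mder (\<lambda>t x. \<Psi> t x $ 1 $ 2) t x))"
proof -
  let ?a = "\<lambda>t x. gam (\<Psi> t x) * gam (\<Psi> t x)" and ?b = "\<lambda>t x. \<Psi> t x $ 1 $ 2 * \<Psi> t x $ 1 $ 2"
  have e: "(\<lambda>t x. disc (\<Psi> t x)) = (\<lambda>t x. 1 * ?a t x + 1 * ?b t x)"
    by (simp add: disc_def fun_eq_iff power2_eq_square)
  have c: "?a \<in> calH T s D" "?b \<in> calH T s D" by (intro calH_mult gam_calH \<Psi>_calH)+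
  show "(\<lambda>t x. disc (\<Psi> t x)) \<in> calH T s D" unfolding e by (intro calH_lincomb c)
  show "AE_on D (\<lambda>x. mder (\<lambda>t x. disc (\<Psi> t x)) t x
    = 2 * (gam (\<Psi> t x) * gam (\<chi> i j. mder (\<lambda>t x. \<Psi> t x $ i $ j) t x) + \<Psi> t x $ 1 $ 2 * mder (\<lambda>t x. \<Psi> t x $ 1 $ 2) t x))"
    if t: "t \<in> {0..T}"
    unfolding e using mder_lincomb[OF c t, of 1 1] mder_mult[OF gam_calH gam_calH t] mder_mult[OF \<Psi>_calH[of 1 2] \<Psi>_calH[of 1 2] t] mder_gam[OF t]
    by eventually_elim (auto simp: algebra_simps)
qed

abbreviation (input) "cE \<equiv> \<lambda>t x. ps exp_coeff (tr2 (\<Psi> t x))"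
abbreviation (input) "cC \<equiv> \<lambda>t x. ps cosh_coeff (disc (\<Psi> t x))"
abbreviation (input) "cS \<equiv> \<lambda>t x. ps sinhc_coeff (disc (\<Psi> t x))"

lemma coeff_calH: "cE \<in> calH T s D" "cC \<in> calH T s D" "cS \<in> calH T s D"
  by (intro calH_ps entire_exp_coeff entire_cosh_coeff entire_sinhc_coeff tr2_calH disc_calH)+

text \<open>Covers all entries of the exponential: the triple (a, b, q) is (1, 1,
  \<open>gam\<close>) or (1, -1, \<open>gam\<close>) on the diagonal and (0, 1, upper right entry of
  \<Psi>) off it.\<close>

lemma mder_affine:
  fixes a b :: real
  assumes q: "q \<in> calH T s D" and t: "t \<in> {0..T}"
  defines "v \<equiv> \<lambda>t x. cE t x * (a * cC t x + b * (cS t x * q t x))"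
  shows "v \<in> calH T s D"
    "AE_on D (\<lambda>x. mder v t x = mder (\<lambda>t x. tr2 (\<Psi> t x)) t x * exp (tr2 (\<Psi> t x)) * (a * cC t x + b * (cS t x * q t x))
      + exp (tr2 (\<Psi> t x)) * (a * (mder (\<lambda>t x. disc (\<Psi> t x)) t x * cS t x / 2)
         + b * (mder (\<lambda>t x. disc (\<Psi> t x)) t x * ps (diffs sinhc_coeff) (disc (\<Psi> t x)) * q t x + cS t x * mder q t x)))"
proof -
  have c1: "(\<lambda>t x. cS t x * q t x) \<in> calH T s D" by (intro calH_mult coeff_calH q)
  have c2: "(\<lambda>t x. a * cC t x + b * (cS t x * q t x)) \<in> calH T s D" by (intro calH_lincomb coeff_calH c1)
  show "v \<in> calH T s D" unfolding v_def by (intro calH_mult coeff_calH c2)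
  show "AE_on D (\<lambda>x. mder v t x = mder (\<lambda>t x. tr2 (\<Psi> t x)) t x * exp (tr2 (\<Psi> t x)) * (a * cC t x + b * (cS t x * q t x))
      + exp (tr2 (\<Psi> t x)) * (a * (mder (\<lambda>t x. disc (\<Psi> t x)) t x * cS t x / 2)
         + b * (mder (\<lambda>t x. disc (\<Psi> t x)) t x * ps (diffs sinhc_coeff) (disc (\<Psi> t x)) * q t x + cS t x * mder q t x)))"
    unfolding v_def
    using mder_mult[OF coeff_calH(1) c2 t] mder_lincomb[OF coeff_calH(2) c1 t, of a b] mder_mult[OF coeff_calH(3) q t]
      mder_ps[OF entire_exp_coeff tr2_calH t] mder_ps[OF entire_cosh_coeff disc_calH t] mder_ps[OF entire_sinhc_coeff disc_calH t]
  proof eventually_elim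
    case (elim x)
    show ?case
    proof
      assume x: "x \<in> D"
      note e = elim[THEN mp, OF x]
      show "mder (\<lambda>t x. cE t x * (a * cC t x + b * (cS t x * q t x))) t x
        = mder (\<lambda>t x. tr2 (\<Psi> t x)) t x * exp (tr2 (\<Psi> t x)) * (a * cC t x + b * (cS t x * q t x))
      + exp (tr2 (\<Psi> t x)) * (a * (mder (\<lambda>t x. disc (\<Psi> t x)) t x * cS t x / 2)
         + b * (mder (\<lambda>t x. disc (\<Psi> t x)) t x * ps (diffs sinhc_coeff) (disc (\<Psi> t x)) * q t x + cS t x * mder q t x))"
        unfolding e by (simp add: diffs_exp ps_exp ps_diffs_cosh algebra_simps)
    qed
  qed
qed

lemma mexp_coords:
  "\<forall>t\<in>{0..T}. AE_on D (\<lambda>x. mexp (\<Psi> t x) $ 1 $ 1 = cE t x * (1 * cC t x + 1 * (cS t x * gam (\<Psi> t x))))"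
  "\<forall>t\<in>{0..T}. AE_on D (\<lambda>x. mexp (\<Psi> t x) $ 1 $ 2 = cE t x * (0 * cC t x + 1 * (cS t x * \<Psi> t x $ 1 $ 2)))"
  "\<forall>t\<in>{0..T}. AE_on D (\<lambda>x. mexp (\<Psi> t x) $ 2 $ 1 = cE t x * (0 * cC t x + 1 * (cS t x * \<Psi> t x $ 1 $ 2)))"
  "\<forall>t\<in>{0..T}. AE_on D (\<lambda>x. mexp (\<Psi> t x) $ 2 $ 2 = cE t x * (1 * cC t x + (-1) * (cS t x * gam (\<Psi> t x))))"
  by (intro ballI; erule eventually_mono[OF \<Psi>_sym]; auto simp: mexp_entries ps_exp)+

lemma mexp_calH: "(\<lambda>t x. mexp (\<Psi> t x) $ i $ j) \<in> calH T s D"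
proof -
  \<comment> \<open>\<open>mder_affine\<close> is stated at a time of the interval; 0 is
    one.\<close>
  have 0: "0 \<in> {0..T}" using T by simp
  have "\<forall>i j. (\<lambda>t x. mexp (\<Psi> t x) $ i $ j) \<in> calH T s D"
    unfolding forall_2
    using calH_cong[OF mder_affine(1)[OF gam_calH 0] mexp_coords(1)]
      calH_cong[OF mder_affine(1)[OF \<Psi>_calH 0] mexp_coords(2)]
      calH_cong[OF mder_affine(1)[OF \<Psi>_calH 0] mexp_coords(3)]
      calH_cong[OF mder_affine(1)[OF gam_calH 0] mexp_coords(4)] by blast
  then show ?thesis by blast
qed

lemma mexp_matH_sym: "(\<lambda>t x. mexp (\<Psi> t x)) \<in> matH_sym T s D"
proof -
  have "AE_on D (\<lambda>x. transpose (mexp (\<Psi> t x)) = mexp (\<Psi> t x))" if t: "t \<in> {0..T}" for t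
    using bspec[OF mexp_coords(2) t] bspec[OF mexp_coords(3) t] by eventually_elim (auto simp: mat2_eq_iff transpose_def)
  then show ?thesis by (auto simp: matH_sym_def matH_def mexp_calH)
qed

lemma mder_mexp:
  assumes t: "t \<in> {0..T}"
  shows "AE_on D (\<lambda>x. (\<chi> i j. mder (\<lambda>t x. mexp (\<Psi> t x) $ i $ j) t x)
    = mexp_deriv (\<Psi> t x) (\<chi> i j. mder (\<lambda>t x. \<Psi> t x $ i $ j) t x))"
  using mder_cong[OF mder_affine(1)[OF gam_calH t] mexp_coords(1) t]
    mder_cong[OF mder_affine(1)[OF \<Psi>_calH t] mexp_coords(2) t]
    mder_cong[OF mder_affine(1)[OF \<Psi>_calH t] mexp_coords(3) t]
    mder_cong[OF mder_affine(1)[OF gam_calH t] mexp_coords(4) t]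
    mder_affine(2)[OF gam_calH t, of 1 1] mder_affine(2)[OF gam_calH t, of 1 "-1"] mder_affine(2)[OF \<Psi>_calH[of 1 2] t, of 0 1]
    mder_tr2[OF t] mder_disc[OF t] mder_gam[OF t]
proof eventually_elim
  case (elim x)
  show ?case
  proof
    assume x: "x \<in> D"
    note e = elim[THEN mp, OF x]
    show "(\<chi> i j. mder (\<lambda>t x. mexp (\<Psi> t x) $ i $ j) t x) = mexp_deriv (\<Psi> t x) (\<chi> i j. mder (\<lambda>t x. \<Psi> t x $ i $ j) t x)"
      unfolding mat2_eq_iff vec_lambda_beta e mexp_deriv_def Let_def
      by (simp add: dev_entries mat1_entries algebra_simps)
  qed
qed

end

end

text \<open>\<open>LM\<close>, \<open>LG\<close>, \<open>LP\<close> are the trace, diagonal and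
  off-diagonal components of the material derivative of \<Psi>, as given by its equation;
  \<open>te\<close>, \<open>ge\<close>, \<open>e\<close> are those of the strain, \<open>w\<close>
  is the vorticity and \<open>q\<close> is 1 / lam. The conclusions are the same components of the
  equation for sigma, divided by the exponential of the trace part.\<close>

lemma conformation_scalar_identities:
  fixes g p :: real
  assumes CS: "C\<^sup>2 - (g\<^sup>2 + p\<^sup>2) * S\<^sup>2 = 1" and Th: "2 * (g\<^sup>2 + p\<^sup>2) * Th = C - S" and Sf: "f * S = 2 * Th"
    and LM: "LM = 2 * te - q * (a * C + b)"
    and LG: "LG = 2 * p * w + q * a * S * g + 2 * ge - 2 * (g * e - p * ge) * f * p"
    and LP: "LP = - 2 * g * w + q * a * S * p + 2 * e + 2 * (g * e - p * ge) * f * g"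
  shows "LM * C + 2 * (g * LG + p * LP) * S / 2 = 2 * te * C + 2 * S * (g * ge + p * e) - q * (a + b * C)"
    and "LM * S * g + 2 * (g * LG + p * LP) * Th * g + S * LG = 2 * C * ge + 2 * S * te * g + 2 * S * w * p - q * b * S * g"
    and "LM * S * p + 2 * (g * LG + p * LP) * Th * p + S * LP = 2 * C * e + 2 * S * te * p - 2 * S * w * g - q * b * S * p"
proof -
  have h: "g * LG + p * LP = q * a * S * (g\<^sup>2 + p\<^sup>2) + 2 * (g * ge + p * e)"
    unfolding LG LP by (simp add: algebra_simps power2_eq_square)
  \<comment> \<open>Here Ch^2 - z Sh^2 = 1 undoes the inverse exponential in the relaxation
    term.\<close>
  have "LM * C + 2 * (g * LG + p * LP) * S / 2
      = 2 * te * C + 2 * S * (g * ge + p * e) - q * (a * (C\<^sup>2 - (g\<^sup>2 + p\<^sup>2) * S\<^sup>2) + b * C)"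
    unfolding LM h by (simp add: algebra_simps power2_eq_square)
  then show "LM * C + 2 * (g * LG + p * LP) * S / 2 = 2 * te * C + 2 * S * (g * ge + p * e) - q * (a + b * C)"
    unfolding CS by simp
  have hT: "2 * (g * LG + p * LP) * Th = q * a * S * (C - S) + 4 * (g * ge + p * e) * Th"
    unfolding h Th[symmetric] by (simp add: algebra_simps)
  have SG: "S * LG = 2 * p * w * S + q * a * S\<^sup>2 * g + 2 * ge * S - 2 * (g * e - p * ge) * p * (f * S)"
    unfolding LG by (simp add: algebra_simps power2_eq_square)
  have SP: "S * LP = - 2 * g * w * S + q * a * S\<^sup>2 * p + 2 * e * S + 2 * (g * e - p * ge) * g * (f * S)"
    unfolding LP by (simp add: algebra_simps power2_eq_square)
  \<comment> \<open>Once f S = 2 Th, the terms with g p e cancel between the derivative of Sh and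
    the correction term; 4 z Th ge remains, and S + 2 z Th = C. This is the purpose of the
    correction term.\<close>
  have "LM * S * g + 2 * (g * LG + p * LP) * Th * g + S * LG
    = 2 * ge * (S + 2 * (g\<^sup>2 + p\<^sup>2) * Th) + 2 * S * te * g + 2 * S * w * p - q * b * S * g"
    unfolding hT SG Sf LM by (simp add: algebra_simps power2_eq_square)
  then show "LM * S * g + 2 * (g * LG + p * LP) * Th * g + S * LG = 2 * C * ge + 2 * S * te * g + 2 * S * w * p - q * b * S * g"
    unfolding Th by (simp add: algebra_simps)
  have "LM * S * p + 2 * (g * LG + p * LP) * Th * p + S * LP
    = 2 * e * (S + 2 * (g\<^sup>2 + p\<^sup>2) * Th) + 2 * S * te * p - 2 * S * w * g - q * b * S * p"
    unfolding hT SP Sf LM by (simp add: algebra_simps power2_eq_square)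
  then show "LM * S * p + 2 * (g * LG + p * LP) * Th * p + S * LP = 2 * C * e + 2 * S * te * p - 2 * S * w * g - q * b * S * p"
    unfolding Th by (simp add: algebra_simps)
qed

lemma mexp_uminus_sym:
  assumes A: "A $ 2 $ 1 = A $ 1 $ 2"
  shows "mexp (- A) = exp (- tr2 A) *\<^sub>R (ps cosh_coeff (disc A) *\<^sub>R mat 1 - ps sinhc_coeff (disc A) *\<^sub>R dev A)"
proof -
  have t: "tr2 (- A) = - tr2 A" by (simp add: tr2_def add_divide_distrib)
  have g: "gam (- A) = - gam A" by (simp add: gam_def diff_divide_distrib)
  have z: "disc (- A) = disc A" by (simp add: disc_def g)
  have d: "dev (- A) = - dev A" by (simp add: mat2_eq_iff dev_entries g)
  have "(- A) $ 2 $ 1 = (- A) $ 1 $ 2" using A by simp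
  from mexp_sym[OF this] show ?thesis unfolding t z d by simp
qed

lemma mexp_mult_uminus:
  assumes A: "A $ 2 $ 1 = A $ 1 $ 2"
  shows "mexp A ** mexp (- A) = mat 1"
proof -
  define C S where "C = ps cosh_coeff (disc A)" and "S = ps sinhc_coeff (disc A)"
  have CS: "C\<^sup>2 - disc A * S\<^sup>2 = 1" unfolding C_def S_def by (rule ps_cosh_sinhc[OF disc_nonneg])
  have "(C *\<^sub>R mat 1 + S *\<^sub>R dev A) ** (C *\<^sub>R mat 1 - S *\<^sub>R dev A) = (C\<^sup>2 - disc A * S\<^sup>2) *\<^sub>R mat 1"
    by (simp add: mat2_eq_iff matmul2 mat1_entries dev_entries disc_def power2_eq_square algebra_simps)
  moreover have "(a *\<^sub>R X) ** (b *\<^sub>R Y) = (a * b) *\<^sub>R (X ** Y)" for a b and X Y :: "real^2^2"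
    by (simp add: mat2_eq_iff matmul2 algebra_simps)
  ultimately show ?thesis
    unfolding mexp_sym[OF A] mexp_uminus_sym[OF A] C_def[symmetric] S_def[symmetric] CS
    by (simp add: exp_minus)
qed

text \<open>\<open>X\<close> stands for the material derivative of \<Psi>, \<open>F\<close> for
  P(sigma) and \<open>q\<close> for 1 / lam. Solving \<open>eq\<close> for the entries of
  \<open>X\<close> and splitting into trace, diagonal and off-diagonal components reduces the claim
  to \<open>conformation_scalar_identities\<close>.\<close>

lemma mexp_deriv_conformation:
  fixes A e w X F :: "real^2^2"
  assumes A: "A $ 2 $ 1 = A $ 1 $ 2" and e: "e $ 2 $ 1 = e $ 1 $ 2"
    and w: "w $ 1 $ 1 = 0" "w $ 2 $ 2 = 0" "w $ 2 $ 1 = - w $ 1 $ 2"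
    and F: "F = a *\<^sub>R mat 1 + b *\<^sub>R mexp A"
    and eq: "X + commutator A w + q *\<^sub>R (F ** mexp (- A)) - 2 *\<^sub>R e
       - (2 * (gam A * e $ 1 $ 2 - A $ 1 $ 2 * gam e) * f_fun A) *\<^sub>R corr_mat A = 0"
  shows "mexp_deriv A X - (e + w) ** mexp A - mexp A ** (e - w) = - (q *\<^sub>R F)"
proof -
  define C S Th where "C = ps cosh_coeff (disc A)" and "S = ps sinhc_coeff (disc A)" and "Th = ps (diffs sinhc_coeff) (disc A)"
  define E where "E = exp (tr2 A)"
  \<comment> \<open>In the product of \<open>F\<close> with \<open>mexp (- A)\<close> the part with
    \<open>b\<close> becomes scalar and only the part with \<open>a\<close> keeps the factor 1 / E;
    absorbed into \<open>a'\<close>, it leaves no exponential in the scalar identities.\<close>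
  define a' where "a' = a / E"
  define g p f where "g = gam A" and "p = A $ 1 $ 2" and "f = f_fun A"
  have z: "disc A = g\<^sup>2 + p\<^sup>2" by (simp add: disc_def g_def p_def)
  have id: "C\<^sup>2 - (g\<^sup>2 + p\<^sup>2) * S\<^sup>2 = 1" "2 * (g\<^sup>2 + p\<^sup>2) * Th = C - S" "f * S = 2 * Th"
    using ps_cosh_sinhc[OF disc_nonneg] ps_diffs_sinhc h_fun_sinhc[OF disc_nonneg]
    unfolding C_def S_def Th_def f_def f_fun_def disc_def[symmetric] z[symmetric] by blast+
  have "F ** mexp (- A) = a *\<^sub>R mexp (- A) + b *\<^sub>R (mexp A ** mexp (- A))"
    unfolding F by (simp add: mat2_eq_iff matmul2 mat1_entries algebra_simps)
  also have "\<dots> = a' *\<^sub>R (C *\<^sub>R mat 1 - S *\<^sub>R dev A) + b *\<^sub>R mat 1"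
    unfolding mexp_mult_uminus[OF A] unfolding mexp_uminus_sym[OF A] C_def S_def E_def a'_def
    by (simp add: exp_minus divide_inverse)
  finally have FA: "F ** mexp (- A) = a' *\<^sub>R (C *\<^sub>R mat 1 - S *\<^sub>R dev A) + b *\<^sub>R mat 1" .
  have cm: "corr_mat A $ 1 $ 1 = - p" "corr_mat A $ 1 $ 2 = g" "corr_mat A $ 2 $ 2 = p"
    by (simp_all add: corr_mat_def vector_2 g_def p_def)
  have Ad: "A $ 1 $ 1 = tr2 A + g" "A $ 2 $ 2 = tr2 A - g" by (simp_all add: tr2_def g_def gam_def field_simps)
  define r where "r = 2 * (g * e $ 1 $ 2 - p * gam e) * f"
  note eq' = eq[folded g_def p_def f_def, folded r_def, unfolded FA mat2_eq_iff]
  have X: "X $ 1 $ 1 = 2 * p * w $ 1 $ 2 - q * (a' * (C - S * g) + b) + 2 * e $ 1 $ 1 - r * p"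
    "X $ 1 $ 2 = - 2 * g * w $ 1 $ 2 + q * (a' * (S * p)) + 2 * e $ 1 $ 2 + r * g"
    "X $ 2 $ 2 = - 2 * p * w $ 1 $ 2 - q * (a' * (C + S * g) + b) + 2 * e $ 2 $ 2 + r * p"
    using eq' by (simp_all add: commutator_def matmul2 mat1_entries dev_entries cm w A Ad p_def[symmetric] g_def[symmetric] algebra_simps)
  have LM: "tr2 X = 2 * tr2 e - q * (a' * C + b)"
    unfolding tr2_def X by (simp add: field_simps)
  have LG: "gam X = 2 * p * w $ 1 $ 2 + q * a' * S * g + 2 * gam e - 2 * (g * e $ 1 $ 2 - p * gam e) * f * p"
    unfolding gam_def[of X] X r_def by (simp add: gam_def[of e] field_simps)
  have LP: "X $ 1 $ 2 = - 2 * g * w $ 1 $ 2 + q * a' * S * p + 2 * e $ 1 $ 2 + 2 * (g * e $ 1 $ 2 - p * gam e) * f * g"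
    unfolding X(2) r_def by simp
  note sc = conformation_scalar_identities[OF id LM LG LP]
  \<comment> \<open>Up to the factor \<open>E\<close> these are the components of
    \<open>mexp_deriv A X\<close>: \<open>I0\<close> along the identity, \<open>I1\<close> along the
    diagonal matrix with entries 1 and -1, \<open>I2\<close> off the diagonal.\<close>
  define I0 where "I0 = tr2 X * C + 2 * (g * gam X + p * X $ 1 $ 2) * S / 2"
  define I1 where "I1 = tr2 X * S * g + 2 * (g * gam X + p * X $ 1 $ 2) * Th * g + S * gam X"
  define I2 where "I2 = tr2 X * S * p + 2 * (g * gam X + p * X $ 1 $ 2) * Th * p + S * X $ 1 $ 2"
  have E: "E > 0" by (simp add: E_def)
  have md: "mexp_deriv A X $ 1 $ 1 = E * (I0 + I1)" "mexp_deriv A X $ 1 $ 2 = E * I2"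
    "mexp_deriv A X $ 2 $ 1 = E * I2" "mexp_deriv A X $ 2 $ 2 = E * (I0 - I1)"
    unfolding mexp_deriv_def Let_def C_def[symmetric] S_def[symmetric] Th_def[symmetric] E_def[symmetric] I0_def I1_def I2_def g_def p_def
    by (simp_all add: mat1_entries dev_entries algebra_simps)
  have me: "mexp A = E *\<^sub>R (C *\<^sub>R mat 1 + S *\<^sub>R dev A)" unfolding mexp_sym[OF A] E_def C_def S_def ..
  have e': "e $ 1 $ 1 = tr2 e + gam e" "e $ 2 $ 2 = tr2 e - gam e" by (simp_all add: tr2_def gam_def field_simps)
  have Ea: "E * a' = a" using E by (simp add: a'_def)
  have sE: "E * I0 = 2 * tr2 e * (E * C) + 2 * (E * S) * (g * gam e + p * e $ 1 $ 2) - q * (a + b * (E * C))"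
    "E * I1 = 2 * (E * C) * gam e + 2 * (E * S) * tr2 e * g + 2 * (E * S) * w $ 1 $ 2 * p - q * b * (E * S) * g"
    "E * I2 = 2 * (E * C) * e $ 1 $ 2 + 2 * (E * S) * tr2 e * p - 2 * (E * S) * w $ 1 $ 2 * g - q * b * (E * S) * p"
    unfolding I0_def I1_def I2_def sc Ea[symmetric] by (simp_all add: algebra_simps)
  show ?thesis
    unfolding mat2_eq_iff F me vector_minus_component vector_uminus_component md
    by (simp add: matmul2 mat1_entries dev_entries w e e' distrib_left right_diff_distrib[of E] sE p_def[symmetric] g_def[symmetric])
      (simp add: algebra_simps)
qed

theorem theorem2:
  fixes T lam s :: real
    and D :: "(real^2) set"
    and P :: "complex \<Rightarrow> complex"
    and S :: "complex set"
    and u :: "real \<Rightarrow> real^2 \<Rightarrow> real^2"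
    and \<Psi> :: "real \<Rightarrow> real^2 \<Rightarrow> real^2^2"
  assumes "T > 0" and "lam > 0" and "s > 1"
    and "bounded_lipschitz_domain D"
    and "open S"
    and "spectrum_matH T s D (\<lambda>t x. mexp (\<Psi> t x)) \<subseteq> S"
    and "P holomorphic_on S"
    and "\<forall>a::real. complex_of_real a \<in> S \<longrightarrow> P (complex_of_real a) \<in> \<real>"
    and "\<forall>i. (\<lambda>t x. u t x $ i) \<in> C0_sobolev T s D"
    and "\<Psi> \<in> matH_sym T s D"
    and "eq_in_matH' T s D
           (\<lambda>t x. dt_mat T s D \<Psi> t x + advect D u \<Psi> t x
              + commutator (\<Psi> t x) (vorticity D u t x)
              + (1 / lam) *\<^sub>R (matfun P (mexp (\<Psi> t x)) ** mexp (- \<Psi> t x))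
              - 2 *\<^sub>R strain D u t x
              - (2 * (gam (\<Psi> t x) * strain D u t x $ 1 $ 2
                      - \<Psi> t x $ 1 $ 2 * gam (strain D u t x)) * f_fun (\<Psi> t x))
                  *\<^sub>R corr_mat (\<Psi> t x))
           (\<lambda>t x. 0)"
  shows "(\<lambda>t x. mexp (\<Psi> t x)) \<in> matH_sym T s D \<and>
         eq_in_matH' T s D
           (\<lambda>t x. dt_mat T s D (\<lambda>t x. mexp (\<Psi> t x)) t x
              + advect D u (\<lambda>t x. mexp (\<Psi> t x)) t x
              - (strain D u t x + vorticity D u t x) ** mexp (\<Psi> t x)
              - mexp (\<Psi> t x) ** (strain D u t x - vorticity D u t x))
           (\<lambda>t x. - ((1 / lam) *\<^sub>R matfun P (mexp (\<Psi> t x))))"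
proof -
  have D: "open D" "bounded D" using assms(4) by (auto simp: bounded_lipschitz_domain_def)
  interpret transport s D T u by unfold_locales (use assms D in auto)
  let ?\<sigma> = "\<lambda>t x. mexp (\<Psi> t x)"
  let ?X = "\<lambda>t x. \<chi> i j. mder (\<lambda>t x. \<Psi> t x $ i $ j) t x"
  let ?Y = "\<lambda>t x. \<chi> i j. mder (\<lambda>t x. ?\<sigma> t x $ i $ j) t x"
  \<comment> \<open>This holds at every point by definition, so it can rewrite both the hypothesis
    and the goal.\<close>
  have dt_adv: "dt_mat T s D Z t x + advect D u Z t x = (\<chi> i j. mder (\<lambda>t x. Z t x $ i $ j) t x)" for Z t x
    by (simp add: vec_eq_iff dt_mat_def advect_def mder_def)
  have half: "(1 / 2) *\<^sub>R (G + H) + (1 / 2) *\<^sub>R (G - H) = G" "(1 / 2) *\<^sub>R (G + H) - (1 / 2) *\<^sub>R (G - H) = H" for G H :: "real^2^2"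
    by (simp_all add: scaleR_add_right scaleR_diff_right flip: scaleR_left.add)
  \<comment> \<open>Sum and difference of strain and vorticity are the gradient and its transpose,
    so the left-hand side involves weak derivatives of \<open>u\<close> only multiplied by entries
    of the exponential.\<close>
  have gr: "strain D u t x + vorticity D u t x = grad D u t x" "strain D u t x - vorticity D u t x = transpose (grad D u t x)" for t x
    unfolding strain_def vorticity_def by (rule half)+
  let ?L = "\<lambda>t x. ?Y t x - (strain D u t x + vorticity D u t x) ** ?\<sigma> t x - ?\<sigma> t x ** (strain D u t x - vorticity D u t x)"
  have \<sigma>0: "(\<lambda>t x. ?\<sigma> t x $ i $ j) \<in> C0 s" for i j by (rule calH_C0[OF mexp_calH[OF assms(10)]])
  have wu: "(\<lambda>t x. wp k (\<lambda>y. u t y $ i) x) \<in> C0 (s - 1)" for k i using C0_wp[OF u[of i], of k] by simp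
  have Lc: "?L t x $ i $ j = mder (\<lambda>t x. ?\<sigma> t x $ i $ j) t x
     - (wp 1 (\<lambda>y. u t y $ i) x * ?\<sigma> t x $ 1 $ j + wp 2 (\<lambda>y. u t y $ i) x * ?\<sigma> t x $ 2 $ j)
     - (wp 1 (\<lambda>y. u t y $ j) x * ?\<sigma> t x $ i $ 1 + wp 2 (\<lambda>y. u t y $ j) x * ?\<sigma> t x $ i $ 2)" for t x i j
    unfolding gr by (simp add: matmul2 grad_def transpose_def mult.commute)
  have L: "?L \<in> matH' T s D"
    unfolding matH'_def calH'_def Lc mem_Collect_eq
    by (intro allI C0_diff C0_add C0_mult1 mder_C0 mexp_calH[OF assms(10)] wu \<sigma>0 disjI2 refl)
  have ae: "AE_on D (\<lambda>x. ?L t x = - ((1 / lam) *\<^sub>R matfun P (?\<sigma> t x)))" if t: "t \<in> {0..T}" for t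
  proof -
    have "AE_on D (\<lambda>x. ?X t x + commutator (\<Psi> t x) (vorticity D u t x)
              + (1 / lam) *\<^sub>R (matfun P (mexp (\<Psi> t x)) ** mexp (- \<Psi> t x))
              - 2 *\<^sub>R strain D u t x
              - (2 * (gam (\<Psi> t x) * strain D u t x $ 1 $ 2
                      - \<Psi> t x $ 1 $ 2 * gam (strain D u t x)) * f_fun (\<Psi> t x))
                  *\<^sub>R corr_mat (\<Psi> t x) = 0)"
      using assms(11) t unfolding eq_in_matH'_def dt_adv by blast
    then show ?thesis
      using \<Psi>_sym[OF assms(10) t] mder_mexp[OF assms(10) t] eigenvalues_in_spectrum[OF assms(6) t]
    proof eventually_elim
      case (elim x)
      show ?case
      proof
        assume x: "x \<in> D"
        note el = elim[THEN mp, OF x]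
        \<comment> \<open>\<open>a\<close> and \<open>b\<close> depend on the time and the point;
          the identity to be proved is pointwise, so nothing about this dependence has to be
          known.\<close>
        obtain a b where F: "matfun P (?\<sigma> t x) = a *\<^sub>R mat 1 + b *\<^sub>R ?\<sigma> t x"
          using matfun_eq[OF assms(5,7)] el(4) by blast
        have e: "strain D u t x $ 2 $ 1 = strain D u t x $ 1 $ 2" by (simp add: strain_def transpose_def)
        have w: "vorticity D u t x $ 1 $ 1 = 0" "vorticity D u t x $ 2 $ 2 = 0"
          "vorticity D u t x $ 2 $ 1 = - vorticity D u t x $ 1 $ 2"
          by (simp_all add: vorticity_def transpose_def diff_divide_distrib)
        show "?L t x = - ((1 / lam) *\<^sub>R matfun P (?\<sigma> t x))"
          unfolding el(3) by (rule mexp_deriv_conformation[OF el(2) e w F el(1)])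
      qed
    qed
  qed
  have "(\<lambda>t x. - ((1 / lam) *\<^sub>R matfun P (?\<sigma> t x))) \<in> matH' T s D"
    unfolding matH'_def calH'_def mem_Collect_eq
  proof (intro allI)
    fix i j
    have "(\<lambda>t x. ?L t x $ i $ j) \<in> C0 (s - 1)" using L by (simp add: matH'_def calH'_def)
    then show "(\<lambda>t x. (- ((1 / lam) *\<^sub>R matfun P (?\<sigma> t x))) $ i $ j) \<in> C0 (s - 1)"
    proof (rule C0_cong)
      show "AE_on D (\<lambda>x. (- ((1 / lam) *\<^sub>R matfun P (?\<sigma> t x))) $ i $ j = ?L t x $ i $ j)" if "t \<in> {0..T}" for t
        using ae[OF that] by eventually_elim simp
    qed
  qed
  then show ?thesis using mexp_matH_sym[OF assms(10)] L ae unfolding eq_in_matH'_def dt_adv by blast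
qed

end
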